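(* Let $(M^n,g(t))$, $t\in(0,T)$, be a solution of the Ricci flow $\frac{\partial}{\partial t}g=-2\,Rc$ with positive curvature operator, $Rm>0$. Let $Z_{ab}=M_{ab}-S_{ijkl}P_{ija}P_{klb}$ be the Harnack quantity defined in the context. Then, at every point $(x,t)$ at which the Harnack quadratic $Z(U,W)$ is nonnegative definite, with $\{Y^N\oplus X^N\}_{N=1}^m$ an orthogonal set as in the context, the components of $Z_{ab}$ in an evolving orthonormal frame satisfy $$\left(\frac{\partial}{\partial t}-\Delta\right)Z_{ab}=2\,S_{mntu}K_{avtu}K_{bvmn}+L_a^{NM}L_b^{NM}-\frac{2}{t}Z_{ab},$$ where $$K_{avtu}=S_{ijrs}P_{ija}\nabla_vR_{rstu}-\nabla_vP_{tua}+R_{tuaw}R_{vw}+\frac{1}{2t}R_{tuav},$$ $$L_a^{NM}=2Y_{id}^{N}Y_{jd}^{M}S_{ijkl}P_{kla}+Y_{ah}^{N}X_h^{M}-Y_{ah}^{M}X_h^{N}.$$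
   Context: Conventions. All tensors are written in components with respect to a local orthonormal frame. Repeated indices are summed: each lower-case index over $1,\dots,n$ (so a pair of 2-form indices is summed over all ordered pairs), and $N,M$ in superscripts over $1,\dots,m$. $\nabla=D$ is the Levi-Civita connection of $g(t)$ and $\Delta=\nabla_v\nabla_v$ is the rough Laplacian on tensors. The curvature tensor $R_{abcd}$ follows Hamilton's sign convention $R_{ijkl}=g_{kh}R^h_{ijl}$, so that $R_{abab}>0$ (for $a\ne b$, no sum) on the round sphere; the Ricci tensor is $R_{ac}=R_{abcb}$ and the scalar curvature is $R=R_{aa}$. Positive curvature operator ($Rm>0$) means $R_{abcd}U_{ab}U_{cd}>0$ for every nonzero 2-form $U$. Evolving frame and time derivative. The equation is understood in an evolving (moving) orthonormal frame: the frame vectors $F_a=F_a^i\partial_i$ evolve by $\frac{\partial}{\partial t}F_a^i=g^{ij}R_{jk}F_a^k$, so that they stay $g(t)$-orthonormal, and $\frac{\partial}{\partial t}$ (also written $D_t$) denotes the time derivative of the components of a tensor in this frame. Inverse curvature operator. $S_{abcd}$ is the inverse of $R_{abcd}$ as an operator on 2-forms: it has the symmetries $S_{abcd}=-S_{bacd}=-S_{abdc}=S_{cdab}$, and $\sum_{e,f}S_{abef}R_{efcd}=I_{abcd}$, where $I:\wedge^2M\to\wedge^2M$ is the identity, i.e. $I_{abcd}U_{cd}=U_{ab}$ for every 2-form $U$. Harnack tensors (for $t>0$). $$P_{abc}=D_aR_{bc}-D_bR_{ac},$$ $$M_{ab}=\Delta R_{ab}-\tfrac12D_aD_bR+2R_{acbd}R_{cd}-R_{ac}R_{bc}+\tfrac{1}{2t}R_{ab},$$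 $$Z_{ab}=M_{ab}-S_{ijkl}P_{ija}P_{klb}.$$ The Harnack quadratic is $$Z(U,W)=M_{ab}W_aW_b+2P_{abc}U_{ab}W_c+R_{abcd}U_{ab}U_{cd}$$ for 2-forms $U$ and 1-forms $W$. (When $Rm>0$, for fixed $W$ the minimum of $Z(U,W)$ over $U$ is $Z_{ab}W_aW_b$, so $Z(U,W)$ is nonnegative definite if and only if $Z_{ab}$ is.) The vectors $Y^N\oplus X^N$. At a point $(x,t)$ where the Harnack quadratic is nonnegative definite, it can be written as a sum of squares: $\{Y^N\oplus X^N\}_{N=1}^m$ denotes an orthogonal set of vectors in $\wedge^2M_x\oplus\wedge^1M_x$ (some of which may be zero), with $m=\dim\wedge^2M_x+\dim\wedge^1M_x=\frac{n(n+1)}{2}$, such that at $(x,t)$ $$R_{abcd}=\sum_NY^N_{ab}Y^N_{cd},\qquad P_{abc}=\sum_NY^N_{ab}X^N_c,\qquad M_{ab}=\sum_NX^N_aX^N_b.$$ *)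

theory Defs
  imports "HOL-Analysis.Analysis"
begin

section \<open>Smooth functions and smooth manifolds\<close>

text \<open>Only meaningful on open sets.\<close>

fun Ck_on :: "nat \<Rightarrow> ('a::real_normed_vector \<Rightarrow> 'b::real_normed_vector) \<Rightarrow> 'a set \<Rightarrow> bool" where
  "Ck_on 0 f S \<longleftrightarrow> continuous_on S f"
| "Ck_on (Suc k) f S \<longleftrightarrow>
     (\<forall>x\<in>S. f differentiable (at x)) \<and> (\<forall>v. Ck_on k (\<lambda>x. frechet_derivative f (at x) v) S)"

definition smooth_on :: "('a::real_normed_vector \<Rightarrow> 'b::real_normed_vector) \<Rightarrow> 'a set \<Rightarrow> bool" where
  "smooth_on f S \<longleftrightarrow> (\<forall>k. Ck_on k f S)"

definition partial :: "'n::finite \<Rightarrow> (real^'n \<Rightarrow> real) \<Rightarrow> real^'n \<Rightarrow> real" where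
  "partial i f x = frechet_derivative f (at x) (axis i 1)"

text \<open>
  A chart is a pair of its domain and its coordinate map. The manifold described by an atlas \<open>A\<close>
  is the union of the chart domains, an open subset of the underlying (Hausdorff, second countable)
  space; its dimension is the cardinality of the index type \<open>'n\<close>.
\<close>

type_synonym ('m, 'n) chart = "'m set \<times> ('m \<Rightarrow> real^'n)"

definition transition :: "('m, 'n::finite) chart \<Rightarrow> ('m, 'n) chart \<Rightarrow> real^'n \<Rightarrow> real^'n" where
  "transition c c' y = snd c' (inv_into (fst c) (snd c) y)"

definition smooth_atlas ::
  "('m::{t2_space, second_countable_topology}, 'n::finite) chart set \<Rightarrow> bool" where
  "smooth_atlas A \<longleftrightarrow>
     (\<forall>(U, \<phi>)\<in>A. open U \<and> open (\<phi> ` U) \<and> (\<exists>\<psi>. homeomorphism U (\<phi> ` U) \<phi> \<psi>)) \<and>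
     (\<forall>c\<in>A. \<forall>c'\<in>A. smooth_on (transition c c') (snd c ` (fst c \<inter> fst c')))"

section \<open>Tensor calculus in a chart\<close>

text \<open>
  \<open>g x $ i $ j\<close> are the coordinate components of a metric. A covariant tensor field is
  given by its coordinate components, indexed by the list of its lower indices.
\<close>

type_synonym 'n metric = "real^'n \<Rightarrow> real^'n^'n"
type_synonym 'n tensor = "'n list \<Rightarrow> real^'n \<Rightarrow> real"

definition tensor0 :: "(real^'n \<Rightarrow> real) \<Rightarrow> 'n::finite tensor" where
  "tensor0 f is = (case is of [] \<Rightarrow> f | _ \<Rightarrow> (\<lambda>_. 0))"

definition tensor2 :: "('n \<Rightarrow> 'n \<Rightarrow> real^'n \<Rightarrow> real) \<Rightarrow> 'n::finite tensor" where
  "tensor2 f is = (case is of [i, j] \<Rightarrow> f i j | _ \<Rightarrow> (\<lambda>_. 0))"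

definition tensor3 :: "('n \<Rightarrow> 'n \<Rightarrow> 'n \<Rightarrow> real^'n \<Rightarrow> real) \<Rightarrow> 'n::finite tensor" where
  "tensor3 f is = (case is of [i, j, k] \<Rightarrow> f i j k | _ \<Rightarrow> (\<lambda>_. 0))"

definition tensor4 :: "('n \<Rightarrow> 'n \<Rightarrow> 'n \<Rightarrow> 'n \<Rightarrow> real^'n \<Rightarrow> real) \<Rightarrow> 'n::finite tensor" where
  "tensor4 f is = (case is of [i, j, k, l] \<Rightarrow> f i j k l | _ \<Rightarrow> (\<lambda>_. 0))"

text \<open>The value \<open>T(F a\<^sub>1, \<dots>, F a\<^sub>k)\<close>: the components of \<open>T\<close> in the frame \<open>F\<close>.\<close>

fun frame_comp :: "('n \<Rightarrow> real^'n) \<Rightarrow> 'n::finite tensor \<Rightarrow> 'n list \<Rightarrow> real^'n \<Rightarrow> real" where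
  "frame_comp F T [] x = T [] x"
| "frame_comp F T (a # as) x = (\<Sum>i\<in>UNIV. F a $ i * frame_comp F (\<lambda>is. T (i # is)) as x)"

definition ginv :: "'n::finite metric \<Rightarrow> 'n \<Rightarrow> 'n \<Rightarrow> real^'n \<Rightarrow> real" where
  "ginv g i j x = matrix_inv (g x) $ i $ j"

text \<open>
  All indices raised: \<open>sharp g T [i, j, \<dots>]\<close> is \<open>g\<^sup>i\<^sup>p g\<^sup>j\<^sup>q \<dots> T\<^sub>p\<^sub>q\<^sub>\<dots>\<close>, since row \<open>i\<close> of the inverse
  metric consists of the components \<open>g\<^sup>i\<^sup>p\<close>.
\<close>

definition sharp :: "'n::finite metric \<Rightarrow> 'n tensor \<Rightarrow> 'n tensor" where
  "sharp g T is x = frame_comp (\<lambda>i. matrix_inv (g x) $ i) T is x"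

definition christoffel :: "'n::finite metric \<Rightarrow> 'n \<Rightarrow> 'n \<Rightarrow> 'n \<Rightarrow> real^'n \<Rightarrow> real" where
  "christoffel g k i j x =
     (1/2) * (\<Sum>l\<in>UNIV. ginv g k l x *
       (partial i (\<lambda>y. g y $ j $ l) x + partial j (\<lambda>y. g y $ i $ l) x
         - partial l (\<lambda>y. g y $ i $ j) x))"

text \<open>The index of differentiation comes first: \<open>nabla g T (k # is)\<close> is \<open>\<nabla>\<^sub>k T\<^sub>i\<^sub>s\<close>.\<close>

fun nabla :: "'n::finite metric \<Rightarrow> 'n tensor \<Rightarrow> 'n tensor" where
  "nabla g T [] x = 0"
| "nabla g T (k # is) x =
     partial k (T is) x
       - (\<Sum>p<length is. \<Sum>l\<in>UNIV. christoffel g l k (is ! p) x * T (is[p := l]) x)"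

definition laplacian :: "'n::finite metric \<Rightarrow> 'n tensor \<Rightarrow> 'n tensor" where
  "laplacian g T is x =
     (\<Sum>k\<in>UNIV. \<Sum>l\<in>UNIV. ginv g k l x * nabla g (nabla g T) (k # l # is) x)"

text \<open>
  Hamilton's convention: \<open>riemann_up g h i j l\<close> is \<open>R\<^sup>h\<^sub>i\<^sub>j\<^sub>l\<close>, i.e.
  \<open>R(\<partial>\<^sub>i, \<partial>\<^sub>j) \<partial>\<^sub>l = R\<^sup>h\<^sub>i\<^sub>j\<^sub>l \<partial>\<^sub>h\<close>, and \<open>R\<^sub>i\<^sub>j\<^sub>k\<^sub>l = g\<^sub>k\<^sub>h R\<^sup>h\<^sub>i\<^sub>j\<^sub>l\<close>.
\<close>

definition riemann_up :: "'n::finite metric \<Rightarrow> 'n \<Rightarrow> 'n \<Rightarrow> 'n \<Rightarrow> 'n \<Rightarrow> real^'n \<Rightarrow> real" where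
  "riemann_up g h i j l x =
     partial i (christoffel g h j l) x - partial j (christoffel g h i l) x
       + (\<Sum>p\<in>UNIV. christoffel g h i p x * christoffel g p j l x
                     - christoffel g h j p x * christoffel g p i l x)"

definition Rm :: "'n::finite metric \<Rightarrow> 'n tensor" where
  "Rm g = tensor4 (\<lambda>i j k l x. \<Sum>h\<in>UNIV. g x $ k $ h * riemann_up g h i j l x)"

definition Ric :: "'n::finite metric \<Rightarrow> 'n tensor" where
  "Ric g = tensor2 (\<lambda>i k x. \<Sum>j\<in>UNIV. \<Sum>l\<in>UNIV. ginv g j l x * Rm g [i, j, k, l] x)"

definition scal :: "'n::finite metric \<Rightarrow> 'n tensor" where
  "scal g = tensor0 (\<lambda>x. \<Sum>i\<in>UNIV. \<Sum>j\<in>UNIV. ginv g i j x * Ric g [i, j] x)"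

definition orthonormal_frame :: "'n::finite metric \<Rightarrow> real^'n \<Rightarrow> ('n \<Rightarrow> real^'n) \<Rightarrow> bool" where
  "orthonormal_frame g x F \<longleftrightarrow>
     (\<forall>a b. (\<Sum>i\<in>UNIV. \<Sum>j\<in>UNIV. g x $ i $ j * F a $ i * F b $ j) = (if a = b then 1 else 0))"

definition two_form :: "('n \<Rightarrow> 'n \<Rightarrow> real) \<Rightarrow> bool" where
  "two_form U \<longleftrightarrow> (\<forall>a b. U a b = - U b a)"

definition positive_curvature_operator :: "'n::finite metric \<Rightarrow> real^'n \<Rightarrow> bool" where
  "positive_curvature_operator g x \<longleftrightarrow>
     (\<forall>F U. orthonormal_frame g x F \<longrightarrow> two_form U \<longrightarrow> (\<exists>a b. U a b \<noteq> 0) \<longrightarrow>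
       (\<Sum>a\<in>UNIV. \<Sum>b\<in>UNIV. \<Sum>c\<in>UNIV. \<Sum>d\<in>UNIV.
          frame_comp F (Rm g) [a, b, c, d] x * U a b * U c d) > 0)"

text \<open>
  The right-hand side \<open>(g\<^sub>i\<^sub>k g\<^sub>j\<^sub>l - g\<^sub>i\<^sub>l g\<^sub>j\<^sub>k) / 2\<close> is the identity of \<open>\<wedge>\<^sup>2\<close>; the factor \<open>1/2\<close> is due
  to 2-form indices being summed over all ordered pairs. The inverse exists and is unique
  wherever the curvature operator is positive.
\<close>

definition is_curvature_inverse ::
  "'n::finite metric \<Rightarrow> real^'n \<Rightarrow> ('n \<Rightarrow> 'n \<Rightarrow> 'n \<Rightarrow> 'n \<Rightarrow> real) \<Rightarrow> bool" where
  "is_curvature_inverse g x S \<longleftrightarrow>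
     (\<forall>i j k l. S i j k l = - S j i k l \<and> S i j k l = - S i j l k \<and> S i j k l = S k l i j) \<and>
     (\<forall>i j k l.
        (\<Sum>p\<in>UNIV. \<Sum>q\<in>UNIV. \<Sum>r\<in>UNIV. \<Sum>s\<in>UNIV.
           S i j p q * ginv g p r x * ginv g q s x * Rm g [r, s, k, l] x)
        = (g x $ i $ k * g x $ j $ l - g x $ i $ l * g x $ j $ k) / 2)"

definition curvature_inverse :: "'n::finite metric \<Rightarrow> 'n tensor" where
  "curvature_inverse g = tensor4 (\<lambda>i j k l x. (THE S. is_curvature_inverse g x S) i j k l)"

section \<open>The Harnack tensors\<close>

definition harnack_P :: "'n::finite metric \<Rightarrow> 'n tensor" where
  "harnack_P g =
     tensor3 (\<lambda>i j k x. nabla g (Ric g) [i, j, k] x - nabla g (Ric g) [j, i, k] x)"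

definition harnack_M :: "real \<Rightarrow> 'n::finite metric \<Rightarrow> 'n tensor" where
  "harnack_M t g = tensor2 (\<lambda>i j x.
     laplacian g (Ric g) [i, j] x
       - (1/2) * nabla g (nabla g (scal g)) [i, j] x
       + 2 * (\<Sum>k\<in>UNIV. \<Sum>l\<in>UNIV. Rm g [i, k, j, l] x * sharp g (Ric g) [k, l] x)
       - (\<Sum>k\<in>UNIV. \<Sum>l\<in>UNIV. ginv g k l x * Ric g [i, k] x * Ric g [j, l] x)
       + 1 / (2 * t) * Ric g [i, j] x)"

definition harnack_Z :: "real \<Rightarrow> 'n::finite metric \<Rightarrow> 'n tensor" where
  "harnack_Z t g = tensor2 (\<lambda>i j x.
     harnack_M t g [i, j] x
       - (\<Sum>k\<in>UNIV. \<Sum>l\<in>UNIV. \<Sum>p\<in>UNIV. \<Sum>q\<in>UNIV.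
            sharp g (curvature_inverse g) [k, l, p, q] x
              * harnack_P g [k, l, i] x * harnack_P g [p, q, j] x))"

text \<open>In the following definitions \<open>F\<close> is an orthonormal frame at \<open>x\<close>; all components refer to it.\<close>

definition harnack_form ::
  "real \<Rightarrow> 'n::finite metric \<Rightarrow> ('n \<Rightarrow> real^'n) \<Rightarrow> real^'n \<Rightarrow> ('n \<Rightarrow> 'n \<Rightarrow> real) \<Rightarrow> ('n \<Rightarrow> real) \<Rightarrow> real"
  where
  "harnack_form t g F x U W =
     (\<Sum>a\<in>UNIV. \<Sum>b\<in>UNIV. frame_comp F (harnack_M t g) [a, b] x * W a * W b)
     + 2 * (\<Sum>a\<in>UNIV. \<Sum>b\<in>UNIV. \<Sum>c\<in>UNIV. frame_comp F (harnack_P g) [a, b, c] x * U a b * W c)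
     + (\<Sum>a\<in>UNIV. \<Sum>b\<in>UNIV. \<Sum>c\<in>UNIV. \<Sum>d\<in>UNIV.
          frame_comp F (Rm g) [a, b, c, d] x * U a b * U c d)"

text \<open>The index \<open>N\<close> of the vectors \<open>Y\<^sup>N \<oplus> X\<^sup>N\<close> runs over \<open>{..<m}\<close> with \<open>m = n(n+1)/2\<close>.\<close>

definition harnack_dim :: "'n::finite itself \<Rightarrow> nat" where
  "harnack_dim _ = CARD('n) * (CARD('n) + 1) div 2"

definition harnack_decomposition ::
  "real \<Rightarrow> 'n::finite metric \<Rightarrow> ('n \<Rightarrow> real^'n) \<Rightarrow> real^'n
    \<Rightarrow> (nat \<Rightarrow> 'n \<Rightarrow> 'n \<Rightarrow> real) \<Rightarrow> (nat \<Rightarrow> 'n \<Rightarrow> real) \<Rightarrow> bool" where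
  "harnack_decomposition t g F x Y X \<longleftrightarrow>
     (let m = harnack_dim TYPE('n) in
       (\<forall>N<m. two_form (Y N)) \<and>
       (\<forall>N<m. \<forall>M<m. N \<noteq> M \<longrightarrow>
          (\<Sum>a\<in>UNIV. \<Sum>b\<in>UNIV. Y N a b * Y M a b) + (\<Sum>a\<in>UNIV. X N a * X M a) = 0) \<and>
       (\<forall>a b c d. frame_comp F (Rm g) [a, b, c, d] x = (\<Sum>N<m. Y N a b * Y N c d)) \<and>
       (\<forall>a b c. frame_comp F (harnack_P g) [a, b, c] x = (\<Sum>N<m. Y N a b * X N c)) \<and>
       (\<forall>a b. frame_comp F (harnack_M t g) [a, b] x = (\<Sum>N<m. X N a * X N b)))"

definition harnack_K ::
  "real \<Rightarrow> 'n::finite metric \<Rightarrow> ('n \<Rightarrow> real^'n) \<Rightarrow> real^'n \<Rightarrow> 'n \<Rightarrow> 'n \<Rightarrow> 'n \<Rightarrow> 'n \<Rightarrow> real" where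
  "harnack_K \<tau> g F x a v t u =
     (\<Sum>i\<in>UNIV. \<Sum>j\<in>UNIV. \<Sum>r\<in>UNIV. \<Sum>s\<in>UNIV.
        frame_comp F (curvature_inverse g) [i, j, r, s] x * frame_comp F (harnack_P g) [i, j, a] x
          * frame_comp F (nabla g (Rm g)) [v, r, s, t, u] x)
     - frame_comp F (nabla g (harnack_P g)) [v, t, u, a] x
     + (\<Sum>w\<in>UNIV. frame_comp F (Rm g) [t, u, a, w] x * frame_comp F (Ric g) [v, w] x)
     + 1 / (2 * \<tau>) * frame_comp F (Rm g) [t, u, a, v] x"

definition harnack_L ::
  "'n::finite metric \<Rightarrow> ('n \<Rightarrow> real^'n) \<Rightarrow> real^'n
    \<Rightarrow> (nat \<Rightarrow> 'n \<Rightarrow> 'n \<Rightarrow> real) \<Rightarrow> (nat \<Rightarrow> 'n \<Rightarrow> real) \<Rightarrow> nat \<Rightarrow> nat \<Rightarrow> 'n \<Rightarrow> real" where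
  "harnack_L g F x Y X N M a =
     2 * (\<Sum>i\<in>UNIV. \<Sum>d\<in>UNIV. \<Sum>j\<in>UNIV. \<Sum>k\<in>UNIV. \<Sum>l\<in>UNIV.
        Y N i d * Y M j d * frame_comp F (curvature_inverse g) [i, j, k, l] x
          * frame_comp F (harnack_P g) [k, l, a] x)
     + (\<Sum>h\<in>UNIV. Y N a h * X M h) - (\<Sum>h\<in>UNIV. Y M a h * X N h)"

section \<open>Ricci flow and evolving frames\<close>

text \<open>
  A time-dependent metric on the manifold assigns to every chart \<open>c\<close> of the atlas its components
  \<open>g c t\<close>, with the usual transformation law between overlapping charts.
\<close>

definition smooth_metric_family ::
  "('m::{t2_space, second_countable_topology}, 'n::finite) chart set \<Rightarrow> real set
    \<Rightarrow> (('m, 'n) chart \<Rightarrow> real \<Rightarrow> 'n metric) \<Rightarrow> bool" where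
  "smooth_metric_family A I g \<longleftrightarrow>
     (\<forall>(U, \<phi>)\<in>A.
        smooth_on (\<lambda>(t, x). g (U, \<phi>) t x) (I \<times> \<phi> ` U) \<and>
        (\<forall>t\<in>I. \<forall>x\<in>\<phi> ` U.
           transpose (g (U, \<phi>) t x) = g (U, \<phi>) t x \<and>
           (\<forall>v. v \<noteq> 0 \<longrightarrow> v \<bullet> (g (U, \<phi>) t x *v v) > 0))) \<and>
     (\<forall>c\<in>A. \<forall>c'\<in>A. \<forall>t\<in>I. \<forall>p\<in>fst c \<inter> fst c'. \<forall>i j.
        g c t (snd c p) $ i $ j =
          (\<Sum>k\<in>UNIV. \<Sum>l\<in>UNIV.
             partial i (\<lambda>y. transition c c' y $ k) (snd c p)
               * partial j (\<lambda>y. transition c c' y $ l) (snd c p)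
               * g c' t (snd c' p) $ k $ l))"

definition ricci_flow ::
  "('m::{t2_space, second_countable_topology}, 'n::finite) chart set \<Rightarrow> real set
    \<Rightarrow> (('m, 'n) chart \<Rightarrow> real \<Rightarrow> 'n metric) \<Rightarrow> bool" where
  "ricci_flow A I g \<longleftrightarrow>
     smooth_metric_family A I g \<and>
     (\<forall>c\<in>A. \<forall>t\<in>I. \<forall>x\<in>snd c ` fst c. \<forall>i j.
        ((\<lambda>s. g c s x $ i $ j) has_real_derivative (- 2 * Ric (g c t) [i, j] x)) (at t))"

definition evolving_orthonormal_frame ::
  "real set \<Rightarrow> (real \<Rightarrow> 'n::finite metric) \<Rightarrow> real^'n \<Rightarrow> (real \<Rightarrow> 'n \<Rightarrow> real^'n) \<Rightarrow> bool" where
  "evolving_orthonormal_frame I g x F \<longleftrightarrow>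
     (\<forall>t\<in>I. orthonormal_frame (g t) x (F t) \<and>
        (\<forall>a i. ((\<lambda>s. F s a $ i) has_real_derivative
           (\<Sum>j\<in>UNIV. \<Sum>k\<in>UNIV. ginv (g t) i j x * Ric (g t) [j, k] x * F t a $ k)) (at t)))"

end

theory Submission
  imports Defs
begin

text \<open>
  Following Chow and Chu, a Ricci flow defines a torsion-free connection on space-time whose Christoffel
  symbols in the time direction are the Ricci tensor and the gradient of the scalar curvature. Its
  curvature has the components \<open>R\<^sub>a\<^sub>b\<^sub>c\<^sub>d\<close>, \<open>P\<^sub>a\<^sub>b\<^sub>c\<close> and \<open>M\<^sub>a\<^sub>b - R\<^sub>a\<^sub>b / 2t\<close>, so that all of Hamilton's evolution
  equations for them become the single heat equation \<open>(D\<^sub>t - \<Delta>) Rm = Q(Rm)\<close> for the space-time curvature.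
  The tensor \<open>Z\<close> is the Schur complement of \<open>R\<close> in this curvature: it is its value on the space-time
  two-forms \<open>E\<^sub>a\<close> that are annihilated by all spatial two-forms. Differentiating the relation which
  defines \<open>E\<^sub>a\<close> gives \<open>(D\<^sub>t - \<Delta>) Z = Q(E, E) + 2 R(\<nabla>E, \<nabla>E)\<close>. The term \<open>R(\<nabla>E, \<nabla>E)\<close> is \<open>S K K\<close> up to terms
  that account for \<open>- 2 Z / t\<close>, and writing the curvature as a sum of squares turns \<open>Q(E, E)\<close> into \<open>L L\<close>.
\<close>

section \<open>Smooth functions\<close>

text \<open>All spacetime directions in use are constant: the time direction and a spatial frame
  frozen at its value at the base time. They commute, so torsion-freeness is symmetry of the
  symbols. The evolving frame enters only at the end, where its changing coefficients reproduce the
  Ricci terms of the time connection. The cometric is degenerate and traces only spatial indices;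
  the divergence of the curvature is its contraction with the time field, and this is what couples
  the Laplacian to the time derivative. To differentiate \<open>Z\<close>, the tensor
  \<open>S\<close> must be a smooth function near the point. It is given by a definite description,
  and Rm is singular on all two-tensors, so a symmetric part is added before Cramer's rule is
  applied. The squares represent \<open>M\<close> with its term R/2t, the spacetime curvature
  contains \<open>M\<close> without it. The resulting corrections cancel between Q, the heat
  operator of Ric and \<open>S K K\<close>.\<close>

lemma frechet_derivative_eqI:
  "(f has_derivative f') (at x) \<Longrightarrow> frechet_derivative f (at x) = f'"
  by (metis frechet_derivative_at)

lemma has_derivative_cong_open:
  assumes "open S" "x \<in> S" "\<And>y. y \<in> S \<Longrightarrow> f y = g y"
  shows "(f has_derivative D) (at x) \<longleftrightarrow> (g has_derivative D) (at x)"
  using assms has_derivative_transform_within_open[of f D x UNIV S g]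
    has_derivative_transform_within_open[of g D x UNIV S f] by auto

lemma frechet_derivative_cong_open:
  assumes "open S" "x \<in> S" "\<And>y. y \<in> S \<Longrightarrow> f y = g y"
  shows "frechet_derivative f (at x) = frechet_derivative g (at x)"
  unfolding frechet_derivative_def using has_derivative_cong_open[OF assms] by simp

lemma Ck_on_cong:
  assumes "open S" "\<And>y. y \<in> S \<Longrightarrow> f y = g y"
  shows "Ck_on k f S \<longleftrightarrow> Ck_on k g S"
  using assms(2)
proof (induction k arbitrary: f g)
  case 0
  then show ?case by (simp cong: continuous_on_cong)
next
  case (Suc k)
  have "f differentiable (at x) \<longleftrightarrow> g differentiable (at x)" if "x \<in> S" for x
    unfolding differentiable_def using has_derivative_cong_open[OF assms(1) that Suc.prems] by simp
  moreover have "Ck_on k (\<lambda>x. frechet_derivative f (at x) v) S \<longleftrightarrow>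
      Ck_on k (\<lambda>x. frechet_derivative g (at x) v) S" for v
    by (rule Suc.IH) (simp add: frechet_derivative_cong_open[OF assms(1) _ Suc.prems])
  ultimately show ?case by simp
qed

text \<open>Lets the induction for products close: the derivative of a product contains
  undifferentiated factors, which are then needed at the lower order.\<close>

lemma Ck_on_SucD: "Ck_on (Suc k) f S \<Longrightarrow> Ck_on k f S"
proof (induction k arbitrary: f)
  case 0
  then show ?case
    by (auto intro!: continuous_at_imp_continuous_on differentiable_imp_continuous_within)
next
  case (Suc k)
  then show ?case by (metis Ck_on.simps(2))
qed

lemma Ck_on_add:
  assumes "open S" "Ck_on k f S" "Ck_on k g S"
  shows "Ck_on k (\<lambda>x. f x + g x) S"
  using assms(2,3)
proof (induction k arbitrary: f g)
  case 0
  then show ?case by (auto intro: continuous_intros)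
next
  case (Suc k)
  have D: "frechet_derivative (\<lambda>x. f x + g x) (at x) = 
      (\<lambda>v. frechet_derivative f (at x) v + frechet_derivative g (at x) v)" if "x \<in> S" for x
    using Suc.prems that
    by (intro frechet_derivative_eqI has_derivative_add) (simp_all add: frechet_derivative_works[symmetric])
  have "Ck_on k (\<lambda>x. frechet_derivative (\<lambda>x. f x + g x) (at x) v) S" for v
    using Suc.IH[of "\<lambda>x. frechet_derivative f (at x) v" "\<lambda>x. frechet_derivative g (at x) v"] Suc.prems
    by (subst Ck_on_cong[OF assms(1)]) (auto simp: D)
  then show ?case using Suc.prems by (auto intro: differentiable_add)
qed

lemma Ck_on_mult:
  fixes f g :: "'a::real_normed_vector \<Rightarrow> real"
  assumes "open S" "Ck_on k f S" "Ck_on k g S"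
  shows "Ck_on k (\<lambda>x. f x * g x) S"
  using assms(2,3)
proof (induction k arbitrary: f g)
  case 0
  then show ?case by (auto intro: continuous_intros)
next
  case (Suc k)
  have D: "frechet_derivative (\<lambda>x. f x * g x) (at x) = 
      (\<lambda>v. f x * frechet_derivative g (at x) v + frechet_derivative f (at x) v * g x)" if "x \<in> S" for x
    using Suc.prems that
    by (intro frechet_derivative_eqI has_derivative_mult) (simp_all add: frechet_derivative_works[symmetric])
  have "Ck_on k (\<lambda>x. frechet_derivative (\<lambda>x. f x * g x) (at x) v) S" for v
  proof (subst Ck_on_cong[OF assms(1)])
    show "Ck_on k (\<lambda>x. f x * frechet_derivative g (at x) v + frechet_derivative f (at x) v * g x) S"
      using Suc.prems Ck_on_SucD[OF Suc.prems(1)] Ck_on_SucD[OF Suc.prems(2)]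
      by (intro Ck_on_add assms(1) Suc.IH) auto
  qed (simp add: D)
  then show ?case using Suc.prems by (auto intro: differentiable_mult)
qed

lemma Ck_on_const: "Ck_on k (\<lambda>x. c) S"
  by (induction k arbitrary: c) auto

lemma Ck_on_bounded_linear:
  assumes "open S" "bounded_linear L" "Ck_on k f S"
  shows "Ck_on k (\<lambda>x. L (f x)) S"
  using assms(3)
proof (induction k arbitrary: f)
  case 0
  then show ?case using assms(2) by (auto intro: bounded_linear.continuous_on)
next
  case (Suc k)
  have d: "((\<lambda>x. L (f x)) has_derivative (\<lambda>v. L (frechet_derivative f (at x) v))) (at x)" 
    if "x \<in> S" for x
    using Suc.prems that
    by (intro bounded_linear.has_derivative[OF assms(2)]) (simp add: frechet_derivative_works[symmetric])
  have "Ck_on k (\<lambda>x. frechet_derivative (\<lambda>x. L (f x)) (at x) v) S" for v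
    using Suc by (subst Ck_on_cong[OF assms(1)]) (auto simp: frechet_derivative_eqI[OF d])
  then show ?case using d by (auto simp: differentiable_def)
qed

text \<open>The derivative of 1/f contains only f' and 1/f itself, so the induction hypothesis
  applies to it.\<close>

lemma Ck_on_inverse:
  fixes f :: "'a::real_normed_vector \<Rightarrow> real"
  assumes "open S" "Ck_on k f S" "\<And>x. x \<in> S \<Longrightarrow> f x \<noteq> 0"
  shows "Ck_on k (\<lambda>x. inverse (f x)) S"
  using assms(2)
proof (induction k)
  case 0
  then show ?case using assms(3) by (auto intro: continuous_intros)
next
  case (Suc k)
  have d: "((\<lambda>x. inverse (f x)) has_derivative
      (\<lambda>v. - (inverse (f x) * frechet_derivative f (at x) v * inverse (f x)))) (at x)" if "x \<in> S" for x
    using Suc.prems that assms(3)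
    by (intro Deriv.has_derivative_inverse) (simp_all add: frechet_derivative_works[symmetric])
  have "Ck_on k (\<lambda>x. frechet_derivative (\<lambda>x. inverse (f x)) (at x) v) S" for v
  proof (subst Ck_on_cong[OF assms(1)])
    have "Ck_on k (\<lambda>x. (-1) * (inverse (f x) * frechet_derivative f (at x) v * inverse (f x))) S"
      using Suc.prems Suc.IH Ck_on_SucD[OF Suc.prems]
      by (intro Ck_on_mult assms(1) Ck_on_const) auto
    then show "Ck_on k (\<lambda>x. - (inverse (f x) * frechet_derivative f (at x) v * inverse (f x))) S"
      by simp
  qed (simp add: frechet_derivative_eqI[OF d])
  then show ?case using d by (auto simp: differentiable_def)
qed

lemma smooth_on_cong:
  "open S \<Longrightarrow> (\<And>y. y \<in> S \<Longrightarrow> f y = g y) \<Longrightarrow> smooth_on f S \<longleftrightarrow> smooth_on g S"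
  unfolding smooth_on_def using Ck_on_cong by blast

lemma smooth_on_const [simp]: "smooth_on (\<lambda>x. c) S"
  by (simp add: smooth_on_def Ck_on_const)

lemma smooth_on_add: "open S \<Longrightarrow> smooth_on f S \<Longrightarrow> smooth_on g S \<Longrightarrow> smooth_on (\<lambda>x. f x + g x) S"
  by (simp add: smooth_on_def Ck_on_add)

lemma smooth_on_mult:
  fixes f g :: "'a::real_normed_vector \<Rightarrow> real"
  shows "open S \<Longrightarrow> smooth_on f S \<Longrightarrow> smooth_on g S \<Longrightarrow> smooth_on (\<lambda>x. f x * g x) S"
  by (simp add: smooth_on_def Ck_on_mult)

lemma smooth_on_inverse:
  fixes f :: "'a::real_normed_vector \<Rightarrow> real"
  shows "open S \<Longrightarrow> smooth_on f S \<Longrightarrow> (\<And>x. x \<in> S \<Longrightarrow> f x \<noteq> 0) \<Longrightarrow> smooth_on (\<lambda>x. inverse (f x)) S"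
  by (simp add: smooth_on_def Ck_on_inverse)

lemma smooth_on_bounded_linear:
  "open S \<Longrightarrow> bounded_linear L \<Longrightarrow> smooth_on f S \<Longrightarrow> smooth_on (\<lambda>x. L (f x)) S"
  by (simp add: smooth_on_def Ck_on_bounded_linear)

lemma smooth_on_minus: "open S \<Longrightarrow> smooth_on f S \<Longrightarrow> smooth_on (\<lambda>x. - f x) S"
  by (rule smooth_on_bounded_linear) (auto intro: bounded_linear_minus bounded_linear_ident)

lemma smooth_on_diff:
  assumes "open S" "smooth_on f S" "smooth_on g S" shows "smooth_on (\<lambda>x. f x - g x) S"
  using smooth_on_add[OF assms(1,2) smooth_on_minus[OF assms(1,3)]] by simp

lemma smooth_on_sum:
  "open S \<Longrightarrow> (\<And>i. i \<in> A \<Longrightarrow> smooth_on (f i) S) \<Longrightarrow> smooth_on (\<lambda>x. \<Sum>i\<in>A. f i x) S"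
  by (induction A rule: infinite_finite_induct) (auto intro: smooth_on_add)

lemma smooth_on_prod:
  fixes f :: "'i \<Rightarrow> 'a::real_normed_vector \<Rightarrow> real"
  shows "open S \<Longrightarrow> (\<And>i. i \<in> A \<Longrightarrow> smooth_on (f i) S) \<Longrightarrow> smooth_on (\<lambda>x. \<Prod>i\<in>A. f i x) S"
  by (induction A rule: infinite_finite_induct) (auto intro: smooth_on_mult)

lemma smooth_on_differentiable: "smooth_on f S \<Longrightarrow> x \<in> S \<Longrightarrow> f differentiable (at x)"
  unfolding smooth_on_def by (metis Ck_on.simps(2))

lemma smooth_on_frechet_derivative:
  "smooth_on f S \<Longrightarrow> smooth_on (\<lambda>x. frechet_derivative f (at x) v) S"
  unfolding smooth_on_def by (metis Ck_on.simps(2))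

lemma smooth_on_continuous: "smooth_on f S \<Longrightarrow> continuous_on S f"
  unfolding smooth_on_def by (metis Ck_on.simps(1))

lemma smooth_on_det:
  fixes M :: "'a::real_normed_vector \<Rightarrow> real^'k^'k"
  assumes "open S" "\<And>i j. smooth_on (\<lambda>x. M x $ i $ j) S"
  shows "smooth_on (\<lambda>x. det (M x)) S"
  unfolding det_def using assms by (intro smooth_on_sum smooth_on_mult smooth_on_prod) auto

lemma matrix_inv_both:
  assumes "invertible (A :: real^'k^'k)"
  shows matrix_inv_right: "A ** matrix_inv A = mat 1" and matrix_inv_left: "matrix_inv A ** A = mat 1"
  using assms someI_ex[of "\<lambda>A'. A ** A' = mat 1 \<and> A' ** A = mat 1"]
  unfolding invertible_def matrix_inv_def by auto

text \<open>By Cramer's rule.\<close>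

lemma smooth_on_matrix_inv:
  fixes M :: "'a::real_normed_vector \<Rightarrow> real^'k^'k"
  assumes S: "open S" and M: "\<And>i j. smooth_on (\<lambda>x. M x $ i $ j) S"
    and inv: "\<And>x. x \<in> S \<Longrightarrow> invertible (M x)"
  shows "smooth_on (\<lambda>x. matrix_inv (M x) $ i $ j) S"
proof -
  \<comment> \<open>\<open>M x\<close> with its column \<open>i\<close> replaced by the
    \<open>j\<close>-th unit vector.\<close>
  let ?N = "\<lambda>x. (\<chi> p q. if q = i then axis j 1 $ p else M x $ p $ q) :: real^'k^'k"
  have eq: "matrix_inv (M x) $ i $ j = det (?N x) * inverse (det (M x))" if "x \<in> S" for x
  proof -
    have d: "det (M x) \<noteq> 0" using inv[OF that] by (simp add: invertible_det_nz)
    have "M x *v (matrix_inv (M x) *v axis j 1) = axis j 1"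
      using matrix_inv_right[OF inv[OF that]] by (simp add: matrix_vector_mul_assoc)
    then have "matrix_inv (M x) *v axis j 1 = (\<chi> k. det (\<chi> p q. if q = k then axis j 1 $ p else M x $ p $ q) / det (M x))"
      using cramer[OF d] by blast
    moreover have "(matrix_inv (M x) *v axis j 1) $ i = matrix_inv (M x) $ i $ j"
      by (simp add: matrix_vector_mult_basis column_def)
    ultimately show ?thesis by (simp add: divide_inverse)
  qed
  have "smooth_on (\<lambda>x. det (?N x) * inverse (det (M x))) S"
  proof (intro smooth_on_mult smooth_on_inverse smooth_on_det S M)
    fix p q show "smooth_on (\<lambda>x. ?N x $ p $ q) S" using M by (cases "q = i") auto
  qed (use inv invertible_det_nz in auto)
  then show ?thesis by (subst smooth_on_cong[OF S eq])
qed

lemma frechet_derivative_line: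
  assumes "f differentiable (at (z + s *\<^sub>R u))"
  shows "((\<lambda>s. f (z + s *\<^sub>R u)) has_vector_derivative frechet_derivative f (at (z + s *\<^sub>R u)) u) (at s)"
proof -
  have "((\<lambda>s. f (z + s *\<^sub>R u)) has_derivative (\<lambda>h. frechet_derivative f (at (z + s *\<^sub>R u)) (h *\<^sub>R u))) (at s)"
  proof -
    have "((\<lambda>s. z + s *\<^sub>R u) has_derivative (\<lambda>h. h *\<^sub>R u)) (at s)"
      by (auto intro!: derivative_eq_intros)
    from has_derivative_compose[OF this assms[unfolded frechet_derivative_works]] show ?thesis .
  qed
  then show ?thesis
    unfolding has_vector_derivative_def
    using linear_frechet_derivative[OF assms] by (simp add: linear_cmul)
qed

text \<open>
  Both mixed derivatives are limits of the second difference quotient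
  \<open>(f (z + hu + hv) - f (z + hu) - f (z + hv) + f z) / h\<^sup>2\<close>.
\<close>

lemma second_difference:
  fixes f :: "'a::real_normed_vector \<Rightarrow> real"
  assumes h: "0 < h" and box: "\<And>a b. 0 \<le> a \<Longrightarrow> a \<le> h \<Longrightarrow> 0 \<le> b \<Longrightarrow> b \<le> h \<Longrightarrow> z + a *\<^sub>R u + b *\<^sub>R v \<in> S"
    and f: "\<And>x. x \<in> S \<Longrightarrow> f differentiable (at x)"
    and f': "\<And>x. x \<in> S \<Longrightarrow> (\<lambda>x. frechet_derivative f (at x) u) differentiable (at x)"
  obtains a b where "0 \<le> a" "a \<le> h" "0 \<le> b" "b \<le> h"
    "f (z + h *\<^sub>R u + h *\<^sub>R v) - f (z + h *\<^sub>R u) - f (z + h *\<^sub>R v) + f z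
      = h * h * frechet_derivative (\<lambda>x. frechet_derivative f (at x) u) (at (z + a *\<^sub>R u + b *\<^sub>R v)) v"
proof -
  \<comment> \<open>The mean value theorem is applied twice: to the difference in direction
    \<open>v\<close> as a function of the step along \<open>u\<close>, then to the derivative along
    \<open>u\<close> as a function of the step along \<open>v\<close>.\<close>
  let ?\<phi> = "\<lambda>s. f ((z + h *\<^sub>R v) + s *\<^sub>R u) - f (z + s *\<^sub>R u)"
  let ?g = "\<lambda>x. frechet_derivative f (at x) u"
  have "\<exists>a. 0 < a \<and> a < h \<and> ?\<phi> h - ?\<phi> 0 = (h - 0) * (?g ((z + h *\<^sub>R v) + a *\<^sub>R u) - ?g (z + a *\<^sub>R u))"
  proof (rule MVT2[OF h])
    fix s assume s: "0 \<le> s" "s \<le> h"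
    have 1: "(z + h *\<^sub>R v) + s *\<^sub>R u \<in> S" using box[of s h] s h by (simp add: algebra_simps)
    have 2: "z + s *\<^sub>R u \<in> S" using box[of s 0] s h by simp
    show "(?\<phi> has_real_derivative ?g ((z + h *\<^sub>R v) + s *\<^sub>R u) - ?g (z + s *\<^sub>R u)) (at s)"
      using frechet_derivative_line[OF f[OF 1]] frechet_derivative_line[OF f[OF 2]]
      unfolding has_real_derivative_iff_has_vector_derivative by (rule has_vector_derivative_diff)
  qed
  then obtain a where a: "0 < a" "a < h"
    and A: "?\<phi> h - ?\<phi> 0 = h * (?g ((z + h *\<^sub>R v) + a *\<^sub>R u) - ?g (z + a *\<^sub>R u))" by auto
  let ?\<psi> = "\<lambda>s. ?g ((z + a *\<^sub>R u) + s *\<^sub>R v)"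
  have "\<exists>b. 0 < b \<and> b < h \<and> ?\<psi> h - ?\<psi> 0 = (h - 0) * frechet_derivative ?g (at ((z + a *\<^sub>R u) + b *\<^sub>R v)) v"
  proof (rule MVT2[OF h])
    fix s assume s: "0 \<le> s" "s \<le> h"
    show "(?\<psi> has_real_derivative frechet_derivative ?g (at ((z + a *\<^sub>R u) + s *\<^sub>R v)) v) (at s)"
      unfolding has_real_derivative_iff_has_vector_derivative
      using a s by (intro frechet_derivative_line f' box) auto
  qed
  then obtain b where b: "0 < b" "b < h"
    and B: "?\<psi> h - ?\<psi> 0 = h * frechet_derivative ?g (at ((z + a *\<^sub>R u) + b *\<^sub>R v)) v" by auto
  have "?\<phi> h - ?\<phi> 0 = h * (?\<psi> h - ?\<psi> 0)" using A by (simp add: algebra_simps)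
  also have "\<dots> = h * h * frechet_derivative ?g (at (z + a *\<^sub>R u + b *\<^sub>R v)) v" using B by simp
  finally have 1: "?\<phi> h - ?\<phi> 0 = h * h * frechet_derivative ?g (at (z + a *\<^sub>R u + b *\<^sub>R v)) v" .
  have 2: "f (z + h *\<^sub>R u + h *\<^sub>R v) - f (z + h *\<^sub>R u) - f (z + h *\<^sub>R v) + f z = ?\<phi> h - ?\<phi> 0"
  proof -
    have "z + h *\<^sub>R v + h *\<^sub>R u = z + h *\<^sub>R u + h *\<^sub>R v" by (simp only: ac_simps)
    then have "f (z + h *\<^sub>R v + h *\<^sub>R u) = f (z + h *\<^sub>R u + h *\<^sub>R v)" by (rule arg_cong)
    then show ?thesis by simp
  qed
  show ?thesis
  proof (rule that[of a b])
    show "0 \<le> a" "a \<le> h" "0 \<le> b" "b \<le> h" using a b by simp_all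
  qed (rule trans[OF 2 1])
qed

lemma frechet_derivative_commute:
  fixes f :: "'a::real_normed_vector \<Rightarrow> real"
  assumes S: "open S" and f: "smooth_on f S" and z: "z \<in> S"
  shows "frechet_derivative (\<lambda>x. frechet_derivative f (at x) u) (at z) v
    = frechet_derivative (\<lambda>x. frechet_derivative f (at x) v) (at z) u" (is "?A z = ?B z")
proof (rule ccontr)
  assume neq: "?A z \<noteq> ?B z"
  define \<epsilon> where "\<epsilon> = \<bar>?A z - ?B z\<bar> / 2"
  have \<epsilon>: "\<epsilon> > 0" using neq by (simp add: \<epsilon>_def)
  have "continuous_on S ?A" "continuous_on S ?B"
    using f by (auto intro!: smooth_on_continuous smooth_on_frechet_derivative)
  then have "isCont ?A z" "isCont ?B z" using S z by (auto simp: continuous_on_eq_continuous_at)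
  then obtain d1 d2 where d: "d1 > 0" "\<And>x. dist x z < d1 \<Longrightarrow> dist (?A x) (?A z) < \<epsilon>"
    "d2 > 0" "\<And>x. dist x z < d2 \<Longrightarrow> dist (?B x) (?B z) < \<epsilon>"
    unfolding continuous_at_eps_delta using \<epsilon> by metis
  obtain d3 where d3: "d3 > 0" "ball z d3 \<subseteq> S" using S z open_contains_ball by blast
  define \<delta> where "\<delta> = min d1 (min d2 d3)"
  \<comment> \<open>The whole parallelogram with sides \<open>h u\<close> and \<open>h v\<close>
    must stay within \<delta> of \<open>z\<close>; the summand 1 keeps the denominator positive when
    both vectors vanish.\<close>
  define h where "h = \<delta> / (2 * (norm u + norm v + 1))"
  have \<delta>: "\<delta> > 0" using d d3 by (simp add: \<delta>_def)
  have h: "h > 0" using \<delta> by (simp add: h_def add_nonneg_pos)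
  have near: "dist (z + a *\<^sub>R u + b *\<^sub>R v) z < \<delta>" if "0 \<le> a" "a \<le> h" "0 \<le> b" "b \<le> h" for a b
  proof -
    have "norm (a *\<^sub>R u + b *\<^sub>R v) \<le> a * norm u + b * norm v"
      using norm_triangle_ineq[of "a *\<^sub>R u" "b *\<^sub>R v"] that by simp
    also have "\<dots> \<le> h * norm u + h * norm v" using that by (intro add_mono mult_right_mono) auto
    also have "\<dots> \<le> h * (norm u + norm v + 1)" using h by (simp add: algebra_simps)
    also have "\<dots> = \<delta> / 2" unfolding h_def
      using norm_ge_zero[of u] norm_ge_zero[of v] by (simp add: field_simps del: norm_ge_zero)
    also have "\<dots> < \<delta>" using \<delta> by simp
    finally show ?thesis by (simp add: dist_norm algebra_simps)
  qed
  have box: "z + a *\<^sub>R u + b *\<^sub>R v \<in> S" if "0 \<le> a" "a \<le> h" "0 \<le> b" "b \<le> h" for a b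
    using near[OF that] d3 by (auto simp: \<delta>_def dist_commute)
  have box': "z + a *\<^sub>R v + b *\<^sub>R u \<in> S" if "0 \<le> a" "a \<le> h" "0 \<le> b" "b \<le> h" for a b
    using box[of b a] that by (simp add: algebra_simps)
  have df: "f differentiable (at x)" "(\<lambda>x. frechet_derivative f (at x) w) differentiable (at x)" if "x \<in> S" for x w
    using that f by (auto intro!: smooth_on_differentiable smooth_on_frechet_derivative)
  obtain a b where ab: "0 \<le> a" "a \<le> h" "0 \<le> b" "b \<le> h"
    "f (z + h *\<^sub>R u + h *\<^sub>R v) - f (z + h *\<^sub>R u) - f (z + h *\<^sub>R v) + f z = h * h * ?A (z + a *\<^sub>R u + b *\<^sub>R v)"
    by (rule second_difference[OF h box df(1) df(2)])
  obtain a' b' where ab': "0 \<le> a'" "a' \<le> h" "0 \<le> b'" "b' \<le> h"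
    "f (z + h *\<^sub>R v + h *\<^sub>R u) - f (z + h *\<^sub>R v) - f (z + h *\<^sub>R u) + f z = h * h * ?B (z + a' *\<^sub>R v + b' *\<^sub>R u)"
    by (rule second_difference[OF h box' df(1) df(2)])
  \<comment> \<open>The second difference is symmetric in \<open>u\<close> and \<open>v\<close>, so
    both orders of the mean value theorem evaluate the same number.\<close>
  have "h * h * ?A (z + a *\<^sub>R u + b *\<^sub>R v) = h * h * ?B (z + b' *\<^sub>R u + a' *\<^sub>R v)"
  proof -
    have "z + h *\<^sub>R v + h *\<^sub>R u = z + h *\<^sub>R u + h *\<^sub>R v" "z + a' *\<^sub>R v + b' *\<^sub>R u = z + b' *\<^sub>R u + a' *\<^sub>R v"
      by (simp_all only: ac_simps)
    then show ?thesis using ab(5) ab'(5) by (smt (verit))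
  qed
  then have "?A (z + a *\<^sub>R u + b *\<^sub>R v) = ?B (z + b' *\<^sub>R u + a' *\<^sub>R v)" using h by simp
  moreover have "dist (?A (z + a *\<^sub>R u + b *\<^sub>R v)) (?A z) < \<epsilon>" "dist (?B (z + b' *\<^sub>R u + a' *\<^sub>R v)) (?B z) < \<epsilon>"
    using near[of a b] near[of b' a'] ab ab' d by (auto simp: \<delta>_def)
  ultimately have "\<bar>?A z - ?B z\<bar> < 2 * \<epsilon>" by (auto simp: dist_real_def)
  then show False by (simp add: \<epsilon>_def)
qed

section \<open>Torsion-free connections in a commuting frame\<close>

text \<open>The matrix \<open>M\<close> acting as a derivation on the indices of a tensor: on one index, \<open>T\<^sub>i \<mapsto> M\<^sub>i\<^sup>j T\<^sub>j\<close>.\<close>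

primrec act :: "('i::finite \<Rightarrow> 'i \<Rightarrow> real) \<Rightarrow> ('i list \<Rightarrow> real) \<Rightarrow> 'i list \<Rightarrow> real" where
  "act M T [] = 0"
| "act M T (i # is) = (\<Sum>j\<in>UNIV. M i j * T (j # is)) + act M (\<lambda>js. T (i # js)) is"

lemma act_add: "act M (\<lambda>js. T js + U js) is = act M T is + act M U is"
  by (induction "is" arbitrary: T U) (auto simp: algebra_simps sum.distrib)

lemma act_cmult: "act M (\<lambda>js. c * T js) is = c * act M T is"
  by (induction "is" arbitrary: T) (auto simp: algebra_simps sum_distrib_left)

lemma act_zero [simp]: "act M (\<lambda>js. 0) is = 0"
  using act_cmult[of M 0 "\<lambda>_. 0"] by simp

lemma act_uminus: "act M (\<lambda>js. - T js) is = - act M T is"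
  using act_cmult[of M "-1" T] by simp

lemma act_diff: "act M (\<lambda>js. T js - U js) is = act M T is - act M U is"
  using act_add[of M T "\<lambda>js. - U js"] by (simp add: act_uminus)

lemma act_sum: "act M (\<lambda>js. \<Sum>k\<in>A. T k js) is = (\<Sum>k\<in>A. act M (T k) is)"
  by (induction A rule: infinite_finite_induct) (auto simp: act_add)

lemma act_matrix_add: "act (\<lambda>i j. M i j + N i j) T is = act M T is + act N T is"
  by (induction "is" arbitrary: T) (auto simp: algebra_simps sum.distrib)

lemma act_matrix_diff: "act (\<lambda>i j. M i j - N i j) T is = act M T is - act N T is"
  by (induction "is" arbitrary: T) (auto simp: algebra_simps sum_subtractf)

lemma act_append:
  "act M T (is @ js) = act M (\<lambda>is. T (is @ js)) is + act M (\<lambda>js. T (is @ js)) js"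
  by (induction "is" arbitrary: T) auto

text \<open>Leibniz rule for tensor products; \<open>cov_contraction\<close> needs it to separate
  the free indices of the two factors.\<close>

lemma act_tensor:
  "act M (\<lambda>js. T (take m js) * U (drop m js)) is
    = act M T (take m is) * U (drop m is) + T (take m is) * act M U (drop m is)"
proof (induction m arbitrary: T "is")
  case 0
  then show ?case by (simp add: act_cmult)
next
  case (Suc m)
  show ?case
  proof (cases "is")
    case (Cons i js)
    then show ?thesis using Suc.IH[of "\<lambda>js. T (i # js)" js]
      by (simp add: distrib_right sum_distrib_right mult.assoc)
  qed simp
qed

text \<open>Matrices act on tensors as a Lie algebra. This is the source of the terms of the
  curvature that are quadratic in the connection.\<close>

lemma act_commutator:
  "act M (\<lambda>js. act N T js) is - act N (\<lambda>js. act M T js) is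
    = act (\<lambda>i k. \<Sum>j\<in>UNIV. M i j * N j k - N i j * M j k) T is"
proof (induction "is" arbitrary: T)
  case (Cons i "is")
  have 1: "(\<Sum>j\<in>UNIV. M i j * (\<Sum>k\<in>UNIV. N j k * T (k # is)))
      = (\<Sum>k\<in>UNIV. (\<Sum>j\<in>UNIV. M i j * N j k) * T (k # is))" for M N :: "'a \<Rightarrow> 'a \<Rightarrow> real"
    unfolding sum_distrib_left sum_distrib_right mult.assoc by (rule sum.swap)
  show ?case using Cons.IH[of "\<lambda>js. T (i # js)"] 1[of M N] 1[of N M]
    by (simp add: act_add act_sum act_cmult distrib_left left_diff_distrib sum.distrib sum_subtractf)
qed simp

text \<open>The directions \<open>e\<close> are constant vectors and therefore commute, which keeps
  brackets out of torsion, curvature and the Ricci identity.\<close>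

locale frame_domain =
  fixes \<Omega> :: "'z::real_normed_vector set" and e :: "'i::finite \<Rightarrow> 'z"
  assumes open_domain: "open \<Omega>"
begin

definition pd :: "'i \<Rightarrow> ('z \<Rightarrow> real) \<Rightarrow> 'z \<Rightarrow> real" where
  "pd \<alpha> f z = frechet_derivative f (at z) (e \<alpha>)"

abbreviation smooth :: "('z \<Rightarrow> real) \<Rightarrow> bool" where "smooth f \<equiv> smooth_on f \<Omega>"

lemma smooth_pd: "smooth f \<Longrightarrow> smooth (pd \<alpha> f)"
  unfolding pd_def by (rule smooth_on_frechet_derivative)

lemmas smooth_intros [intro!] =
  smooth_on_add[OF open_domain] smooth_on_mult[OF open_domain] smooth_on_minus[OF open_domain]
  smooth_on_diff[OF open_domain] smooth_on_sum[OF open_domain] smooth_pd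

lemma works: "smooth f \<Longrightarrow> z \<in> \<Omega> \<Longrightarrow> (f has_derivative frechet_derivative f (at z)) (at z)"
  using smooth_on_differentiable frechet_derivative_works by blast

lemma pd_cong: "(\<And>y. y \<in> \<Omega> \<Longrightarrow> f y = h y) \<Longrightarrow> z \<in> \<Omega> \<Longrightarrow> pd \<alpha> f z = pd \<alpha> h z"
  unfolding pd_def using frechet_derivative_cong_open[OF open_domain] by metis

lemma pd_const [simp]: "pd \<alpha> (\<lambda>z. c) z = 0"
  by (simp add: pd_def)

lemma pd_add: "smooth f \<Longrightarrow> smooth h \<Longrightarrow> z \<in> \<Omega> \<Longrightarrow> pd \<alpha> (\<lambda>z. f z + h z) z = pd \<alpha> f z + pd \<alpha> h z"
  unfolding pd_def by (subst frechet_derivative_eqI[OF has_derivative_add[OF works works]]) auto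

lemma pd_diff: "smooth f \<Longrightarrow> smooth h \<Longrightarrow> z \<in> \<Omega> \<Longrightarrow> pd \<alpha> (\<lambda>z. f z - h z) z = pd \<alpha> f z - pd \<alpha> h z"
  unfolding pd_def by (subst frechet_derivative_eqI[OF has_derivative_diff[OF works works]]) auto

lemma pd_uminus: "smooth f \<Longrightarrow> z \<in> \<Omega> \<Longrightarrow> pd \<alpha> (\<lambda>z. - f z) z = - pd \<alpha> f z"
  unfolding pd_def by (subst frechet_derivative_eqI[OF has_derivative_minus[OF works]]) auto

lemma pd_mult: "smooth f \<Longrightarrow> smooth h \<Longrightarrow> z \<in> \<Omega> \<Longrightarrow> pd \<alpha> (\<lambda>z. f z * h z) z = pd \<alpha> f z * h z + f z * pd \<alpha> h z"
  unfolding pd_def by (subst frechet_derivative_eqI[OF has_derivative_mult[OF works works]]) auto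

lemma pd_cmult: "smooth f \<Longrightarrow> z \<in> \<Omega> \<Longrightarrow> pd \<alpha> (\<lambda>z. c * f z) z = c * pd \<alpha> f z"
  by (subst pd_mult) auto

lemma pd_sum:
  "(\<And>k. k \<in> A \<Longrightarrow> smooth (f k)) \<Longrightarrow> z \<in> \<Omega> \<Longrightarrow> pd \<alpha> (\<lambda>z. \<Sum>k\<in>A. f k z) z = (\<Sum>k\<in>A. pd \<alpha> (f k) z)"
  by (induction A rule: infinite_finite_induct) (auto simp: pd_add smooth_on_sum[OF open_domain])

lemma pd_commute: "smooth f \<Longrightarrow> z \<in> \<Omega> \<Longrightarrow> pd \<alpha> (pd \<beta> f) z = pd \<beta> (pd \<alpha> f) z"
  unfolding pd_def by (rule frechet_derivative_commute[OF open_domain])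

lemma smooth_act:
  assumes "\<And>i j. smooth (\<lambda>z. M z i j)" "\<And>is. smooth (T is)"
  shows "smooth (\<lambda>z. act (M z) (\<lambda>js. T js z) is)"
  using assms(2) by (induction "is" arbitrary: T) (auto intro: assms(1))

lemma pd_act:
  assumes M: "\<And>i j. smooth (\<lambda>z. M z i j)" and T: "\<And>is. smooth (T is)" and z: "z \<in> \<Omega>"
  shows "pd \<alpha> (\<lambda>z. act (M z) (\<lambda>js. T js z) is) z
    = act (\<lambda>i j. pd \<alpha> (\<lambda>z. M z i j) z) (\<lambda>js. T js z) is + act (M z) (\<lambda>js. pd \<alpha> (T js) z) is"
  using T
proof (induction "is" arbitrary: T)
  case (Cons i "is")
  have "smooth (\<lambda>z. act (M z) (\<lambda>js. T (i # js) z) is)" by (rule smooth_act) (auto intro: M Cons.prems)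
  then show ?case using Cons.IH[of "\<lambda>js. T (i # js)"] Cons.prems M z
    by (simp add: pd_add pd_sum pd_mult smooth_on_sum[OF open_domain] smooth_on_mult[OF open_domain]
        sum.distrib)
qed simp

end

text \<open>In a commuting frame the torsion vanishes exactly when the symbols are symmetric in
  their lower indices. No metric enters, because spacetime carries only a degenerate
  cometric.\<close>

locale connection = frame_domain \<Omega> e for \<Omega> :: "'z::real_normed_vector set" and e :: "'i::finite \<Rightarrow> 'z" +
  fixes G :: "'i \<Rightarrow> 'i \<Rightarrow> 'i \<Rightarrow> 'z \<Rightarrow> real"
  assumes smooth_G [intro!]: "smooth_on (G k \<alpha> \<beta>) \<Omega>"
    and G_sym: "z \<in> \<Omega> \<Longrightarrow> G k \<alpha> \<beta> z = G k \<beta> \<alpha> z"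
begin

text \<open>As in \<open>nabla\<close>, the index of differentiation comes first.\<close>

fun cov :: "('i list \<Rightarrow> 'z \<Rightarrow> real) \<Rightarrow> 'i list \<Rightarrow> 'z \<Rightarrow> real" where
  "cov T [] z = 0"
| "cov T (\<alpha> # is) z = pd \<alpha> (T is) z - act (\<lambda>\<beta> k. G k \<alpha> \<beta> z) (\<lambda>js. T js z) is"

lemma cov_Cons_fun:
  "cov T (\<alpha> # is) = (\<lambda>z. pd \<alpha> (T is) z - act (\<lambda>\<beta> k. G k \<alpha> \<beta> z) (\<lambda>js. T js z) is)"
  by (rule ext) simp

lemma smooth_cov: "(\<And>is. smooth (T is)) \<Longrightarrow> smooth (cov T is)"
proof (cases "is")
  case Nil
  then show ?thesis by (simp add: fun_eq_iff[THEN iffD2, of "cov T []" "\<lambda>_. 0"])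
next
  case (Cons \<alpha> js)
  assume "\<And>is. smooth (T is)"
  then show ?thesis unfolding Cons cov_Cons_fun by (auto intro!: smooth_act)
qed

lemma cov_cong:
  assumes "\<And>is y. y \<in> \<Omega> \<Longrightarrow> T is y = U is y" "z \<in> \<Omega>"
  shows "cov T is z = cov U is z"
proof (cases "is")
  case (Cons \<alpha> js)
  have "pd \<alpha> (T js) z = pd \<alpha> (U js) z" using assms by (intro pd_cong) auto
  then show ?thesis using assms Cons by simp
qed simp

lemma cov_zero: "(\<And>is y. y \<in> \<Omega> \<Longrightarrow> T is y = 0) \<Longrightarrow> z \<in> \<Omega> \<Longrightarrow> cov T is z = 0"
proof -
  assume "\<And>is y. y \<in> \<Omega> \<Longrightarrow> T is y = 0" "z \<in> \<Omega>"
  then have "cov T is z = cov (\<lambda>_ _. 0) is z" by (intro cov_cong) auto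
  also have "\<dots> = 0" by (cases "is") auto
  finally show ?thesis .
qed

text \<open>The component with upper index \<open>k\<close> of the curvature operator of directions
  \<alpha>, \<beta> applied to direction \<delta>; the index order is that of
  \<open>riemann_up\<close>.\<close>

definition curv :: "'i \<Rightarrow> 'i \<Rightarrow> 'i \<Rightarrow> 'i \<Rightarrow> 'z \<Rightarrow> real" where
  "curv k \<alpha> \<beta> \<delta> z = pd \<alpha> (G k \<beta> \<delta>) z - pd \<beta> (G k \<alpha> \<delta>) z
    + (\<Sum>p\<in>UNIV. G k \<alpha> p z * G p \<beta> \<delta> z - G k \<beta> p z * G p \<alpha> \<delta> z)"

lemma smooth_curv [intro!]: "smooth (curv k \<alpha> \<beta> \<delta>)"
  unfolding curv_def by auto

lemma curv_antisym: "curv k \<beta> \<alpha> \<delta> z = - curv k \<alpha> \<beta> \<delta> z"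
  unfolding curv_def by (simp add: sum_subtractf)

lemma pd_G_sym: "z \<in> \<Omega> \<Longrightarrow> pd \<gamma> (G k \<alpha> \<beta>) z = pd \<gamma> (G k \<beta> \<alpha>) z"
  by (rule pd_cong) (auto intro: G_sym)

lemma curv_cyclic:
  assumes "z \<in> \<Omega>"
  shows "curv k \<alpha> \<beta> \<delta> z + curv k \<beta> \<delta> \<alpha> z + curv k \<delta> \<alpha> \<beta> z = 0"
  unfolding curv_def using assms
  by (simp add: sum_subtractf pd_G_sym[of z \<alpha> k \<delta> \<beta>] pd_G_sym[of z \<beta> k \<delta> \<alpha>] pd_G_sym[of z \<delta> k \<beta> \<alpha>]
      G_sym[of z _ \<beta> \<alpha>] G_sym[of z _ \<delta> \<alpha>] G_sym[of z _ \<delta> \<beta>])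

text \<open>In the difference of the two orders the second partial derivatives cancel, the terms
  with one derivative of \<open>T\<close> cancel crosswise, and torsion-freeness removes the
  correction on the differentiation index. Derivatives of \<open>G\<close> and a commutator remain,
  which is the curvature.\<close>

theorem ricci_identity:
  assumes T: "\<And>is. smooth (T is)" and z: "z \<in> \<Omega>"
  shows "cov (cov T) (\<alpha> # \<beta> # is) z - cov (cov T) (\<beta> # \<alpha> # is) z
    = - act (\<lambda>i k. curv k \<alpha> \<beta> i z) (\<lambda>js. T js z) is"
proof -
  let ?A = "\<lambda>\<alpha> \<beta> k. G k \<alpha> \<beta> z" and ?T = "\<lambda>js. T js z"
  have expand: "cov (cov T) (\<alpha> # \<beta> # is) z = pd \<alpha> (pd \<beta> (T is)) z
      - act (\<lambda>i k. pd \<alpha> (G k \<beta> i) z) ?T is - act (?A \<beta>) (\<lambda>js. pd \<alpha> (T js) z) is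
      - (\<Sum>k\<in>UNIV. G k \<alpha> \<beta> z * cov T (k # is) z)
      - (act (?A \<alpha>) (\<lambda>js. pd \<beta> (T js) z) is - act (?A \<alpha>) (\<lambda>js. act (?A \<beta>) ?T js) is)" for \<alpha> \<beta>
  proof -
    have "pd \<alpha> (cov T (\<beta> # is)) z = pd \<alpha> (pd \<beta> (T is)) z
        - (act (\<lambda>i k. pd \<alpha> (G k \<beta> i) z) ?T is + act (?A \<beta>) (\<lambda>js. pd \<alpha> (T js) z) is)"
      unfolding cov_Cons_fun using T z
      by (subst pd_diff) (auto intro!: smooth_act simp: pd_act smooth_G)
    then show ?thesis by (simp add: act_diff)
  qed
  have G: "(\<Sum>k\<in>UNIV. G k \<beta> \<alpha> z * cov T (k # is) z) = (\<Sum>k\<in>UNIV. G k \<alpha> \<beta> z * cov T (k # is) z)"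
    using G_sym[OF z] by simp
  have "act (\<lambda>i k. curv k \<alpha> \<beta> i z) ?T is = act (\<lambda>i k. pd \<alpha> (G k \<beta> i) z) ?T is
      - act (\<lambda>i k. pd \<beta> (G k \<alpha> i) z) ?T is
      - (act (?A \<alpha>) (\<lambda>js. act (?A \<beta>) ?T js) is - act (?A \<beta>) (\<lambda>js. act (?A \<alpha>) ?T js) is)"
    unfolding act_commutator act_matrix_diff[symmetric]
    by (rule arg_cong[of _ _ "\<lambda>M. act M ?T is"]) (auto simp: curv_def sum_subtractf mult.commute fun_eq_iff)
  then show ?thesis unfolding expand using G pd_commute[OF T z, of \<alpha> \<beta> "is"] by linarith
qed

text \<open>The second Bianchi identity with connection terms only on \<open>k\<close> and \<delta>.
  Those on the three cyclic indices cancel among themselves by symmetry of \<open>G\<close>, which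
  is done in \<open>second_bianchi\<close>.\<close>

lemma curv_bianchi:
  assumes z: "z \<in> \<Omega>"
  shows "(pd \<epsilon> (curv k \<alpha> \<beta> \<delta>) z + (\<Sum>p\<in>UNIV. G k \<epsilon> p z * curv p \<alpha> \<beta> \<delta> z - curv k \<alpha> \<beta> p z * G p \<epsilon> \<delta> z))
    + (pd \<alpha> (curv k \<beta> \<epsilon> \<delta>) z + (\<Sum>p\<in>UNIV. G k \<alpha> p z * curv p \<beta> \<epsilon> \<delta> z - curv k \<beta> \<epsilon> p z * G p \<alpha> \<delta> z))
    + (pd \<beta> (curv k \<epsilon> \<alpha> \<delta>) z + (\<Sum>p\<in>UNIV. G k \<beta> p z * curv p \<epsilon> \<alpha> \<delta> z - curv k \<epsilon> \<alpha> p z * G p \<beta> \<delta> z)) = 0"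
proof -
  \<comment> \<open>\<open>c\<close> collects the products of three symbols, \<open>l\<close> and
    \<open>r\<close> the products in which the right or the left factor is differentiated. All of
    them cancel in the cyclic sum.\<close>
  define c where "c a b d = (\<Sum>p\<in>UNIV. \<Sum>q\<in>UNIV. G k a p z * G p b q z * G q d \<delta> z)" for a b d
  define l where "l a b d = (\<Sum>p\<in>UNIV. G k a p z * pd b (G p d \<delta>) z)" for a b d
  define r where "r a b d = (\<Sum>p\<in>UNIV. pd b (G k d p) z * G p a \<delta> z)" for a b d
  have D: "pd \<epsilon> (curv k \<alpha> \<beta> \<delta>) z = pd \<epsilon> (pd \<alpha> (G k \<beta> \<delta>)) z - pd \<epsilon> (pd \<beta> (G k \<alpha> \<delta>)) z
      + r \<beta> \<epsilon> \<alpha> + l \<alpha> \<epsilon> \<beta> - r \<alpha> \<epsilon> \<beta> - l \<beta> \<epsilon> \<alpha>" for \<epsilon> \<alpha> \<beta>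
    unfolding curv_def l_def r_def using z
    by (subst pd_add pd_diff pd_sum pd_mult; (auto)?)+
      (simp add: pd_diff pd_sum pd_mult smooth_on_mult[OF open_domain] smooth_G sum.distrib sum_subtractf)
  have L: "(\<Sum>p\<in>UNIV. G k \<epsilon> p z * curv p \<alpha> \<beta> \<delta> z) = l \<epsilon> \<alpha> \<beta> - l \<epsilon> \<beta> \<alpha> + c \<epsilon> \<alpha> \<beta> - c \<epsilon> \<beta> \<alpha>" for \<epsilon> \<alpha> \<beta>
    unfolding curv_def l_def c_def
    by (simp add: sum.distrib sum_subtractf sum_distrib_left algebra_simps)
  have R: "(\<Sum>p\<in>UNIV. curv k \<alpha> \<beta> p z * G p \<epsilon> \<delta> z) = r \<epsilon> \<alpha> \<beta> - r \<epsilon> \<beta> \<alpha> + c \<alpha> \<beta> \<epsilon> - c \<beta> \<alpha> \<epsilon>" for \<epsilon> \<alpha> \<beta>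
  proof -
    have "(\<Sum>p\<in>UNIV. (\<Sum>q\<in>UNIV. G k a q z * G q b p z) * G p d \<delta> z) = c a b d" for a b d
      unfolding c_def by (subst sum.swap) (simp add: sum_distrib_right)
    then show ?thesis
      unfolding curv_def r_def by (simp add: sum.distrib sum_subtractf algebra_simps)
  qed
  show ?thesis unfolding sum_subtractf D L R
    using pd_commute[OF smooth_G z, of \<epsilon> \<alpha> k \<beta> \<delta>] pd_commute[OF smooth_G z, of \<epsilon> \<beta> k \<alpha> \<delta>]
      pd_commute[OF smooth_G z, of \<alpha> \<beta> k \<epsilon> \<delta>] by linarith
qed

text \<open>The covariant derivative of a tensor whose first two arguments are upper indices.\<close>

fun covu :: "('i \<Rightarrow> 'i \<Rightarrow> 'i list \<Rightarrow> 'z \<Rightarrow> real) \<Rightarrow> 'i \<Rightarrow> 'i \<Rightarrow> 'i list \<Rightarrow> 'z \<Rightarrow> real" where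
  "covu E \<alpha> \<beta> [] z = 0"
| "covu E \<alpha> \<beta> (v # is) z = cov (E \<alpha> \<beta>) (v # is) z
    + (\<Sum>k\<in>UNIV. G \<alpha> v k z * E k \<beta> is z + G \<beta> v k z * E \<alpha> k is z)"

lemma smooth_covu:
  assumes E: "\<And>\<alpha> \<beta> is. smooth (E \<alpha> \<beta> is)"
  shows "smooth (covu E \<alpha> \<beta> is)"
proof (cases "is")
  case Nil
  then show ?thesis by (simp add: fun_eq_iff[THEN iffD2, of "covu E \<alpha> \<beta> []" "\<lambda>_. 0"])
next
  case (Cons v js)
  have "covu E \<alpha> \<beta> (v # js) = (\<lambda>z. cov (E \<alpha> \<beta>) (v # js) z
    + (\<Sum>k\<in>UNIV. G \<alpha> v k z * E k \<beta> js z + G \<beta> v k z * E \<alpha> k js z))" by (rule ext) simp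
  then show ?thesis using E smooth_cov[of "E \<alpha> \<beta>"] Cons by (auto simp del: cov.simps)
qed

text \<open>Leibniz rule for a contraction. The connection terms on the lower indices of
  \<open>T\<close> cancel those on the upper indices of \<open>E\<close> after relabelling
  (\<open>s1\<close>, \<open>s2\<close>). The first \<open>m\<close> free indices belong to
  \<open>T\<close>, the others to \<open>E\<close>.\<close>

theorem cov_contraction:
  assumes T: "\<And>is. smooth (T is)" and E: "\<And>\<alpha> \<beta> is. smooth (E \<alpha> \<beta> is)" and z: "z \<in> \<Omega>"
  shows "cov (\<lambda>is z. \<Sum>\<alpha>\<in>UNIV. \<Sum>\<beta>\<in>UNIV. T (take m is @ [\<alpha>, \<beta>]) z * E \<alpha> \<beta> (drop m is) z) (v # is) z
    = (\<Sum>\<alpha>\<in>UNIV. \<Sum>\<beta>\<in>UNIV. cov T (v # take m is @ [\<alpha>, \<beta>]) z * E \<alpha> \<beta> (drop m is) z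
        + T (take m is @ [\<alpha>, \<beta>]) z * covu E \<alpha> \<beta> (v # drop m is) z)"
proof -
  let ?A = "\<lambda>\<beta> k. G k v \<beta> z" and ?i = "take m is" and ?j = "drop m is"
  have act: "act ?A (\<lambda>is. \<Sum>\<alpha>\<in>UNIV. \<Sum>\<beta>\<in>UNIV. T (take m is @ [\<alpha>, \<beta>]) z * E \<alpha> \<beta> (drop m is) z) is
    = (\<Sum>\<alpha>\<in>UNIV. \<Sum>\<beta>\<in>UNIV. act ?A (\<lambda>js. T (js @ [\<alpha>, \<beta>]) z) ?i * E \<alpha> \<beta> ?j z
        + T (?i @ [\<alpha>, \<beta>]) z * act ?A (\<lambda>js. E \<alpha> \<beta> js z) ?j)"
    unfolding act_sum act_tensor[where T = "\<lambda>is. T (is @ [_, _]) z" and U = "\<lambda>is. E _ _ is z"] ..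
  have covT: "cov T (v # ?i @ [\<alpha>, \<beta>]) z = pd v (T (?i @ [\<alpha>, \<beta>])) z - act ?A (\<lambda>js. T (js @ [\<alpha>, \<beta>]) z) ?i
      - (\<Sum>k\<in>UNIV. G k v \<alpha> z * T (?i @ [k, \<beta>]) z) - (\<Sum>k\<in>UNIV. G k v \<beta> z * T (?i @ [\<alpha>, k]) z)" for \<alpha> \<beta>
    by (simp add: act_append)
  have s1: "(\<Sum>\<alpha>\<in>UNIV. \<Sum>\<beta>\<in>UNIV. (\<Sum>k\<in>UNIV. G k v \<alpha> z * T (?i @ [k, \<beta>]) z) * E \<alpha> \<beta> ?j z)
      = (\<Sum>\<alpha>\<in>UNIV. \<Sum>\<beta>\<in>UNIV. T (?i @ [\<alpha>, \<beta>]) z * (\<Sum>k\<in>UNIV. G \<alpha> v k z * E k \<beta> ?j z))"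
    (is "?l1 = ?r1")
  proof -
    have "?l1 = (\<Sum>\<beta>\<in>UNIV. \<Sum>\<alpha>\<in>UNIV. \<Sum>k\<in>UNIV. G k v \<alpha> z * T (?i @ [k, \<beta>]) z * E \<alpha> \<beta> ?j z)"
      by (subst sum.swap) (simp add: sum_distrib_right)
    also have "\<dots> = (\<Sum>\<beta>\<in>UNIV. \<Sum>k\<in>UNIV. \<Sum>\<alpha>\<in>UNIV. G k v \<alpha> z * T (?i @ [k, \<beta>]) z * E \<alpha> \<beta> ?j z)"
      by (intro sum.cong refl sum.swap)
    also have "\<dots> = ?r1" by (subst sum.swap) (simp add: sum_distrib_left mult_ac)
    finally show ?thesis .
  qed
  have s2: "(\<Sum>\<alpha>\<in>UNIV. \<Sum>\<beta>\<in>UNIV. (\<Sum>k\<in>UNIV. G k v \<beta> z * T (?i @ [\<alpha>, k]) z) * E \<alpha> \<beta> ?j z)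
      = (\<Sum>\<alpha>\<in>UNIV. \<Sum>\<beta>\<in>UNIV. T (?i @ [\<alpha>, \<beta>]) z * (\<Sum>k\<in>UNIV. G \<beta> v k z * E \<alpha> k ?j z))"
    (is "?l2 = ?r2")
  proof -
    have "?l2 = (\<Sum>\<alpha>\<in>UNIV. \<Sum>\<beta>\<in>UNIV. \<Sum>k\<in>UNIV. G k v \<beta> z * T (?i @ [\<alpha>, k]) z * E \<alpha> \<beta> ?j z)"
      by (simp add: sum_distrib_right)
    also have "\<dots> = (\<Sum>\<alpha>\<in>UNIV. \<Sum>k\<in>UNIV. \<Sum>\<beta>\<in>UNIV. G k v \<beta> z * T (?i @ [\<alpha>, k]) z * E \<alpha> \<beta> ?j z)"
      by (intro sum.cong refl sum.swap)
    also have "\<dots> = ?r2" by (simp add: sum_distrib_left mult_ac)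
    finally show ?thesis .
  qed
  have pd: "pd v (\<lambda>z. \<Sum>\<alpha>\<in>UNIV. \<Sum>\<beta>\<in>UNIV. T (?i @ [\<alpha>, \<beta>]) z * E \<alpha> \<beta> ?j z) z
      = (\<Sum>\<alpha>\<in>UNIV. \<Sum>\<beta>\<in>UNIV. pd v (T (?i @ [\<alpha>, \<beta>])) z * E \<alpha> \<beta> ?j z + T (?i @ [\<alpha>, \<beta>]) z * pd v (E \<alpha> \<beta> ?j) z)"
    using T E z by (simp add: pd_sum pd_mult smooth_on_mult[OF open_domain] smooth_on_sum[OF open_domain])
  show ?thesis
    unfolding covT covu.simps cov.simps(2)[of _ _ "is"] cov.simps(2)[of "E _ _"] pd act using s1 s2
    by (simp add: algebra_simps sum.distrib sum_subtractf)
qed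

end

section \<open>The spacetime connection of a Ricci flow\<close>

lemma sum_option: "(\<Sum>\<alpha>\<in>UNIV. f \<alpha>) = f None + (\<Sum>a\<in>UNIV. f (Some a))" for f :: "'n::finite option \<Rightarrow> real"
  unfolding UNIV_option_conv by (subst sum.insert) (auto simp: sum.reindex)

lemma sum_delta_mult: "(\<Sum>i\<in>UNIV. (if i = k then 1 else 0) * f i) = f k" for f :: "'n::finite \<Rightarrow> real"
  by (simp add: if_distrib[of "\<lambda>x. x * _"] cong: if_cong)

text \<open>
  The index \<open>None\<close> is the time direction. \<open>\<Gamma>\<close> is only required to be torsion-free and compatible
  with \<open>g\<close>; \<open>h\<close> is the inverse of \<open>g\<close>.
\<close>

locale ricci_flow_frame = frame_domain \<Omega> e
  for \<Omega> :: "'z::real_normed_vector set" and e :: "'n::finite option \<Rightarrow> 'z" +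
  fixes g h :: "'n \<Rightarrow> 'n \<Rightarrow> 'z \<Rightarrow> real" and \<Gamma> :: "'n \<Rightarrow> 'n \<Rightarrow> 'n \<Rightarrow> 'z \<Rightarrow> real"
    and ric :: "'n \<Rightarrow> 'n \<Rightarrow> 'z \<Rightarrow> real" and scal :: "'z \<Rightarrow> real"
  assumes smooth_g [intro!]: "smooth_on (g i j) \<Omega>"
    and smooth_h [intro!]: "smooth_on (h i j) \<Omega>"
    and smooth_\<Gamma> [intro!]: "smooth_on (\<Gamma> k i j) \<Omega>"
    and g_sym: "z \<in> \<Omega> \<Longrightarrow> g i j z = g j i z"
    and h_sym: "z \<in> \<Omega> \<Longrightarrow> h i j z = h j i z"
    and g_h: "z \<in> \<Omega> \<Longrightarrow> (\<Sum>j\<in>UNIV. g i j z * h j k z) = (if i = k then 1 else 0)"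
    and \<Gamma>_sym: "z \<in> \<Omega> \<Longrightarrow> \<Gamma> k i j z = \<Gamma> k j i z"
    and \<Gamma>_metric: "z \<in> \<Omega> \<Longrightarrow> pd (Some k) (g i j) z = (\<Sum>l\<in>UNIV. \<Gamma> l k i z * g l j z + \<Gamma> l k j z * g l i z)"
    and ric_def: "ric i k = (\<lambda>z. \<Sum>j\<in>UNIV. \<Sum>l\<in>UNIV. h j l z * (\<Sum>p\<in>UNIV. g k p z *
          (pd (Some i) (\<Gamma> p j l) z - pd (Some j) (\<Gamma> p i l) z
            + (\<Sum>q\<in>UNIV. \<Gamma> p i q z * \<Gamma> q j l z - \<Gamma> p j q z * \<Gamma> q i l z))))"
    and scal_def: "scal = (\<lambda>z. \<Sum>i\<in>UNIV. \<Sum>j\<in>UNIV. h i j z * ric i j z)"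
    and flow: "z \<in> \<Omega> \<Longrightarrow> pd None (g i j) z = - 2 * ric i j z"
begin

lemma h_g: "z \<in> \<Omega> \<Longrightarrow> (\<Sum>j\<in>UNIV. h i j z * g j k z) = (if i = k then 1 else 0)"
  using g_h[of z k i] by (simp add: g_sym[of z k] h_sym[of z i] mult.commute cong: if_cong)

lemma lower_raise:
  assumes "z \<in> \<Omega>" shows "(\<Sum>k\<in>UNIV. g l k z * (\<Sum>m\<in>UNIV. h k m z * f m)) = f l"
proof -
  have "(\<Sum>k\<in>UNIV. g l k z * (\<Sum>m\<in>UNIV. h k m z * f m)) = (\<Sum>m\<in>UNIV. (\<Sum>k\<in>UNIV. g l k z * h k m z) * f m)"
    unfolding sum_distrib_left sum_distrib_right mult.assoc by (rule sum.swap)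
  also have "\<dots> = (\<Sum>m\<in>UNIV. (if m = l then 1 else 0) * f m)"
    using g_h[OF assms] by (intro sum.cong) auto
  finally show ?thesis by (simp add: sum_delta_mult)
qed

lemma raise_lower:
  assumes "z \<in> \<Omega>" shows "(\<Sum>k\<in>UNIV. h l k z * (\<Sum>m\<in>UNIV. g k m z * f m)) = f l"
proof -
  have "(\<Sum>k\<in>UNIV. h l k z * (\<Sum>m\<in>UNIV. g k m z * f m)) = (\<Sum>m\<in>UNIV. (\<Sum>k\<in>UNIV. h l k z * g k m z) * f m)"
    unfolding sum_distrib_left sum_distrib_right mult.assoc by (rule sum.swap)
  also have "\<dots> = (\<Sum>m\<in>UNIV. (if m = l then 1 else 0) * f m)"
    using h_g[OF assms] by (intro sum.cong) auto
  finally show ?thesis by (simp add: sum_delta_mult)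
qed

lemma smooth_ric [intro!]: "smooth (ric i k)"
  unfolding ric_def by auto

lemma smooth_scal [intro!]: "smooth scal"
  unfolding scal_def by auto

text \<open>Read off from the flow equation: the time derivative of a symmetric metric is
  symmetric.\<close>

lemma ric_sym: "z \<in> \<Omega> \<Longrightarrow> ric i j z = ric j i z"
  using flow[of z i j] flow[of z j i] pd_cong[of "g i j" "g j i" z None] g_sym by simp

text \<open>The Ricci tensor of the spacetime connection, with the second index spatial.\<close>

fun rho :: "'n option \<Rightarrow> 'n \<Rightarrow> 'z \<Rightarrow> real" where
  "rho (Some i) l z = ric i l z"
| "rho None l z = (1/2) * pd (Some l) scal z"

lemma smooth_rho [intro!]: "smooth (rho \<alpha> l)"
proof (cases \<alpha>)
  case None
  have "rho None l = (\<lambda>z. (1/2) * pd (Some l) scal z)" by (rule ext) simp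
  moreover have "smooth (\<lambda>z. (1/2) * pd (Some l) scal z)"
    by (intro smooth_intros smooth_on_const smooth_scal)
  ultimately show ?thesis using None by metis
next
  case (Some i)
  have "rho (Some i) l = ric i l" by (rule ext) simp
  then show ?thesis using Some by auto
qed

text \<open>
  The torsion-free connection on spacetime of Chow and Chu: the Levi-Civita connection of \<open>g(t)\<close> in
  the spatial directions, with \<open>\<nabla>\<^sub>i \<partial>\<^sub>t = - Rc(\<partial>\<^sub>i)\<close> and \<open>\<nabla>\<^sub>t \<partial>\<^sub>t = - \<nabla>R / 2\<close>.
\<close>

fun stG :: "'n option \<Rightarrow> 'n option \<Rightarrow> 'n option \<Rightarrow> 'z \<Rightarrow> real" where
  "stG None \<alpha> \<beta> z = 0"
| "stG (Some k) (Some i) (Some j) z = \<Gamma> k i j z"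
| "stG (Some k) None \<beta> z = - (\<Sum>l\<in>UNIV. h k l z * rho \<beta> l z)"
| "stG (Some k) (Some i) None z = - (\<Sum>l\<in>UNIV. h k l z * rho (Some i) l z)"

lemma stG_None: "stG (Some k) \<alpha> None z = - (\<Sum>l\<in>UNIV. h k l z * rho \<alpha> l z)"
  by (cases \<alpha>) simp_all

lemma smooth_stG: "smooth (stG k \<alpha> \<beta>)"
proof (cases k)
  case None
  then have "stG k \<alpha> \<beta> = (\<lambda>z. 0)" by (auto simp: fun_eq_iff)
  then show ?thesis by simp
next
  case (Some k')
  consider i j where "\<alpha> = Some i" "\<beta> = Some j" | "\<alpha> = None" | "\<beta> = None" by (cases \<alpha>; cases \<beta>) auto
  then show ?thesis
  proof cases
    case 1
    then have "stG k \<alpha> \<beta> = \<Gamma> k' i j" using Some by (auto simp: fun_eq_iff)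
    then show ?thesis by auto
  next
    case 2
    then have "stG k \<alpha> \<beta> = (\<lambda>z. - (\<Sum>l\<in>UNIV. h k' l z * rho \<beta> l z))" using Some by (auto simp: fun_eq_iff)
    then show ?thesis by auto
  next
    case 3
    then have "stG k \<alpha> \<beta> = (\<lambda>z. - (\<Sum>l\<in>UNIV. h k' l z * rho \<alpha> l z))" using Some stG_None by (auto simp: fun_eq_iff)
    then show ?thesis by auto
  qed
qed

sublocale connection \<Omega> e stG
proof
  show "smooth_on (stG k \<alpha> \<beta>) \<Omega>" for k \<alpha> \<beta> by (rule smooth_stG)
  show "stG k \<alpha> \<beta> z = stG k \<beta> \<alpha> z" if "z \<in> \<Omega>" for z k \<alpha> \<beta>
    using \<Gamma>_sym[OF that] by (cases k; cases \<alpha>; cases \<beta>) auto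
qed

text \<open>The metric is parallel also along the time direction: there each of the two connection
  terms contributes \<open>- ric\<close>, which together is the flow equation.\<close>

lemma metric:
  assumes z: "z \<in> \<Omega>"
  shows "pd \<alpha> (g i j) z = (\<Sum>l\<in>UNIV. stG (Some l) \<alpha> (Some i) z * g l j z + stG (Some l) \<alpha> (Some j) z * g l i z)"
proof (cases \<alpha>)
  case None
  have "(\<Sum>l\<in>UNIV. (\<Sum>m\<in>UNIV. h l m z * ric i m z) * g l j z) = ric i j z" for i j
    using lower_raise[OF z, of j "\<lambda>m. ric i m z"] by (simp add: g_sym[OF z, of j] mult.commute)
  then show ?thesis using None flow[OF z, of i j] ric_sym[OF z, of i j]
    by (simp add: sum.distrib sum_negf sum_subtractf)
qed (simp add: \<Gamma>_metric[OF z])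

lemma inverse_metric:
  assumes z: "z \<in> \<Omega>"
  shows "pd \<alpha> (h i j) z = - (\<Sum>l\<in>UNIV. stG (Some i) \<alpha> (Some l) z * h l j z + stG (Some j) \<alpha> (Some l) z * h l i z)"
proof -
  have "(\<Sum>q\<in>UNIV. pd \<alpha> (g p q) z * h q j z + g p q z * pd \<alpha> (h q j) z) = 0" for p
  proof -
    have "pd \<alpha> (\<lambda>z. \<Sum>q\<in>UNIV. g p q z * h q j z) z = 0"
      using pd_cong[of "\<lambda>z. \<Sum>q\<in>UNIV. g p q z * h q j z" "\<lambda>z. if p = j then 1 else 0" z \<alpha>] g_h z
      by simp
    then show ?thesis using z by (simp add: pd_sum pd_mult smooth_on_mult[OF open_domain] smooth_g smooth_h)
  qed
  then have 1: "(\<Sum>q\<in>UNIV. g p q z * pd \<alpha> (h q j) z) = - (\<Sum>q\<in>UNIV. pd \<alpha> (g p q) z * h q j z)" for p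
    by (simp add: sum.distrib add_eq_0_iff2 algebra_simps)
  have 2: "(\<Sum>q\<in>UNIV. pd \<alpha> (g p q) z * h q j z)
      = stG (Some j) \<alpha> (Some p) z + (\<Sum>m\<in>UNIV. g p m z * (\<Sum>q\<in>UNIV. stG (Some m) \<alpha> (Some q) z * h q j z))" for p
  proof -
    have a: "(\<Sum>q\<in>UNIV. (\<Sum>l\<in>UNIV. stG (Some l) \<alpha> (Some p) z * g l q z) * h q j z)
      = (\<Sum>l\<in>UNIV. stG (Some l) \<alpha> (Some p) z * (\<Sum>q\<in>UNIV. g l q z * h q j z))"
      unfolding sum_distrib_left sum_distrib_right mult.assoc by (rule sum.swap)
    have b: "(\<Sum>q\<in>UNIV. (\<Sum>l\<in>UNIV. stG (Some l) \<alpha> (Some q) z * g l p z) * h q j z)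
      = (\<Sum>m\<in>UNIV. g p m z * (\<Sum>q\<in>UNIV. stG (Some m) \<alpha> (Some q) z * h q j z))"
      unfolding sum_distrib_left sum_distrib_right
      by (subst sum.swap) (simp add: g_sym[OF z, of p] mult_ac)
    have c: "(\<Sum>l\<in>UNIV. stG (Some l) \<alpha> (Some p) z * (\<Sum>q\<in>UNIV. g l q z * h q j z)) = stG (Some j) \<alpha> (Some p) z"
      using sum_delta_mult[of j "\<lambda>l. stG (Some l) \<alpha> (Some p) z"] by (simp add: g_h[OF z] mult.commute)
    show ?thesis unfolding metric[OF z] sum.distrib distrib_right a b c ..
  qed
  have "pd \<alpha> (h i j) z = (\<Sum>p\<in>UNIV. h i p z * (\<Sum>q\<in>UNIV. g p q z * pd \<alpha> (h q j) z))"
    using raise_lower[OF z, of i "\<lambda>q. pd \<alpha> (h q j) z"] by simp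
  also have "\<dots> = - ((\<Sum>p\<in>UNIV. h i p z * stG (Some j) \<alpha> (Some p) z)
      + (\<Sum>p\<in>UNIV. h i p z * (\<Sum>m\<in>UNIV. g p m z * (\<Sum>q\<in>UNIV. stG (Some m) \<alpha> (Some q) z * h q j z))))"
    unfolding 1 2 by (simp add: algebra_simps sum.distrib sum_negf sum_subtractf)
  also have "\<dots> = - (\<Sum>l\<in>UNIV. stG (Some i) \<alpha> (Some l) z * h l j z + stG (Some j) \<alpha> (Some l) z * h l i z)"
    unfolding raise_lower[OF z] by (simp add: sum.distrib h_sym[OF z, of i] mult.commute)
  finally show ?thesis .
qed

definition tr :: "('n option list \<Rightarrow> 'z \<Rightarrow> real) \<Rightarrow> 'n option list \<Rightarrow> 'z \<Rightarrow> real" where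
  "tr T is z = (\<Sum>p\<in>UNIV. \<Sum>q\<in>UNIV. h p q z * T (Some p # Some q # is) z)"

lemma smooth_tr: "(\<And>is. smooth (T is)) \<Longrightarrow> smooth (tr T is)"
  unfolding tr_def by auto

text \<open>By \<open>inverse_metric\<close> the cometric \<open>h\<close> is parallel, so tracing
  commutes with differentiation; a time index cannot enter the traced slots because
  \<open>stG None\<close> vanishes.\<close>

lemma cov_tr:
  assumes T: "\<And>is. smooth (T is)" and z: "z \<in> \<Omega>"
  shows "cov (tr T) (v # is) z = (\<Sum>p\<in>UNIV. \<Sum>q\<in>UNIV. h p q z * cov T (v # Some p # Some q # is) z)"
proof -
  let ?G = "\<lambda>k i. stG (Some k) v (Some i) z" and ?T = "\<lambda>p q. T (Some p # Some q # is) z"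
  have 1: "pd v (tr T is) z = (\<Sum>p\<in>UNIV. \<Sum>q\<in>UNIV. pd v (h p q) z * ?T p q + h p q z * pd v (T (Some p # Some q # is)) z)"
    unfolding tr_def using T z
    by (simp add: pd_sum pd_mult smooth_on_mult[OF open_domain] smooth_on_sum[OF open_domain] smooth_h)
  have 2: "act M (\<lambda>js. tr T js z) is = (\<Sum>p\<in>UNIV. \<Sum>q\<in>UNIV. h p q z * act M (\<lambda>js. T (Some p # Some q # js) z) is)" for M
    unfolding tr_def act_sum act_cmult ..
  have 3: "(\<Sum>p\<in>UNIV. \<Sum>q\<in>UNIV. (\<Sum>l\<in>UNIV. ?G p l * h l q z) * ?T p q)
      = (\<Sum>p\<in>UNIV. \<Sum>q\<in>UNIV. h p q z * (\<Sum>k\<in>UNIV. ?G k p * ?T k q))"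
  proof -
    have "(\<Sum>p\<in>UNIV. \<Sum>q\<in>UNIV. (\<Sum>l\<in>UNIV. ?G p l * h l q z) * ?T p q)
      = (\<Sum>q\<in>UNIV. \<Sum>p\<in>UNIV. \<Sum>l\<in>UNIV. ?G p l * h l q z * ?T p q)"
      by (subst sum.swap) (simp add: sum_distrib_right)
    also have "\<dots> = (\<Sum>q\<in>UNIV. \<Sum>l\<in>UNIV. \<Sum>p\<in>UNIV. ?G p l * h l q z * ?T p q)"
      by (intro sum.cong refl sum.swap)
    also have "\<dots> = (\<Sum>l\<in>UNIV. \<Sum>q\<in>UNIV. h l q z * (\<Sum>k\<in>UNIV. ?G k l * ?T k q))"
      by (subst sum.swap) (simp add: sum_distrib_left mult_ac)
    finally show ?thesis .
  qed
  have 4: "(\<Sum>p\<in>UNIV. \<Sum>q\<in>UNIV. (\<Sum>l\<in>UNIV. ?G q l * h l p z) * ?T p q)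
      = (\<Sum>p\<in>UNIV. \<Sum>q\<in>UNIV. h p q z * (\<Sum>k\<in>UNIV. ?G k q * ?T p k))"
  proof -
    have "(\<Sum>p\<in>UNIV. \<Sum>q\<in>UNIV. (\<Sum>l\<in>UNIV. ?G q l * h l p z) * ?T p q)
      = (\<Sum>p\<in>UNIV. \<Sum>q\<in>UNIV. \<Sum>l\<in>UNIV. ?G q l * h l p z * ?T p q)"
      by (simp add: sum_distrib_right)
    also have "\<dots> = (\<Sum>p\<in>UNIV. \<Sum>l\<in>UNIV. \<Sum>q\<in>UNIV. ?G q l * h l p z * ?T p q)"
      by (intro sum.cong refl sum.swap)
    also have "\<dots> = (\<Sum>p\<in>UNIV. \<Sum>l\<in>UNIV. h p l z * (\<Sum>k\<in>UNIV. ?G k l * ?T p k))"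
      by (simp add: sum_distrib_left mult_ac h_sym[OF z])
    finally show ?thesis .
  qed
  have 5: "(\<Sum>p\<in>UNIV. \<Sum>q\<in>UNIV. pd v (h p q) z * ?T p q)
      = - (\<Sum>p\<in>UNIV. \<Sum>q\<in>UNIV. h p q z * (\<Sum>k\<in>UNIV. ?G k p * ?T k q))
        - (\<Sum>p\<in>UNIV. \<Sum>q\<in>UNIV. h p q z * (\<Sum>k\<in>UNIV. ?G k q * ?T p k))"
    unfolding 3[symmetric] 4[symmetric] inverse_metric[OF z]
    by (simp add: sum.distrib algebra_simps sum_negf sum_subtractf)
  show ?thesis
    unfolding cov.simps 1 2 sum.distrib 5
    by (simp add: sum_option algebra_simps sum.distrib sum_subtractf)
qed

end

text \<open>Rearrangements of indices that commute with every derivation, so that symmetries of a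
  tensor pass to its covariant derivatives through \<open>cov_permute\<close>. The length is fixed
  because the rearrangements select entries by position.\<close>

definition natural :: "nat \<Rightarrow> ('i::finite list \<Rightarrow> 'i list) \<Rightarrow> bool" where
  "natural n \<pi> \<longleftrightarrow> (\<forall>is. length is = n \<longrightarrow> length (\<pi> is) = n \<and>
     (\<forall>M T. act M (\<lambda>js. T (\<pi> js)) is = act M T (\<pi> is)))"

lemma naturalD: "natural n \<pi> \<Longrightarrow> length is = n \<Longrightarrow> act M (\<lambda>js. T (\<pi> js)) is = act M T (\<pi> is)"
  by (simp add: natural_def)

lemma natural_Cons:
  assumes "natural n \<pi>" shows "natural (Suc n) (\<lambda>js. hd js # \<pi> (tl js))"
  unfolding natural_def
proof (intro allI impI)
  fix "is" :: "'a list" assume "length is = Suc n"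
  then obtain i js where "is = i # js" "length js = n" by (cases "is") auto
  then show "length (hd is # \<pi> (tl is)) = Suc n \<and>
      (\<forall>M T. act M (\<lambda>js. T (hd js # \<pi> (tl js))) is = act M T (hd is # \<pi> (tl is)))"
    using assms naturalD[OF assms, of js _ "\<lambda>js. _ (i # js)"] by (simp add: natural_def)
qed

lemma length_4: "length xs = 4 \<longleftrightarrow> (\<exists>a b c d. xs = [a, b, c, d])"
  by (auto simp: numeral_eq_Suc length_Suc_conv)

lemma length_5: "length xs = 5 \<longleftrightarrow> (\<exists>a b c d e. xs = [a, b, c, d, e])"
  by (auto simp: numeral_eq_Suc length_Suc_conv)

lemma act_cong_length:
  "(\<And>js. length js = length is \<Longrightarrow> T js = U js) \<Longrightarrow> act M T is = act M U is"
proof (induction "is" arbitrary: T U)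
  case (Cons i "is")
  show ?case using Cons.IH[of "\<lambda>js. T (i # js)" "\<lambda>js. U (i # js)"] Cons.prems by simp
qed simp

context connection
begin

lemma cov_add:
  assumes "\<And>is. smooth (T is)" "\<And>is. smooth (U is)" "z \<in> \<Omega>"
  shows "cov (\<lambda>js z. T js z + U js z) is z = cov T is z + cov U is z"
  using assms by (cases "is") (auto simp: pd_add act_add)

lemma cov_cong_length:
  assumes "\<And>js y. y \<in> \<Omega> \<Longrightarrow> length js = length is \<Longrightarrow> T js y = U js y" "z \<in> \<Omega>"
  shows "cov T (v # is) z = cov U (v # is) z"
proof -
  have "pd v (T is) z = pd v (U is) z" using assms by (intro pd_cong) auto
  moreover have "act M (\<lambda>js. T js z) is = act M (\<lambda>js. U js z) is" for M
    using assms by (intro act_cong_length) auto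
  ultimately show ?thesis by simp
qed

lemma cov_zero_length:
  assumes "\<And>js y. y \<in> \<Omega> \<Longrightarrow> length js = length is \<Longrightarrow> T js y = 0" "z \<in> \<Omega>"
  shows "cov T (v # is) z = 0"
  using cov_cong_length[of "is" T "\<lambda>_ _. 0" z v] cov_zero[of "\<lambda>_ _. 0"] assms by simp

lemma cov_natural: "natural n \<pi> \<Longrightarrow> length is = n \<Longrightarrow> cov (\<lambda>js. T (\<pi> js)) (v # is) z = cov T (v # \<pi> is) z"
  using naturalD[of n \<pi> "is" _ "\<lambda>js. T js z"] by simp

lemma cov_permute:
  assumes "natural n \<pi>" "length is = n" "\<And>is. smooth (T is)" "z \<in> \<Omega>"
    and "\<And>js y. y \<in> \<Omega> \<Longrightarrow> length js = n \<Longrightarrow> T js y = c * T (\<pi> js) y"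
  shows "cov T (v # is) z = c * cov T (v # \<pi> is) z"
proof -
  have "cov T (v # is) z = cov (\<lambda>js z. c * T (\<pi> js) z) (v # is) z"
    using assms by (intro cov_cong_length) auto
  also have "\<dots> = c * cov (\<lambda>js. T (\<pi> js)) (v # is) z"
    using assms by (simp add: pd_cmult act_cmult algebra_simps)
  finally show ?thesis using cov_natural[OF assms(1,2)] by simp
qed

end

section \<open>Symmetries of the spacetime curvature\<close>

context ricci_flow_frame
begin

lemma curv_None [simp]: "curv None \<alpha> \<beta> \<delta> z = 0"
proof -
  have "stG None \<beta> \<delta> = (\<lambda>z. 0)" for \<beta> \<delta> by (rule ext) simp
  then show ?thesis by (simp add: curv_def)
qed

text \<open>
  The curvature with its third index lowered. As the cometric \<open>h\<close> is degenerate in the time direction,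
  the components with third index \<open>None\<close> are defined by skew symmetry.
\<close>

fun Rm4 :: "'n option \<Rightarrow> 'n option \<Rightarrow> 'n option \<Rightarrow> 'n option \<Rightarrow> 'z \<Rightarrow> real" where
  "Rm4 \<alpha> \<beta> (Some c) \<delta> z = (\<Sum>k\<in>UNIV. g c k z * curv (Some k) \<alpha> \<beta> \<delta> z)"
| "Rm4 \<alpha> \<beta> None (Some d) z = - (\<Sum>k\<in>UNIV. g d k z * curv (Some k) \<alpha> \<beta> None z)"
| "Rm4 \<alpha> \<beta> None None z = 0"

definition Rl :: "'n option list \<Rightarrow> 'z \<Rightarrow> real" where
  "Rl is = (case is of [\<alpha>, \<beta>, \<gamma>, \<delta>] \<Rightarrow> Rm4 \<alpha> \<beta> \<gamma> \<delta> | _ \<Rightarrow> (\<lambda>_. 0))"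

lemma Rl_simp [simp]: "Rl [\<alpha>, \<beta>, \<gamma>, \<delta>] = Rm4 \<alpha> \<beta> \<gamma> \<delta>"
  by (simp add: Rl_def)

lemma smooth_Rm4 [intro!]: "smooth (Rm4 \<alpha> \<beta> \<gamma> \<delta>)"
proof -
  have "smooth (Rm4 \<alpha> \<beta> (Some c) \<delta>)" for c \<delta>
  proof -
    have "Rm4 \<alpha> \<beta> (Some c) \<delta> = (\<lambda>z. \<Sum>k\<in>UNIV. g c k z * curv (Some k) \<alpha> \<beta> \<delta> z)" by (rule ext) simp
    then show ?thesis by auto
  qed
  moreover have "smooth (Rm4 \<alpha> \<beta> None (Some d))" for d
  proof -
    have "Rm4 \<alpha> \<beta> None (Some d) = (\<lambda>z. - (\<Sum>k\<in>UNIV. g d k z * curv (Some k) \<alpha> \<beta> None z))" by (rule ext) simp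
    then show ?thesis by auto
  qed
  moreover have "Rm4 \<alpha> \<beta> None None = (\<lambda>z. 0)" by (rule ext) simp
  ultimately show ?thesis by (cases \<gamma>; cases \<delta>) auto
qed

lemma smooth_Rl [intro!]: "smooth (Rl is)"
  unfolding Rl_def by (auto split: list.split)

lemma curv_raise: "z \<in> \<Omega> \<Longrightarrow> curv (Some k) \<alpha> \<beta> \<delta> z = (\<Sum>l\<in>UNIV. h k l z * Rm4 \<alpha> \<beta> (Some l) \<delta> z)"
  by (simp add: raise_lower)

lemma Rm4_skew12: "Rm4 \<beta> \<alpha> \<gamma> \<delta> z = - Rm4 \<alpha> \<beta> \<gamma> \<delta> z"
  by (cases \<gamma>; cases \<delta>) (simp_all add: curv_antisym[of _ \<beta> \<alpha>] sum_negf)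

definition gT :: "'n option list \<Rightarrow> 'z \<Rightarrow> real" where
  "gT is = (case is of [Some i, Some j] \<Rightarrow> g i j | _ \<Rightarrow> (\<lambda>_. 0))"

lemma gT_simps [simp]: "gT [Some i, Some j] = g i j" "gT [None, \<beta>] = (\<lambda>_. 0)" "gT [\<alpha>, None] = (\<lambda>_. 0)"
  by (auto simp: gT_def split: option.split)

lemma smooth_gT: "smooth (gT is)"
  unfolding gT_def by (auto split: list.split option.split)

text \<open>The Ricci identity for the parallel tensor \<open>g\<close>.\<close>

lemma Rm4_skew34_spatial:
  assumes z: "z \<in> \<Omega>"
  shows "Rm4 \<alpha> \<beta> (Some c) (Some d) z = - Rm4 \<alpha> \<beta> (Some d) (Some c) z"
proof -
  \<comment> \<open>Only the spatial components are parallel: with a time argument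
    \<open>cov gT\<close> yields \<open>rho\<close>. They suffice, because
    \<open>stG None = 0\<close> keeps time indices out of the connection terms of the second
    derivative.\<close>
  have cov1: "cov gT [\<alpha>, Some i, Some j] z = 0" if "z \<in> \<Omega>" for \<alpha> i j z
    using that by (simp add: metric sum_option sum.distrib g_sym[of z i])
  have cov2: "cov (cov gT) [\<alpha>, \<beta>, Some i, Some j] z = 0" for \<alpha> \<beta> i j
  proof -
    have "pd \<alpha> (cov gT [\<beta>, Some i, Some j]) z = pd \<alpha> (\<lambda>z. 0) z" using z cov1 by (intro pd_cong) auto
    then show ?thesis using cov1[OF z] by (simp add: sum_option del: cov.simps add: cov.simps(2)[of "cov gT"])
  qed
  have "act (\<lambda>i k. curv k \<alpha> \<beta> i z) (\<lambda>js. gT js z) [Some c, Some d] = 0"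
    using ricci_identity[of gT z \<alpha> \<beta> "[Some c, Some d]"] smooth_gT z cov2 by simp
  then show ?thesis by (simp add: sum_option g_sym[OF z, of _ c] g_sym[OF z, of _ d] mult.commute)
qed

lemma Rm4_skew34:
  assumes z: "z \<in> \<Omega>" shows "Rm4 \<alpha> \<beta> \<delta> \<gamma> z = - Rm4 \<alpha> \<beta> \<gamma> \<delta> z"
proof (cases \<gamma>)
  case None
  then show ?thesis by (cases \<delta>) simp_all
next
  case (Some c)
  show ?thesis
  proof (cases \<delta>)
    case None
    then show ?thesis using Some by simp
  next
    case (Some d)
    then show ?thesis using \<open>\<gamma> = Some c\<close> Rm4_skew34_spatial[OF z] by metis
  qed
qed

definition rhoT :: "'n option list \<Rightarrow> 'z \<Rightarrow> real" where
  "rhoT is = (case is of [\<beta>, Some l] \<Rightarrow> rho \<beta> l | _ \<Rightarrow> (\<lambda>_. 0))"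

lemma rhoT_simps [simp]: "rhoT [\<beta>, Some l] = rho \<beta> l" "rhoT [\<beta>, None] = (\<lambda>_. 0)"
  by (auto simp: rhoT_def)

lemma cov_rhoT: "cov rhoT [\<alpha>, \<beta>, Some l] z = pd \<alpha> (rho \<beta> l) z - (\<Sum>k\<in>UNIV. stG k \<alpha> \<beta> z * rhoT [k, Some l] z)
    - (\<Sum>m\<in>UNIV. stG (Some m) \<alpha> (Some l) z * rho \<beta> m z)"
  by (simp add: sum_option)

text \<open>The curvature acting on the vector field \<open>\<partial>\<^sub>t\<close>, whose covariant derivative is \<open>- rho\<close>.\<close>

lemma Rm4_None:
  assumes z: "z \<in> \<Omega>"
  shows "Rm4 \<alpha> \<beta> (Some l) None z = cov rhoT [\<beta>, \<alpha>, Some l] z - cov rhoT [\<alpha>, \<beta>, Some l] z"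
proof -
  let ?n = "\<lambda>\<beta> k. stG (Some k) \<beta> None"
  have low: "(\<Sum>k\<in>UNIV. g l k z * ?n \<beta> k z) = - rho \<beta> l z" if "z \<in> \<Omega>" for \<beta> l z
    using lower_raise[OF that, of l "\<lambda>m. rho \<beta> m z"] by (simp add: stG_None sum_negf)
  \<comment> \<open>Lowering commutes with differentiation: \<open>?n \<beta>\<close> is the
    derivative of the time field along \<beta>, and its lowered form is
    \<open>- rho \<beta>\<close>.\<close>
  have A: "(\<Sum>k\<in>UNIV. g l k z * pd \<alpha> (?n \<beta> k) z) + (\<Sum>k\<in>UNIV. g l k z * (\<Sum>p\<in>UNIV. stG (Some k) \<alpha> (Some p) z * ?n \<beta> p z))
      = - pd \<alpha> (rho \<beta> l) z + (\<Sum>m\<in>UNIV. stG (Some m) \<alpha> (Some l) z * rho \<beta> m z)" for \<alpha> \<beta>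
  proof -
    have "pd \<alpha> (\<lambda>z. \<Sum>k\<in>UNIV. g l k z * ?n \<beta> k z) z = pd \<alpha> (\<lambda>z. - rho \<beta> l z) z"
      using z low by (intro pd_cong) auto
    then have 1: "(\<Sum>k\<in>UNIV. pd \<alpha> (g l k) z * ?n \<beta> k z) + (\<Sum>k\<in>UNIV. g l k z * pd \<alpha> (?n \<beta> k) z) = - pd \<alpha> (rho \<beta> l) z"
      using z by (simp add: pd_sum pd_mult pd_uminus smooth_on_mult[OF open_domain] smooth_g smooth_G smooth_rho sum.distrib
          del: stG.simps)
    have 2: "(\<Sum>k\<in>UNIV. (\<Sum>m\<in>UNIV. stG (Some m) \<alpha> (Some l) z * g m k z) * ?n \<beta> k z)
        = - (\<Sum>m\<in>UNIV. stG (Some m) \<alpha> (Some l) z * rho \<beta> m z)"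
    proof -
      have "(\<Sum>k\<in>UNIV. (\<Sum>m\<in>UNIV. stG (Some m) \<alpha> (Some l) z * g m k z) * ?n \<beta> k z)
        = (\<Sum>m\<in>UNIV. stG (Some m) \<alpha> (Some l) z * (\<Sum>k\<in>UNIV. g m k z * ?n \<beta> k z))"
        unfolding sum_distrib_left sum_distrib_right mult.assoc by (rule sum.swap)
      then show ?thesis unfolding low[OF z] by (simp add: sum_negf)
    qed
    have 3: "(\<Sum>k\<in>UNIV. (\<Sum>m\<in>UNIV. stG (Some m) \<alpha> (Some k) z * g m l z) * ?n \<beta> k z)
        = (\<Sum>k\<in>UNIV. g l k z * (\<Sum>p\<in>UNIV. stG (Some k) \<alpha> (Some p) z * ?n \<beta> p z))"
      unfolding sum_distrib_left sum_distrib_right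
      by (subst sum.swap) (simp add: g_sym[OF z, of l] mult_ac del: stG.simps)
    show ?thesis using 1 unfolding metric[OF z] sum.distrib distrib_right 2 3 by linarith
  qed
  have "Rm4 \<alpha> \<beta> (Some l) None z = (\<Sum>k\<in>UNIV. g l k z * pd \<alpha> (?n \<beta> k) z) + (\<Sum>k\<in>UNIV. g l k z * (\<Sum>p\<in>UNIV. stG (Some k) \<alpha> (Some p) z * ?n \<beta> p z))
     - ((\<Sum>k\<in>UNIV. g l k z * pd \<beta> (?n \<alpha> k) z) + (\<Sum>k\<in>UNIV. g l k z * (\<Sum>p\<in>UNIV. stG (Some k) \<beta> (Some p) z * ?n \<alpha> p z)))"
    by (simp add: curv_def sum_option sum.distrib sum_subtractf algebra_simps del: stG.simps(2-4))
  then show ?thesis unfolding A cov_rhoT using G_sym[OF z, of _ \<alpha> \<beta>] by simp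
qed

lemma double_sum_sym:
  "z \<in> \<Omega> \<Longrightarrow> (\<Sum>l\<in>UNIV. (\<Sum>m\<in>UNIV. h l m z * u m) * v l) = (\<Sum>l\<in>UNIV. (\<Sum>m\<in>UNIV. h l m z * v m) * u l)"
  unfolding sum_distrib_left sum_distrib_right
  by (subst sum.swap) (simp add: h_sym mult_ac)

lemma rho_sym: "z \<in> \<Omega> \<Longrightarrow> cov rhoT [Some a, Some b, Some c] z = cov rhoT [Some a, Some c, Some b] z"
proof -
  assume z: "z \<in> \<Omega>"
  have "rho (Some b) c = ric b c" for b c by (rule ext) simp
  then show ?thesis unfolding cov_rhoT using pd_cong[of "ric b c" "ric c b" z "Some a"] ric_sym[of _ b c] ric_sym[OF z] z
    by (simp add: sum_option)
qed

text \<open>By \<open>Rm4_None\<close> this is a difference of two symmetric terms: the time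
  derivative of Ricci, and half the Hessian of the scalar curvature plus the square of Ricci. The
  second is symmetric because \<open>rho None\<close> is half a gradient, which is the reason for
  that choice in the connection.\<close>

lemma Rm4_time_sym:
  assumes z: "z \<in> \<Omega>"
  shows "Rm4 None (Some a) (Some b) None z = Rm4 None (Some b) (Some a) None z"
proof -
  have rho0: "rho None l = (\<lambda>z. (1/2) * pd (Some l) scal z)" "rho (Some i) l = ric i l" for i l by (rule ext, simp)+
  have 1: "cov rhoT [None, Some a, Some b] z = cov rhoT [None, Some b, Some a] z"
  proof -
    have "pd None (ric a b) z = pd None (ric b a) z" using z ric_sym by (intro pd_cong) auto
    then show ?thesis unfolding cov_rhoT rho0 using ric_sym[OF z] by (simp add: sum_option rho0 algebra_simps)
  qed
  have half: "pd v (\<lambda>z. pd w scal z / 2) z = pd v (pd w scal) z / 2" for v w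
    using pd_cmult[of "pd w scal" z v "1/2"] z by (simp add: smooth_pd smooth_scal)
  have 2: "cov rhoT [Some a, None, Some b] z = cov rhoT [Some b, None, Some a] z"
    unfolding cov_rhoT rho0 using z pd_commute[OF smooth_scal z, of "Some a" "Some b"] \<Gamma>_sym[OF z, of _ a b]
      double_sum_sym[OF z, of "\<lambda>m. ric a m z" "\<lambda>l. ric l b z"] ric_sym[OF z]
    by (simp add: sum_option rho0 half sum_negf)
  show ?thesis using 1 2 Rm4_None[OF z] by simp
qed

text \<open>For a spatial third index this is \<open>curv_cyclic\<close> lowered. For third index
  \<open>None\<close> the components were set by skew symmetry, so the identity has content: with
  three spatial arguments it is the cyclic identity of \<open>P\<close>, with one time argument the
  symmetry of \<open>M\<close>.\<close>

lemma Rm4_cyclic: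
  assumes z: "z \<in> \<Omega>"
  shows "Rm4 \<alpha> \<beta> \<gamma> \<delta> z + Rm4 \<beta> \<delta> \<gamma> \<alpha> z + Rm4 \<delta> \<alpha> \<gamma> \<beta> z = 0"
proof (cases \<gamma>)
  case (Some c)
  have "Rm4 \<alpha> \<beta> \<gamma> \<delta> z + Rm4 \<beta> \<delta> \<gamma> \<alpha> z + Rm4 \<delta> \<alpha> \<gamma> \<beta> z
    = (\<Sum>k\<in>UNIV. g c k z * (curv (Some k) \<alpha> \<beta> \<delta> z + curv (Some k) \<beta> \<delta> \<alpha> z + curv (Some k) \<delta> \<alpha> \<beta> z))"
    using Some by (simp add: sum.distrib distrib_left)
  then show ?thesis using curv_cyclic[OF z] by simp
next
  case None
  have sk: "Rm4 \<alpha> \<beta> None (Some d) z = - Rm4 \<alpha> \<beta> (Some d) None z" for \<alpha> \<beta> d by simp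
  have sym0: "Rm4 (Some a) None (Some b) None z = Rm4 (Some b) None (Some a) None z" for a b
    using Rm4_time_sym[OF z, of a b] Rm4_skew12[of None "Some a" "Some b" None z] Rm4_skew12[of None "Some b" "Some a" None z] by simp
  have self: "Rm4 \<alpha> \<alpha> \<gamma> \<delta> z = 0" for \<alpha> \<gamma> \<delta> using Rm4_skew12[of \<alpha> \<alpha> \<gamma> \<delta> z] by simp
  note [simp del] = Rm4.simps(1,2)
  show ?thesis
  proof (cases \<alpha>; cases \<beta>; cases \<delta>)
    fix a b d assume "\<alpha> = Some a" "\<beta> = Some b" "\<delta> = Some d"
    then show ?thesis using None rho_sym[OF z] by (simp add: sk Rm4_None[OF z] del: cov.simps)
  qed (use None sk sym0 Rm4_time_sym[OF z] self Rm4_skew12[of None _ _ _ z] in \<open>auto\<close>)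
qed

text \<open>The classical octahedron argument: four cyclic sums combined with signs. The cyclic sum
  runs over the first, second and fourth position.\<close>

lemma pair_symmetryI:
  fixes f :: "'x \<Rightarrow> 'x \<Rightarrow> 'x \<Rightarrow> 'x \<Rightarrow> real"
  assumes s1: "\<And>a b c d. f b a c d = - f a b c d" and s2: "\<And>a b c d. f a b d c = - f a b c d"
    and cyc: "\<And>a b c d. f a b c d + f b d c a + f d a c b = 0"
  shows "f a b c d = f c d a b"
  using cyc[of a b c d] cyc[of a b d c] cyc[of b c a d] cyc[of a c b d]
    s1[of c a d b] s1[of d b a c] s1[of d a c b] s2[of c d a b] s2[of a b c d]
    s2[of b c d a] s2[of d a c b] s1[of d b c a] s2[of b d c a] s2[of a c b d] s1[of a c b d] s2[of a c d b]
    s1[of b d c a] s1[of a d c b] s2[of c a d b] s2[of d b a c] s1[of b d a c] s1[of c a b d] s2[of d a b c]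
    s1[of a c d b] s1[of d b c a]
  by linarith

lemma Rm4_pair: "z \<in> \<Omega> \<Longrightarrow> Rm4 \<alpha> \<beta> \<gamma> \<delta> z = Rm4 \<gamma> \<delta> \<alpha> \<beta> z"
  by (rule pair_symmetryI[where f = "\<lambda>\<alpha> \<beta> \<gamma> \<delta>. Rm4 \<alpha> \<beta> \<gamma> \<delta> z"]) (auto intro: Rm4_skew12 Rm4_skew34 Rm4_cyclic simp del: Rm4.simps)

end

lemma sum_swap3: "(\<Sum>c\<in>C. \<Sum>p\<in>P. \<Sum>q\<in>Q. f c p q) = (\<Sum>p\<in>P. \<Sum>q\<in>Q. \<Sum>c\<in>C. f c p q)"
  by (subst sum.swap, intro sum.cong refl, rule sum.swap)

lemma sum_swap4: "(\<Sum>a\<in>A. \<Sum>c\<in>C. \<Sum>p\<in>P. \<Sum>q\<in>Q. f a c p q) = (\<Sum>p\<in>P. \<Sum>q\<in>Q. \<Sum>a\<in>A. \<Sum>c\<in>C. f a c p q)"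
  unfolding sum_swap3[where C = C] by (rule sum_swap3)

section \<open>The second Bianchi identity on spacetime\<close>

context ricci_flow_frame
begin

text \<open>Lowering with the parallel \<open>g\<close> commutes with differentiation. The result is
  arranged as the expression of \<open>curv_bianchi\<close> plus the connection terms on the first
  index pair.\<close>

lemma cov_Rl_spatial:
  assumes z: "z \<in> \<Omega>"
  shows "cov Rl [\<epsilon>, \<alpha>, \<beta>, Some c, \<delta>] z
    = (\<Sum>k\<in>UNIV. g c k z * (pd \<epsilon> (curv (Some k) \<alpha> \<beta> \<delta>) z
        + (\<Sum>p\<in>UNIV. stG (Some k) \<epsilon> p z * curv p \<alpha> \<beta> \<delta> z - curv (Some k) \<alpha> \<beta> p z * stG p \<epsilon> \<delta> z)))
      - (\<Sum>k\<in>UNIV. stG k \<epsilon> \<alpha> z * Rm4 k \<beta> (Some c) \<delta> z) - (\<Sum>k\<in>UNIV. stG k \<epsilon> \<beta> z * Rm4 \<alpha> k (Some c) \<delta> z)"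
proof -
  note [simp del] = stG.simps(2-4)
  have 1: "pd \<epsilon> (Rm4 \<alpha> \<beta> (Some c) \<delta>) z
    = (\<Sum>k\<in>UNIV. pd \<epsilon> (g c k) z * curv (Some k) \<alpha> \<beta> \<delta> z) + (\<Sum>k\<in>UNIV. g c k z * pd \<epsilon> (curv (Some k) \<alpha> \<beta> \<delta>) z)"
  proof -
    have "Rm4 \<alpha> \<beta> (Some c) \<delta> = (\<lambda>z. \<Sum>k\<in>UNIV. g c k z * curv (Some k) \<alpha> \<beta> \<delta> z)" by (rule ext) simp
    then show ?thesis using z
      by (simp add: pd_sum pd_mult smooth_on_mult[OF open_domain] smooth_g smooth_curv sum.distrib)
  qed
  have 2: "(\<Sum>k\<in>UNIV. (\<Sum>l\<in>UNIV. stG (Some l) \<epsilon> (Some c) z * g l k z) * curv (Some k) \<alpha> \<beta> \<delta> z)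
      = (\<Sum>l\<in>UNIV. stG (Some l) \<epsilon> (Some c) z * Rm4 \<alpha> \<beta> (Some l) \<delta> z)"
    unfolding Rm4.simps sum_distrib_left sum_distrib_right mult.assoc by (rule sum.swap)
  have 3: "(\<Sum>k\<in>UNIV. (\<Sum>l\<in>UNIV. stG (Some l) \<epsilon> (Some k) z * g l c z) * curv (Some k) \<alpha> \<beta> \<delta> z)
      = (\<Sum>k\<in>UNIV. g c k z * (\<Sum>p\<in>UNIV. stG (Some k) \<epsilon> (Some p) z * curv (Some p) \<alpha> \<beta> \<delta> z))"
    unfolding sum_distrib_left sum_distrib_right
    by (subst sum.swap) (simp add: g_sym[OF z, of c] mult_ac)
  have 4: "(\<Sum>k\<in>UNIV. stG k \<epsilon> \<delta> z * Rm4 \<alpha> \<beta> (Some c) k z)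
      = (\<Sum>k\<in>UNIV. g c k z * (\<Sum>p\<in>UNIV. curv (Some k) \<alpha> \<beta> p z * stG p \<epsilon> \<delta> z))"
    unfolding Rm4.simps sum_distrib_left
    by (subst sum.swap) (simp add: mult_ac)
  have 5: "(\<Sum>k\<in>UNIV. stG k \<epsilon> (Some c) z * Rm4 \<alpha> \<beta> k \<delta> z) = (\<Sum>l\<in>UNIV. stG (Some l) \<epsilon> (Some c) z * Rm4 \<alpha> \<beta> (Some l) \<delta> z)"
    by (simp add: sum_option)
  have 6: "(\<Sum>p\<in>UNIV. stG k \<epsilon> p z * curv p \<alpha> \<beta> \<delta> z) = (\<Sum>p\<in>UNIV. stG k \<epsilon> (Some p) z * curv (Some p) \<alpha> \<beta> \<delta> z)" for k
    by (simp add: sum_option)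
  have "cov Rl [\<epsilon>, \<alpha>, \<beta>, Some c, \<delta>] z = pd \<epsilon> (Rm4 \<alpha> \<beta> (Some c) \<delta>) z
      - (\<Sum>k\<in>UNIV. stG k \<epsilon> \<alpha> z * Rm4 k \<beta> (Some c) \<delta> z) - (\<Sum>k\<in>UNIV. stG k \<epsilon> \<beta> z * Rm4 \<alpha> k (Some c) \<delta> z)
      - (\<Sum>k\<in>UNIV. stG k \<epsilon> (Some c) z * Rm4 \<alpha> \<beta> k \<delta> z) - (\<Sum>k\<in>UNIV. stG k \<epsilon> \<delta> z * Rm4 \<alpha> \<beta> (Some c) k z)"
    by (simp del: Rm4.simps)
  then show ?thesis
    unfolding 1 metric[OF z] sum.distrib distrib_right distrib_left 2 3 4 5 6 sum_subtractf right_diff_distrib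
    by (simp del: Rm4.simps)
qed

lemma natural_perms:
  "natural 4 (\<lambda>js. [js!1, js!0, js!2, js!3])"
  "natural 4 (\<lambda>js. [js!0, js!1, js!3, js!2])"
  "natural 4 (\<lambda>js. [js!2, js!3, js!0, js!1])"
  "natural 5 (\<lambda>js. [js!1, js!2, js!0, js!3, js!4])"
  "natural 5 (\<lambda>js. [js!2, js!0, js!1, js!3, js!4])"
  unfolding natural_def length_4 length_5 by (auto simp: add_ac)

lemma cov_Rl_skew12: "z \<in> \<Omega> \<Longrightarrow> cov Rl [v, \<beta>, \<alpha>, \<gamma>, \<delta>] z = - cov Rl [v, \<alpha>, \<beta>, \<gamma>, \<delta>] z"
proof -
  assume z: "z \<in> \<Omega>"
  have "Rl js y = -1 * Rl [js!1, js!0, js!2, js!3] y" if y: "y \<in> \<Omega>" and "length js = 4" for js y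
  proof -
    obtain a b c d where "js = [a, b, c, d]" using \<open>length js = 4\<close> unfolding length_4 by blast
    then show ?thesis using Rm4_skew12[of a b c d y] by (simp del: Rm4.simps)
  qed
  then show ?thesis
    using cov_permute[OF natural_perms(1), of "[\<beta>, \<alpha>, \<gamma>, \<delta>]" Rl z "-1" v] z
    by (simp add: smooth_Rl del: cov.simps)
qed

lemma cov_Rl_skew34: "z \<in> \<Omega> \<Longrightarrow> cov Rl [v, \<alpha>, \<beta>, \<delta>, \<gamma>] z = - cov Rl [v, \<alpha>, \<beta>, \<gamma>, \<delta>] z"
proof -
  assume z: "z \<in> \<Omega>"
  have "Rl js y = -1 * Rl [js!0, js!1, js!3, js!2] y" if y: "y \<in> \<Omega>" and "length js = 4" for js y
  proof -
    obtain a b c d where "js = [a, b, c, d]" using \<open>length js = 4\<close> unfolding length_4 by blast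
    then show ?thesis using Rm4_skew34[OF y, of a b c d] by (simp del: Rm4.simps)
  qed
  then show ?thesis
    using cov_permute[OF natural_perms(2), of "[\<alpha>, \<beta>, \<delta>, \<gamma>]" Rl z "-1" v] z
    by (simp add: smooth_Rl del: cov.simps)
qed

lemma cov_Rl_pair: "z \<in> \<Omega> \<Longrightarrow> cov Rl [v, \<alpha>, \<beta>, \<gamma>, \<delta>] z = cov Rl [v, \<gamma>, \<delta>, \<alpha>, \<beta>] z"
proof -
  assume z: "z \<in> \<Omega>"
  have "Rl js y = 1 * Rl [js!2, js!3, js!0, js!1] y" if y: "y \<in> \<Omega>" and "length js = 4" for js y
  proof -
    obtain a b c d where "js = [a, b, c, d]" using \<open>length js = 4\<close> unfolding length_4 by blast
    then show ?thesis using Rm4_pair[OF y, of a b c d] by (simp del: Rm4.simps)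
  qed
  then show ?thesis
    using cov_permute[OF natural_perms(3), of "[\<alpha>, \<beta>, \<gamma>, \<delta>]" Rl z 1 v] z
    by (simp add: smooth_Rl del: cov.simps)
qed

text \<open>After \<open>curv_bianchi\<close> only connection terms on the cyclic indices are left;
  they cancel in pairs because \<open>stG\<close> is symmetric and the curvature skew. A third index
  \<open>None\<close> is exchanged with the fourth by skew symmetry.\<close>

lemma second_bianchi:
  assumes z: "z \<in> \<Omega>"
  shows "cov Rl [\<epsilon>, \<alpha>, \<beta>, \<gamma>, \<delta>] z + cov Rl [\<alpha>, \<beta>, \<epsilon>, \<gamma>, \<delta>] z + cov Rl [\<beta>, \<epsilon>, \<alpha>, \<gamma>, \<delta>] z = 0"
proof -
  have spatial: "cov Rl [\<epsilon>, \<alpha>, \<beta>, Some c, \<delta>] z + cov Rl [\<alpha>, \<beta>, \<epsilon>, Some c, \<delta>] z + cov Rl [\<beta>, \<epsilon>, \<alpha>, Some c, \<delta>] z = 0" for c \<delta>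
  proof -
    define X where "X \<epsilon> \<alpha> \<beta> k = pd \<epsilon> (curv (Some k) \<alpha> \<beta> \<delta>) z
      + (\<Sum>p\<in>UNIV. stG (Some k) \<epsilon> p z * curv p \<alpha> \<beta> \<delta> z - curv (Some k) \<alpha> \<beta> p z * stG p \<epsilon> \<delta> z)" for \<epsilon> \<alpha> \<beta> k
    have "(\<Sum>k\<in>UNIV. g c k z * X \<epsilon> \<alpha> \<beta> k) + (\<Sum>k\<in>UNIV. g c k z * X \<alpha> \<beta> \<epsilon> k) + (\<Sum>k\<in>UNIV. g c k z * X \<beta> \<epsilon> \<alpha> k)
      = (\<Sum>k\<in>UNIV. g c k z * (X \<epsilon> \<alpha> \<beta> k + X \<alpha> \<beta> \<epsilon> k + X \<beta> \<epsilon> \<alpha> k))"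
      by (simp add: sum.distrib distrib_left)
    also have "\<dots> = 0" unfolding X_def using curv_bianchi[OF z] by simp
    finally have 1: "(\<Sum>k\<in>UNIV. g c k z * X \<epsilon> \<alpha> \<beta> k) + (\<Sum>k\<in>UNIV. g c k z * X \<alpha> \<beta> \<epsilon> k) + (\<Sum>k\<in>UNIV. g c k z * X \<beta> \<epsilon> \<alpha> k) = 0" .
    have 2: "(\<Sum>k\<in>UNIV. stG k \<beta> \<alpha> z * Rm4 \<epsilon> k (Some c) \<delta> z) = - (\<Sum>k\<in>UNIV. stG k \<alpha> \<beta> z * Rm4 k \<epsilon> (Some c) \<delta> z)" for \<epsilon> \<alpha> \<beta>
    proof -
      have "Rm4 \<epsilon> k (Some c) \<delta> z = - Rm4 k \<epsilon> (Some c) \<delta> z" for k by (rule Rm4_skew12)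
      then have "stG k \<beta> \<alpha> z * Rm4 \<epsilon> k (Some c) \<delta> z = - (stG k \<alpha> \<beta> z * Rm4 k \<epsilon> (Some c) \<delta> z)" for k
        using G_sym[OF z, of k \<beta> \<alpha>] by (metis mult_minus_right)
      then show ?thesis by (simp only: sum_negf)
    qed
    show ?thesis unfolding cov_Rl_spatial[OF z] X_def[symmetric]
      using 1 2[of \<alpha> \<epsilon> \<beta>] 2[of \<beta> \<alpha> \<epsilon>] 2[of \<epsilon> \<beta> \<alpha>] by linarith
  qed
  show ?thesis
  proof (cases \<gamma>)
    case None
    show ?thesis
    proof (cases \<delta>)
      case (Some d)
      then show ?thesis using spatial[of d None] None cov_Rl_skew34[OF z, of _ _ _ "Some d" None] by simp
    next
      case None2: None
      have "cov Rl [v, a, b, None, None] z = 0" for v a b using cov_Rl_skew34[OF z, of v a b None None] by simp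
      then show ?thesis using None None2 by (simp del: cov.simps)
    qed
  qed (use spatial in auto)
qed

lemma cov2_Rl_bianchi:
  assumes z: "z \<in> \<Omega>"
  shows "cov (cov Rl) [w, \<epsilon>, \<alpha>, \<beta>, \<gamma>, \<delta>] z + cov (cov Rl) [w, \<alpha>, \<beta>, \<epsilon>, \<gamma>, \<delta>] z + cov (cov Rl) [w, \<beta>, \<epsilon>, \<alpha>, \<gamma>, \<delta>] z = 0"
proof -
  let ?T1 = "\<lambda>js. cov Rl [js!1, js!2, js!0, js!3, js!4]" and ?T2 = "\<lambda>js. cov Rl [js!2, js!0, js!1, js!3, js!4]"
  have sm: "smooth (cov Rl is)" for "is" by (rule smooth_cov) (rule smooth_Rl)
  have sm1: "smooth (\<lambda>z. cov Rl is z + ?T1 is z)" for "is"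
    by (intro smooth_intros sm)
  have "cov (\<lambda>js z. cov Rl js z + ?T1 js z + ?T2 js z) [w, \<epsilon>, \<alpha>, \<beta>, \<gamma>, \<delta>] z = 0"
  proof (rule cov_zero_length[OF _ z])
    fix js :: "'n option list" and y assume y: "y \<in> \<Omega>" and "length js = length [\<epsilon>, \<alpha>, \<beta>, \<gamma>, \<delta>]"
    then have "length js = 5" by simp
    then obtain a b c d e where "js = [a, b, c, d, e]" unfolding length_5 by blast
    then show "cov Rl js y + ?T1 js y + ?T2 js y = 0" using second_bianchi[OF y, of a b c d e] by (simp del: cov.simps)
  qed
  moreover have "cov (\<lambda>js z. cov Rl js z + ?T1 js z + ?T2 js z) is z = cov (\<lambda>js z. cov Rl js z + ?T1 js z) is z + cov ?T2 is z" for "is"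
    by (rule cov_add[OF sm1 sm z])
  moreover have "cov (\<lambda>js z. cov Rl js z + ?T1 js z) is z = cov (cov Rl) is z + cov ?T1 is z" for "is"
    by (rule cov_add[OF sm sm z])
  moreover have "cov ?T1 [w, \<epsilon>, \<alpha>, \<beta>, \<gamma>, \<delta>] z = cov (cov Rl) [w, \<alpha>, \<beta>, \<epsilon>, \<gamma>, \<delta>] z"
    using cov_natural[OF natural_perms(4), of "[\<epsilon>, \<alpha>, \<beta>, \<gamma>, \<delta>]" "cov Rl" w z] by (simp del: cov.simps)
  moreover have "cov ?T2 [w, \<epsilon>, \<alpha>, \<beta>, \<gamma>, \<delta>] z = cov (cov Rl) [w, \<beta>, \<epsilon>, \<alpha>, \<gamma>, \<delta>] z"
    using cov_natural[OF natural_perms(5), of "[\<epsilon>, \<alpha>, \<beta>, \<gamma>, \<delta>]" "cov Rl" w z] by (simp del: cov.simps)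
  ultimately show ?thesis by (simp del: cov.simps)
qed

lemma cov2_Rl_skew12:
  assumes z: "z \<in> \<Omega>"
  shows "cov (cov Rl) [w, v, \<beta>, \<alpha>, \<gamma>, \<delta>] z = - cov (cov Rl) [w, v, \<alpha>, \<beta>, \<gamma>, \<delta>] z"
proof -
  have nat: "natural 5 (\<lambda>js. hd js # [tl js!1, tl js!0, tl js!2, tl js!3])"
    using natural_Cons[OF natural_perms(1)] by simp
  have "cov Rl js y = -1 * cov Rl (hd js # [tl js!1, tl js!0, tl js!2, tl js!3]) y" if y: "y \<in> \<Omega>" and "length js = 5" for js y
  proof -
    obtain v a b c d where "js = [v, a, b, c, d]" using \<open>length js = 5\<close> unfolding length_5 by blast
    then show ?thesis using cov_Rl_skew12[OF y, of v a b c d] by (simp del: cov.simps)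
  qed
  then have "cov (cov Rl) (w # [v, \<beta>, \<alpha>, \<gamma>, \<delta>]) z = -1 * cov (cov Rl) (w # (\<lambda>js. hd js # [tl js!1, tl js!0, tl js!2, tl js!3]) [v, \<beta>, \<alpha>, \<gamma>, \<delta>]) z"
    by (intro cov_permute[OF nat _ smooth_cov[OF smooth_Rl] z]) simp_all
  then show ?thesis by (simp del: cov.simps)
qed

section \<open>Contractions and divergence of the spacetime curvature\<close>

definition ricT :: "'n option list \<Rightarrow> 'z \<Rightarrow> real" where
  "ricT = tr (\<lambda>js. Rl [js!2, js!0, js!3, js!1])"

lemma ricT: "ricT [\<beta>, \<gamma>] z = (\<Sum>p\<in>UNIV. \<Sum>q\<in>UNIV. h p q z * Rm4 \<beta> (Some p) \<gamma> (Some q) z)"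
  by (simp add: ricT_def tr_def numeral_eq_Suc del: Rm4.simps)

lemma smooth_ricT: "smooth (ricT is)"
  unfolding ricT_def by (rule smooth_tr) (rule smooth_Rl)

lemma ricT_sym: "z \<in> \<Omega> \<Longrightarrow> ricT [\<beta>, \<gamma>] z = ricT [\<gamma>, \<beta>] z"
  unfolding ricT by (subst sum.swap) (simp add: h_sym Rm4_pair[of z \<beta>] del: Rm4.simps)

lemma ricT_spatial: "z \<in> \<Omega> \<Longrightarrow> ricT [Some i, Some k] z = ric i k z"
proof -
  have "stG (Some k) (Some i) (Some j) = \<Gamma> k i j" for i j k by (rule ext) simp
  then show ?thesis unfolding ricT fun_cong[OF ric_def[of i k], of z] by (simp add: curv_def sum_option)
qed

lemma cov_ricT: 
  assumes z: "z \<in> \<Omega>"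
  shows "cov ricT [v, \<beta>, \<gamma>] z = (\<Sum>p\<in>UNIV. \<Sum>q\<in>UNIV. h p q z * cov Rl [v, \<beta>, Some p, \<gamma>, Some q] z)"
proof -
  have nat: "natural 4 (\<lambda>js. [js!2, js!0, js!3, js!1])"
    unfolding natural_def length_4 by (auto simp: add_ac)
  show ?thesis unfolding ricT_def cov_tr[OF smooth_Rl z]
    using cov_natural[OF nat, of "[Some _, Some _, \<beta>, \<gamma>]" Rl v z] by (simp del: cov.simps)
qed

text \<open>The second Bianchi identity, traced over the differentiation index and the last
  index.\<close>

lemma div_last:
  assumes z: "z \<in> \<Omega>"
  shows "(\<Sum>p\<in>UNIV. \<Sum>q\<in>UNIV. h p q z * cov Rl [Some p, \<alpha>, \<beta>, \<gamma>, Some q] z) = cov ricT [\<beta>, \<alpha>, \<gamma>] z - cov ricT [\<alpha>, \<beta>, \<gamma>] z"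
proof -
  have "cov Rl [Some p, \<alpha>, \<beta>, \<gamma>, Some q] z = cov Rl [\<beta>, \<alpha>, Some p, \<gamma>, Some q] z - cov Rl [\<alpha>, \<beta>, Some p, \<gamma>, Some q] z" for p q
    using second_bianchi[OF z, of "Some p" \<alpha> \<beta> \<gamma> "Some q"] cov_Rl_skew12[OF z, of \<beta> \<alpha> "Some p" \<gamma> "Some q"] by linarith
  then show ?thesis unfolding cov_ricT[OF z] by (simp add: sum_subtractf right_diff_distrib del: cov.simps)
qed

lemma tr_ricT: "z \<in> \<Omega> \<Longrightarrow> tr ricT [] z = scal z"
  unfolding tr_def fun_cong[OF scal_def, of z] by (simp add: ricT_spatial)

lemma trace_cov_ricT:
  assumes z: "z \<in> \<Omega>" shows "(\<Sum>p\<in>UNIV. \<Sum>q\<in>UNIV. h p q z * cov ricT [\<beta>, Some p, Some q] z) = pd \<beta> scal z"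
proof -
  have "pd \<beta> (tr ricT []) z = pd \<beta> scal z" by (rule pd_cong[OF tr_ricT z])
  moreover have "cov (tr ricT) [\<beta>] z = (\<Sum>p\<in>UNIV. \<Sum>q\<in>UNIV. h p q z * cov ricT [\<beta>, Some p, Some q] z)"
    by (rule cov_tr[OF smooth_ricT z])
  ultimately show ?thesis by (simp del: cov.simps add: cov.simps(2)[of "tr ricT"])
qed

text \<open>A further trace of \<open>div_last\<close> gives the derivative of \<open>scal\<close>
  minus \<open>?S\<close>, while skew symmetry in both pairs identifies the same double trace with
  \<open>?S\<close>. For \<beta> = \<open>None\<close> this contains the evolution of the scalar
  curvature.\<close>

lemma contracted_bianchi:
  assumes z: "z \<in> \<Omega>" shows "(\<Sum>p\<in>UNIV. \<Sum>q\<in>UNIV. h p q z * cov ricT [Some p, \<beta>, Some q] z) = (1/2) * pd \<beta> scal z"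
proof -
  let ?S = "\<Sum>p\<in>UNIV. \<Sum>q\<in>UNIV. h p q z * cov ricT [Some p, \<beta>, Some q] z"
  have "(\<Sum>a\<in>UNIV. \<Sum>c\<in>UNIV. h a c z * (\<Sum>p\<in>UNIV. \<Sum>q\<in>UNIV. h p q z * cov Rl [Some p, Some a, \<beta>, Some c, Some q] z)) = pd \<beta> scal z - ?S"
    unfolding div_last[OF z] trace_cov_ricT[OF z, of \<beta>, symmetric] by (simp add: right_diff_distrib sum_subtractf del: cov.simps)
  moreover have "(\<Sum>a\<in>UNIV. \<Sum>c\<in>UNIV. h a c z * (\<Sum>p\<in>UNIV. \<Sum>q\<in>UNIV. h p q z * cov Rl [Some p, Some a, \<beta>, Some c, Some q] z)) = ?S"
  proof -
    have flip: "cov Rl [Some p, Some a, \<beta>, Some c, Some q] z = cov Rl [Some p, \<beta>, Some a, Some q, Some c] z" for p a c q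
      using cov_Rl_skew12[OF z, of "Some p" \<beta> "Some a" "Some q" "Some c"] cov_Rl_skew34[OF z, of "Some p" "Some a" \<beta> "Some q" "Some c"] by simp
    have "(\<Sum>a\<in>UNIV. \<Sum>c\<in>UNIV. h a c z * (\<Sum>p\<in>UNIV. \<Sum>q\<in>UNIV. h p q z * cov Rl [Some p, Some a, \<beta>, Some c, Some q] z))
      = (\<Sum>p\<in>UNIV. \<Sum>q\<in>UNIV. \<Sum>a\<in>UNIV. \<Sum>c\<in>UNIV. h a c z * (h p q z * cov Rl [Some p, \<beta>, Some a, Some q, Some c] z))"
      unfolding flip sum_distrib_left by (rule sum_swap4)
    also have "\<dots> = ?S" unfolding cov_ricT[OF z] sum_distrib_left by (simp add: mult_ac del: cov.simps)
    finally show ?thesis .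
  qed
  ultimately show ?thesis by simp
qed

lemma cov_rhoT_spatial: "z \<in> \<Omega> \<Longrightarrow> cov rhoT [\<alpha>, Some b, Some c] z = cov ricT [\<alpha>, Some b, Some c] z"
proof -
  assume z: "z \<in> \<Omega>"
  have r: "rho (Some b) c = ric b c" for b c by (rule ext) simp
  have "pd \<alpha> (ricT [Some b, Some c]) z = pd \<alpha> (ric b c) z" using z ricT_spatial by (intro pd_cong) auto
  then show ?thesis using z ricT_spatial[OF z] by (simp add: sum_option r)
qed

lemma sum_uminus_mult: "(\<Sum>p\<in>UNIV. \<Sum>q\<in>UNIV. f p q * - k p q) = - (\<Sum>p\<in>UNIV. \<Sum>q\<in>UNIV. f p q * (k p q::real))"
  by (simp add: sum_negf)

text \<open>The trace of \<open>P\<close> is the full gradient of \<open>scal\<close> minus half of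
  it. Hence \<open>rho\<close>, which was put into the connection by hand, is the Ricci contraction
  of its own curvature.\<close>

lemma ricT_rho:
  assumes z: "z \<in> \<Omega>" shows "ricT [\<beta>, Some l] z = rho \<beta> l z"
proof (cases \<beta>)
  case None
  have "Rm4 None (Some p) (Some l) (Some q) z = cov ricT [Some l, Some q, Some p] z - cov ricT [Some q, Some l, Some p] z" for p q
    using Rm4_pair[OF z, of None "Some p" "Some l" "Some q"] Rm4_skew34[OF z, of "Some l" "Some q" None "Some p"]
      Rm4_None[OF z, of "Some l" "Some q" p] cov_rhoT_spatial[OF z] by (simp del: Rm4.simps cov.simps)
  then have "ricT [None, Some l] z = (\<Sum>p\<in>UNIV. \<Sum>q\<in>UNIV. h p q z * cov ricT [Some l, Some q, Some p] z)
      - (\<Sum>p\<in>UNIV. \<Sum>q\<in>UNIV. h p q z * cov ricT [Some q, Some l, Some p] z)"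
    unfolding ricT by (simp add: right_diff_distrib sum_subtractf del: Rm4.simps cov.simps)
  also have "\<dots> = pd (Some l) scal z - (1/2) * pd (Some l) scal z"
  proof -
    have "(\<Sum>p\<in>UNIV. \<Sum>q\<in>UNIV. h p q z * f q p) = (\<Sum>p\<in>UNIV. \<Sum>q\<in>UNIV. h p q z * f p q)" for f
      by (subst sum.swap) (simp only: h_sym[OF z])
    from this[of "\<lambda>q p. cov ricT [Some l, Some q, Some p] z"] this[of "\<lambda>q p. cov ricT [Some q, Some l, Some p] z"]
    show ?thesis unfolding trace_cov_ricT[OF z] contracted_bianchi[OF z] by simp
  qed
  finally show ?thesis using None by simp
qed (simp add: ricT_spatial z)

lemma cov_rhoT_ricT:
  assumes z: "z \<in> \<Omega>" shows "cov rhoT [\<alpha>, \<beta>, Some c] z = cov ricT [\<alpha>, \<beta>, Some c] z"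
proof -
  have "pd \<alpha> (ricT [\<beta>, Some c]) z = pd \<alpha> (rho \<beta> c) z" using z ricT_rho by (intro pd_cong) auto
  then show ?thesis using ricT_rho[OF z] by (simp add: sum_option del: rho.simps)
qed

lemma ricT_time:
  assumes z: "z \<in> \<Omega>" shows "ricT [\<beta>, None] z = (1/2) * pd \<beta> scal z"
proof (cases \<beta>)
  case None
  have "Rm4 None (Some p) None (Some q) z = cov ricT [None, Some p, Some q] z - cov ricT [Some p, None, Some q] z" for p q
    using Rm4_skew34[OF z, of None "Some p" None "Some q"] Rm4_skew12[of None "Some p" "Some q" None z]
      Rm4_None[OF z, of "Some p" None q] cov_rhoT_ricT[OF z] by (simp del: Rm4.simps cov.simps)
  then have "ricT [None, None] z = (\<Sum>p\<in>UNIV. \<Sum>q\<in>UNIV. h p q z * cov ricT [None, Some p, Some q] z)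
      - (\<Sum>p\<in>UNIV. \<Sum>q\<in>UNIV. h p q z * cov ricT [Some p, None, Some q] z)"
    unfolding ricT by (simp add: right_diff_distrib sum_subtractf del: Rm4.simps cov.simps)
  then show ?thesis using None unfolding trace_cov_ricT[OF z] contracted_bianchi[OF z] by simp
next
  case (Some b)
  then show ?thesis using ricT_rho[OF z, of None b] ricT_sym[OF z, of None "Some b"] by simp
qed

text \<open>The divergence of the spacetime curvature is its contraction with \<open>\<partial>\<^sub>t\<close>.\<close>

lemma div_last_eq:
  assumes z: "z \<in> \<Omega>"
  shows "(\<Sum>p\<in>UNIV. \<Sum>q\<in>UNIV. h p q z * cov Rl [Some p, \<alpha>, \<beta>, \<gamma>, Some q] z) = Rm4 \<alpha> \<beta> \<gamma> None z"
proof (cases \<gamma>)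
  case (Some l)
  then show ?thesis unfolding div_last[OF z] using Rm4_None[OF z, of \<alpha> \<beta> l] cov_rhoT_ricT[OF z] by simp
next
  case None
  \<comment> \<open>Here the right-hand side is zero, and the claim is that the one-form
    \<open>ricT [_, None]\<close>, half the differential of \<open>scal\<close>, is closed.\<close>
  have pd0: "pd \<beta> (ricT [\<alpha>, None]) z = (1/2) * pd \<beta> (pd \<alpha> scal) z" for \<alpha> \<beta>
  proof -
    have "pd \<beta> (ricT [\<alpha>, None]) z = pd \<beta> (\<lambda>z. (1/2) * pd \<alpha> scal z) z" using z ricT_time by (intro pd_cong) auto
    also have "\<dots> = (1/2) * pd \<beta> (pd \<alpha> scal) z" by (rule pd_cmult[OF smooth_pd[OF smooth_scal] z])
    finally show ?thesis .
  qed
  have c: "cov ricT [\<beta>, \<alpha>, None] z = (1/2) * pd \<beta> (pd \<alpha> scal) z - (\<Sum>k\<in>UNIV. stG k \<beta> \<alpha> z * ricT [k, None] z)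
      + (\<Sum>m\<in>UNIV. (\<Sum>l\<in>UNIV. h m l z * rho \<beta> l z) * rho \<alpha> m z)" for \<alpha> \<beta>
    unfolding cov.simps act.simps pd0 by (simp add: sum_option[of "\<lambda>k. stG k _ None z * _ k"] stG_None ricT_rho[OF z] sum_negf del: stG.simps(2-4) rho.simps)
  have "cov ricT [\<beta>, \<alpha>, None] z = cov ricT [\<alpha>, \<beta>, None] z"
    unfolding c using pd_commute[OF smooth_scal z, of \<alpha> \<beta>] G_sym[OF z, of _ \<alpha> \<beta>]
      double_sum_sym[OF z, of "\<lambda>l. rho \<alpha> l z" "\<lambda>l. rho \<beta> l z"] by simp
  then show ?thesis unfolding div_last[OF z] using None by simp
qed

lemma div_first:
  assumes z: "z \<in> \<Omega>"
  shows "tr (cov Rl) [\<beta>, \<gamma>, \<delta>] z = Rm4 None \<beta> \<gamma> \<delta> z"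
proof -
  have "cov Rl [Some p, Some q, \<beta>, \<gamma>, \<delta>] z = - cov Rl [Some p, \<gamma>, \<delta>, \<beta>, Some q] z" for p q
    using cov_Rl_pair[OF z, of "Some p" "Some q" \<beta> \<gamma> \<delta>] cov_Rl_skew34[OF z, of "Some p" \<gamma> \<delta> \<beta> "Some q"] by simp
  then have "tr (cov Rl) [\<beta>, \<gamma>, \<delta>] z = - Rm4 \<gamma> \<delta> \<beta> None z"
    unfolding tr_def div_last_eq[OF z, symmetric] by (simp add: sum_negf del: cov.simps)
  then show ?thesis using Rm4_pair[OF z, of None \<beta> \<gamma> \<delta>] Rm4_skew34[OF z, of \<gamma> \<delta> \<beta> None] by (simp del: Rm4.simps)
qed

text \<open>Differentiates \<open>div_first\<close>. The Ricci term appears because the time field,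
  with which the curvature is contracted there, is not parallel.\<close>

lemma cov_div:
  assumes z: "z \<in> \<Omega>"
  shows "(\<Sum>p\<in>UNIV. \<Sum>q\<in>UNIV. h p q z * cov (cov Rl) [v, Some p, Some q, \<beta>, \<gamma>, \<delta>] z)
    = cov Rl [v, None, \<beta>, \<gamma>, \<delta>] z - (\<Sum>m\<in>UNIV. (\<Sum>l\<in>UNIV. h m l z * rho v l z) * Rm4 (Some m) \<beta> \<gamma> \<delta> z)"
proof -
  have len: "length js = 3 \<longleftrightarrow> (\<exists>a b c. js = [a, b, c])" for js :: "'n option list"
    by (auto simp: numeral_eq_Suc length_Suc_conv)
  have "cov (tr (cov Rl)) [v, \<beta>, \<gamma>, \<delta>] z = cov (\<lambda>js. Rl (None # js)) [v, \<beta>, \<gamma>, \<delta>] z"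
  proof (rule cov_cong_length[OF _ z])
    fix js :: "'n option list" and y assume y: "y \<in> \<Omega>" and "length js = length [\<beta>, \<gamma>, \<delta>]"
    then have "length js = 3" by simp
    then obtain a b c where "js = [a, b, c]" unfolding len by blast
    then show "tr (cov Rl) js y = Rl (None # js) y" using div_first[OF y, of a b c] by (simp del: cov.simps Rm4.simps)
  qed
  also have "\<dots> = cov Rl [v, None, \<beta>, \<gamma>, \<delta>] z + (\<Sum>k\<in>UNIV. stG k v None z * Rm4 k \<beta> \<gamma> \<delta> z)"
    by (simp del: Rm4.simps stG.simps)
  also have "(\<Sum>k\<in>UNIV. stG k v None z * Rm4 k \<beta> \<gamma> \<delta> z) = - (\<Sum>m\<in>UNIV. (\<Sum>l\<in>UNIV. h m l z * rho v l z) * Rm4 (Some m) \<beta> \<gamma> \<delta> z)"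
    by (simp add: sum_option stG_None sum_negf del: stG.simps(2-4) Rm4.simps rho.simps)
  finally show ?thesis unfolding cov_tr[OF smooth_cov[OF smooth_Rl] z] by (simp only: diff_conv_add_uminus)
qed

end

section \<open>Hamilton's M as the time-time component of the curvature\<close>

context ricci_flow_frame
begin

lemma act_cong_spatial:
  assumes "\<And>i. M i None = 0" "None \<notin> set is"
    and "\<And>js. length js = length is \<Longrightarrow> None \<notin> set js \<Longrightarrow> T js = U js"
  shows "act M T is = act M U is"
  using assms(2,3)
proof (induction "is" arbitrary: T U)
  case (Cons i "is")
  have "(\<Sum>j\<in>UNIV. M i j * T (j # is)) = (\<Sum>j\<in>UNIV. M i j * U (j # is))"
  proof (rule sum.cong)
    show "M i j * T (j # is) = M i j * U (j # is)" for j using Cons.prems assms(1) by (cases j) auto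
  qed simp
  moreover have "act M (\<lambda>js. T (i # js)) is = act M (\<lambda>js. U (i # js)) is"
    using Cons.prems by (intro Cons.IH) auto
  ultimately show ?case by simp
qed simp

text \<open>Since \<open>stG None = 0\<close>, a derivative with spatial tensor indices sees only
  spatial components, so an identity that holds for these alone may be differentiated in any
  direction.\<close>

lemma cov_cong_spatial:
  assumes "\<And>js y. y \<in> \<Omega> \<Longrightarrow> length js = length is \<Longrightarrow> None \<notin> set js \<Longrightarrow> T js y = U js y"
    and "None \<notin> set is" "z \<in> \<Omega>"
  shows "cov T (v # is) z = cov U (v # is) z"
proof -
  have "pd v (T is) z = pd v (U is) z" using assms by (intro pd_cong) auto
  moreover have "act (\<lambda>i k. stG k v i z) (\<lambda>js. T js z) is = act (\<lambda>i k. stG k v i z) (\<lambda>js. U js z) is"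
    using assms by (intro act_cong_spatial) auto
  ultimately show ?thesis by simp
qed

lemma natural_3: "natural 3 (\<lambda>js. [js!1, js!0, js!2])" "natural 2 (\<lambda>js. [js!1, js!0])"
  "natural 4 (\<lambda>js. [js!1, js!2, js!0, js!3])"
proof -
  have len: "length js = 3 \<longleftrightarrow> (\<exists>a b c. js = [a, b, c])" "length js = 2 \<longleftrightarrow> (\<exists>a b. js = [a, b])" for js :: "'x list"
    by (auto simp: numeral_eq_Suc length_Suc_conv)
  show "natural 3 (\<lambda>js. [js!1, js!0, js!2])" "natural 2 (\<lambda>js. [js!1, js!0])" "natural 4 (\<lambda>js. [js!1, js!2, js!0, js!3])"
    unfolding natural_def len length_4 by (auto simp: add_ac)
qed

lemma cov_ricT_sym: "z \<in> \<Omega> \<Longrightarrow> cov ricT [v, \<alpha>, \<beta>] z = cov ricT [v, \<beta>, \<alpha>] z"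
proof -
  assume z: "z \<in> \<Omega>"
  have sym: "ricT js y = 1 * ricT [js!1, js!0] y" if y: "y \<in> \<Omega>" and "length js = 2" for js y
  proof -
    obtain a b where "js = [a, b]" using \<open>length js = 2\<close> by (auto simp: numeral_eq_Suc length_Suc_conv)
    then show ?thesis using ricT_sym[OF y, of a b] by simp
  qed
  have "cov ricT (v # [\<alpha>, \<beta>]) z = 1 * cov ricT (v # (\<lambda>js. [js!1, js!0]) [\<alpha>, \<beta>]) z"
    by (rule cov_permute[OF natural_3(2) _ smooth_ricT z]) (simp, rule sym)
  then show ?thesis by (simp del: cov.simps)
qed

lemma trace_cov2_ricT:
  assumes z: "z \<in> \<Omega>"
  shows "(\<Sum>p\<in>UNIV. \<Sum>q\<in>UNIV. h p q z * cov (cov ricT) [v, Some p, Some q, \<beta>] z)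
    = (1/2) * (pd v (pd \<beta> scal) z - (\<Sum>k\<in>UNIV. stG k v \<beta> z * pd k scal z))"
proof -
  let ?H = "\<lambda>js. case js of [\<beta>] \<Rightarrow> \<lambda>z. (1/2) * pd \<beta> scal z | _ \<Rightarrow> (\<lambda>_. 0)"
  have "(\<Sum>p\<in>UNIV. \<Sum>q\<in>UNIV. h p q z * cov (cov ricT) [v, Some p, Some q, \<beta>] z) = cov (tr (cov ricT)) [v, \<beta>] z"
    by (rule cov_tr[OF smooth_cov[OF smooth_ricT] z, symmetric])
  also have "\<dots> = cov ?H [v, \<beta>] z"
  proof (rule cov_cong_length[OF _ z])
    fix js :: "'n option list" and y assume y: "y \<in> \<Omega>" and "length js = length [\<beta>]"
    then obtain a where js: "js = [a]" by (cases js) auto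
    show "tr (cov ricT) js y = ?H js y"
      unfolding js tr_def cov_ricT_sym[OF y, of _ _ a] using contracted_bianchi[OF y, of a] by simp
  qed
  also have "\<dots> = (1/2) * (pd v (pd \<beta> scal) z - (\<Sum>k\<in>UNIV. stG k v \<beta> z * pd k scal z))"
  proof -
    have "pd v (\<lambda>z. (1/2) * pd \<beta> scal z) z = (1/2) * pd v (pd \<beta> scal) z"
      by (rule pd_cmult[OF smooth_pd[OF smooth_scal] z])
    then show ?thesis by (simp add: sum_distrib_left algebra_simps sum_divide_distrib)
  qed
  finally show ?thesis .
qed

abbreviation hessR :: "'n \<Rightarrow> 'n \<Rightarrow> 'z \<Rightarrow> real" where
  "hessR b c z \<equiv> pd (Some b) (pd (Some c) scal) z - (\<Sum>k\<in>UNIV. \<Gamma> k b c z * pd (Some k) scal z)"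

lemma quad_relabel:
  assumes z: "z \<in> \<Omega>"
  shows "(\<Sum>p\<in>UNIV. \<Sum>q\<in>UNIV. \<Sum>k\<in>UNIV. \<Sum>l\<in>UNIV. h p q z * (h k l z * (f p l * r q k)))
    = (\<Sum>p\<in>UNIV. \<Sum>q\<in>UNIV. \<Sum>k\<in>UNIV. \<Sum>l\<in>UNIV. h p q z * (h k l z * (f q k * r p l)))"
proof -
  have "(\<Sum>p\<in>UNIV. \<Sum>q\<in>UNIV. \<Sum>k\<in>UNIV. \<Sum>l\<in>UNIV. h p q z * (h k l z * (f p l * r q k)))
    = (\<Sum>p\<in>UNIV. \<Sum>q\<in>UNIV. \<Sum>l\<in>UNIV. \<Sum>k\<in>UNIV. h p q z * (h k l z * (f p l * r q k)))"
    by (intro sum.cong refl sum.swap)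
  then show ?thesis by (subst (asm) (2) sum.swap) (simp add: h_sym[OF z])
qed

text \<open>
  Hamilton's \<open>M\<^sub>b\<^sub>c\<close> without the term \<open>R\<^sub>b\<^sub>c / 2t\<close>, obtained by commuting derivatives in the divergence of
  the components \<open>P\<close> of the spacetime curvature.
\<close>

lemma Rm4_time_time:
  assumes z: "z \<in> \<Omega>"
  shows "Rm4 None (Some b) None (Some c) z
    = (\<Sum>p\<in>UNIV. \<Sum>q\<in>UNIV. h p q z * cov (cov ricT) [Some p, Some q, Some b, Some c] z) - (1/2) * hessR b c z
      + 2 * (\<Sum>p\<in>UNIV. \<Sum>q\<in>UNIV. \<Sum>m\<in>UNIV. \<Sum>l\<in>UNIV. h p q z * (h m l z * (Rm4 (Some q) (Some b) (Some m) (Some c) z * ric p l z)))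
      - (\<Sum>k\<in>UNIV. \<Sum>l\<in>UNIV. h k l z * (ric b k z * ric c l z))"
proof -
  have 1: "cov Rl [Some p, Some q, Some b, Some c, None] z
      = cov (cov ricT) [Some p, Some b, Some q, Some c] z - cov (cov ricT) [Some p, Some q, Some b, Some c] z
        + (\<Sum>m\<in>UNIV. \<Sum>l\<in>UNIV. h m l z * (ric p l z * Rm4 (Some q) (Some b) (Some c) (Some m) z))" for p q
  proof -
    let ?V = "\<lambda>js z. cov ricT [js!1, js!0, js!2] z + - cov ricT js z"
    have sm: "smooth (cov ricT is)" for "is" by (rule smooth_cov) (rule smooth_ricT)
    have len3: "length js = 3 \<longleftrightarrow> (\<exists>a b c. js = [a, b, c])" for js :: "'n option list"
      by (auto simp: numeral_eq_Suc length_Suc_conv)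
    \<comment> \<open>The last index is frozen at \<open>None\<close> to view \<open>P\<close> as a
      tensor with three indices; differentiating the time field as well adds the Ricci term of the
      claim.\<close>
    have "cov (\<lambda>js. Rl (js @ [None])) [Some p, Some q, Some b, Some c] z = cov ?V [Some p, Some q, Some b, Some c] z"
    proof (rule cov_cong_spatial[OF _ _ z])
      fix js :: "'n option list" and y assume y: "y \<in> \<Omega>" and "length js = length [Some q, Some b, Some c]" and no: "None \<notin> set js"
      then have "length js = 3" by simp
      then obtain a' b' c' where js': "js = [a', b', c']" unfolding len3 by blast
      then obtain a b c where "js = [Some a, Some b, Some c]" using no by (cases a'; cases b'; cases c') auto
      then show "Rl (js @ [None]) y = ?V js y"
        using Rm4_None[OF y, of "Some a" "Some b" c] cov_rhoT_ricT[OF y] by (simp del: cov.simps Rm4.simps)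
    qed simp
    also have "\<dots> = cov (\<lambda>js. cov ricT [js!1, js!0, js!2]) [Some p, Some q, Some b, Some c] z
        + cov (\<lambda>js z. - cov ricT js z) [Some p, Some q, Some b, Some c] z"
      by (intro cov_add sm smooth_intros z)
    also have "cov (\<lambda>js. cov ricT [js!1, js!0, js!2]) [Some p, Some q, Some b, Some c] z = cov (cov ricT) [Some p, Some b, Some q, Some c] z"
      using cov_natural[OF natural_3(1), of "[Some q, Some b, Some c]" "cov ricT" "Some p" z] by (simp del: cov.simps)
    also have "cov (\<lambda>js z. - cov ricT js z) [Some p, Some q, Some b, Some c] z = - cov (cov ricT) [Some p, Some q, Some b, Some c] z"
      unfolding cov.simps(2)[of _ "Some p"] using sm z by (simp add: pd_uminus act_uminus del: cov.simps act.simps)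
    finally have "cov (\<lambda>js. Rl (js @ [None])) [Some p, Some q, Some b, Some c] z
      = cov (cov ricT) [Some p, Some b, Some q, Some c] z - cov (cov ricT) [Some p, Some q, Some b, Some c] z" by simp
    moreover have "cov Rl [Some p, Some q, Some b, Some c, None] z = cov (\<lambda>js. Rl (js @ [None])) [Some p, Some q, Some b, Some c] z
        - (\<Sum>k\<in>UNIV. stG k (Some p) None z * Rm4 (Some q) (Some b) (Some c) k z)"
      by (simp del: Rm4.simps stG.simps)
    moreover have "(\<Sum>k\<in>UNIV. stG k (Some p) None z * Rm4 (Some q) (Some b) (Some c) k z)
        = - (\<Sum>m\<in>UNIV. \<Sum>l\<in>UNIV. h m l z * (ric p l z * Rm4 (Some q) (Some b) (Some c) (Some m) z))"
      by (simp add: sum_option stG_None sum_negf sum_distrib_right mult.assoc del: Rm4.simps)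
    ultimately show ?thesis by simp
  qed
  \<comment> \<open>The trace can reach the divergence of Ricci only after the two derivatives have
    been exchanged; the Ricci identity supplies the quadratic terms.\<close>
  have 2: "cov (cov ricT) [Some p, Some b, Some q, Some c] z = cov (cov ricT) [Some b, Some p, Some q, Some c] z
      - (\<Sum>k\<in>UNIV. \<Sum>l\<in>UNIV. h k l z * (Rm4 (Some p) (Some b) (Some l) (Some q) z * ric k c z))
      - (\<Sum>k\<in>UNIV. \<Sum>l\<in>UNIV. h k l z * (Rm4 (Some p) (Some b) (Some l) (Some c) z * ric q k z))" for p q
  proof -
    have "act (\<lambda>i k. curv k (Some p) (Some b) i z) (\<lambda>js. ricT js z) [Some q, Some c]
      = (\<Sum>k\<in>UNIV. \<Sum>l\<in>UNIV. h k l z * (Rm4 (Some p) (Some b) (Some l) (Some q) z * ric k c z))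
        + (\<Sum>k\<in>UNIV. \<Sum>l\<in>UNIV. h k l z * (Rm4 (Some p) (Some b) (Some l) (Some c) z * ric q k z))"
      by (simp add: sum_option ricT_spatial[OF z] curv_raise[OF z] sum_distrib_right mult.assoc del: Rm4.simps)
    then show ?thesis
      using ricci_identity[of ricT z "Some p" "Some b" "[Some q, Some c]", OF smooth_ricT z] by (simp del: cov.simps)
  qed
  have 3: "(\<Sum>p\<in>UNIV. \<Sum>q\<in>UNIV. h p q z * cov (cov ricT) [Some b, Some p, Some q, Some c] z) = (1/2) * hessR b c z"
    unfolding trace_cov2_ricT[OF z] by (simp add: sum_option)
  have 4: "(\<Sum>p\<in>UNIV. \<Sum>q\<in>UNIV. h p q z * (\<Sum>k\<in>UNIV. \<Sum>l\<in>UNIV. h k l z * (Rm4 (Some p) (Some b) (Some l) (Some q) z * ric k c z)))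
      = - (\<Sum>k\<in>UNIV. \<Sum>l\<in>UNIV. h k l z * (ric b k z * ric c l z))"
  proof -
    have "(\<Sum>p\<in>UNIV. \<Sum>q\<in>UNIV. h p q z * (\<Sum>k\<in>UNIV. \<Sum>l\<in>UNIV. h k l z * (Rm4 (Some p) (Some b) (Some l) (Some q) z * ric k c z)))
      = (\<Sum>k\<in>UNIV. \<Sum>l\<in>UNIV. \<Sum>p\<in>UNIV. \<Sum>q\<in>UNIV. h p q z * (h k l z * (Rm4 (Some p) (Some b) (Some l) (Some q) z * ric k c z)))"
      unfolding sum_distrib_left by (rule sum_swap4)
    also have "\<dots> = (\<Sum>k\<in>UNIV. \<Sum>l\<in>UNIV. h k l z * ric k c z * (\<Sum>p\<in>UNIV. \<Sum>q\<in>UNIV. h p q z * Rm4 (Some p) (Some b) (Some l) (Some q) z))"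
      unfolding sum_distrib_left by (simp add: mult_ac del: Rm4.simps)
    also have "(\<lambda>l. \<Sum>p\<in>UNIV. \<Sum>q\<in>UNIV. h p q z * Rm4 (Some p) (Some b) (Some l) (Some q) z) = (\<lambda>l. - ric b l z)"
    proof
      fix l
      have "Rm4 (Some p) (Some b) (Some l) (Some q) z = - Rm4 (Some b) (Some p) (Some l) (Some q) z" for p q by (rule Rm4_skew12)
      then show "(\<Sum>p\<in>UNIV. \<Sum>q\<in>UNIV. h p q z * Rm4 (Some p) (Some b) (Some l) (Some q) z) = - ric b l z"
        unfolding ricT_spatial[OF z, symmetric] ricT by (simp only: sum_uminus_mult)
    qed
    finally have "(\<Sum>p\<in>UNIV. \<Sum>q\<in>UNIV. h p q z * (\<Sum>k\<in>UNIV. \<Sum>l\<in>UNIV. h k l z * (Rm4 (Some p) (Some b) (Some l) (Some q) z * ric k c z)))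
      = - (\<Sum>k\<in>UNIV. \<Sum>l\<in>UNIV. h k l z * ric k c z * ric b l z)" by (simp add: sum_negf)
    also have "(\<Sum>k\<in>UNIV. \<Sum>l\<in>UNIV. h k l z * ric k c z * ric b l z) = (\<Sum>k\<in>UNIV. \<Sum>l\<in>UNIV. h k l z * (ric b k z * ric c l z))"
      by (subst sum.swap) (simp add: h_sym[OF z] ric_sym[OF z, of _ c] mult_ac)
    finally show ?thesis .
  qed
  have 5: "(\<Sum>p\<in>UNIV. \<Sum>q\<in>UNIV. h p q z * (\<Sum>k\<in>UNIV. \<Sum>l\<in>UNIV. h k l z * (Rm4 (Some p) (Some b) (Some l) (Some c) z * ric q k z)))
     = (\<Sum>p\<in>UNIV. \<Sum>q\<in>UNIV. \<Sum>m\<in>UNIV. \<Sum>l\<in>UNIV. h p q z * (h m l z * (Rm4 (Some q) (Some b) (Some m) (Some c) z * ric p l z)))"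
    unfolding sum_distrib_left by (rule quad_relabel[OF z])
  have 6: "(\<Sum>p\<in>UNIV. \<Sum>q\<in>UNIV. h p q z * (\<Sum>m\<in>UNIV. \<Sum>l\<in>UNIV. h m l z * (ric p l z * Rm4 (Some q) (Some b) (Some c) (Some m) z)))
    = - (\<Sum>p\<in>UNIV. \<Sum>q\<in>UNIV. \<Sum>m\<in>UNIV. \<Sum>l\<in>UNIV. h p q z * (h m l z * (Rm4 (Some q) (Some b) (Some m) (Some c) z * ric p l z)))"
    unfolding sum_distrib_left Rm4_skew34[OF z, of "Some _" "Some b" "Some c" "Some _"]
    by (simp add: sum_negf mult_ac del: Rm4.simps)
  have "Rm4 None (Some b) None (Some c) z = - tr (cov Rl) [Some b, Some c, None] z"
    using div_first[OF z, of "Some b" "Some c" None] Rm4_skew34[OF z, of None "Some b" None "Some c"] by simp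
  also have "\<dots> = (\<Sum>p\<in>UNIV. \<Sum>q\<in>UNIV. h p q z * cov (cov ricT) [Some p, Some q, Some b, Some c] z)
     - ((\<Sum>p\<in>UNIV. \<Sum>q\<in>UNIV. h p q z * cov (cov ricT) [Some b, Some p, Some q, Some c] z)
       - (\<Sum>p\<in>UNIV. \<Sum>q\<in>UNIV. h p q z * (\<Sum>k\<in>UNIV. \<Sum>l\<in>UNIV. h k l z * (Rm4 (Some p) (Some b) (Some l) (Some q) z * ric k c z)))
       - (\<Sum>p\<in>UNIV. \<Sum>q\<in>UNIV. h p q z * (\<Sum>k\<in>UNIV. \<Sum>l\<in>UNIV. h k l z * (Rm4 (Some p) (Some b) (Some l) (Some c) z * ric q k z))))
     - (\<Sum>p\<in>UNIV. \<Sum>q\<in>UNIV. h p q z * (\<Sum>m\<in>UNIV. \<Sum>l\<in>UNIV. h m l z * (ric p l z * Rm4 (Some q) (Some b) (Some c) (Some m) z)))"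
    unfolding tr_def 1 2 by (simp add: right_diff_distrib distrib_left sum.distrib sum_subtractf del: cov.simps Rm4.simps)
  finally show ?thesis unfolding 3 4 5 6 by simp
qed

end

lemma sum_delta2: "(\<Sum>p\<in>UNIV. \<Sum>q\<in>UNIV. (if p = q then 1 else 0) * f p q) = (\<Sum>p\<in>UNIV. f p p)" for f :: "'n::finite \<Rightarrow> 'n \<Rightarrow> real"
  by (simp add: if_distrib[of "\<lambda>x. x * _"] cong: if_cong)

lemma sum_delta_mult': "(\<Sum>i\<in>UNIV. (if k = i then 1 else 0) * f i) = f k" for f :: "'n::finite \<Rightarrow> real"
  by (simp add: if_distrib[of "\<lambda>x. x * _"] cong: if_cong)

section \<open>The heat equation of the spacetime curvature\<close>

context ricci_flow_frame
begin

declare Rm4.simps [simp del] stG.simps(2-4) [simp del] rho.simps [simp del] cov.simps [simp del]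

text \<open>The reaction term of Hamilton's evolution equation for Rm, its square plus its sharp.
  The outer indices range over spacetime, the contracted ones only over space.\<close>

definition Qm :: "'n option \<Rightarrow> 'n option \<Rightarrow> 'n option \<Rightarrow> 'n option \<Rightarrow> 'z \<Rightarrow> real" where
  "Qm \<alpha> \<beta> \<gamma> \<delta> z = (\<Sum>e\<in>UNIV. \<Sum>k\<in>UNIV. Rm4 \<alpha> \<beta> (Some e) (Some k) z * Rm4 (Some e) (Some k) \<gamma> \<delta> z
     + 2 * (Rm4 (Some e) \<alpha> (Some k) \<gamma> z * Rm4 (Some e) \<beta> (Some k) \<delta> z)
     - 2 * (Rm4 (Some e) \<alpha> (Some k) \<delta> z * Rm4 (Some e) \<beta> (Some k) \<gamma> z))"

text \<open>A constant frame can be orthonormal at the base point only; the cometric is not trivial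
  nearby, so this is used after all derivatives have been taken.\<close>

definition orthonormal_at :: "'z \<Rightarrow> bool" where
  "orthonormal_at z \<longleftrightarrow> z \<in> \<Omega> \<and> (\<forall>i j. h i j z = (if i = j then 1 else 0))"

lemma orthonormal_at_simps:
  assumes "orthonormal_at z"
  shows "z \<in> \<Omega>" "h i j z = (if i = j then 1 else 0)"
  using assms by (auto simp: orthonormal_at_def)

text \<open>The second Bianchi identity writes the Laplacian as a skew pair of derivatives.
  Commuting them produces a divergence, which is the contraction with the time field, and the
  Bianchi identity once more turns the two remaining terms into the time derivative. The commutators
  give \<open>Qm\<close>.\<close>

theorem heat_operator_Rl:
  assumes o: "orthonormal_at z"
  shows "cov Rl [None, \<alpha>, \<beta>, \<gamma>, \<delta>] z - (\<Sum>e\<in>UNIV. cov (cov Rl) [Some e, Some e, \<alpha>, \<beta>, \<gamma>, \<delta>] z) = Qm \<alpha> \<beta> \<gamma> \<delta> z"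
proof -
  note z = orthonormal_at_simps(1)[OF o] and h = orthonormal_at_simps(2)[OF o]
  have div: "(\<Sum>e\<in>UNIV. cov (cov Rl) [v, Some e, Some e, \<beta>, \<gamma>, \<delta>] z)
    = cov Rl [v, None, \<beta>, \<gamma>, \<delta>] z - (\<Sum>m\<in>UNIV. rho v m z * Rm4 (Some m) \<beta> \<gamma> \<delta> z)" for v \<beta>
    using cov_div[OF z, of v \<beta> \<gamma> \<delta>] by (simp add: h sum_delta2 sum_delta_mult')
  define T where "T \<alpha> \<beta> e k = Rm4 (Some e) \<alpha> (Some k) \<beta> z * Rm4 (Some e) (Some k) \<gamma> \<delta> z
     + Rm4 (Some e) \<alpha> (Some k) \<gamma> z * Rm4 (Some e) \<beta> (Some k) \<delta> z
     + Rm4 (Some e) \<alpha> (Some k) \<delta> z * Rm4 (Some e) \<beta> \<gamma> (Some k) z" for \<alpha> \<beta> e k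
  \<comment> \<open>The Ricci term from commuting derivatives; it cancels the one in
    \<open>div\<close> that is due to the time field not being parallel.\<close>
  have ric: "(\<Sum>e\<in>UNIV. \<Sum>k\<in>UNIV. Rm4 (Some e) \<alpha> (Some k) (Some e) z * f k) = - (\<Sum>m\<in>UNIV. rho \<alpha> m z * f m)" for \<alpha> and f :: "'n \<Rightarrow> real"
  proof -
    have "rho \<alpha> k z = (\<Sum>e\<in>UNIV. Rm4 \<alpha> (Some e) (Some k) (Some e) z)" for k
      unfolding ricT_rho[OF z, symmetric] ricT by (simp add: h sum_delta2)
    moreover have "Rm4 (Some e) \<alpha> (Some k) (Some e) z = - Rm4 \<alpha> (Some e) (Some k) (Some e) z" for e k by (rule Rm4_skew12)
    ultimately show ?thesis
      by (subst sum.swap) (simp add: sum_distrib_right sum_negf)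
  qed
  have A: "(\<Sum>e\<in>UNIV. cov (cov Rl) [Some e, \<alpha>, Some e, \<beta>, \<gamma>, \<delta>] z)
    = cov Rl [\<alpha>, None, \<beta>, \<gamma>, \<delta>] z - (\<Sum>e\<in>UNIV. \<Sum>k\<in>UNIV. T \<alpha> \<beta> e k)" for \<alpha> \<beta>
  proof -
    have curv: "curv (Some k) \<alpha> \<beta> \<delta> z = Rm4 \<alpha> \<beta> (Some k) \<delta> z" for k \<alpha> \<beta> \<delta>
      using curv_raise[OF z, of k] by (simp add: h if_distrib[of "\<lambda>x. x * _"] cong: if_cong)
    have "cov (cov Rl) [Some e, \<alpha>, Some e, \<beta>, \<gamma>, \<delta>] z = cov (cov Rl) [\<alpha>, Some e, Some e, \<beta>, \<gamma>, \<delta>] z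
      - ((\<Sum>k\<in>UNIV. Rm4 (Some e) \<alpha> (Some k) (Some e) z * Rm4 (Some k) \<beta> \<gamma> \<delta> z) + (\<Sum>k\<in>UNIV. T \<alpha> \<beta> e k))" for e
    proof -
      have "act (\<lambda>i k. curv k (Some e) \<alpha> i z) (\<lambda>js. Rl js z) [Some e, \<beta>, \<gamma>, \<delta>]
        = (\<Sum>k\<in>UNIV. Rm4 (Some e) \<alpha> (Some k) (Some e) z * Rm4 (Some k) \<beta> \<gamma> \<delta> z) + (\<Sum>k\<in>UNIV. T \<alpha> \<beta> e k)"
        by (simp add: sum_option curv T_def sum.distrib)
      then show ?thesis
        using ricci_identity[of Rl z "Some e" \<alpha> "[Some e, \<beta>, \<gamma>, \<delta>]", OF smooth_Rl z] by simp
    qed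
    then have "(\<Sum>e\<in>UNIV. cov (cov Rl) [Some e, \<alpha>, Some e, \<beta>, \<gamma>, \<delta>] z) = (\<Sum>e\<in>UNIV. cov (cov Rl) [\<alpha>, Some e, Some e, \<beta>, \<gamma>, \<delta>] z)
      - (\<Sum>e\<in>UNIV. \<Sum>k\<in>UNIV. Rm4 (Some e) \<alpha> (Some k) (Some e) z * Rm4 (Some k) \<beta> \<gamma> \<delta> z) - (\<Sum>e\<in>UNIV. \<Sum>k\<in>UNIV. T \<alpha> \<beta> e k)"
      by (simp add: sum_subtractf sum.distrib)
    then show ?thesis unfolding div ric by simp
  qed
  have "cov (cov Rl) [Some e, Some e, \<alpha>, \<beta>, \<gamma>, \<delta>] z
    = cov (cov Rl) [Some e, \<alpha>, Some e, \<beta>, \<gamma>, \<delta>] z - cov (cov Rl) [Some e, \<beta>, Some e, \<alpha>, \<gamma>, \<delta>] z" for e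
    using cov2_Rl_bianchi[OF z, of "Some e" "Some e" \<alpha> \<beta> \<gamma> \<delta>] cov2_Rl_skew12[OF z, of "Some e" \<alpha> \<beta> "Some e" \<gamma> \<delta>] by simp
  then have "(\<Sum>e\<in>UNIV. cov (cov Rl) [Some e, Some e, \<alpha>, \<beta>, \<gamma>, \<delta>] z)
    = cov Rl [\<alpha>, None, \<beta>, \<gamma>, \<delta>] z - cov Rl [\<beta>, None, \<alpha>, \<gamma>, \<delta>] z - (\<Sum>e\<in>UNIV. \<Sum>k\<in>UNIV. T \<alpha> \<beta> e k - T \<beta> \<alpha> e k)"
    by (simp add: sum_subtractf A)
  moreover have "cov Rl [\<alpha>, None, \<beta>, \<gamma>, \<delta>] z - cov Rl [\<beta>, None, \<alpha>, \<gamma>, \<delta>] z = cov Rl [None, \<alpha>, \<beta>, \<gamma>, \<delta>] z"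
    using second_bianchi[OF z, of None \<alpha> \<beta> \<gamma> \<delta>] cov_Rl_skew12[OF z, of \<alpha> \<beta> None \<gamma> \<delta>] by simp
  moreover have "(\<Sum>e\<in>UNIV. \<Sum>k\<in>UNIV. T \<alpha> \<beta> e k - T \<beta> \<alpha> e k) = Qm \<alpha> \<beta> \<gamma> \<delta> z"
    unfolding Qm_def
  proof (intro sum.cong refl)
    fix e k
    have "Rm4 (Some e) \<alpha> (Some k) \<beta> z - Rm4 (Some e) \<beta> (Some k) \<alpha> z = Rm4 \<alpha> \<beta> (Some e) (Some k) z"
      using Rm4_cyclic[OF z, of "Some e" \<alpha> "Some k" \<beta>] Rm4_skew12[of \<beta> "Some e" "Some k" \<alpha> z] Rm4_skew34[OF z, of \<alpha> \<beta> "Some k" "Some e"]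
      by simp
    then have 1: "Rm4 (Some e) \<alpha> (Some k) \<beta> z = Rm4 (Some e) \<beta> (Some k) \<alpha> z + Rm4 \<alpha> \<beta> (Some e) (Some k) z" by simp
    show "T \<alpha> \<beta> e k - T \<beta> \<alpha> e k = Rm4 \<alpha> \<beta> (Some e) (Some k) z * Rm4 (Some e) (Some k) \<gamma> \<delta> z
     + 2 * (Rm4 (Some e) \<alpha> (Some k) \<gamma> z * Rm4 (Some e) \<beta> (Some k) \<delta> z)
     - 2 * (Rm4 (Some e) \<alpha> (Some k) \<delta> z * Rm4 (Some e) \<beta> (Some k) \<gamma> z)"
      unfolding T_def 1 Rm4_skew34[OF z, of "Some e" \<beta> \<gamma> "Some k"] Rm4_skew34[OF z, of "Some e" \<alpha> \<gamma> "Some k"]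
      by (simp add: algebra_simps)
  qed
  ultimately show ?thesis by simp
qed

text \<open>Equates two expressions for the time-time component: \<open>Rm4_None\<close>, which
  contains the time derivative of Ricci, and \<open>Rm4_time_time\<close>, which contains its
  Laplacian.\<close>

lemma heat_operator_ric:
  assumes o: "orthonormal_at z"
  shows "cov ricT [None, Some b, Some c] z - (\<Sum>e\<in>UNIV. cov (cov ricT) [Some e, Some e, Some b, Some c] z)
    = 2 * (\<Sum>k\<in>UNIV. \<Sum>l\<in>UNIV. Rm4 (Some b) (Some k) (Some c) (Some l) z * ric k l z)"
proof -
  note z = orthonormal_at_simps(1)[OF o] and h = orthonormal_at_simps(2)[OF o]
  have 1: "Rm4 None (Some b) None (Some c) z = cov ricT [None, Some b, Some c] z - cov ricT [Some b, None, Some c] z"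
    using Rm4_None[OF z, of "Some b" None c] cov_rhoT_ricT[OF z] Rm4_skew34[OF z, of None "Some b" None "Some c"]
      Rm4_skew12[of None "Some b" "Some c" None z] by simp
  have half: "pd v (\<lambda>z. pd w scal z / 2) z = pd v (pd w scal) z / 2" for v w
    using pd_cmult[of "pd w scal" z v "1/2"] z by (simp add: smooth_pd smooth_scal)
  have rho0: "rho None l = (\<lambda>z. pd (Some l) scal z / 2)" for l by (rule ext) (simp add: rho.simps)
  have delta: "(\<Sum>l\<in>UNIV. h k l z * f l) = f k" for k f
    by (simp add: h if_distrib[of "\<lambda>x. x * _"] cong: if_cong)
  have 2: "cov ricT [Some b, None, Some c] z = (1/2) * hessR b c z + (\<Sum>k\<in>UNIV. ric b k z * ric c k z)"
    unfolding cov_rhoT_ricT[OF z, symmetric] cov_rhoT rho0 half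
    by (simp add: sum_option stG_None delta sum_negf rho.simps stG.simps sum_distrib_left ric_sym[OF z, of _ c] algebra_simps sum_divide_distrib)
  have 3: "Rm4 None (Some b) None (Some c) z = (\<Sum>e\<in>UNIV. cov (cov ricT) [Some e, Some e, Some b, Some c] z) - (1/2) * hessR b c z
    + 2 * (\<Sum>q\<in>UNIV. \<Sum>m\<in>UNIV. Rm4 (Some q) (Some b) (Some m) (Some c) z * ric q m z) - (\<Sum>k\<in>UNIV. ric b k z * ric c k z)"
    using Rm4_time_time[OF z, of b c] by (simp add: h sum_delta2 sum_delta_mult' sum_distrib_left[symmetric] delta)
  have "Rm4 (Some q) (Some b) (Some m) (Some c) z = Rm4 (Some b) (Some q) (Some c) (Some m) z" for q m
    using Rm4_skew12[of "Some b" "Some q" "Some m" "Some c" z] Rm4_skew34[OF z, of "Some b" "Some q" "Some m" "Some c"] by simp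
  then show ?thesis using 1 2 3 by simp
qed

end

section \<open>The Schur complement of the spatial curvature and its heat operator\<close>

locale harnack_vector = ricci_flow_frame +
  fixes Ev :: "'b \<Rightarrow> 'b \<Rightarrow> 'b \<Rightarrow> 'a \<Rightarrow> real"
  assumes smooth_Ev: "smooth_on (Ev i j a) \<Omega>"
    and solves: "z \<in> \<Omega> \<Longrightarrow> Rm4 (Some c) (Some d) None (Some a) z
      + (\<Sum>i\<in>UNIV. \<Sum>j\<in>UNIV. Rm4 (Some c) (Some d) (Some i) (Some j) z * Ev i j a z) = 0"
begin

text \<open>
  The two-vectors \<open>E\<^sub>a = \<partial>\<^sub>t \<wedge> e\<^sub>a + Ev\<^sub>a\<close> on spacetime (not antisymmetrized in the first summand) span the
  complement of the spatial two-vectors with respect to the curvature.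
\<close>

definition EE :: "'b option \<Rightarrow> 'b option \<Rightarrow> 'b option list \<Rightarrow> 'a \<Rightarrow> real" where
  "EE \<alpha> \<beta> is = (case is of [Some a] \<Rightarrow>
      (case \<beta> of None \<Rightarrow> (\<lambda>_. 0) | Some j \<Rightarrow>
        (case \<alpha> of None \<Rightarrow> (\<lambda>_. if a = j then 1 else 0) | Some i \<Rightarrow> Ev i j a)) | _ \<Rightarrow> (\<lambda>_. 0))"

lemma EE_simps [simp]:
  "EE \<alpha> None is = (\<lambda>_. 0)"
  "EE None (Some j) [Some a] = (\<lambda>_. if a = j then 1 else 0)"
  "EE (Some i) (Some j) [Some a] = Ev i j a"
  by (auto simp: EE_def split: list.split option.split)

lemma smooth_EE: "smooth (EE \<alpha> \<beta> is)"
  unfolding EE_def using smooth_Ev by (auto split: list.split option.split)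

text \<open>The components of E with a time index are those of the parallel identity, or zero. Hence
  the derivative of E, called \<open>omega\<close> below, is purely spatial.\<close>

lemma covu_EE_None:
  assumes z: "z \<in> \<Omega>"
  shows "covu EE \<alpha> None [v, Some a] z = 0" "covu EE None \<beta> [v, Some a] z = 0"
proof -
  show 1: "covu EE \<alpha> None [v, Some a] z = 0" for \<alpha>
    by (simp add: cov.simps sum_option)
  show "covu EE None \<beta> [v, Some a] z = 0"
  proof (cases \<beta>)
    case (Some b)
    have "(\<Sum>k\<in>UNIV. stG (Some k) v (Some a) z * (if k = b then 1 else 0)) = stG (Some b) v (Some a) z"
      "(\<Sum>k\<in>UNIV. stG (Some b) v (Some k) z * (if a = k then 1 else 0)) = stG (Some b) v (Some a) z"
      by (simp_all add: if_distrib[of "\<lambda>x. _ * x"] cong: if_cong)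
    then show ?thesis using Some by (simp add: cov.simps sum_option)
  next
    case None
    then show ?thesis using 1[of None] by (simp only:)
  qed
qed

lemma covu2_EE_None:
  assumes z: "z \<in> \<Omega>"
  shows "covu (covu EE) \<alpha> None [w, v, Some a] z = 0" "covu (covu EE) None \<beta> [w, v, Some a] z = 0"
proof -
  have pd0: "pd w (covu EE \<alpha> None [v, Some a]) z = 0" "pd w (covu EE None \<beta> [v, Some a]) z = 0" for w v a \<alpha> \<beta>
    using pd_cong[of "covu EE \<alpha> None [v, Some a]" "\<lambda>_. 0" z w] pd_cong[of "covu EE None \<beta> [v, Some a]" "\<lambda>_. 0" z w]
      covu_EE_None z by simp_all
  show "covu (covu EE) \<alpha> None [w, v, Some a] z = 0" "covu (covu EE) None \<beta> [w, v, Some a] z = 0"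
    unfolding covu.simps(2)[of "covu EE"] cov.simps act.simps pd0 
    by (simp_all add: sum_option covu_EE_None[OF z] del: covu.simps)
qed

text \<open>The curvature with its second pair contracted with E. As it vanishes on spatial first
  pairs, contracting the first pair with E as well leaves only the component with first index
  \<open>None\<close>.\<close>

definition UU :: "'b option list \<Rightarrow> 'a \<Rightarrow> real" where
  "UU is z = (\<Sum>\<alpha>\<in>UNIV. \<Sum>\<beta>\<in>UNIV. Rl (take 2 is @ [\<alpha>, \<beta>]) z * EE \<alpha> \<beta> (drop 2 is) z)"

lemma smooth_UU: "smooth (UU is)"
  unfolding UU_def using smooth_Rl smooth_EE by (intro smooth_intros)

abbreviation omega :: "'b option \<Rightarrow> 'b \<Rightarrow> 'b \<Rightarrow> 'b \<Rightarrow> 'a \<Rightarrow> real" where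
  "omega v i j a \<equiv> covu EE (Some i) (Some j) [v, Some a]"

lemma sum_EE: "(\<Sum>\<alpha>\<in>UNIV. \<Sum>\<beta>\<in>UNIV. f \<alpha> \<beta> * EE \<alpha> \<beta> [Some a] z) = f None (Some a) + (\<Sum>i\<in>UNIV. \<Sum>j\<in>UNIV. f (Some i) (Some j) * Ev i j a z)"
proof -
  have "(\<Sum>j\<in>UNIV. f None (Some j) * (if a = j then 1 else 0)) = f None (Some a)"
    by (simp add: if_distrib[of "\<lambda>x. _ * x"] cong: if_cong)
  then show ?thesis by (simp add: sum_option)
qed

lemma sum_spatial:
  fixes f W :: "'b option \<Rightarrow> 'b option \<Rightarrow> real"
  shows "(\<And>\<alpha>. W \<alpha> None = 0) \<Longrightarrow> (\<And>\<beta>. W None \<beta> = 0) \<Longrightarrow>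
    (\<Sum>\<alpha>\<in>UNIV. \<Sum>\<beta>\<in>UNIV. f \<alpha> \<beta> * W \<alpha> \<beta>) = (\<Sum>i\<in>UNIV. \<Sum>j\<in>UNIV. f (Some i) (Some j) * W (Some i) (Some j))"
  by (simp add: sum_option)

lemma UU: "UU [\<gamma>, \<delta>, Some a] z = Rm4 \<gamma> \<delta> None (Some a) z + (\<Sum>i\<in>UNIV. \<Sum>j\<in>UNIV. Rm4 \<gamma> \<delta> (Some i) (Some j) z * Ev i j a z)"
  using sum_EE[of "\<lambda>\<alpha> \<beta>. Rm4 \<gamma> \<delta> \<alpha> \<beta> z" a z] by (simp add: UU_def)

lemma UU_spatial: "z \<in> \<Omega> \<Longrightarrow> UU [Some c, Some d, Some a] z = 0"
  unfolding UU by (rule solves)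

lemma cov_UU_gen:
  assumes z: "z \<in> \<Omega>"
  shows "cov UU (v # is) z = (\<Sum>\<alpha>\<in>UNIV. \<Sum>\<beta>\<in>UNIV. cov Rl (v # take 2 is @ [\<alpha>, \<beta>]) z * EE \<alpha> \<beta> (drop 2 is) z
      + Rl (take 2 is @ [\<alpha>, \<beta>]) z * covu EE \<alpha> \<beta> (v # drop 2 is) z)"
  unfolding UU_def[abs_def] by (rule cov_contraction[OF smooth_Rl smooth_EE z])

lemma cov_UU:
  assumes z: "z \<in> \<Omega>"
  shows "cov UU [v, \<gamma>, \<delta>, Some a] z = cov Rl [v, \<gamma>, \<delta>, None, Some a] z
      + (\<Sum>i\<in>UNIV. \<Sum>j\<in>UNIV. cov Rl [v, \<gamma>, \<delta>, Some i, Some j] z * Ev i j a z)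
      + (\<Sum>i\<in>UNIV. \<Sum>j\<in>UNIV. Rm4 \<gamma> \<delta> (Some i) (Some j) z * omega v i j a z)"
  using cov_UU_gen[OF z, of v "[\<gamma>, \<delta>, Some a]"] sum_EE[of "\<lambda>\<alpha> \<beta>. cov Rl [v, \<gamma>, \<delta>, \<alpha>, \<beta>] z" a z]
    sum_spatial[of "\<lambda>\<alpha> \<beta>. covu EE \<alpha> \<beta> [v, Some a] z" "\<lambda>\<alpha> \<beta>. Rm4 \<gamma> \<delta> \<alpha> \<beta> z"] covu_EE_None[OF z]
  by (simp add: sum.distrib del: covu.simps)

lemma cov2_UU:
  assumes z: "z \<in> \<Omega>"
  shows "cov (cov UU) [w, v, \<gamma>, \<delta>, Some a] z = cov (cov Rl) [w, v, \<gamma>, \<delta>, None, Some a] z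
      + (\<Sum>i\<in>UNIV. \<Sum>j\<in>UNIV. cov (cov Rl) [w, v, \<gamma>, \<delta>, Some i, Some j] z * Ev i j a z)
      + (\<Sum>i\<in>UNIV. \<Sum>j\<in>UNIV. cov Rl [v, \<gamma>, \<delta>, Some i, Some j] z * omega w i j a z)
      + (\<Sum>i\<in>UNIV. \<Sum>j\<in>UNIV. cov Rl [w, \<gamma>, \<delta>, Some i, Some j] z * omega v i j a z)
      + (\<Sum>i\<in>UNIV. \<Sum>j\<in>UNIV. Rm4 \<gamma> \<delta> (Some i) (Some j) z * covu (covu EE) (Some i) (Some j) [w, v, Some a] z)"
proof -
  let ?U1 = "\<lambda>is z. \<Sum>\<alpha>\<in>UNIV. \<Sum>\<beta>\<in>UNIV. cov Rl (take 3 is @ [\<alpha>, \<beta>]) z * EE \<alpha> \<beta> (drop 3 is) z"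
  let ?U2 = "\<lambda>is z. \<Sum>\<alpha>\<in>UNIV. \<Sum>\<beta>\<in>UNIV. Rl (take 2 is @ [\<alpha>, \<beta>]) z * covu EE \<alpha> \<beta> (drop 2 is) z"
  have smR: "smooth (cov Rl is)" for "is" by (rule smooth_cov) (rule smooth_Rl)
  have smE: "smooth (covu EE \<alpha> \<beta> is)" for \<alpha> \<beta> "is" by (rule smooth_covu) (rule smooth_EE)
  have sm1: "smooth (?U1 is)" for "is" by (intro smooth_intros smR smooth_EE)
  have sm2: "smooth (?U2 is)" for "is" by (intro smooth_intros smE smooth_Rl)
  \<comment> \<open>The differentiation index \<open>v\<close> belongs to the derivative of E, so in
    the second summand it is moved behind \<gamma> and \<delta>, where
    \<open>cov_contraction\<close> expects the indices of that factor.\<close>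
  have "cov (cov UU) [w, v, \<gamma>, \<delta>, Some a] z = cov (\<lambda>is z. ?U1 is z + ?U2 [is!1, is!2, is!0, is!3] z) [w, v, \<gamma>, \<delta>, Some a] z"
  proof (rule cov_cong_length[OF _ z])
    fix js :: "'b option list" and y assume y: "y \<in> \<Omega>" and "length js = length [v, \<gamma>, \<delta>, Some a]"
    then have "length js = 4" by simp
    then obtain b c d e where js: "js = [b, c, d, e]" unfolding length_4 by blast
    show "cov UU js y = ?U1 js y + ?U2 [js!1, js!2, js!0, js!3] y"
      unfolding js cov_UU_gen[OF y] by (simp add: sum.distrib numeral_eq_Suc del: covu.simps)
  qed
  also have "\<dots> = cov ?U1 [w, v, \<gamma>, \<delta>, Some a] z + cov (\<lambda>is. ?U2 [is!1, is!2, is!0, is!3]) [w, v, \<gamma>, \<delta>, Some a] z"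
    by (rule cov_add[OF sm1 sm2 z])
  also have "cov (\<lambda>is. ?U2 [is!1, is!2, is!0, is!3]) [w, v, \<gamma>, \<delta>, Some a] z = cov ?U2 [w, \<gamma>, \<delta>, v, Some a] z"
    using cov_natural[OF natural_3(3), of "[v, \<gamma>, \<delta>, Some a]" ?U2 w z] by simp
  also have "cov ?U1 [w, v, \<gamma>, \<delta>, Some a] z = (\<Sum>\<alpha>\<in>UNIV. \<Sum>\<beta>\<in>UNIV. cov (cov Rl) [w, v, \<gamma>, \<delta>, \<alpha>, \<beta>] z * EE \<alpha> \<beta> [Some a] z)
      + (\<Sum>\<alpha>\<in>UNIV. \<Sum>\<beta>\<in>UNIV. cov Rl [v, \<gamma>, \<delta>, \<alpha>, \<beta>] z * covu EE \<alpha> \<beta> [w, Some a] z)"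
    using cov_contraction[of "cov Rl" EE z 3 w "[v, \<gamma>, \<delta>, Some a]", OF smR smooth_EE z] by (simp add: sum.distrib numeral_eq_Suc del: covu.simps)
  also have "cov ?U2 [w, \<gamma>, \<delta>, v, Some a] z = (\<Sum>\<alpha>\<in>UNIV. \<Sum>\<beta>\<in>UNIV. cov Rl [w, \<gamma>, \<delta>, \<alpha>, \<beta>] z * covu EE \<alpha> \<beta> [v, Some a] z)
      + (\<Sum>\<alpha>\<in>UNIV. \<Sum>\<beta>\<in>UNIV. Rm4 \<gamma> \<delta> \<alpha> \<beta> z * covu (covu EE) \<alpha> \<beta> [w, v, Some a] z)"
    using cov_contraction[of Rl "covu EE" z 2 w "[\<gamma>, \<delta>, v, Some a]", OF smooth_Rl smE z] by (simp add: sum.distrib numeral_eq_Suc del: covu.simps)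
  finally show ?thesis
    unfolding sum_EE sum_spatial[of "\<lambda>\<alpha> \<beta>. covu EE \<alpha> \<beta> [v, Some a] z" for v, OF covu_EE_None[OF z]]
      sum_spatial[of "\<lambda>\<alpha> \<beta>. covu (covu EE) \<alpha> \<beta> [w, v, Some a] z", OF covu2_EE_None[OF z]]
    by simp
qed

lemma cov_UU_spatial: "z \<in> \<Omega> \<Longrightarrow> cov UU [v, Some c, Some d, Some a] z = 0"
proof -
  assume z: "z \<in> \<Omega>"
  have "pd v (UU [Some c, Some d, Some a]) z = 0" using pd_cong[of "UU [Some c, Some d, Some a]" "\<lambda>_. 0" z v] UU_spatial z by simp
  then show ?thesis by (simp add: cov.simps sum_option UU_spatial[OF z])
qed

lemma cov2_UU_spatial: "z \<in> \<Omega> \<Longrightarrow> cov (cov UU) [w, v, Some c, Some d, Some a] z = 0"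
proof -
  assume z: "z \<in> \<Omega>"
  have "pd w (cov UU [v, Some c, Some d, Some a]) z = 0" using pd_cong[of "cov UU [v, Some c, Some d, Some a]" "\<lambda>_. 0" z w] cov_UU_spatial z by simp
  then show ?thesis by (simp add: cov.simps(2)[of "cov UU"] sum_option cov_UU_spatial[OF z])
qed

text \<open>\<open>ZZ\<close> is Hamilton's \<open>Z\<close> without the term \<open>R\<^sub>a\<^sub>b / 2t\<close>.\<close>

abbreviation ZZ :: "'b option list \<Rightarrow> 'a \<Rightarrow> real" where
  "ZZ \<equiv> \<lambda>is. UU (None # is)"

text \<open>Freezing the first index at \<open>None\<close> omits only connection terms that contain
  \<open>UU\<close> on spatial pairs, and these are zero.\<close>

lemma cov_ZZ: "z \<in> \<Omega> \<Longrightarrow> cov ZZ [v, Some d, Some a] z = cov UU [v, None, Some d, Some a] z"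
  by (simp add: cov.simps sum_option UU_spatial)

lemma cov2_ZZ:
  assumes z: "z \<in> \<Omega>"
  shows "cov (cov ZZ) [w, v, Some d, Some a] z = cov (cov UU) [w, v, None, Some d, Some a] z"
proof -
  have "pd w (cov ZZ [v, Some d, Some a]) z = pd w (cov UU [v, None, Some d, Some a]) z"
    by (rule pd_cong[OF cov_ZZ z])
  then show ?thesis
    by (simp add: cov.simps(2)[of "cov UU"] cov.simps(2)[of "cov ZZ"] sum_option cov_ZZ[OF z] cov_UU_spatial[OF z])
qed

definition QEE :: "'b \<Rightarrow> 'b \<Rightarrow> 'a \<Rightarrow> real" where
  "QEE d a z = (\<Sum>\<gamma>\<in>UNIV. \<Sum>\<delta>\<in>UNIV. (\<Sum>\<alpha>\<in>UNIV. \<Sum>\<beta>\<in>UNIV. Qm \<gamma> \<delta> \<alpha> \<beta> z * EE \<alpha> \<beta> [Some a] z) * EE \<gamma> \<delta> [Some d] z)"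

text \<open>The heat operator of \<open>UU\<close> is contracted with E in its first pair. Second
  derivatives of E are spatial and drop out; the cross term with the derivative of the curvature
  becomes the quadratic term in \<open>omega\<close> by the differentiated constraint.\<close>

theorem heat_operator_ZZ:
  assumes o: "orthonormal_at z"
  shows "cov ZZ [None, Some d, Some a] z - (\<Sum>e\<in>UNIV. cov (cov ZZ) [Some e, Some e, Some d, Some a] z)
    = QEE d a z + 2 * (\<Sum>e\<in>UNIV. \<Sum>i\<in>UNIV. \<Sum>j\<in>UNIV. \<Sum>k\<in>UNIV. \<Sum>l\<in>UNIV.
        Rm4 (Some i) (Some j) (Some k) (Some l) z * omega (Some e) k l d z * omega (Some e) i j a z)"
proof -
  note z = orthonormal_at_simps(1)[OF o]
  define \<Psi> where "\<Psi> i j = omega None i j a z - (\<Sum>e\<in>UNIV. covu (covu EE) (Some i) (Some j) [Some e, Some e, Some a] z)" for i j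
  define B where "B \<gamma> \<delta> = cov UU [None, \<gamma>, \<delta>, Some a] z - (\<Sum>e\<in>UNIV. cov (cov UU) [Some e, Some e, \<gamma>, \<delta>, Some a] z)" for \<gamma> \<delta>
  have B: "B \<gamma> \<delta> = (\<Sum>\<alpha>\<in>UNIV. \<Sum>\<beta>\<in>UNIV. Qm \<gamma> \<delta> \<alpha> \<beta> z * EE \<alpha> \<beta> [Some a] z)
      - 2 * (\<Sum>e\<in>UNIV. \<Sum>i\<in>UNIV. \<Sum>j\<in>UNIV. cov Rl [Some e, \<gamma>, \<delta>, Some i, Some j] z * omega (Some e) i j a z)
      + (\<Sum>i\<in>UNIV. \<Sum>j\<in>UNIV. Rm4 \<gamma> \<delta> (Some i) (Some j) z * \<Psi> i j)" for \<gamma> \<delta>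
  proof -
    have s: "(\<Sum>e\<in>UNIV. \<Sum>i\<in>UNIV. \<Sum>j\<in>UNIV. f e i j * c i j) = (\<Sum>i\<in>UNIV. \<Sum>j\<in>UNIV. (\<Sum>e\<in>UNIV. f e i j) * c i j)"
      "(\<Sum>e\<in>UNIV. \<Sum>i\<in>UNIV. \<Sum>j\<in>UNIV. c i j * f e i j) = (\<Sum>i\<in>UNIV. \<Sum>j\<in>UNIV. c i j * (\<Sum>e\<in>UNIV. f e i j))"
      for f :: "'b \<Rightarrow> 'b \<Rightarrow> 'b \<Rightarrow> real" and c :: "'b \<Rightarrow> 'b \<Rightarrow> real"
      unfolding sum_distrib_left sum_distrib_right by (rule sum_swap3)+
    show ?thesis
      unfolding B_def cov_UU[OF z] cov2_UU[OF z] \<Psi>_def sum_EE heat_operator_Rl[OF o, symmetric] sum.distrib s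
      by (simp add: sum_subtractf right_diff_distrib left_diff_distrib algebra_simps del: covu.simps)
  qed
  have B0: "B (Some k) (Some l) = 0" for k l
    unfolding B_def using cov_UU_spatial[OF z] cov2_UU_spatial[OF z] by simp
  have "cov ZZ [None, Some d, Some a] z - (\<Sum>e\<in>UNIV. cov (cov ZZ) [Some e, Some e, Some d, Some a] z) = B None (Some d)"
    unfolding B_def cov_ZZ[OF z] cov2_ZZ[OF z] ..
  \<comment> \<open>Allowed because \<open>B\<close> vanishes on spatial pairs: this completes the
    component \<open>None\<close> to the contraction with E.\<close>
  also have "\<dots> = (\<Sum>\<gamma>\<in>UNIV. \<Sum>\<delta>\<in>UNIV. B \<gamma> \<delta> * EE \<gamma> \<delta> [Some d] z)"
    unfolding sum_EE B0 by simp
  also have "\<dots> = QEE d a z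
      - 2 * (\<Sum>\<gamma>\<in>UNIV. \<Sum>\<delta>\<in>UNIV. (\<Sum>e\<in>UNIV. \<Sum>i\<in>UNIV. \<Sum>j\<in>UNIV. cov Rl [Some e, \<gamma>, \<delta>, Some i, Some j] z * omega (Some e) i j a z) * EE \<gamma> \<delta> [Some d] z)
      + (\<Sum>\<gamma>\<in>UNIV. \<Sum>\<delta>\<in>UNIV. (\<Sum>i\<in>UNIV. \<Sum>j\<in>UNIV. Rm4 \<gamma> \<delta> (Some i) (Some j) z * \<Psi> i j) * EE \<gamma> \<delta> [Some d] z)"
  proof -
    have "(\<Sum>\<gamma>\<in>UNIV. \<Sum>\<delta>\<in>UNIV. (q \<gamma> \<delta> - 2 * w \<gamma> \<delta> + r \<gamma> \<delta>) * E \<gamma> \<delta>)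
      = (\<Sum>\<gamma>\<in>UNIV. \<Sum>\<delta>\<in>UNIV. q \<gamma> \<delta> * E \<gamma> \<delta>) - 2 * (\<Sum>\<gamma>\<in>UNIV. \<Sum>\<delta>\<in>UNIV. w \<gamma> \<delta> * E \<gamma> \<delta>)
        + (\<Sum>\<gamma>\<in>UNIV. \<Sum>\<delta>\<in>UNIV. r \<gamma> \<delta> * E \<gamma> \<delta>)" for q w r E :: "'b option \<Rightarrow> 'b option \<Rightarrow> real"
      by (simp add: sum.distrib sum_subtractf distrib_right left_diff_distrib sum_distrib_left mult.assoc)
    then show ?thesis unfolding B QEE_def .
  qed
  also have "(\<Sum>\<gamma>\<in>UNIV. \<Sum>\<delta>\<in>UNIV. (\<Sum>i\<in>UNIV. \<Sum>j\<in>UNIV. Rm4 \<gamma> \<delta> (Some i) (Some j) z * \<Psi> i j) * EE \<gamma> \<delta> [Some d] z)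
      = (\<Sum>i\<in>UNIV. \<Sum>j\<in>UNIV. (\<Sum>\<gamma>\<in>UNIV. \<Sum>\<delta>\<in>UNIV. Rm4 (Some i) (Some j) \<gamma> \<delta> z * EE \<gamma> \<delta> [Some d] z) * \<Psi> i j)"
    unfolding sum_distrib_right Rm4_pair[OF z, of _ _ "Some _" "Some _"]
    by (subst sum_swap4) (simp add: mult_ac del: EE_simps)
  \<comment> \<open>Whatever \<Psi> is, it is paired with the curvature of E against a spatial pair,
    which is zero.\<close>
  also have "\<dots> = 0" unfolding sum_EE solves[OF z] by simp
  also have "(\<Sum>\<gamma>\<in>UNIV. \<Sum>\<delta>\<in>UNIV. (\<Sum>e\<in>UNIV. \<Sum>i\<in>UNIV. \<Sum>j\<in>UNIV. cov Rl [Some e, \<gamma>, \<delta>, Some i, Some j] z * omega (Some e) i j a z) * EE \<gamma> \<delta> [Some d] z)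
      = (\<Sum>e\<in>UNIV. \<Sum>i\<in>UNIV. \<Sum>j\<in>UNIV. (\<Sum>\<gamma>\<in>UNIV. \<Sum>\<delta>\<in>UNIV. cov Rl [Some e, Some i, Some j, \<gamma>, \<delta>] z * EE \<gamma> \<delta> [Some d] z) * omega (Some e) i j a z)"
  proof -
    have "(\<Sum>\<gamma>\<in>UNIV. \<Sum>\<delta>\<in>UNIV. (\<Sum>e\<in>UNIV. \<Sum>i\<in>UNIV. \<Sum>j\<in>UNIV. cov Rl [Some e, \<gamma>, \<delta>, Some i, Some j] z * omega (Some e) i j a z) * EE \<gamma> \<delta> [Some d] z)
      = (\<Sum>e\<in>UNIV. \<Sum>\<gamma>\<in>UNIV. \<Sum>\<delta>\<in>UNIV. \<Sum>i\<in>UNIV. \<Sum>j\<in>UNIV. cov Rl [Some e, \<gamma>, \<delta>, Some i, Some j] z * omega (Some e) i j a z * EE \<gamma> \<delta> [Some d] z)"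
      unfolding sum_distrib_right by (rule sum_swap3[symmetric])
    also have "\<dots> = (\<Sum>e\<in>UNIV. \<Sum>i\<in>UNIV. \<Sum>j\<in>UNIV. \<Sum>\<gamma>\<in>UNIV. \<Sum>\<delta>\<in>UNIV. cov Rl [Some e, \<gamma>, \<delta>, Some i, Some j] z * omega (Some e) i j a z * EE \<gamma> \<delta> [Some d] z)"
      by (intro sum.cong refl sum_swap4)
    finally show ?thesis
      unfolding sum_distrib_right cov_Rl_pair[OF z, of _ _ _ "Some _" "Some _"] by (simp add: mult_ac del: EE_simps covu.simps)
  qed
  \<comment> \<open>Differentiating the constraint trades the derivative of the curvature on E for
    minus the curvature on the derivative of E; this makes the final sign positive.\<close>
  also have "(\<lambda>e i j. \<Sum>\<gamma>\<in>UNIV. \<Sum>\<delta>\<in>UNIV. cov Rl [Some e, Some i, Some j, \<gamma>, \<delta>] z * EE \<gamma> \<delta> [Some d] z)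
      = (\<lambda>e i j. - (\<Sum>k\<in>UNIV. \<Sum>l\<in>UNIV. Rm4 (Some i) (Some j) (Some k) (Some l) z * omega (Some e) k l d z))"
  proof (intro ext)
    fix e i j
    show "(\<Sum>\<gamma>\<in>UNIV. \<Sum>\<delta>\<in>UNIV. cov Rl [Some e, Some i, Some j, \<gamma>, \<delta>] z * EE \<gamma> \<delta> [Some d] z)
      = - (\<Sum>k\<in>UNIV. \<Sum>l\<in>UNIV. Rm4 (Some i) (Some j) (Some k) (Some l) z * omega (Some e) k l d z)"
      unfolding sum_EE using cov_UU[OF z, of "Some e" "Some i" "Some j" d] cov_UU_spatial[OF z, of "Some e" i j d] by linarith
  qed
  finally show ?thesis by (simp add: sum_distrib_right sum_negf del: covu.simps)
qed

end

lemma delta_sum2: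
  "(\<Sum>i\<in>UNIV. \<Sum>j\<in>UNIV. f i j * ((if p = i then 1 else 0) * (if q = j then 1 else 0))) = f p q"
  for f :: "'n::finite \<Rightarrow> 'n \<Rightarrow> real"
proof -
  have "(\<Sum>j\<in>UNIV. f i j * ((if p = i then 1 else 0) * (if q = j then 1 else 0))) = (if p = i then 1 else 0) * f i q" for i
    by (simp add: if_distrib[of "\<lambda>x. _ * x"] cong: if_cong)
  then show ?thesis by (simp add: sum_delta_mult')
qed

text \<open>Abstractly \<open>S(R v, R w) = R(v, w)\<close>. The tensors \<open>v\<close> and
  \<open>w\<close> may have symmetric parts, since \<open>R\<close> annihilates them;
  \<open>shifted_omega\<close> needs this generality.\<close>

lemma inverse_quadratic_form:
  fixes S R :: "'n::finite \<Rightarrow> 'n \<Rightarrow> 'n \<Rightarrow> 'n \<Rightarrow> real"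
  assumes S: "\<And>i j k l. (\<Sum>p\<in>UNIV. \<Sum>q\<in>UNIV. S i j p q * R p q k l)
      = ((if i = k then 1 else 0) * (if j = l then 1 else 0) - (if i = l then 1 else 0) * (if j = k then 1 else 0)) / 2"
    and R: "\<And>i j k l. R j i k l = - R i j k l"
  shows "(\<Sum>m\<in>UNIV. \<Sum>n\<in>UNIV. \<Sum>t\<in>UNIV. \<Sum>u\<in>UNIV. S m n t u * (\<Sum>i\<in>UNIV. \<Sum>j\<in>UNIV. R t u i j * v i j)
        * (\<Sum>k\<in>UNIV. \<Sum>l\<in>UNIV. R m n k l * w k l))
    = (\<Sum>i\<in>UNIV. \<Sum>j\<in>UNIV. \<Sum>k\<in>UNIV. \<Sum>l\<in>UNIV. R i j k l * v i j * w k l)"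
proof -
  let ?W = "\<lambda>m n. \<Sum>k\<in>UNIV. \<Sum>l\<in>UNIV. R m n k l * w k l"
  have Wanti: "?W n m = - ?W m n" for m n
  proof -
    have "?W n m = (\<Sum>k\<in>UNIV. \<Sum>l\<in>UNIV. - (R m n k l * w k l))"
      by (intro sum.cong refl) (subst R, simp)
    then show ?thesis by (simp add: sum_negf)
  qed
  \<comment> \<open>\<open>S R\<close> is the identity on two-forms, hence the antisymmetrizer on
    arbitrary two-tensors.\<close>
  have half: "(\<Sum>t\<in>UNIV. \<Sum>u\<in>UNIV. S m n t u * (\<Sum>i\<in>UNIV. \<Sum>j\<in>UNIV. R t u i j * v i j)) = (v m n - v n m) / 2" for m n
  proof -
    have "(\<Sum>t\<in>UNIV. \<Sum>u\<in>UNIV. S m n t u * (\<Sum>i\<in>UNIV. \<Sum>j\<in>UNIV. R t u i j * v i j))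
      = (\<Sum>i\<in>UNIV. \<Sum>j\<in>UNIV. \<Sum>t\<in>UNIV. \<Sum>u\<in>UNIV. S m n t u * (R t u i j * v i j))"
      unfolding sum_distrib_left by (rule sum_swap4)
    also have "\<dots> = (\<Sum>i\<in>UNIV. \<Sum>j\<in>UNIV. (\<Sum>t\<in>UNIV. \<Sum>u\<in>UNIV. S m n t u * R t u i j) * v i j)"
      by (simp add: sum_distrib_right mult.assoc)
    also have "\<dots> = ((\<Sum>i\<in>UNIV. \<Sum>j\<in>UNIV. v i j * ((if m = i then 1 else 0) * (if n = j then 1 else 0)))
        - (\<Sum>j\<in>UNIV. \<Sum>i\<in>UNIV. v i j * ((if m = j then 1 else 0) * (if n = i then 1 else 0)))) / 2"
      unfolding S by (subst (3) sum.swap) (simp add: algebra_simps sum_subtractf sum_divide_distrib diff_divide_distrib)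
    also have "\<dots> = (v m n - v n m) / 2"
      unfolding delta_sum2 using delta_sum2[of "\<lambda>j i. v i j" m n] by simp
    finally show ?thesis .
  qed
  have "(\<Sum>m\<in>UNIV. \<Sum>n\<in>UNIV. \<Sum>t\<in>UNIV. \<Sum>u\<in>UNIV. S m n t u * (\<Sum>i\<in>UNIV. \<Sum>j\<in>UNIV. R t u i j * v i j) * ?W m n)
      = (\<Sum>m\<in>UNIV. \<Sum>n\<in>UNIV. (v m n - v n m) / 2 * ?W m n)"
    by (simp only: sum_distrib_right[symmetric] half)
  also have "\<dots> = (1/2) * ((\<Sum>m\<in>UNIV. \<Sum>n\<in>UNIV. v m n * ?W m n) - (\<Sum>m\<in>UNIV. \<Sum>n\<in>UNIV. v n m * ?W m n))"
    by (simp add: left_diff_distrib sum_subtractf sum_divide_distrib diff_divide_distrib)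
  also have "(\<Sum>m\<in>UNIV. \<Sum>n\<in>UNIV. v n m * ?W m n) = - (\<Sum>m\<in>UNIV. \<Sum>n\<in>UNIV. v m n * ?W m n)"
  proof -
    have "(\<Sum>m\<in>UNIV. \<Sum>n\<in>UNIV. v n m * ?W m n) = (\<Sum>n\<in>UNIV. \<Sum>m\<in>UNIV. v n m * - ?W n m)"
      unfolding Wanti[symmetric] by (rule sum.swap)
    then show ?thesis by (simp add: sum_negf)
  qed
  also have "(1/2) * ((\<Sum>m\<in>UNIV. \<Sum>n\<in>UNIV. v m n * ?W m n) - - (\<Sum>m\<in>UNIV. \<Sum>n\<in>UNIV. v m n * ?W m n))
     = (\<Sum>i\<in>UNIV. \<Sum>j\<in>UNIV. \<Sum>k\<in>UNIV. \<Sum>l\<in>UNIV. R i j k l * v i j * w k l)"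
    by (simp add: sum_distrib_left mult_ac)
  finally show ?thesis .
qed

lemma sum_of_products:
  fixes f p g q :: "'k \<Rightarrow> 'n::finite \<Rightarrow> real"
  shows "(\<Sum>e\<in>UNIV. \<Sum>k\<in>UNIV. (\<Sum>N\<in>I. f N e * g N k) * (\<Sum>M\<in>I. p M e * q M k))
    = (\<Sum>N\<in>I. \<Sum>M\<in>I. (\<Sum>e\<in>UNIV. f N e * p M e) * (\<Sum>k\<in>UNIV. g N k * q M k))"
  unfolding sum_product by (subst sum_swap4) (simp add: mult_ac)

lemma sum_bilinear:
  fixes E F :: "'a \<Rightarrow> 'b \<Rightarrow> real"
  shows "(\<Sum>\<gamma>\<in>A. \<Sum>\<delta>\<in>B. (\<Sum>\<alpha>\<in>A. \<Sum>\<beta>\<in>B. (\<Sum>N\<in>I. \<Sum>M\<in>I. c N M \<gamma> \<delta> * w N M \<alpha> \<beta>) * E \<alpha> \<beta>) * F \<gamma> \<delta>)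
    = (\<Sum>N\<in>I. \<Sum>M\<in>I. (\<Sum>\<gamma>\<in>A. \<Sum>\<delta>\<in>B. c N M \<gamma> \<delta> * F \<gamma> \<delta>) * (\<Sum>\<alpha>\<in>A. \<Sum>\<beta>\<in>B. w N M \<alpha> \<beta> * E \<alpha> \<beta>))"
proof -
  let ?W = "\<lambda>N M. \<Sum>\<alpha>\<in>A. \<Sum>\<beta>\<in>B. w N M \<alpha> \<beta> * E \<alpha> \<beta>"
  have c: "(\<Sum>\<alpha>\<in>A. \<Sum>\<beta>\<in>B. (\<Sum>N\<in>I. \<Sum>M\<in>I. c N M \<gamma> \<delta> * w N M \<alpha> \<beta>) * E \<alpha> \<beta>)
    = (\<Sum>N\<in>I. \<Sum>M\<in>I. c N M \<gamma> \<delta> * ?W N M)" for \<gamma> \<delta>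
    unfolding sum_distrib_left sum_distrib_right by (subst sum_swap4) (simp add: mult_ac)
  have "(\<Sum>\<gamma>\<in>A. \<Sum>\<delta>\<in>B. (\<Sum>N\<in>I. \<Sum>M\<in>I. c N M \<gamma> \<delta> * ?W N M) * F \<gamma> \<delta>)
    = (\<Sum>\<gamma>\<in>A. \<Sum>\<delta>\<in>B. \<Sum>N\<in>I. \<Sum>M\<in>I. c N M \<gamma> \<delta> * F \<gamma> \<delta> * ?W N M)"
    unfolding sum_distrib_right[of _ _ "F _ _"] by (intro sum.cong refl) (simp only: mult_ac)
  also have "\<dots> = (\<Sum>N\<in>I. \<Sum>M\<in>I. \<Sum>\<gamma>\<in>A. \<Sum>\<delta>\<in>B. c N M \<gamma> \<delta> * F \<gamma> \<delta> * ?W N M)" by (rule sum_swap4)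
  finally show ?thesis unfolding c by (simp only: sum_distrib_right[of _ _ "?W _ _"])
qed

lemma sum_antisymmetrize:
  fixes d a :: "'k \<Rightarrow> 'k \<Rightarrow> real"
  shows "(\<Sum>N\<in>I. \<Sum>M\<in>I. 2 * d N M * (a N M - a M N)) = (\<Sum>N\<in>I. \<Sum>M\<in>I. (d N M - d M N) * (a N M - a M N))"
proof -
  have "(\<Sum>N\<in>I. \<Sum>M\<in>I. d M N * (a N M - a M N)) = (\<Sum>M\<in>I. \<Sum>N\<in>I. d M N * (a N M - a M N))" by (rule sum.swap)
  also have "\<dots> = - (\<Sum>N\<in>I. \<Sum>M\<in>I. d N M * (a N M - a M N))"
    by (simp add: sum_negf[symmetric] algebra_simps)
  finally show ?thesis by (simp add: left_diff_distrib sum_subtractf sum_distrib_left mult.assoc)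
qed

section \<open>The term S K K and the origin of - 2 Z / t\<close>

context harnack_vector
begin

declare covu.simps [simp del]

context
  fixes z :: 'a and \<tau> :: real and S :: "'b \<Rightarrow> 'b \<Rightarrow> 'b \<Rightarrow> 'b \<Rightarrow> real"
  assumes o: "orthonormal_at z" and \<tau>: "\<tau> \<noteq> 0"
    and S_skew: "\<And>i j k l. S j i k l = - S i j k l" and S_pair: "\<And>i j k l. S k l i j = S i j k l"
    and S_inverse: "\<And>i j k l. (\<Sum>p\<in>UNIV. \<Sum>q\<in>UNIV. S i j p q * Rm4 (Some p) (Some q) (Some k) (Some l) z)
      = ((if i = k then 1 else 0) * (if j = l then 1 else 0) - (if i = l then 1 else 0) * (if j = k then 1 else 0)) / 2"
    and Ev: "\<And>i j a. Ev i j a z = - (\<Sum>k\<in>UNIV. \<Sum>l\<in>UNIV. S i j k l * Rm4 (Some k) (Some l) None (Some a) z)"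
begin

abbreviation (input) "R i j k l \<equiv> Rm4 (Some i) (Some j) (Some k) (Some l) z"
abbreviation (input) "P i j a \<equiv> Rm4 (Some i) (Some j) None (Some a) z"
abbreviation (input) "DR v i j k l \<equiv> cov Rl [Some v, Some i, Some j, Some k, Some l] z"
text \<open>The spatial derivative of \<open>P\<close> keeps the time index frozen, whereas the
  spacetime derivative also differentiates the time field; the Ricci term is the difference.\<close>

abbreviation (input) "DP v i j a \<equiv> cov Rl [Some v, Some i, Some j, None, Some a] z - (\<Sum>w\<in>UNIV. ric v w z * R i j w a)"

lemmas z_in = orthonormal_at_simps(1)[OF o]
lemmas h_z = orthonormal_at_simps(2)[OF o]

lemma Ev_skew: "Ev j i a z = - Ev i j a z"
  unfolding Ev using S_skew[of j i] by (simp add: sum_negf)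

lemma ZZ_sym: "ZZ [Some a, Some b] z = ZZ [Some b, Some a] z"
proof -
  have 1: "(\<Sum>i\<in>UNIV. \<Sum>j\<in>UNIV. Rm4 None (Some a) (Some i) (Some j) z * Ev i j b z)
    = - (\<Sum>i\<in>UNIV. \<Sum>j\<in>UNIV. \<Sum>k\<in>UNIV. \<Sum>l\<in>UNIV. P i j a * (S i j k l * P k l b))" for a b
    unfolding Ev Rm4_pair[OF z_in, of None "Some _" "Some _"] by (simp add: sum_distrib_left sum_negf)
  have "(\<Sum>i\<in>UNIV. \<Sum>j\<in>UNIV. \<Sum>k\<in>UNIV. \<Sum>l\<in>UNIV. P i j a * (S i j k l * P k l b))
    = (\<Sum>i\<in>UNIV. \<Sum>j\<in>UNIV. \<Sum>k\<in>UNIV. \<Sum>l\<in>UNIV. P i j b * (S i j k l * P k l a))"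
    by (subst sum_swap4) (simp add: S_pair mult_ac)
  then show ?thesis unfolding UU 1 using Rm4_pair[OF z_in, of None "Some a" None "Some b"] by simp
qed

text \<open>Contracts the divergence identity with \<open>E\<close>; the origin of the term \<open>- 2 Z / t\<close>.\<close>

lemma omega_trace: "(\<Sum>v\<in>UNIV. \<Sum>k\<in>UNIV. \<Sum>l\<in>UNIV. R v a k l * omega (Some v) k l b z) = - ZZ [Some a, Some b] z"
proof -
  have div: "(\<Sum>v\<in>UNIV. cov Rl [Some v, Some v, \<beta>, \<gamma>, \<delta>] z) = Rm4 None \<beta> \<gamma> \<delta> z" for \<beta> \<gamma> \<delta>
    using div_first[OF z_in, of \<beta> \<gamma> \<delta>] by (simp add: tr_def h_z sum_delta2)
  have "(\<Sum>v\<in>UNIV. \<Sum>k\<in>UNIV. \<Sum>l\<in>UNIV. R v a k l * omega (Some v) k l b z)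
    = (\<Sum>v\<in>UNIV. - cov Rl [Some v, Some v, Some a, None, Some b] z
        - (\<Sum>i\<in>UNIV. \<Sum>j\<in>UNIV. cov Rl [Some v, Some v, Some a, Some i, Some j] z * Ev i j b z))"
  proof (rule sum.cong)
    fix v
    show "(\<Sum>k\<in>UNIV. \<Sum>l\<in>UNIV. R v a k l * omega (Some v) k l b z)
      = - cov Rl [Some v, Some v, Some a, None, Some b] z
        - (\<Sum>i\<in>UNIV. \<Sum>j\<in>UNIV. cov Rl [Some v, Some v, Some a, Some i, Some j] z * Ev i j b z)"
      using cov_UU[OF z_in, of "Some v" "Some v" "Some a" b] cov_UU_spatial[OF z_in, of "Some v" v a b] by linarith
  qed simp
  also have "\<dots> = - Rm4 None (Some a) None (Some b) z
      - (\<Sum>i\<in>UNIV. \<Sum>j\<in>UNIV. (\<Sum>v\<in>UNIV. cov Rl [Some v, Some v, Some a, Some i, Some j] z) * Ev i j b z)"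
    unfolding sum_subtractf sum_negf div sum_distrib_right
    by (subst sum_swap3) (simp add: sum_distrib_right[symmetric] div)
  finally show ?thesis unfolding div UU by simp
qed

definition K :: "'b \<Rightarrow> 'b \<Rightarrow> 'b \<Rightarrow> 'b \<Rightarrow> real" where
  "K a v t u = (\<Sum>i\<in>UNIV. \<Sum>j\<in>UNIV. \<Sum>r\<in>UNIV. \<Sum>s\<in>UNIV. S i j r s * P i j a * DR v r s t u)
     - DP v t u a + (\<Sum>w\<in>UNIV. R t u a w * ric v w z) + 1 / (2 * \<tau>) * R t u a v"

text \<open>The last term of \<open>K\<close> is the curvature applied to a multiple of the
  identity, so it is absorbed into \<open>omega\<close> as a shift.\<close>

definition shifted_omega :: "'b \<Rightarrow> 'b \<Rightarrow> 'b \<Rightarrow> 'b \<Rightarrow> real" where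
  "shifted_omega v i j a = omega (Some v) i j a z - 1 / (2 * \<tau>) * ((if v = i then 1 else 0) * (if a = j then 1 else 0))"

lemma sum_shifted_omega:
  "(\<Sum>i\<in>UNIV. \<Sum>j\<in>UNIV. f i j * shifted_omega v i j a)
    = (\<Sum>i\<in>UNIV. \<Sum>j\<in>UNIV. f i j * omega (Some v) i j a z) - 1 / (2 * \<tau>) * f v a"
proof -
  have "f i j * shifted_omega v i j a = f i j * omega (Some v) i j a z
      - 1 / (2 * \<tau>) * (f i j * ((if v = i then 1 else 0) * (if a = j then 1 else 0)))" for i j
    by (simp add: shifted_omega_def algebra_simps)
  then show ?thesis by (simp only: sum_subtractf sum_distrib_left[symmetric] delta_sum2)
qed

text \<open>The term with \<open>S P\<close> is minus the derivative of the curvature on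
  \<open>Ev\<close>, and the Ricci term of \<open>K\<close> cancels the one in \<open>DP\<close>.
  What is left is the differentiated constraint solved for the curvature on
  \<open>omega\<close>.\<close>

lemma K_eq: "K a v t u = (\<Sum>i\<in>UNIV. \<Sum>j\<in>UNIV. R t u i j * shifted_omega v i j a)"
proof -
  have "(\<Sum>i\<in>UNIV. \<Sum>j\<in>UNIV. \<Sum>r\<in>UNIV. \<Sum>s\<in>UNIV. S i j r s * P i j a * DR v r s t u)
    = (\<Sum>r\<in>UNIV. \<Sum>s\<in>UNIV. DR v t u r s * (\<Sum>i\<in>UNIV. \<Sum>j\<in>UNIV. S r s i j * P i j a))"
    unfolding sum_distrib_left by (subst sum_swap4) (simp add: S_pair[of _ _ _ _] cov_Rl_pair[OF z_in, of "Some v" "Some _" "Some _" "Some t" "Some u"] mult_ac)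
  also have "\<dots> = - (\<Sum>r\<in>UNIV. \<Sum>s\<in>UNIV. DR v t u r s * Ev r s a z)"
    unfolding Ev by (simp add: sum_negf)
  finally have 1: "(\<Sum>i\<in>UNIV. \<Sum>j\<in>UNIV. \<Sum>r\<in>UNIV. \<Sum>s\<in>UNIV. S i j r s * P i j a * DR v r s t u)
    = - (\<Sum>r\<in>UNIV. \<Sum>s\<in>UNIV. DR v t u r s * Ev r s a z)" .
  have "R t u w a = - R t u a w" for w by (rule Rm4_skew34[OF z_in])
  then have 2: "(\<Sum>w\<in>UNIV. ric v w z * R t u w a) = - (\<Sum>w\<in>UNIV. R t u a w * ric v w z)"
    by (simp add: sum_negf mult.commute)
  show ?thesis
    unfolding K_def 1 2 sum_shifted_omega
    using cov_UU[OF z_in, of "Some v" "Some t" "Some u" a] cov_UU_spatial[OF z_in, of "Some v" t u a]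
      Rm4_skew34[OF z_in, of "Some t" "Some u" "Some v" "Some a"] by simp
qed

text \<open>By \<open>K_eq\<close> and \<open>inverse_quadratic_form\<close> the left side is the
  curvature on \<open>shifted_omega\<close>. Expanding the shift gives two cross terms, each a
  multiple of \<open>ZZ\<close> by \<open>omega_trace\<close>, and a square, whose trace is
  Ricci.\<close>

lemma SKK:
  "2 * (\<Sum>m\<in>UNIV. \<Sum>n\<in>UNIV. \<Sum>t\<in>UNIV. \<Sum>u\<in>UNIV. \<Sum>v\<in>UNIV. S m n t u * K a v t u * K b v m n)
    = 2 * (\<Sum>e\<in>UNIV. \<Sum>i\<in>UNIV. \<Sum>j\<in>UNIV. \<Sum>k\<in>UNIV. \<Sum>l\<in>UNIV. R i j k l * omega (Some e) k l a z * omega (Some e) i j b z)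
      + 2 / \<tau> * ZZ [Some a, Some b] z + ric a b z / (2 * \<tau>^2)"
proof -
  let ?c = "1 / (2 * \<tau>)"
  have form: "(\<Sum>i\<in>UNIV. \<Sum>j\<in>UNIV. \<Sum>k\<in>UNIV. \<Sum>l\<in>UNIV. R i j k l * shifted_omega v i j a * shifted_omega v k l b)
    = (\<Sum>i\<in>UNIV. \<Sum>j\<in>UNIV. \<Sum>k\<in>UNIV. \<Sum>l\<in>UNIV. R i j k l * omega (Some v) k l a z * omega (Some v) i j b z)
      - ?c * (\<Sum>k\<in>UNIV. \<Sum>l\<in>UNIV. R v a k l * omega (Some v) k l b z)
      - ?c * (\<Sum>k\<in>UNIV. \<Sum>l\<in>UNIV. R v b k l * omega (Some v) k l a z) + ?c * ?c * R v a v b" for v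
  proof -
    let ?G = "\<lambda>i j. \<Sum>k\<in>UNIV. \<Sum>l\<in>UNIV. R i j k l * shifted_omega v k l b"
    have "(\<Sum>i\<in>UNIV. \<Sum>j\<in>UNIV. \<Sum>k\<in>UNIV. \<Sum>l\<in>UNIV. R i j k l * shifted_omega v i j a * shifted_omega v k l b)
      = (\<Sum>i\<in>UNIV. \<Sum>j\<in>UNIV. ?G i j * shifted_omega v i j a)"
      by (simp add: sum_distrib_right sum_distrib_left mult_ac)
    also have "\<dots> = (\<Sum>i\<in>UNIV. \<Sum>j\<in>UNIV. ?G i j * omega (Some v) i j a z) - ?c * ?G v a"
      by (rule sum_shifted_omega)
    also have "(\<Sum>i\<in>UNIV. \<Sum>j\<in>UNIV. ?G i j * omega (Some v) i j a z)
      = (\<Sum>i\<in>UNIV. \<Sum>j\<in>UNIV. \<Sum>k\<in>UNIV. \<Sum>l\<in>UNIV. R i j k l * omega (Some v) k l b z * omega (Some v) i j a z)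
        - ?c * (\<Sum>i\<in>UNIV. \<Sum>j\<in>UNIV. R i j v b * omega (Some v) i j a z)"
    proof -
      have lin: "(\<Sum>i\<in>UNIV. \<Sum>j\<in>UNIV. (f i j - c * f' i j) * w i j)
        = (\<Sum>i\<in>UNIV. \<Sum>j\<in>UNIV. f i j * w i j) - c * (\<Sum>i\<in>UNIV. \<Sum>j\<in>UNIV. f' i j * w i j)"
        for f f' w :: "'b \<Rightarrow> 'b \<Rightarrow> real" and c
        by (simp add: left_diff_distrib sum_subtractf sum_distrib_left mult.assoc)
      show ?thesis unfolding sum_shifted_omega lin by (simp only: sum_distrib_right)
    qed
    also have "(\<Sum>i\<in>UNIV. \<Sum>j\<in>UNIV. \<Sum>k\<in>UNIV. \<Sum>l\<in>UNIV. R i j k l * omega (Some v) k l b z * omega (Some v) i j a z)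
      = (\<Sum>i\<in>UNIV. \<Sum>j\<in>UNIV. \<Sum>k\<in>UNIV. \<Sum>l\<in>UNIV. R i j k l * omega (Some v) k l a z * omega (Some v) i j b z)"
      by (subst sum_swap4) (simp add: Rm4_pair[OF z_in, of "Some _" "Some _" "Some _" "Some _"] mult_ac)
    also have "(\<Sum>i\<in>UNIV. \<Sum>j\<in>UNIV. R i j v b * omega (Some v) i j a z) = (\<Sum>k\<in>UNIV. \<Sum>l\<in>UNIV. R v b k l * omega (Some v) k l a z)"
      unfolding Rm4_pair[OF z_in, of "Some _" "Some _" "Some v" "Some b"] ..
    finally show ?thesis unfolding sum_shifted_omega by (simp add: algebra_simps)
  qed
  have ric: "(\<Sum>v\<in>UNIV. R v a v b) = ric a b z"
  proof -
    have "R v a v b = R a v b v" for v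
      using Rm4_skew12[of "Some v" "Some a" "Some v" "Some b" z] Rm4_skew34[OF z_in, of "Some a" "Some v" "Some b" "Some v"] by simp
    then show ?thesis using ricT_spatial[OF z_in, of a b] by (simp add: ricT h_z sum_delta2)
  qed
  have "(\<Sum>m\<in>UNIV. \<Sum>n\<in>UNIV. \<Sum>t\<in>UNIV. \<Sum>u\<in>UNIV. \<Sum>v\<in>UNIV. S m n t u * K a v t u * K b v m n)
    = (\<Sum>v\<in>UNIV. \<Sum>m\<in>UNIV. \<Sum>n\<in>UNIV. \<Sum>t\<in>UNIV. \<Sum>u\<in>UNIV. S m n t u * K a v t u * K b v m n)"
  proof -
    have "(\<Sum>m\<in>UNIV. \<Sum>n\<in>UNIV. \<Sum>t\<in>UNIV. \<Sum>u\<in>UNIV. \<Sum>v\<in>UNIV. S m n t u * K a v t u * K b v m n)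
      = (\<Sum>m\<in>UNIV. \<Sum>n\<in>UNIV. \<Sum>v\<in>UNIV. \<Sum>t\<in>UNIV. \<Sum>u\<in>UNIV. S m n t u * K a v t u * K b v m n)"
      by (intro sum.cong refl sum_swap3[symmetric])
    also have "\<dots> = (\<Sum>v\<in>UNIV. \<Sum>m\<in>UNIV. \<Sum>n\<in>UNIV. \<Sum>t\<in>UNIV. \<Sum>u\<in>UNIV. S m n t u * K a v t u * K b v m n)"
      by (rule sum_swap3[symmetric])
    finally show ?thesis .
  qed
  also have "\<dots> = (\<Sum>v\<in>UNIV. \<Sum>i\<in>UNIV. \<Sum>j\<in>UNIV. \<Sum>k\<in>UNIV. \<Sum>l\<in>UNIV. R i j k l * shifted_omega v i j a * shifted_omega v k l b)"
    unfolding K_eq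
    by (intro sum.cong refl inverse_quadratic_form[of S "\<lambda>i j k l. R i j k l"]) (rule S_inverse, rule Rm4_skew12)
  also have "\<dots> = (\<Sum>e\<in>UNIV. \<Sum>i\<in>UNIV. \<Sum>j\<in>UNIV. \<Sum>k\<in>UNIV. \<Sum>l\<in>UNIV. R i j k l * omega (Some e) k l a z * omega (Some e) i j b z)
      + ?c * ZZ [Some a, Some b] z + ?c * ZZ [Some b, Some a] z + ?c * ?c * ric a b z"
    unfolding form sum.distrib sum_subtractf sum_distrib_left[symmetric] omega_trace ric by simp
  finally show ?thesis using ZZ_sym[of a b] \<tau> by (simp add: field_simps power2_eq_square)
qed

section \<open>The term L L from the decomposition into squares\<close>

context
  fixes m :: nat and Y :: "nat \<Rightarrow> 'b \<Rightarrow> 'b \<Rightarrow> real" and X :: "nat \<Rightarrow> 'b \<Rightarrow> real"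
  assumes Y_skew: "\<And>N i j. N < m \<Longrightarrow> Y N i j = - Y N j i"
    and R_squares: "\<And>i j k l. R i j k l = (\<Sum>N<m. Y N i j * Y N k l)"
    and P_squares: "\<And>i j a. P i j a = (\<Sum>N<m. Y N i j * X N a)"
    and M_squares: "\<And>a b. Rm4 None (Some a) None (Some b) z + 1 / (2 * \<tau>) * ric a b z = (\<Sum>N<m. X N a * X N b)"
begin

definition L :: "nat \<Rightarrow> nat \<Rightarrow> 'b \<Rightarrow> real" where
  "L N M a = 2 * (\<Sum>i\<in>UNIV. \<Sum>d\<in>UNIV. \<Sum>j\<in>UNIV. \<Sum>k\<in>UNIV. \<Sum>l\<in>UNIV. Y N i d * Y M j d * S i j k l * P k l a)
     + (\<Sum>h\<in>UNIV. Y N a h * X M h) - (\<Sum>h\<in>UNIV. Y M a h * X N h)"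

text \<open>The spacetime two-form \<open>Y\<^sup>N \<oplus> X\<^sup>N\<close>, with \<open>X\<^sup>N\<close> as the components of \<open>dt \<wedge> X\<^sup>N\<close>.\<close>

definition YX :: "nat \<Rightarrow> 'b \<Rightarrow> 'b option \<Rightarrow> real" where
  "YX N c \<alpha> = (case \<alpha> of None \<Rightarrow> - X N c | Some i \<Rightarrow> Y N c i)"

text \<open>The squares represent \<open>M\<close> including its term R/2t, so among these
  components only the time-time one of the spacetime curvature differs from the sum of
  squares.\<close>

lemma Rm4_YX:
  "Rm4 (Some c) \<gamma> (Some k) \<alpha> z = (\<Sum>N<m. YX N c \<gamma> * YX N k \<alpha>)
    - (if \<gamma> = None \<and> \<alpha> = None then 1 / (2 * \<tau>) * ric c k z else 0)"
proof -
  have P': "Rm4 (Some i) (Some j) (Some a) None z = - (\<Sum>N<m. Y N i j * X N a)" for i j a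
    using P_squares Rm4_skew34[OF z_in, of "Some i" "Some j" None "Some a"] by simp
  show ?thesis
  proof (cases \<gamma>; cases \<alpha>)
    fix c' assume "\<gamma> = Some c'" "\<alpha> = None"
    then show ?thesis using P' by (simp add: YX_def sum_negf)
  next
    fix a assume "\<gamma> = None" "\<alpha> = Some a"
    then show ?thesis using P' Rm4_pair[OF z_in, of "Some c" None "Some k" "Some a"] by (simp add: YX_def sum_negf mult.commute)
  next
    assume "\<gamma> = None" "\<alpha> = None"
    then show ?thesis using M_squares[of c k] Rm4_skew12[of None "Some c" "Some k" None z] Rm4_skew34[OF z_in, of None "Some c" "Some k" None]
      by (simp add: YX_def)
  qed (use R_squares in \<open>simp add: YX_def\<close>)
qed

text \<open>Minus the matrix product of two spacetime two-forms, contracted over space; its part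
  skew in \<open>N\<close> and \<open>M\<close> is, up to sign, their Lie bracket.\<close>

definition YXYX :: "nat \<Rightarrow> nat \<Rightarrow> 'b option \<Rightarrow> 'b option \<Rightarrow> real" where
  "YXYX N M \<alpha> \<beta> = (\<Sum>e\<in>UNIV. YX N e \<alpha> * YX M e \<beta>)"

text \<open>Writing Rm as squares turns the sharp term into a sum over commutators, as for Rm
  itself. The square term stays as it is, since it vanishes on E. Second indices are spatial because
  E has no other components.\<close>

lemma Qm_YX:
  "Qm \<gamma> (Some d) \<alpha> (Some b) z = (\<Sum>e\<in>UNIV. \<Sum>k\<in>UNIV. Rm4 \<gamma> (Some d) (Some e) (Some k) z * Rm4 (Some e) (Some k) \<alpha> (Some b) z)
     + (\<Sum>N<m. \<Sum>M<m. 2 * YXYX N M \<gamma> (Some d) * (YXYX N M \<alpha> (Some b) - YXYX M N \<alpha> (Some b)))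
     - (if \<gamma> = None \<and> \<alpha> = None then 1 / \<tau> * (\<Sum>e\<in>UNIV. \<Sum>k\<in>UNIV. ric e k z * R e d k b) else 0)"
proof -
  have 1: "(\<Sum>e\<in>UNIV. \<Sum>k\<in>UNIV. (\<Sum>N<m. YX N e \<gamma> * YX N k \<alpha>) * (\<Sum>N<m. YX N e (Some d) * YX N k (Some b)))
     = (\<Sum>N<m. \<Sum>M<m. YXYX N M \<gamma> (Some d) * YXYX N M \<alpha> (Some b))"
    unfolding sum_of_products YXYX_def ..
  have 2: "(\<Sum>e\<in>UNIV. \<Sum>k\<in>UNIV. (\<Sum>N<m. YX N e \<gamma> * YX N k (Some b)) * (\<Sum>N<m. YX N e (Some d) * YX N k \<alpha>))
     = (\<Sum>N<m. \<Sum>M<m. YXYX N M \<gamma> (Some d) * YXYX M N \<alpha> (Some b))"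
    unfolding sum_of_products YXYX_def by (simp add: mult.commute)
  have 3: "Rm4 (Some e) \<gamma> (Some k) \<alpha> z * R e d k b = (\<Sum>N<m. YX N e \<gamma> * YX N k \<alpha>) * (\<Sum>N<m. YX N e (Some d) * YX N k (Some b))
      - (if \<gamma> = None \<and> \<alpha> = None then 1 / (2 * \<tau>) else 0) * (ric e k z * R e d k b)" for e k
    unfolding Rm4_YX[of e \<gamma> k \<alpha>] Rm4_YX[of e "Some d" k "Some b"] by (auto simp: algebra_simps)
  have 4: "Rm4 (Some e) \<gamma> (Some k) (Some b) z * Rm4 (Some e) (Some d) (Some k) \<alpha> z
     = (\<Sum>N<m. YX N e \<gamma> * YX N k (Some b)) * (\<Sum>N<m. YX N e (Some d) * YX N k \<alpha>)" for e k
    using Rm4_YX[of e \<gamma> k "Some b"] Rm4_YX[of e "Some d" k \<alpha>] by simp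
  show ?thesis
    unfolding Qm_def 3 4
    by (simp add: sum.distrib sum_subtractf sum_distrib_left[symmetric] right_diff_distrib 1 2 mult.assoc)
qed

definition YXE :: "nat \<Rightarrow> nat \<Rightarrow> 'b \<Rightarrow> real" where
  "YXE N M a = (\<Sum>\<alpha>\<in>UNIV. \<Sum>\<beta>\<in>UNIV. YXYX N M \<alpha> \<beta> * EE \<alpha> \<beta> [Some a] z)"

text \<open>\<open>L\<close> is, up to sign, the bracket of two of the forms evaluated on E. The
  time part of E gives the terms \<open>Y X\<close>, its spatial part \<open>- S P\<close> the
  remaining one, doubled because it is already skew in \<open>N\<close> and
  \<open>M\<close>.\<close>

lemma YXE_L:
  assumes "N < m" "M < m" shows "YXE N M a - YXE M N a = - L N M a"
proof -
  have s: "YXE N M a = (\<Sum>h\<in>UNIV. Y M a h * X N h) + (\<Sum>i\<in>UNIV. \<Sum>j\<in>UNIV. (\<Sum>d\<in>UNIV. Y N i d * Y M j d) * Ev i j a z)"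
    if "N < m" "M < m" for N M
  proof -
    have a: "- X N e * Y M e a = Y M a e * X N e" for e using Y_skew[OF that(2), of e a] by simp
    have b: "Y N e i * Y M e j = Y N i e * Y M j e" for e i j using Y_skew[OF that(2), of e j] Y_skew[OF that(1), of e i] by simp
    show ?thesis unfolding YXE_def sum_EE unfolding YXYX_def YX_def by (simp only: option.case a b)
  qed
  have "(\<Sum>i\<in>UNIV. \<Sum>j\<in>UNIV. (\<Sum>d\<in>UNIV. Y M i d * Y N j d) * Ev i j a z)
    = (\<Sum>j\<in>UNIV. \<Sum>i\<in>UNIV. (\<Sum>d\<in>UNIV. Y M i d * Y N j d) * Ev i j a z)" by (rule sum.swap)
  also have "\<dots> = - (\<Sum>i\<in>UNIV. \<Sum>j\<in>UNIV. (\<Sum>d\<in>UNIV. Y N i d * Y M j d) * Ev i j a z)"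
  proof -
    have "(\<Sum>d\<in>UNIV. Y M i d * Y N j d) * Ev i j a z = - ((\<Sum>d\<in>UNIV. Y N j d * Y M i d) * Ev j i a z)" for i j
      by (subst Ev_skew) (simp add: mult.commute)
    then show ?thesis by (simp only: sum_negf)
  qed
  finally have 1: "(\<Sum>i\<in>UNIV. \<Sum>j\<in>UNIV. (\<Sum>d\<in>UNIV. Y M i d * Y N j d) * Ev i j a z)
    = - (\<Sum>i\<in>UNIV. \<Sum>j\<in>UNIV. (\<Sum>d\<in>UNIV. Y N i d * Y M j d) * Ev i j a z)" .
  have 2: "(\<Sum>i\<in>UNIV. \<Sum>j\<in>UNIV. (\<Sum>d\<in>UNIV. Y N i d * Y M j d) * Ev i j a z)
    = - (\<Sum>i\<in>UNIV. \<Sum>d\<in>UNIV. \<Sum>j\<in>UNIV. \<Sum>k\<in>UNIV. \<Sum>l\<in>UNIV. Y N i d * Y M j d * S i j k l * P k l a)"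
  proof -
    have "(\<Sum>i\<in>UNIV. \<Sum>j\<in>UNIV. (\<Sum>d\<in>UNIV. Y N i d * Y M j d) * Ev i j a z)
      = (\<Sum>i\<in>UNIV. \<Sum>j\<in>UNIV. \<Sum>d\<in>UNIV. Y N i d * Y M j d * Ev i j a z)" by (simp add: sum_distrib_right)
    also have "\<dots> = (\<Sum>i\<in>UNIV. \<Sum>d\<in>UNIV. \<Sum>j\<in>UNIV. Y N i d * Y M j d * Ev i j a z)"
      by (intro sum.cong refl sum.swap)
    finally show ?thesis unfolding Ev by (simp add: sum_negf sum_distrib_left mult.assoc)
  qed
  show ?thesis unfolding s[OF assms] s[OF assms(2,1)] 1 2 L_def by simp
qed

text \<open>Pairing with a bracket sees only the skew part of the other factor, so the sharp term of
  \<open>Qm\<close> on E becomes a sum of squares. The additional term is the Ricci correction of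
  \<open>Rm4_YX\<close>.\<close>

lemma LL:
  "(\<Sum>N<m. \<Sum>M<m. L N M a * L N M b) = QEE a b z + 1 / \<tau> * (\<Sum>e\<in>UNIV. \<Sum>k\<in>UNIV. ric e k z * R e a k b)"
proof -
  define q where "q \<gamma> \<delta> \<alpha> \<beta> = (\<Sum>N<m. \<Sum>M<m. 2 * YXYX N M \<gamma> \<delta> * (YXYX N M \<alpha> \<beta> - YXYX M N \<alpha> \<beta>))" for \<gamma> \<delta> \<alpha> \<beta>
  define r where "r \<gamma> \<delta> \<alpha> \<beta> = (\<Sum>e\<in>UNIV. \<Sum>k\<in>UNIV. Rm4 \<gamma> \<delta> (Some e) (Some k) z * Rm4 (Some e) (Some k) \<alpha> \<beta> z)" for \<gamma> \<delta> \<alpha> \<beta>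
  let ?E = "\<lambda>f. \<Sum>\<gamma>\<in>UNIV. \<Sum>\<delta>\<in>UNIV. (\<Sum>\<alpha>\<in>UNIV. \<Sum>\<beta>\<in>UNIV. f \<gamma> \<delta> \<alpha> \<beta> * EE \<alpha> \<beta> [Some b] z) * EE \<gamma> \<delta> [Some a] z"
  have "QEE a b z = ?E r + ?E q - 1 / \<tau> * (\<Sum>e\<in>UNIV. \<Sum>k\<in>UNIV. ric e k z * R e a k b)"
    unfolding QEE_def sum_EE Qm_YX q_def[symmetric] r_def[symmetric]
    by (simp add: distrib_right distrib_left sum.distrib algebra_simps)
  \<comment> \<open>The square term factors through the curvature of E against spatial
    pairs.\<close>
  moreover have "?E r = 0"
  proof -
    have "(\<Sum>\<alpha>\<in>UNIV. \<Sum>\<beta>\<in>UNIV. r \<gamma> \<delta> \<alpha> \<beta> * EE \<alpha> \<beta> [Some b] z)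
      = (\<Sum>e\<in>UNIV. \<Sum>k\<in>UNIV. Rm4 \<gamma> \<delta> (Some e) (Some k) z * (\<Sum>\<alpha>\<in>UNIV. \<Sum>\<beta>\<in>UNIV. Rm4 (Some e) (Some k) \<alpha> \<beta> z * EE \<alpha> \<beta> [Some b] z))" for \<gamma> \<delta>
      unfolding r_def sum_distrib_left sum_distrib_right mult.assoc by (rule sum_swap4)
    then show ?thesis unfolding sum_EE[of "\<lambda>\<alpha> \<beta>. Rm4 (Some _) (Some _) \<alpha> \<beta> z"] solves[OF z_in] by simp
  qed
  moreover have "?E q = (\<Sum>N<m. \<Sum>M<m. 2 * YXE N M a * (YXE N M b - YXE M N b))"
    unfolding q_def sum_bilinear YXE_def
    by (simp add: left_diff_distrib sum_subtractf sum_distrib_left mult.assoc del: EE_simps)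
  moreover have "\<dots> = (\<Sum>N<m. \<Sum>M<m. L N M a * L N M b)"
    unfolding sum_antisymmetrize by (intro sum.cong refl) (simp add: YXE_L)
  ultimately show ?thesis by simp
qed

text \<open>The Ricci-curvature product in \<open>LL\<close> cancels the heat operator of Ricci
  divided by \<open>2 * \<tau>\<close>. The square of the shift in \<open>SKK\<close>, the
  derivative of \<open>1 / (2 * \<tau>)\<close> and the Ricci part of the last term balance as 1/2 =
  1 - 1/2.\<close>

theorem harnack_heat_equation:
  "cov ZZ [None, Some a, Some b] z - (\<Sum>e\<in>UNIV. cov (cov ZZ) [Some e, Some e, Some a, Some b] z)
      + 1 / (2 * \<tau>) * (cov ricT [None, Some a, Some b] z - (\<Sum>e\<in>UNIV. cov (cov ricT) [Some e, Some e, Some a, Some b] z))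
      - ric a b z / (2 * \<tau>^2)
    = 2 * (\<Sum>m\<in>UNIV. \<Sum>n\<in>UNIV. \<Sum>t\<in>UNIV. \<Sum>u\<in>UNIV. \<Sum>v\<in>UNIV. S m n t u * K a v t u * K b v m n)
      + (\<Sum>N<m. \<Sum>M<m. L N M a * L N M b)
      - 2 / \<tau> * (ZZ [Some a, Some b] z + 1 / (2 * \<tau>) * ric a b z)"
proof -
  have "R a k b l = R k a l b" for k l
    using Rm4_skew12[of "Some k" "Some a" "Some l" "Some b" z] Rm4_skew34[OF z_in, of "Some a" "Some k" "Some b" "Some l"] by simp
  then have "(\<Sum>k\<in>UNIV. \<Sum>l\<in>UNIV. R a k b l * ric k l z) = (\<Sum>e\<in>UNIV. \<Sum>k\<in>UNIV. ric e k z * R e a k b)"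
    by (simp add: mult.commute)
  then show ?thesis
    unfolding heat_operator_ZZ[OF o] heat_operator_ric[OF o] SKK LL using \<tau> by (simp add: field_simps power2_eq_square)
qed

end

end

end

section \<open>Tensor components in a constant frame of a chart\<close>

primrec fc :: "('n::finite \<Rightarrow> real^'n) \<Rightarrow> ('n list \<Rightarrow> real) \<Rightarrow> 'n list \<Rightarrow> real" where
  "fc F T [] = T []"
| "fc F T (a # is) = (\<Sum>i\<in>UNIV. F a $ i * fc F (\<lambda>js. T (i # js)) is)"

lemma frame_comp_fc: "frame_comp F T is x = fc F (\<lambda>js. T js x) is"
  by (induction "is" arbitrary: T) auto

lemma fc_add: "fc F (\<lambda>js. T js + U js) is = fc F T is + fc F U is"
  by (induction "is" arbitrary: T U) (auto simp: distrib_left sum.distrib)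

lemma fc_cmult: "fc F (\<lambda>js. c * T js) is = c * fc F T is"
  by (induction "is" arbitrary: T) (auto simp: sum_distrib_left mult_ac)

lemma fc_diff: "fc F (\<lambda>js. T js - U js) is = fc F T is - fc F U is"
  using fc_add[of F T "\<lambda>js. -1 * U js" "is"] unfolding fc_cmult by simp

lemma fc_zero: "fc F (\<lambda>js. 0) is = 0"
  using fc_cmult[of F 0 "\<lambda>_. 0" "is"] by simp

lemma fc_sum: "fc F (\<lambda>js. \<Sum>k\<in>A. T k js) is = (\<Sum>k\<in>A. fc F (T k) is)"
  by (induction A rule: infinite_finite_induct) (auto simp: fc_add fc_zero)

lemma fc_cong: "(\<And>js. length js = length is \<Longrightarrow> T js = U js) \<Longrightarrow> fc F T is = fc F U is"
proof (induction "is" arbitrary: T U)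
  case (Cons i "is")
  have "fc F (\<lambda>js. T (k # js)) is = fc F (\<lambda>js. U (k # js)) is" for k
    by (rule Cons.IH) (simp add: Cons.prems)
  then show ?case by simp
qed simp

lemma act_cmult_matrix: "act (\<lambda>i j. c * M i j) T is = c * act M T is"
  by (induction "is" arbitrary: T) (auto simp: distrib_left sum_distrib_left mult_ac)

lemma act_sum_matrix:
  assumes "finite A" shows "act (\<lambda>i j. \<Sum>k\<in>A. M k i j) T is = (\<Sum>k\<in>A. act (M k) T is)"
  using assms
proof (induction A)
  case empty
  show ?case by (induction "is" arbitrary: T) auto
qed (simp add: act_matrix_add)

text \<open>A change of frame intertwines derivations when it intertwines their matrices; this
  carries Christoffel symbols from coordinates to the frame.\<close>

lemma fc_act:
  assumes "\<And>a k. (\<Sum>i\<in>UNIV. F a $ i * M i k) = (\<Sum>c\<in>UNIV. N a c * F c $ k)"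
  shows "fc F (\<lambda>js. act M T js) is = act N (\<lambda>js. fc F T js) is"
proof (induction "is" arbitrary: T)
  case (Cons a "is")
  have "fc F (\<lambda>js. act M T js) (a # is)
    = (\<Sum>i\<in>UNIV. F a $ i * (\<Sum>k\<in>UNIV. M i k * fc F (\<lambda>js. T (k # js)) is))
      + (\<Sum>i\<in>UNIV. F a $ i * act N (\<lambda>js. fc F (\<lambda>js. T (i # js)) js) is)"
    using Cons.IH by (simp add: fc_add fc_sum fc_cmult distrib_left sum.distrib)
  also have "(\<Sum>i\<in>UNIV. F a $ i * (\<Sum>k\<in>UNIV. M i k * fc F (\<lambda>js. T (k # js)) is))
    = (\<Sum>k\<in>UNIV. (\<Sum>i\<in>UNIV. F a $ i * M i k) * fc F (\<lambda>js. T (k # js)) is)"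
    unfolding sum_distrib_left sum_distrib_right mult.assoc by (rule sum.swap)
  also have "\<dots> = (\<Sum>c\<in>UNIV. N a c * fc F T (c # is))"
    unfolding assms fc.simps(2) sum_distrib_left sum_distrib_right mult.assoc by (rule sum.swap)
  also have "(\<Sum>i\<in>UNIV. F a $ i * act N (\<lambda>js. fc F (\<lambda>js. T (i # js)) js) is) = act N (\<lambda>js. fc F T (a # js)) is"
    by (simp add: act_sum act_cmult)
  finally show ?case by simp
qed simp

lemma fc_dual:
  assumes "\<And>k i. (\<Sum>a\<in>UNIV. B k $ a * F a $ i) = (if k = i then 1 else 0)"
  shows "fc B (\<lambda>js. fc F T js) is = T is"
proof (induction "is" arbitrary: T)
  case (Cons k "is")
  have "fc B (\<lambda>js. fc F T js) (k # is) = (\<Sum>a\<in>UNIV. B k $ a * (\<Sum>i\<in>UNIV. F a $ i * T (i # is)))"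
    using Cons.IH by (simp add: fc_sum fc_cmult)
  also have "\<dots> = (\<Sum>i\<in>UNIV. (\<Sum>a\<in>UNIV. B k $ a * F a $ i) * T (i # is))"
    unfolding sum_distrib_left sum_distrib_right mult.assoc by (rule sum.swap)
  also have "\<dots> = T (k # is)" unfolding assms by (simp add: sum_delta_mult')
  finally show ?case .
qed simp

lemma nabla_act:
  "nabla g T (k # is) x = partial k (T is) x - act (\<lambda>i l. christoffel g l k i x) (\<lambda>js. T js x) is"
proof -
  have "(\<Sum>p<length is. \<Sum>l\<in>UNIV. M (is ! p) l * U (is[p := l])) = act M U is" for M U
    by (induction "is" arbitrary: U) (simp_all add: sum.lessThan_Suc_shift del: sum.lessThan_Suc)
  then show ?thesis by simp
qed

text \<open>\<open>Fr\<close> is a frame independent of time and position, later the evolving frame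
  at one instant, and \<open>B\<close> is its coframe. The open set \<open>D\<close> is kept
  variable so that it can be shrunk to where the curvature operator can be inverted.\<close>

locale chart_ricci_flow =
  fixes G :: "real \<Rightarrow> 'n::finite metric" and D :: "(real \<times> (real^'n)) set" and Fr B :: "'n \<Rightarrow> real^'n"
  assumes open_D: "open D"
    and smooth_G0: "smooth_on (\<lambda>z. G (fst z) (snd z) $ i $ j) D"
    and G0_sym: "z \<in> D \<Longrightarrow> G (fst z) (snd z) $ i $ j = G (fst z) (snd z) $ j $ i"
    and G0_inv: "z \<in> D \<Longrightarrow> invertible (G (fst z) (snd z))"
    and G0_flow: "(s, y) \<in> D \<Longrightarrow> ((\<lambda>s. G s y $ i $ j) has_real_derivative (- 2 * Ric (G s) [i, j] y)) (at s)"
    and dual: "(\<Sum>k\<in>UNIV. B a $ k * Fr b $ k) = (if a = b then 1 else 0)"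
    and dual': "(\<Sum>a\<in>UNIV. Fr a $ k * B a $ l) = (if k = l then 1 else 0)"
begin

fun e0 :: "'n option \<Rightarrow> real \<times> (real^'n)" where
  "e0 None = (1, 0)"
| "e0 (Some a) = (0, Fr a)"

sublocale frame_domain D e0
  by unfold_locales (rule open_D)

definition gz where "gz i j z = G (fst z) (snd z) $ i $ j"
definition hz where "hz i j z = ginv (G (fst z)) i j (snd z)"
definition Cz where "Cz k i j z = christoffel (G (fst z)) k i j (snd z)"

definition sd :: "'n \<Rightarrow> (real \<times> (real^'n) \<Rightarrow> real) \<Rightarrow> real \<times> (real^'n) \<Rightarrow> real" where
  "sd i f z = frechet_derivative f (at z) (0, axis i 1)"

lemma smooth_sd: "smooth f \<Longrightarrow> smooth (sd i f)"
  unfolding sd_def by (rule smooth_on_frechet_derivative)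

lemma slice_derivative:
  assumes "smooth f" "(s, y) \<in> D"
  shows "((\<lambda>y. f (s, y)) has_derivative (\<lambda>v. frechet_derivative f (at (s, y)) (0, v))) (at y)"
proof -
  have "((\<lambda>y. (s, y)) has_derivative (\<lambda>v. (0, v))) (at y)" by (auto intro!: derivative_eq_intros)
  from has_derivative_compose[OF this works[OF assms]] show ?thesis .
qed

lemma partial_slice:
  assumes "smooth f" "(s, y) \<in> D" shows "partial i (\<lambda>y. f (s, y)) y = sd i f (s, y)"
  unfolding partial_def sd_def frechet_derivative_eqI[OF slice_derivative[OF assms]] ..

lemma open_slice: "open {y. (s, y) \<in> D}"
proof -
  have "{y. (s, y) \<in> D} = (\<lambda>y. (s, y)) -` D" by auto
  then show ?thesis using open_D by (simp add: open_vimage continuous_on_Pair)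
qed

lemma partial_cong_slice:
  assumes "\<And>y. (s, y) \<in> D \<Longrightarrow> f y = k y" "(s, y) \<in> D" shows "partial i f y = partial i k y"
  unfolding partial_def using frechet_derivative_cong_open[OF open_slice[of s], of y f k] assms by simp

lemma pd_Some:
  assumes f: "smooth f" "z \<in> D" shows "pd (Some a) f z = (\<Sum>i\<in>UNIV. Fr a $ i * sd i f z)"
proof -
  interpret l: linear "frechet_derivative f (at z)"
    using works[OF f] by (rule has_derivative_linear)
  have "(0::real, Fr a) = (\<Sum>i\<in>UNIV. Fr a $ i *\<^sub>R (0, axis i 1))"
    using basis_expansion[of "Fr a"] by (auto simp: prod_eq_iff fst_sum snd_sum scalar_mult_eq_scaleR)
  moreover have "frechet_derivative f (at z) (c *\<^sub>R (0, v)) = c * frechet_derivative f (at z) (0, v)" for c v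
    using l.scale[of c "(0, v)"] by simp
  ultimately show ?thesis unfolding pd_def sd_def by (simp only: e0.simps l.sum)
qed

lemma pd_None:
  assumes "smooth f" "(s, y) \<in> D" shows "((\<lambda>s. f (s, y)) has_real_derivative pd None f (s, y)) (at s)"
proof -
  have "((\<lambda>s. (s, y)) has_derivative (\<lambda>h. (h, 0))) (at s)" by (auto intro!: derivative_eq_intros)
  from has_derivative_compose[OF this works[OF assms]]
  have 1: "((\<lambda>s. f (s, y)) has_derivative (\<lambda>h. frechet_derivative f (at (s, y)) (h, 0))) (at s)" .
  interpret l: linear "frechet_derivative f (at (s, y))"
    using works[OF assms] by (rule has_derivative_linear)
  have "frechet_derivative f (at (s, y)) (h, 0) = pd None f (s, y) * h" for h
    using l.scale[of h "(1, 0)"] by (simp add: pd_def)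
  then show ?thesis unfolding has_field_derivative_def using 1 by (simp add: fun_eq_iff[symmetric])
qed

lemma smooth_gz [intro!]: "smooth (gz i j)"
  unfolding gz_def by (rule smooth_G0)

lemma smooth_hz [intro!]: "smooth (hz i j)"
  unfolding hz_def ginv_def by (rule smooth_on_matrix_inv[OF open_D]) (auto intro: smooth_G0 G0_inv)

lemma Cz_eq:
  assumes "z \<in> D"
  shows "Cz k i j z = (1/2) * (\<Sum>l\<in>UNIV. hz k l z * (sd i (gz j l) z + sd j (gz i l) z - sd l (gz i j) z))"
proof -
  obtain s y where z: "z = (s, y)" by (cases z)
  have "partial i (\<lambda>y. G s y $ j $ l) y = sd i (gz j l) z" for i j l
    using partial_slice[of "gz j l" s y i] assms z by (simp add: gz_def[abs_def] smooth_G0)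
  then show ?thesis unfolding Cz_def christoffel_def hz_def z by simp
qed

lemma smooth_Cz [intro!]: "smooth (Cz k i j)"
proof -
  have "smooth (\<lambda>z. (1/2) * (\<Sum>l\<in>UNIV. hz k l z * (sd i (gz j l) z + sd j (gz i l) z - sd l (gz i j) z)))"
    by (intro smooth_intros smooth_on_const smooth_sd smooth_gz smooth_hz)
  then show ?thesis by (subst smooth_on_cong[OF open_D Cz_eq])
qed

lemma gz_sym: "z \<in> D \<Longrightarrow> gz i j z = gz j i z"
  unfolding gz_def by (rule G0_sym)

lemma sd_cong: "(\<And>z. z \<in> D \<Longrightarrow> f z = k z) \<Longrightarrow> z \<in> D \<Longrightarrow> sd i f z = sd i k z"
  unfolding sd_def using frechet_derivative_cong_open[OF open_D] by metis

lemma sd_gz_sym: "z \<in> D \<Longrightarrow> sd k (gz i j) z = sd k (gz j i) z"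
  by (rule sd_cong) (auto intro: gz_sym)

lemma gz_hz: "z \<in> D \<Longrightarrow> (\<Sum>j\<in>UNIV. gz i j z * hz j k z) = (if i = k then 1 else 0)"
  using matrix_inv_right[OF G0_inv, of z]
  by (simp add: gz_def hz_def ginv_def matrix_matrix_mult_def mat_def vec_eq_iff)

lemma hz_gz: "z \<in> D \<Longrightarrow> (\<Sum>j\<in>UNIV. hz i j z * gz j k z) = (if i = k then 1 else 0)"
  using matrix_inv_left[OF G0_inv, of z]
  by (simp add: gz_def hz_def ginv_def matrix_matrix_mult_def mat_def vec_eq_iff)

lemma hz_sym:
  assumes z: "z \<in> D" shows "hz i j z = hz j i z"
proof -
  have 2: "(\<Sum>k\<in>UNIV. hz j k z * (\<Sum>l\<in>UNIV. gz k l z * hz i l z)) = hz i j z"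
  proof -
    have "(\<Sum>k\<in>UNIV. hz j k z * (\<Sum>l\<in>UNIV. gz k l z * hz i l z)) = (\<Sum>l\<in>UNIV. (\<Sum>k\<in>UNIV. hz j k z * gz k l z) * hz i l z)"
      unfolding sum_distrib_left sum_distrib_right mult.assoc by (rule sum.swap)
    then show ?thesis unfolding hz_gz[OF z] by (simp add: sum_delta_mult')
  qed
  have 3: "(\<Sum>l\<in>UNIV. gz k l z * hz i l z) = (if i = k then 1 else 0)" for k
    using hz_gz[OF z, of i k] by (simp add: gz_sym[OF z, of k] mult.commute)
  have "(\<Sum>k\<in>UNIV. hz j k z * (if i = k then 1 else 0)) = hz j i z"
    by (simp add: if_distrib[of "\<lambda>x. _ * x"] cong: if_cong)
  then show ?thesis using 2 unfolding 3 by metis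
qed

lemma Cz_sym: "z \<in> D \<Longrightarrow> Cz k i j z = Cz k j i z"
  unfolding Cz_eq by (simp add: sd_gz_sym[of z _ i j] add.commute)

lemma Cz_lower:
  assumes z: "z \<in> D"
  shows "(\<Sum>k\<in>UNIV. Cz k i j z * gz k m z) = (1/2) * (sd i (gz j m) z + sd j (gz i m) z - sd m (gz i j) z)"
proof -
  let ?X = "\<lambda>l. sd i (gz j l) z + sd j (gz i l) z - sd l (gz i j) z"
  have "(\<Sum>k\<in>UNIV. Cz k i j z * gz k m z) = (1/2) * (\<Sum>k\<in>UNIV. (\<Sum>l\<in>UNIV. hz k l z * ?X l) * gz k m z)"
  proof -
    have "(\<Sum>k\<in>UNIV. (c * a k) * b k) = c * (\<Sum>k\<in>UNIV. a k * b k)" for c and a b :: "'n \<Rightarrow> real"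
      by (simp add: sum_distrib_left mult.assoc)
    then show ?thesis unfolding Cz_eq[OF z] .
  qed
  also have "(\<Sum>k\<in>UNIV. (\<Sum>l\<in>UNIV. hz k l z * ?X l) * gz k m z) = (\<Sum>l\<in>UNIV. (\<Sum>k\<in>UNIV. gz m k z * hz k l z) * ?X l)"
    unfolding sum_distrib_right by (subst sum.swap) (simp add: gz_sym[OF z, of m] mult_ac)
  finally show ?thesis unfolding gz_hz[OF z] by (simp add: sum_delta_mult')
qed

definition gE where "gE a b z = (\<Sum>i\<in>UNIV. \<Sum>j\<in>UNIV. Fr a $ i * (Fr b $ j * gz i j z))"
definition hE where "hE a b z = (\<Sum>i\<in>UNIV. \<Sum>j\<in>UNIV. B a $ i * (B b $ j * hz i j z))"
text \<open>With a constant frame the Christoffel symbols transform like a tensor. The upper index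
  stays in coordinates here and is converted by \<open>B\<close> in
  \<open>\<Gamma>E\<close>.\<close>

definition \<Gamma>F where "\<Gamma>F h a b z = (\<Sum>i\<in>UNIV. \<Sum>j\<in>UNIV. Fr a $ i * (Fr b $ j * Cz h i j z))"
definition \<Gamma>E where "\<Gamma>E c a b z = (\<Sum>h\<in>UNIV. B c $ h * \<Gamma>F h a b z)"

lemma smooth_gE [intro!]: "smooth (gE a b)"
  unfolding gE_def by (intro smooth_intros smooth_on_const smooth_gz)

lemma smooth_hE [intro!]: "smooth (hE a b)"
  unfolding hE_def by (intro smooth_intros smooth_on_const smooth_hz)

lemma smooth_\<Gamma>F [intro!]: "smooth (\<Gamma>F h a b)"
  unfolding \<Gamma>F_def by (intro smooth_intros smooth_on_const smooth_Cz)

lemma smooth_\<Gamma>E [intro!]: "smooth (\<Gamma>E c a b)"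
  unfolding \<Gamma>E_def by (intro smooth_intros smooth_on_const smooth_\<Gamma>F)

lemma expand_B: "(\<Sum>a\<in>UNIV. Fr a $ k * (\<Sum>l\<in>UNIV. B a $ l * f l)) = f k"
proof -
  have "(\<Sum>a\<in>UNIV. Fr a $ k * (\<Sum>l\<in>UNIV. B a $ l * f l)) = (\<Sum>l\<in>UNIV. (\<Sum>a\<in>UNIV. Fr a $ k * B a $ l) * f l)"
    unfolding sum_distrib_left sum_distrib_right mult.assoc by (rule sum.swap)
  then show ?thesis unfolding dual' by (simp add: sum_delta_mult')
qed

lemma expand_F: "(\<Sum>a\<in>UNIV. B a $ k * (\<Sum>l\<in>UNIV. Fr a $ l * f l)) = f k"
proof -
  have "(\<Sum>a\<in>UNIV. B a $ k * (\<Sum>l\<in>UNIV. Fr a $ l * f l)) = (\<Sum>l\<in>UNIV. (\<Sum>a\<in>UNIV. Fr a $ l * B a $ k) * f l)"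
    unfolding sum_distrib_left sum_distrib_right by (subst sum.swap) (simp add: mult_ac)
  then show ?thesis unfolding dual' by (simp add: sum_delta_mult)
qed

lemma \<Gamma>E_expand: "(\<Sum>c\<in>UNIV. \<Gamma>E c a b z * Fr c $ h) = \<Gamma>F h a b z"
  using expand_B[of h "\<lambda>h. \<Gamma>F h a b z"] by (simp add: \<Gamma>E_def mult.commute)

lemma contract_frame:
  "(\<Sum>a\<in>UNIV. \<Sum>b\<in>UNIV. hE a b z * (\<Sum>i\<in>UNIV. Fr a $ i * (\<Sum>j\<in>UNIV. Fr b $ j * X i j))) = (\<Sum>i\<in>UNIV. \<Sum>j\<in>UNIV. hz i j z * X i j)"
proof -
  define Z where "Z b i = (\<Sum>j\<in>UNIV. Fr b $ j * X i j)" for b i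
  define Y where "Y a b = (\<Sum>i\<in>UNIV. Fr a $ i * Z b i)" for a b
  have "(\<Sum>a\<in>UNIV. \<Sum>b\<in>UNIV. hE a b z * Y a b)
    = (\<Sum>a\<in>UNIV. \<Sum>b\<in>UNIV. \<Sum>p\<in>UNIV. \<Sum>q\<in>UNIV. hz p q z * (B a $ p * (B b $ q * Y a b)))"
    unfolding hE_def sum_distrib_right by (simp add: mult_ac)
  also have "\<dots> = (\<Sum>p\<in>UNIV. \<Sum>q\<in>UNIV. \<Sum>a\<in>UNIV. \<Sum>b\<in>UNIV. hz p q z * (B a $ p * (B b $ q * Y a b)))"
    by (rule sum_swap4)
  also have "\<dots> = (\<Sum>p\<in>UNIV. \<Sum>q\<in>UNIV. hz p q z * (\<Sum>b\<in>UNIV. B b $ q * (\<Sum>a\<in>UNIV. B a $ p * Y a b)))"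
    by (intro sum.cong refl, subst sum.swap) (simp add: sum_distrib_left mult_ac)
  also have "\<dots> = (\<Sum>i\<in>UNIV. \<Sum>j\<in>UNIV. hz i j z * X i j)"
    unfolding Y_def expand_F Z_def ..
  finally show ?thesis unfolding Y_def Z_def .
qed

lemma gE_hE:
  assumes z: "z \<in> D" shows "(\<Sum>b\<in>UNIV. gE a b z * hE b c z) = (if a = c then 1 else 0)"
proof -
  have g: "gE a b z = (\<Sum>j\<in>UNIV. Fr b $ j * (\<Sum>i\<in>UNIV. Fr a $ i * gz i j z))" for b
    unfolding gE_def by (subst sum.swap) (simp add: sum_distrib_left mult_ac)
  have h: "hE b c z = (\<Sum>k\<in>UNIV. B b $ k * (\<Sum>l\<in>UNIV. B c $ l * hz k l z))" for b
    unfolding hE_def by (simp add: sum_distrib_left)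
  have "(\<Sum>b\<in>UNIV. gE a b z * hE b c z)
    = (\<Sum>j\<in>UNIV. (\<Sum>i\<in>UNIV. Fr a $ i * gz i j z) * (\<Sum>b\<in>UNIV. Fr b $ j * hE b c z))"
    unfolding g sum_distrib_right sum_distrib_left by (subst sum.swap) (simp add: mult_ac)
  also have "\<dots> = (\<Sum>j\<in>UNIV. (\<Sum>i\<in>UNIV. Fr a $ i * gz i j z) * (\<Sum>l\<in>UNIV. B c $ l * hz j l z))"
    unfolding h expand_B ..
  also have "\<dots> = (\<Sum>j\<in>UNIV. \<Sum>i\<in>UNIV. \<Sum>l\<in>UNIV. Fr a $ i * (B c $ l * (gz i j z * hz j l z)))"
    unfolding sum_product by (simp add: mult_ac)
  also have "\<dots> = (\<Sum>i\<in>UNIV. \<Sum>l\<in>UNIV. \<Sum>j\<in>UNIV. Fr a $ i * (B c $ l * (gz i j z * hz j l z)))"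
    by (rule sum_swap3)
  also have "\<dots> = (\<Sum>i\<in>UNIV. \<Sum>l\<in>UNIV. Fr a $ i * (B c $ l * (\<Sum>j\<in>UNIV. gz i j z * hz j l z)))"
    by (simp only: sum_distrib_left)
  also have "\<dots> = (\<Sum>i\<in>UNIV. B c $ i * Fr a $ i)"
    unfolding gz_hz[OF z] by (simp add: if_distrib[of "\<lambda>x. _ * x"] mult.commute cong: if_cong)
  finally show ?thesis unfolding dual by (simp add: eq_commute)
qed

lemma pd_\<Gamma>F: "z \<in> D \<Longrightarrow> pd (Some a) (\<Gamma>F h b c) z = (\<Sum>k\<in>UNIV. \<Sum>i\<in>UNIV. \<Sum>j\<in>UNIV. Fr a $ k * (Fr b $ i * (Fr c $ j * sd k (Cz h i j) z)))"
proof -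
  assume z: "z \<in> D"
  have "pd (Some a) (\<Gamma>F h b c) z = (\<Sum>i\<in>UNIV. \<Sum>j\<in>UNIV. Fr b $ i * (Fr c $ j * pd (Some a) (Cz h i j) z))"
    unfolding \<Gamma>F_def using z
    by (subst pd_sum; (intro smooth_intros smooth_on_const smooth_Cz z)?)+ (simp add: pd_cmult smooth_on_mult[OF open_D] smooth_Cz)
  also have "\<dots> = (\<Sum>k\<in>UNIV. \<Sum>i\<in>UNIV. \<Sum>j\<in>UNIV. Fr b $ i * (Fr c $ j * (Fr a $ k * sd k (Cz h i j) z)))"
    unfolding pd_Some[OF smooth_Cz z] sum_distrib_left by (rule sum_swap3[symmetric])
  finally show ?thesis by (simp add: mult_ac)
qed

end

lemma sum_rotate4: "(\<Sum>e\<in>E. \<Sum>a\<in>A. \<Sum>b\<in>B. \<Sum>d\<in>D. f e a b d) = (\<Sum>a\<in>A. \<Sum>b\<in>B. \<Sum>d\<in>D. \<Sum>e\<in>E. f e a b d)"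
  by (rule trans[OF sum_swap3]) (rule sum.cong[OF refl], rule sum.cong[OF refl], rule sum.swap)

context chart_ricci_flow
begin

lemma \<Gamma>E_gE:
  assumes z: "z \<in> D"
  shows "(\<Sum>l\<in>UNIV. \<Gamma>E l k i z * gE l j z) = (\<Sum>c\<in>UNIV. \<Sum>d\<in>UNIV. \<Sum>b\<in>UNIV. Fr k $ c * (Fr i $ d * (Fr j $ b *
      ((1/2) * (sd c (gz d b) z + sd d (gz c b) z - sd b (gz c d) z)))))"
proof -
  define W where "W a = (\<Sum>b\<in>UNIV. Fr j $ b * gz a b z)" for a
  have g: "gE l j z = (\<Sum>a\<in>UNIV. Fr l $ a * W a)" for l
    unfolding gE_def W_def by (simp add: sum_distrib_left)
  have "(\<Sum>l\<in>UNIV. \<Gamma>E l k i z * gE l j z) = (\<Sum>a\<in>UNIV. (\<Sum>l\<in>UNIV. \<Gamma>E l k i z * Fr l $ a) * W a)"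
    unfolding g sum_distrib_left sum_distrib_right mult.assoc by (rule sum.swap)
  also have "\<dots> = (\<Sum>a\<in>UNIV. \<Sum>c\<in>UNIV. \<Sum>d\<in>UNIV. \<Sum>b\<in>UNIV. Fr k $ c * (Fr i $ d * (Fr j $ b * (Cz a c d z * gz a b z))))"
    unfolding \<Gamma>E_expand \<Gamma>F_def sum_distrib_right unfolding W_def sum_distrib_left by (simp add: mult_ac)
  also have "\<dots> = (\<Sum>c\<in>UNIV. \<Sum>d\<in>UNIV. \<Sum>b\<in>UNIV. Fr k $ c * (Fr i $ d * (Fr j $ b * (\<Sum>a\<in>UNIV. Cz a c d z * gz a b z))))"
    unfolding sum_distrib_left by (rule sum_rotate4)
  finally show ?thesis unfolding Cz_lower[OF z] .
qed

lemma pd_gE: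
  assumes z: "z \<in> D"
  shows "pd (Some k) (gE i j) z = (\<Sum>c\<in>UNIV. \<Sum>d\<in>UNIV. \<Sum>b\<in>UNIV. Fr k $ c * (Fr i $ d * (Fr j $ b * sd c (gz d b) z)))"
proof -
  have "pd (Some k) (gE i j) z = (\<Sum>d\<in>UNIV. \<Sum>b\<in>UNIV. Fr i $ d * (Fr j $ b * pd (Some k) (gz d b) z))"
    unfolding gE_def using z
    by (subst pd_sum; (intro smooth_intros smooth_on_const smooth_gz z)?)+ (simp add: pd_cmult smooth_on_mult[OF open_D] smooth_gz)
  also have "\<dots> = (\<Sum>c\<in>UNIV. \<Sum>d\<in>UNIV. \<Sum>b\<in>UNIV. Fr i $ d * (Fr j $ b * (Fr k $ c * sd c (gz d b) z)))"
    unfolding pd_Some[OF smooth_gz z] sum_distrib_left by (rule sum_swap3[symmetric])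
  finally show ?thesis by (simp add: mult_ac)
qed

lemma \<Gamma>E_metric:
  assumes z: "z \<in> D"
  shows "pd (Some k) (gE i j) z = (\<Sum>l\<in>UNIV. \<Gamma>E l k i z * gE l j z + \<Gamma>E l k j z * gE l i z)"
proof -
  let ?X = "\<lambda>c d b. (1/2) * (sd c (gz d b) z + sd d (gz c b) z - sd b (gz c d) z)"
  have "(\<Sum>l\<in>UNIV. \<Gamma>E l k j z * gE l i z) = (\<Sum>c\<in>UNIV. \<Sum>b\<in>UNIV. \<Sum>d\<in>UNIV. Fr k $ c * (Fr j $ b * (Fr i $ d * ?X c b d)))"
    by (rule \<Gamma>E_gE[OF z])
  also have "\<dots> = (\<Sum>c\<in>UNIV. \<Sum>d\<in>UNIV. \<Sum>b\<in>UNIV. Fr k $ c * (Fr j $ b * (Fr i $ d * ?X c b d)))"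
    by (intro sum.cong refl sum.swap)
  finally have 1: "(\<Sum>l\<in>UNIV. \<Gamma>E l k j z * gE l i z) = (\<Sum>c\<in>UNIV. \<Sum>d\<in>UNIV. \<Sum>b\<in>UNIV. Fr k $ c * (Fr j $ b * (Fr i $ d * ?X c b d)))" .
  have gen: "x = p + q \<Longrightarrow> k * (i * (j * x)) = k * (i * (j * p)) + k * (j * (i * q))" for x p q k i j :: real
    by (simp add: algebra_simps)
  show ?thesis unfolding sum.distrib 1 \<Gamma>E_gE[OF z] unfolding sum.distrib[symmetric] pd_gE[OF z]
  proof (intro sum.cong refl)
    fix c d b
    \<comment> \<open>Koszul's formula: in the sum of the two expressions all other derivatives
      cancel.\<close>
    have "sd c (gz d b) z = ?X c d b + ?X c b d" using sd_gz_sym[OF z, of c d b] by (simp add: field_simps)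
    then show "Fr k $ c * (Fr i $ d * (Fr j $ b * sd c (gz d b) z))
      = Fr k $ c * (Fr i $ d * (Fr j $ b * ?X c d b)) + Fr k $ c * (Fr j $ b * (Fr i $ d * ?X c b d))"
      by (rule gen)
  qed
qed

text \<open>Has exactly the form of the bracket in the assumption \<open>ric_def\<close>, which is
  thereby discharged by unfolding.\<close>

definition REu where
  "REu p i j l z = pd (Some i) (\<Gamma>E p j l) z - pd (Some j) (\<Gamma>E p i l) z
     + (\<Sum>q\<in>UNIV. \<Gamma>E p i q z * \<Gamma>E q j l z - \<Gamma>E p j q z * \<Gamma>E q i l z)"

lemma REu_riemann_up:
  assumes z: "(s, y) \<in> D"
  shows "(\<Sum>p\<in>UNIV. Fr p $ h * REu p i j l (s, y))
    = (\<Sum>a\<in>UNIV. \<Sum>b\<in>UNIV. \<Sum>d\<in>UNIV. Fr i $ a * (Fr j $ b * (Fr l $ d * riemann_up (G s) h a b d y)))"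
proof -
  let ?z = "(s, y)"
  have lin: "(\<Sum>p\<in>UNIV. Fr p $ h * pd (Some i) (\<Gamma>E p j l) ?z)
      = (\<Sum>a\<in>UNIV. \<Sum>b\<in>UNIV. \<Sum>d\<in>UNIV. Fr i $ a * (Fr j $ b * (Fr l $ d * sd a (Cz h b d) ?z)))" for i j
  proof -
    have "pd (Some i) (\<Gamma>E p j l) ?z = (\<Sum>k\<in>UNIV. B p $ k * pd (Some i) (\<Gamma>F k j l) ?z)" for p
      unfolding \<Gamma>E_def using z
      by (subst pd_sum; (intro smooth_intros smooth_on_const smooth_\<Gamma>F z)?) (simp add: pd_cmult smooth_\<Gamma>F)
    then show ?thesis by (simp add: expand_B pd_\<Gamma>F[OF z])
  qed
  have quad: "(\<Sum>p\<in>UNIV. Fr p $ h * (\<Sum>q\<in>UNIV. \<Gamma>E p i q ?z * \<Gamma>E q j l ?z))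
      = (\<Sum>a\<in>UNIV. \<Sum>b\<in>UNIV. \<Sum>d\<in>UNIV. Fr i $ a * (Fr j $ b * (Fr l $ d * (\<Sum>m\<in>UNIV. Cz h a m ?z * Cz m b d ?z))))" for i j
  proof -
    have "(\<Sum>p\<in>UNIV. Fr p $ h * (\<Sum>q\<in>UNIV. \<Gamma>E p i q ?z * \<Gamma>E q j l ?z))
      = (\<Sum>q\<in>UNIV. (\<Sum>p\<in>UNIV. \<Gamma>E p i q ?z * Fr p $ h) * \<Gamma>E q j l ?z)"
      unfolding sum_distrib_left sum_distrib_right by (subst sum.swap) (simp add: mult_ac)
    also have "\<dots> = (\<Sum>q\<in>UNIV. \<Sum>a\<in>UNIV. \<Sum>m\<in>UNIV. Fr i $ a * (Cz h a m ?z * (\<Gamma>E q j l ?z * Fr q $ m)))"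
      unfolding \<Gamma>E_expand unfolding \<Gamma>F_def sum_distrib_right by (simp add: mult_ac)
    also have "\<dots> = (\<Sum>a\<in>UNIV. \<Sum>m\<in>UNIV. Fr i $ a * (Cz h a m ?z * (\<Sum>q\<in>UNIV. \<Gamma>E q j l ?z * Fr q $ m)))"
      unfolding sum_distrib_left by (rule sum_swap3)
    also have "\<dots> = (\<Sum>a\<in>UNIV. \<Sum>m\<in>UNIV. \<Sum>b\<in>UNIV. \<Sum>d\<in>UNIV. Fr i $ a * (Fr j $ b * (Fr l $ d * (Cz h a m ?z * Cz m b d ?z))))"
      unfolding \<Gamma>E_expand unfolding \<Gamma>F_def sum_distrib_left by (simp add: mult_ac)
    also have "\<dots> = (\<Sum>a\<in>UNIV. \<Sum>b\<in>UNIV. \<Sum>d\<in>UNIV. \<Sum>m\<in>UNIV. Fr i $ a * (Fr j $ b * (Fr l $ d * (Cz h a m ?z * Cz m b d ?z))))"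
      by (rule sum.cong[OF refl], rule sum_swap3)
    finally show ?thesis by (simp only: sum_distrib_left)
  qed
  have flip: "(\<Sum>a\<in>UNIV. \<Sum>b\<in>UNIV. \<Sum>d\<in>UNIV. Fr j $ a * (Fr i $ b * (Fr l $ d * f a b d)))
      = (\<Sum>a\<in>UNIV. \<Sum>b\<in>UNIV. \<Sum>d\<in>UNIV. Fr i $ a * (Fr j $ b * (Fr l $ d * f b a d)))" for f :: "'n \<Rightarrow> 'n \<Rightarrow> 'n \<Rightarrow> real"
    by (subst sum.swap) (simp add: mult_ac)
  have partial: "partial a (christoffel (G s) h b d) y = sd a (Cz h b d) ?z" for a b d
    using partial_slice[OF smooth_Cz z, of a h b d] by (simp add: Cz_def)
  have "(\<Sum>p\<in>UNIV. Fr p $ h * REu p i j l ?z)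
    = (\<Sum>p\<in>UNIV. Fr p $ h * pd (Some i) (\<Gamma>E p j l) ?z) - (\<Sum>p\<in>UNIV. Fr p $ h * pd (Some j) (\<Gamma>E p i l) ?z)
      + ((\<Sum>p\<in>UNIV. Fr p $ h * (\<Sum>q\<in>UNIV. \<Gamma>E p i q ?z * \<Gamma>E q j l ?z)) - (\<Sum>p\<in>UNIV. Fr p $ h * (\<Sum>q\<in>UNIV. \<Gamma>E p j q ?z * \<Gamma>E q i l ?z)))"
    unfolding REu_def by (simp add: distrib_left right_diff_distrib sum.distrib sum_subtractf)
  also have "\<dots> = (\<Sum>a\<in>UNIV. \<Sum>b\<in>UNIV. \<Sum>d\<in>UNIV. Fr i $ a * (Fr j $ b * (Fr l $ d * riemann_up (G s) h a b d y)))"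
    unfolding lin quad flip[of "\<lambda>a b d. sd a (Cz h b d) ?z"] flip[of "\<lambda>a b d. \<Sum>m\<in>UNIV. Cz h a m ?z * Cz m b d ?z"]
    unfolding sum.distrib[symmetric] sum_subtractf[symmetric] riemann_up_def partial
    by (intro sum.cong refl) (simp add: Cz_def algebra_simps sum_subtractf)
  finally show ?thesis .
qed

lemma Rm_frame:
  assumes z: "(s, y) \<in> D"
  shows "(\<Sum>p\<in>UNIV. gE k p (s, y) * REu p i j l (s, y)) = fc Fr (\<lambda>js. Rm (G s) js y) [i, j, k, l]"
proof -
  let ?z = "(s, y)"
  have "(\<Sum>p\<in>UNIV. gE k p ?z * REu p i j l ?z)
    = (\<Sum>c\<in>UNIV. \<Sum>e\<in>UNIV. Fr k $ c * (gz c e ?z * (\<Sum>p\<in>UNIV. Fr p $ e * REu p i j l ?z)))"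
    unfolding gE_def sum_distrib_left sum_distrib_right by (subst sum_swap3) (simp add: mult_ac)
  also have "\<dots> = (\<Sum>c\<in>UNIV. \<Sum>e\<in>UNIV. \<Sum>a\<in>UNIV. \<Sum>b\<in>UNIV. \<Sum>d\<in>UNIV. Fr i $ a * (Fr j $ b * (Fr k $ c * (Fr l $ d * (gz c e ?z * riemann_up (G s) e a b d y)))))"
    unfolding REu_riemann_up[OF z] sum_distrib_left by (simp add: mult_ac)
  also have "\<dots> = (\<Sum>c\<in>UNIV. \<Sum>a\<in>UNIV. \<Sum>b\<in>UNIV. \<Sum>d\<in>UNIV. \<Sum>e\<in>UNIV. Fr i $ a * (Fr j $ b * (Fr k $ c * (Fr l $ d * (gz c e ?z * riemann_up (G s) e a b d y)))))"
    by (intro sum.cong refl sum_rotate4)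
  also have "\<dots> = (\<Sum>a\<in>UNIV. \<Sum>b\<in>UNIV. \<Sum>c\<in>UNIV. \<Sum>d\<in>UNIV. \<Sum>e\<in>UNIV. Fr i $ a * (Fr j $ b * (Fr k $ c * (Fr l $ d * (gz c e ?z * riemann_up (G s) e a b d y)))))"
    by (rule sum_swap3)
  also have "\<dots> = fc Fr (\<lambda>js. Rm (G s) js y) [i, j, k, l]"
    by (simp add: Rm_def tensor4_def gz_def sum_distrib_left)
  finally show ?thesis .
qed

lemma contract_fc:
  "(\<Sum>a\<in>UNIV. \<Sum>b\<in>UNIV. hE a b z * fc Fr T (a # b # is)) = fc Fr (\<lambda>js. \<Sum>i\<in>UNIV. \<Sum>j\<in>UNIV. hz i j z * T (i # j # js)) is"
  by (simp add: contract_frame fc_sum fc_cmult)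

definition ricE where
  "ricE i k = (\<lambda>z. \<Sum>j\<in>UNIV. \<Sum>l\<in>UNIV. hE j l z * (\<Sum>p\<in>UNIV. gE k p z * REu p i j l z))"

definition scalE where
  "scalE = (\<lambda>z. \<Sum>i\<in>UNIV. \<Sum>j\<in>UNIV. hE i j z * ricE i j z)"

lemma ricE_Ric:
  assumes z: "(s, y) \<in> D" shows "ricE i k (s, y) = fc Fr (\<lambda>js. Ric (G s) js y) [i, k]"
proof -
  let ?R = "\<lambda>a b c d. Rm (G s) [a, b, c, d] y"
  have perm: "fc Fr (\<lambda>js. Rm (G s) js y) [i, j, k, l]
    = (\<Sum>b\<in>UNIV. Fr j $ b * (\<Sum>d\<in>UNIV. Fr l $ d * (\<Sum>a\<in>UNIV. Fr i $ a * (\<Sum>c\<in>UNIV. Fr k $ c * ?R a b c d))))" for j l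
  proof -
    have "fc Fr (\<lambda>js. Rm (G s) js y) [i, j, k, l]
      = (\<Sum>a\<in>UNIV. \<Sum>b\<in>UNIV. \<Sum>c\<in>UNIV. \<Sum>d\<in>UNIV. Fr i $ a * (Fr j $ b * (Fr k $ c * (Fr l $ d * ?R a b c d))))"
      by (simp add: sum_distrib_left)
    also have "\<dots> = (\<Sum>a\<in>UNIV. \<Sum>b\<in>UNIV. \<Sum>d\<in>UNIV. \<Sum>c\<in>UNIV. Fr i $ a * (Fr j $ b * (Fr k $ c * (Fr l $ d * ?R a b c d))))"
      by (intro sum.cong refl sum.swap)
    also have "\<dots> = (\<Sum>b\<in>UNIV. \<Sum>d\<in>UNIV. \<Sum>a\<in>UNIV. \<Sum>c\<in>UNIV. Fr i $ a * (Fr j $ b * (Fr k $ c * (Fr l $ d * ?R a b c d))))"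
      by (rule sum_swap3)
    finally show ?thesis by (simp add: sum_distrib_left mult_ac)
  qed
  have "ricE i k (s, y) = (\<Sum>b\<in>UNIV. \<Sum>d\<in>UNIV. hz b d (s, y) * (\<Sum>a\<in>UNIV. Fr i $ a * (\<Sum>c\<in>UNIV. Fr k $ c * ?R a b c d)))"
    unfolding ricE_def Rm_frame[OF z] perm contract_frame ..
  also have "\<dots> = (\<Sum>b\<in>UNIV. \<Sum>d\<in>UNIV. \<Sum>a\<in>UNIV. \<Sum>c\<in>UNIV. Fr i $ a * (Fr k $ c * (hz b d (s, y) * ?R a b c d)))"
    by (simp add: sum_distrib_left mult_ac)
  also have "\<dots> = (\<Sum>a\<in>UNIV. \<Sum>c\<in>UNIV. \<Sum>b\<in>UNIV. \<Sum>d\<in>UNIV. Fr i $ a * (Fr k $ c * (hz b d (s, y) * ?R a b c d)))"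
    by (rule sum_swap4)
  also have "\<dots> = fc Fr (\<lambda>js. Ric (G s) js y) [i, k]"
    by (simp add: Ric_def tensor2_def hz_def sum_distrib_left)
  finally show ?thesis .
qed

text \<open>Makes the abstract spacetime calculus available in the chart. The flow equation may be
  contracted with \<open>Fr\<close> because the frame does not depend on time.\<close>

sublocale ricci_flow_frame D e0 gE hE \<Gamma>E ricE scalE
proof
  show "gE i j z = gE j i z" if "z \<in> D" for z i j
    unfolding gE_def by (subst sum.swap) (simp add: gz_sym[OF that] mult_ac)
  show "hE i j z = hE j i z" if "z \<in> D" for z i j
    unfolding hE_def by (subst sum.swap) (simp add: hz_sym[OF that] mult_ac)
  show "\<Gamma>E k i j z = \<Gamma>E k j i z" if "z \<in> D" for z k i j
  proof -
    have "\<Gamma>F h i j z = \<Gamma>F h j i z" for h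
      unfolding \<Gamma>F_def by (subst sum.swap) (simp add: Cz_sym[OF that] mult_ac)
    then show ?thesis by (simp add: \<Gamma>E_def)
  qed
  show "pd None (gE i j) z = - 2 * ricE i j z" if "z \<in> D" for z i j
  proof -
    obtain s y where z: "z = (s, y)" by (cases z)
    have "((\<lambda>s. gE i j (s, y)) has_real_derivative (\<Sum>a\<in>UNIV. \<Sum>b\<in>UNIV. Fr i $ a * (Fr j $ b * (- 2 * Ric (G s) [a, b] y)))) (at s)"
      unfolding gE_def gz_def using that z
      by (auto intro!: derivative_eq_intros G0_flow simp: sum_distrib_left mult_ac)
    then have "pd None (gE i j) z = (\<Sum>a\<in>UNIV. \<Sum>b\<in>UNIV. Fr i $ a * (Fr j $ b * (- 2 * Ric (G s) [a, b] y)))"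
      using pd_None[OF smooth_gE, of s y i j] that z DERIV_unique by blast
    then show ?thesis using that z by (simp add: ricE_Ric sum_distrib_left sum_negf mult_ac)
  qed
qed (auto simp: ricE_def scalE_def REu_def gE_hE \<Gamma>E_metric simp del: sum_subtractf)

lemma Rm_Rl:
  assumes z: "(s, y) \<in> D"
  shows "Rm4 (Some i) (Some j) (Some k) (Some l) (s, y) = fc Fr (\<lambda>js. Rm (G s) js y) [i, j, k, l]"
proof -
  have "stG (Some k) (Some i) (Some j) = \<Gamma>E k i j" for i j k by (rule ext) (simp add: stG.simps)
  then have "curv (Some p) (Some i) (Some j) (Some l) (s, y) = REu p i j l (s, y)" for p
    by (simp add: curv_def REu_def sum_option)
  then show ?thesis unfolding Rm_frame[OF z, symmetric] by (simp add: Rm4.simps)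
qed

text \<open>The bridge between coordinate tensors on a time slice and spacetime tensors: the spatial
  components of \<open>W\<close> are the frame components of \<open>T\<close>. It holds at all
  points of the slice, so that it can be differentiated; the rank is fixed because tensors are lists
  of arbitrary length.\<close>

definition linked :: "nat \<Rightarrow> real \<Rightarrow> 'n tensor \<Rightarrow> ('n option list \<Rightarrow> real \<times> (real^'n) \<Rightarrow> real) \<Rightarrow> bool" where
  "linked n s T W \<longleftrightarrow> (\<forall>y is. (s, y) \<in> D \<longrightarrow> length is = n \<longrightarrow> W (map Some is) (s, y) = fc Fr (\<lambda>js. T js y) is)"

lemma linkedD: "linked n s T W \<Longrightarrow> (s, y) \<in> D \<Longrightarrow> length is = n \<Longrightarrow> W (map Some is) (s, y) = fc Fr (\<lambda>js. T js y) is"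
  by (simp add: linked_def)

lemma smooth_fc: "(\<And>is. smooth (w is)) \<Longrightarrow> smooth (\<lambda>z. fc F (\<lambda>js. w js z) is)"
  by (induction "is" arbitrary: w) (auto intro!: smooth_intros)

lemma sd_fc:
  assumes "\<And>is. smooth (w is)" "z \<in> D"
  shows "sd i (\<lambda>z. fc F (\<lambda>js. w js z) is) z = fc F (\<lambda>js. sd i (w js) z) is"
proof -
  interpret std: frame_domain D "\<lambda>j. (0, axis j 1)" by unfold_locales (rule open_D)
  have sd: "sd i f z = std.pd i f z" for f by (simp add: sd_def std.pd_def)
  show ?thesis unfolding sd using assms(1)
  proof (induction "is" arbitrary: w)
    case (Cons a "is")
    have "std.pd i (\<lambda>z. fc F (\<lambda>js. w js z) (a # is)) z
      = (\<Sum>k\<in>UNIV. F a $ k * std.pd i (\<lambda>z. fc F (\<lambda>js. w (k # js) z) is) z)"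
      using Cons.prems assms(2) by (simp add: std.pd_sum std.pd_cmult smooth_fc smooth_on_mult[OF open_D])
    then show ?case using Cons by simp
  qed simp
qed

lemma act_map_Some:
  "act (\<lambda>\<beta> k. stG k (Some a) \<beta> z) T (map Some is) = act (\<lambda>b c. \<Gamma>E c a b z) (\<lambda>js. T (map Some js)) is"
  by (induction "is" arbitrary: T) (simp_all add: sum_option stG.simps)

text \<open>Smoothness is known only for \<open>W\<close>, so \<open>T\<close> is first recovered
  from it through the dual frame. Its partial derivatives then become derivatives of
  \<open>W\<close>, and the Christoffel terms are carried over by \<open>fc_act\<close>.\<close>

lemma linked_nabla:
  assumes W: "\<And>is. smooth (W is)" and link: "linked n s T W"
  shows "linked (Suc n) s (nabla (G s) T) (cov W)"
  unfolding linked_def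
proof (intro allI impI)
  fix y and "is" :: "'n list" assume z: "(s, y) \<in> D" and "length is = Suc n"
  then obtain a js where js: "is = a # js" "length js = n" by (cases "is") auto
  define w where "w ks = W (map Some ks)" for ks
  have w: "smooth (w ks)" for ks unfolding w_def by (rule W)
  \<comment> \<open>The transpose of \<open>B\<close>: it maps frame components back to
    coordinates.\<close>
  let ?B = "\<lambda>k. (\<chi> a. B a $ k) :: real^'n"
  have B1: "(\<Sum>a\<in>UNIV. ?B k $ a * Fr a $ i) = (if k = i then 1 else 0)" for k i
    using dual'[of i k] by (auto simp: mult.commute)
  have B2: "(\<Sum>a\<in>UNIV. Fr k $ a * ?B a $ i) = (if k = i then 1 else 0)" for k i
    using dual[of i k] by (auto simp: mult.commute)
  have T: "T ks y = fc ?B (\<lambda>is. w is (s, y)) ks" if "(s, y) \<in> D" "length ks = n" for y ks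
  proof -
    have "T ks y = fc ?B (\<lambda>is. fc Fr (\<lambda>js. T js y) is) ks"
      by (rule fc_dual[OF B1, symmetric])
    also have "\<dots> = fc ?B (\<lambda>is. w is (s, y)) ks"
      using linkedD[OF link that(1)] that(2) by (intro fc_cong) (simp add: w_def)
    finally show ?thesis .
  qed
  have "fc Fr (\<lambda>ks. partial i (T ks) y) js = sd i (w js) (s, y)" for i
  proof -
    have "partial i (T ks) y = fc ?B (\<lambda>is. sd i (w is) (s, y)) ks" if "length ks = n" for ks
    proof -
      have "partial i (T ks) y = partial i (\<lambda>y. fc ?B (\<lambda>is. w is (s, y)) ks) y"
        using T that z by (intro partial_cong_slice) auto
      also have "\<dots> = sd i (\<lambda>z. fc ?B (\<lambda>is. w is z) ks) (s, y)"
        by (rule partial_slice[OF smooth_fc[OF w] z])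
      finally show ?thesis unfolding sd_fc[OF w z] .
    qed
    then have "fc Fr (\<lambda>ks. partial i (T ks) y) js = fc Fr (\<lambda>ks. fc ?B (\<lambda>is. sd i (w is) (s, y)) ks) js"
      using js by (intro fc_cong) simp
    also have "\<dots> = sd i (w js) (s, y)" by (rule fc_dual[OF B2])
    finally show ?thesis .
  qed
  then have 1: "(\<Sum>i\<in>UNIV. Fr a $ i * fc Fr (\<lambda>ks. partial i (T ks) y) js) = pd (Some a) (w js) (s, y)"
    unfolding pd_Some[OF w z] by simp
  have 2: "(\<Sum>i\<in>UNIV. Fr a $ i * fc Fr (\<lambda>ks. act (\<lambda>j l. christoffel (G s) l i j y) (\<lambda>ks. T ks y) ks) js)
    = act (\<lambda>b c. \<Gamma>E c a b (s, y)) (\<lambda>ks. w ks (s, y)) js"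
  proof -
    have "(\<Sum>i\<in>UNIV. Fr a $ i * fc Fr (\<lambda>ks. act (\<lambda>j l. christoffel (G s) l i j y) (\<lambda>ks. T ks y) ks) js)
      = fc Fr (\<lambda>ks. act (\<lambda>j l. \<Sum>i\<in>UNIV. Fr a $ i * christoffel (G s) l i j y) (\<lambda>ks. T ks y) ks) js"
      by (simp add: act_sum_matrix act_cmult_matrix fc_sum fc_cmult)
    also have "\<dots> = act (\<lambda>b c. \<Gamma>E c a b (s, y)) (\<lambda>ks. fc Fr (\<lambda>ks. T ks y) ks) js"
    proof (rule fc_act)
      fix b k
      have "(\<Sum>i\<in>UNIV. Fr b $ i * (\<Sum>j\<in>UNIV. Fr a $ j * christoffel (G s) k j i y)) = \<Gamma>F k a b (s, y)"
        unfolding \<Gamma>F_def by (subst sum.swap) (simp add: sum_distrib_left Cz_def mult_ac)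
      then show "(\<Sum>i\<in>UNIV. Fr b $ i * (\<Sum>j\<in>UNIV. Fr a $ j * christoffel (G s) k j i y)) = (\<Sum>c\<in>UNIV. \<Gamma>E c a b (s, y) * Fr c $ k)"
        unfolding \<Gamma>E_expand .
    qed
    also have "\<dots> = act (\<lambda>b c. \<Gamma>E c a b (s, y)) (\<lambda>ks. w ks (s, y)) js"
      using linkedD[OF link z] js by (intro act_cong_length) (simp add: w_def)
    finally show ?thesis .
  qed
  have "fc Fr (\<lambda>ks. nabla (G s) T ks y) (a # js)
    = (\<Sum>i\<in>UNIV. Fr a $ i * fc Fr (\<lambda>ks. partial i (T ks) y) js)
      - (\<Sum>i\<in>UNIV. Fr a $ i * fc Fr (\<lambda>ks. act (\<lambda>j l. christoffel (G s) l i j y) (\<lambda>ks. T ks y) ks) js)"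
    unfolding fc.simps nabla_act fc_diff by (simp add: right_diff_distrib sum_subtractf)
  then show "cov W (map Some is) (s, y) = fc Fr (\<lambda>ks. nabla (G s) T ks y) is"
    unfolding 1 2 js(1) by (simp add: cov.simps act_map_Some w_def)
qed

lemma linked_tr:
  "linked (Suc (Suc n)) s T W \<Longrightarrow> linked n s (\<lambda>is y. \<Sum>k\<in>UNIV. \<Sum>l\<in>UNIV. ginv (G s) k l y * T (k # l # is) y) (tr W)"
  unfolding linked_def tr_def
proof (intro allI impI)
  fix y and "is" :: "'n list" assume link: "\<forall>y is. (s, y) \<in> D \<longrightarrow> length is = Suc (Suc n) \<longrightarrow> W (map Some is) (s, y) = fc Fr (\<lambda>js. T js y) is"
    and z: "(s, y) \<in> D" and len: "length is = n"
  have "W (Some p # Some q # map Some is) (s, y) = fc Fr (\<lambda>js. T js y) (p # q # is)" for p q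
    using link[rule_format, OF z, of "p # q # is"] len by simp
  then show "(\<Sum>p\<in>UNIV. \<Sum>q\<in>UNIV. hE p q (s, y) * W (Some p # Some q # map Some is) (s, y))
    = fc Fr (\<lambda>js. \<Sum>k\<in>UNIV. \<Sum>l\<in>UNIV. ginv (G s) k l y * T (k # l # js) y) is"
    using contract_fc[of "(s, y)" "\<lambda>js. T js y" "is"] by (simp add: hz_def del: fc.simps)
qed

lemma linked_laplacian:
  assumes "\<And>is. smooth (W is)" "linked n s T W"
  shows "linked n s (laplacian (G s) T) (tr (cov (cov W)))"
proof -
  have "linked (Suc (Suc n)) s (nabla (G s) (nabla (G s) T)) (cov (cov W))"
    using assms by (intro linked_nabla smooth_cov)
  from linked_tr[OF this] show ?thesis by (simp add: linked_def laplacian_def)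
qed

end

section \<open>Ric, P and M of the chart as components of spacetime tensors\<close>

context chart_ricci_flow
begin

lemma linkedI2:
  "(\<And>y b c. (s, y) \<in> D \<Longrightarrow> W [Some b, Some c] (s, y) = fc Fr (\<lambda>js. T js y) [b, c]) \<Longrightarrow> linked 2 s T W"
  unfolding linked_def by (auto simp: numeral_eq_Suc length_Suc_conv)

lemma linked_Rm: "linked 4 s (Rm (G s)) Rl"
  unfolding linked_def length_4 using Rm_Rl by (auto simp del: fc.simps)

lemma linked_Ric: "linked 2 s (Ric (G s)) ricT"
  by (rule linkedI2) (simp add: ricT_spatial ricE_Ric del: fc.simps)

lemma linked_scal: "linked 0 s (scal (G s)) (tr ricT)"
proof -
  have "linked 0 s (\<lambda>is y. \<Sum>k\<in>UNIV. \<Sum>l\<in>UNIV. ginv (G s) k l y * Ric (G s) (k # l # is) y) (tr ricT)"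
    using linked_Ric by (intro linked_tr) (simp add: numeral_eq_Suc)
  then show ?thesis by (simp add: linked_def Defs.scal_def tensor0_def)
qed

lemma cov2_tr_ricT: "z \<in> D \<Longrightarrow> cov (cov (tr ricT)) [Some b, Some c] z = hessR b c z"
proof -
  assume z: "z \<in> D"
  have 1: "cov (tr ricT) [\<alpha>] z = pd \<alpha> scalE z" if "z \<in> D" for \<alpha> z
    using pd_cong[OF tr_ricT that] by (simp add: cov.simps)
  have "pd (Some b) (cov (tr ricT) [Some c]) z = pd (Some b) (pd (Some c) scalE) z"
    using 1 z by (intro pd_cong) auto
  then show ?thesis by (simp add: cov.simps(2)[of "cov (tr ricT)"] 1[OF z] sum_option stG.simps)
qed

definition PT :: "'n option list \<Rightarrow> real \<times> (real^'n) \<Rightarrow> real" where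
  "PT js = Rl [js!0, js!1, None, js!2]"

lemma smooth_PT: "smooth (PT is)"
  unfolding PT_def by (rule smooth_Rl)

lemma PT_simp: "PT [\<alpha>, \<beta>, \<gamma>] = Rm4 \<alpha> \<beta> None \<gamma>"
  by (simp add: PT_def numeral_eq_Suc)

lemma linked_P: "linked 3 s (harnack_P (G s)) PT"
  unfolding linked_def
proof (intro allI impI)
  fix y and "is" :: "'n list" assume z: "(s, y) \<in> D" and "length is = 3"
  then obtain a b c where js: "is = [a, b, c]" by (auto simp: numeral_eq_Suc length_Suc_conv)
  have nab: "cov ricT [Some a, Some b, Some c] (s, y) = fc Fr (\<lambda>js. nabla (G s) (Ric (G s)) js y) [a, b, c]" for a b c
    using linkedD[OF linked_nabla[OF smooth_ricT linked_Ric] z, of "[a, b, c]"] by (simp add: numeral_eq_Suc del: fc.simps)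
  have "fc Fr (\<lambda>js. harnack_P (G s) js y) [a, b, c] = fc Fr (\<lambda>js. nabla (G s) (Ric (G s)) js y) [a, b, c]
    - fc Fr (\<lambda>js. nabla (G s) (Ric (G s)) js y) [b, a, c]"
  proof -
    let ?N = "\<lambda>i j k. nabla (G s) (Ric (G s)) [i, j, k] y"
    have "(\<Sum>i\<in>UNIV. Fr a $ i * (\<Sum>j\<in>UNIV. Fr b $ j * (\<Sum>k\<in>UNIV. Fr c $ k * ?N j i k)))
      = (\<Sum>j\<in>UNIV. Fr b $ j * (\<Sum>i\<in>UNIV. Fr a $ i * (\<Sum>k\<in>UNIV. Fr c $ k * ?N j i k)))"
      unfolding sum_distrib_left by (subst sum.swap) (simp add: mult_ac)
    then show ?thesis
      by (simp add: harnack_P_def tensor3_def right_diff_distrib sum_subtractf del: nabla.simps)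
  qed
  then show "PT (map Some is) (s, y) = fc Fr (\<lambda>js. harnack_P (G s) js y) is"
    unfolding js nab[symmetric] using Rm4_None[OF z, of "Some a" "Some b" c] cov_rhoT_ricT[OF z]
      Rm4_skew34[OF z, of "Some a" "Some b" None "Some c"] by (simp add: PT_simp)
qed

lemma contract_prod:
  "(\<Sum>a\<in>UNIV. \<Sum>b\<in>UNIV. hE a b z * ((\<Sum>i\<in>UNIV. Fr a $ i * U i) * (\<Sum>j\<in>UNIV. Fr b $ j * V j)))
    = (\<Sum>i\<in>UNIV. \<Sum>j\<in>UNIV. hz i j z * (U i * V j))"
proof -
  have "(\<Sum>i\<in>UNIV. Fr a $ i * U i) * (\<Sum>j\<in>UNIV. Fr b $ j * V j) = (\<Sum>i\<in>UNIV. Fr a $ i * (\<Sum>j\<in>UNIV. Fr b $ j * (U i * V j)))" for a b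
    unfolding sum_product by (simp add: sum_distrib_left mult_ac)
  then show ?thesis by (simp only: contract_frame)
qed

lemma fc2_swap: "(\<Sum>i\<in>UNIV. Fr a $ i * (\<Sum>j\<in>UNIV. Fr b $ j * X i j)) = (\<Sum>j\<in>UNIV. Fr b $ j * (\<Sum>i\<in>UNIV. Fr a $ i * X i j))"
  unfolding sum_distrib_left by (subst sum.swap) (simp add: mult_ac)

lemma ric_ric:
  assumes z: "(s, y) \<in> D"
  shows "(\<Sum>k\<in>UNIV. \<Sum>l\<in>UNIV. hE k l (s, y) * (ricE b k (s, y) * ricE c l (s, y)))
    = fc Fr (\<lambda>js. tensor2 (\<lambda>i j x. \<Sum>k\<in>UNIV. \<Sum>l\<in>UNIV. ginv (G s) k l x * Ric (G s) [i, k] x * Ric (G s) [j, l] x) js y) [b, c]"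
proof -
  define U where "U b k = (\<Sum>i\<in>UNIV. Fr b $ i * Ric (G s) [i, k] y)" for b k
  have r: "ricE b k (s, y) = (\<Sum>i\<in>UNIV. Fr k $ i * U b i)" for b k
    unfolding ricE_Ric[OF z] U_def by (simp add: fc2_swap[of b k])
  have "(\<Sum>k\<in>UNIV. \<Sum>l\<in>UNIV. hE k l (s, y) * (ricE b k (s, y) * ricE c l (s, y))) = (\<Sum>k\<in>UNIV. \<Sum>l\<in>UNIV. hz k l (s, y) * (U b k * U c l))"
    unfolding r contract_prod ..
  also have "\<dots> = (\<Sum>k\<in>UNIV. \<Sum>l\<in>UNIV. \<Sum>i\<in>UNIV. \<Sum>j\<in>UNIV. Fr b $ i * (Fr c $ j * (hz k l (s, y) * Ric (G s) [i, k] y * Ric (G s) [j, l] y)))"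
    unfolding U_def sum_product by (simp add: sum_distrib_left mult_ac)
  also have "\<dots> = (\<Sum>i\<in>UNIV. \<Sum>j\<in>UNIV. \<Sum>k\<in>UNIV. \<Sum>l\<in>UNIV. Fr b $ i * (Fr c $ j * (hz k l (s, y) * Ric (G s) [i, k] y * Ric (G s) [j, l] y)))"
    by (rule sum_swap4)
  finally show ?thesis by (simp add: tensor2_def hz_def sum_distrib_left)
qed

text \<open>Matches the curvature term of \<open>Rm4_time_time\<close> with that of
  \<open>harnack_M\<close>. Both index pairs are reversed there, so no sign changes.\<close>

lemma rm_ric:
  assumes z: "(s, y) \<in> D"
  shows "(\<Sum>p\<in>UNIV. \<Sum>q\<in>UNIV. \<Sum>m\<in>UNIV. \<Sum>l\<in>UNIV. hE p q (s, y) * (hE m l (s, y) * (Rm4 (Some q) (Some b) (Some m) (Some c) (s, y) * ricE p l (s, y))))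
    = fc Fr (\<lambda>js. tensor2 (\<lambda>i j x. \<Sum>k\<in>UNIV. \<Sum>l\<in>UNIV. Rm (G s) [i, k, j, l] x * sharp (G s) (Ric (G s)) [k, l] x) js y) [b, c]"
proof -
  let ?z = "(s, y)"
  define R1 where "R1 j n = (\<Sum>a\<in>UNIV. Fr b $ a * (\<Sum>e\<in>UNIV. Fr c $ e * Rm (G s) [a, j, e, n] y))" for j n
  define U where "U q n = (\<Sum>j\<in>UNIV. Fr q $ j * R1 j n)" for q n
  define V where "V p k = (\<Sum>i\<in>UNIV. Fr p $ i * Ric (G s) [i, k] y)" for p k
  have R: "Rm4 (Some q) (Some b) (Some m) (Some c) ?z = (\<Sum>n\<in>UNIV. Fr m $ n * U q n)" for q m
  proof -
    have "Rm4 (Some q) (Some b) (Some m) (Some c) ?z = Rm4 (Some b) (Some q) (Some c) (Some m) ?z"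
      using Rm4_skew12[of "Some q" "Some b" "Some m" "Some c" ?z] Rm4_skew34[OF z, of "Some b" "Some q" "Some m" "Some c"] by simp
    also have "\<dots> = (\<Sum>a\<in>UNIV. \<Sum>j\<in>UNIV. \<Sum>e\<in>UNIV. \<Sum>n\<in>UNIV. Fr b $ a * (Fr q $ j * (Fr c $ e * (Fr m $ n * Rm (G s) [a, j, e, n] y))))"
      unfolding Rm_Rl[OF z] by (simp add: sum_distrib_left)
    also have "\<dots> = (\<Sum>a\<in>UNIV. \<Sum>j\<in>UNIV. \<Sum>n\<in>UNIV. \<Sum>e\<in>UNIV. Fr b $ a * (Fr q $ j * (Fr c $ e * (Fr m $ n * Rm (G s) [a, j, e, n] y))))"
      by (rule sum.cong[OF refl], rule sum.cong[OF refl], rule sum.swap)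
    also have "\<dots> = (\<Sum>j\<in>UNIV. \<Sum>n\<in>UNIV. \<Sum>a\<in>UNIV. \<Sum>e\<in>UNIV. Fr b $ a * (Fr q $ j * (Fr c $ e * (Fr m $ n * Rm (G s) [a, j, e, n] y))))"
      by (rule sum_swap3)
    also have "\<dots> = (\<Sum>n\<in>UNIV. \<Sum>j\<in>UNIV. \<Sum>a\<in>UNIV. \<Sum>e\<in>UNIV. Fr b $ a * (Fr q $ j * (Fr c $ e * (Fr m $ n * Rm (G s) [a, j, e, n] y))))"
      by (rule sum.swap)
    finally show ?thesis unfolding U_def R1_def sum_distrib_left by (simp add: mult_ac)
  qed
  have r: "ricE p l ?z = (\<Sum>k\<in>UNIV. Fr l $ k * V p k)" for p l
    unfolding ricE_Ric[OF z] V_def by (simp add: fc2_swap[of p l])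
  have "(\<Sum>p\<in>UNIV. \<Sum>q\<in>UNIV. \<Sum>m\<in>UNIV. \<Sum>l\<in>UNIV. hE p q ?z * (hE m l ?z * (Rm4 (Some q) (Some b) (Some m) (Some c) ?z * ricE p l ?z)))
    = (\<Sum>p\<in>UNIV. \<Sum>q\<in>UNIV. hE p q ?z * (\<Sum>n\<in>UNIV. \<Sum>k\<in>UNIV. hz n k ?z * (U q n * V p k)))"
    unfolding R r sum_distrib_left[symmetric] contract_prod ..
  also have "\<dots> = (\<Sum>p\<in>UNIV. \<Sum>q\<in>UNIV. \<Sum>n\<in>UNIV. \<Sum>k\<in>UNIV. hz n k ?z * (hE p q ?z * (V p k * U q n)))"
    by (simp add: sum_distrib_left mult_ac)
  also have "\<dots> = (\<Sum>n\<in>UNIV. \<Sum>k\<in>UNIV. \<Sum>p\<in>UNIV. \<Sum>q\<in>UNIV. hz n k ?z * (hE p q ?z * (V p k * U q n)))"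
    by (rule sum_swap4)
  also have "\<dots> = (\<Sum>n\<in>UNIV. \<Sum>k\<in>UNIV. hz n k ?z * (\<Sum>i\<in>UNIV. \<Sum>j\<in>UNIV. hz i j ?z * (Ric (G s) [i, k] y * R1 j n)))"
    unfolding sum_distrib_left[symmetric] U_def V_def contract_prod ..
  also have "\<dots> = (\<Sum>n\<in>UNIV. \<Sum>j\<in>UNIV. R1 j n * sharp (G s) (Ric (G s)) [j, n] y)"
  proof (rule sum.cong[OF refl])
    fix n
    have sh: "sharp (G s) (Ric (G s)) [j, n] y = (\<Sum>i\<in>UNIV. \<Sum>k\<in>UNIV. hz j i ?z * (hz n k ?z * Ric (G s) [i, k] y))" for j
      by (simp add: sharp_def hz_def ginv_def sum_distrib_left)
    have "(\<Sum>k\<in>UNIV. hz n k ?z * (\<Sum>i\<in>UNIV. \<Sum>j\<in>UNIV. hz i j ?z * (Ric (G s) [i, k] y * R1 j n)))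
      = (\<Sum>k\<in>UNIV. \<Sum>i\<in>UNIV. \<Sum>j\<in>UNIV. R1 j n * (hz j i ?z * (hz n k ?z * Ric (G s) [i, k] y)))"
      unfolding sum_distrib_left by (simp add: hz_sym[OF z] mult_ac)
    also have "\<dots> = (\<Sum>i\<in>UNIV. \<Sum>j\<in>UNIV. \<Sum>k\<in>UNIV. R1 j n * (hz j i ?z * (hz n k ?z * Ric (G s) [i, k] y)))"
      by (rule sum_swap3)
    also have "\<dots> = (\<Sum>j\<in>UNIV. \<Sum>i\<in>UNIV. \<Sum>k\<in>UNIV. R1 j n * (hz j i ?z * (hz n k ?z * Ric (G s) [i, k] y)))"
      by (rule sum.swap)
    finally show "(\<Sum>k\<in>UNIV. hz n k ?z * (\<Sum>i\<in>UNIV. \<Sum>j\<in>UNIV. hz i j ?z * (Ric (G s) [i, k] y * R1 j n)))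
      = (\<Sum>j\<in>UNIV. R1 j n * sharp (G s) (Ric (G s)) [j, n] y)" unfolding sh by (simp add: sum_distrib_left)
  qed
  also have "\<dots> = (\<Sum>j\<in>UNIV. \<Sum>n\<in>UNIV. \<Sum>a\<in>UNIV. \<Sum>e\<in>UNIV. Fr b $ a * (Fr c $ e * (Rm (G s) [a, j, e, n] y * sharp (G s) (Ric (G s)) [j, n] y)))"
    unfolding R1_def by (subst sum.swap) (simp add: sum_distrib_right sum_distrib_left mult.assoc)
  also have "\<dots> = (\<Sum>a\<in>UNIV. \<Sum>e\<in>UNIV. \<Sum>j\<in>UNIV. \<Sum>n\<in>UNIV. Fr b $ a * (Fr c $ e * (Rm (G s) [a, j, e, n] y * sharp (G s) (Ric (G s)) [j, n] y)))"
    by (rule sum_swap4)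
  finally show ?thesis by (simp add: tensor2_def sum_distrib_left)
qed

lemma linked_M:
  assumes W: "\<And>b c z. W [Some b, Some c] z = Rm4 None (Some b) None (Some c) z + 1 / (2 * \<tau>) * ricE b c z"
  shows "linked 2 s (harnack_M \<tau> (G s)) W"
proof (rule linkedI2)
  fix y b c assume z: "(s, y) \<in> D"
  let ?R = "tensor2 (\<lambda>i j x. \<Sum>k\<in>UNIV. \<Sum>l\<in>UNIV. Rm (G s) [i, k, j, l] x * sharp (G s) (Ric (G s)) [k, l] x)"
  let ?Q = "tensor2 (\<lambda>i j x. \<Sum>k\<in>UNIV. \<Sum>l\<in>UNIV. ginv (G s) k l x * Ric (G s) [i, k] x * Ric (G s) [j, l] x)"
  have "fc Fr (\<lambda>js. harnack_M \<tau> (G s) js y) [b, c] = fc Fr (\<lambda>js. laplacian (G s) (Ric (G s)) js y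
      - (1/2) * nabla (G s) (nabla (G s) (scal (G s))) js y + 2 * ?R js y - ?Q js y + 1 / (2 * \<tau>) * Ric (G s) js y) [b, c]"
    by (rule fc_cong) (auto simp: harnack_M_def tensor2_def numeral_eq_Suc length_Suc_conv simp del: nabla.simps)
  also have "\<dots> = fc Fr (\<lambda>js. laplacian (G s) (Ric (G s)) js y) [b, c]
      - (1/2) * fc Fr (\<lambda>js. nabla (G s) (nabla (G s) (scal (G s))) js y) [b, c]
      + 2 * fc Fr (\<lambda>js. ?R js y) [b, c] - fc Fr (\<lambda>js. ?Q js y) [b, c] + 1 / (2 * \<tau>) * fc Fr (\<lambda>js. Ric (G s) js y) [b, c]"
    unfolding fc_add fc_diff fc_cmult ..
  also have "fc Fr (\<lambda>js. laplacian (G s) (Ric (G s)) js y) [b, c] = tr (cov (cov ricT)) [Some b, Some c] (s, y)"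
    using linkedD[OF linked_laplacian[OF smooth_ricT linked_Ric] z, of "[b, c]"] by simp
  also have "fc Fr (\<lambda>js. nabla (G s) (nabla (G s) (scal (G s))) js y) [b, c] = hessR b c (s, y)"
    using linkedD[OF linked_nabla[OF smooth_cov[OF smooth_tr[OF smooth_ricT]] linked_nabla[OF smooth_tr[OF smooth_ricT] linked_scal]] z, of "[b, c]"]
    by (simp add: cov2_tr_ricT[OF z] del: fc.simps nabla.simps)
  finally show "W [Some b, Some c] (s, y) = fc Fr (\<lambda>js. harnack_M \<tau> (G s) js y) [b, c]"
    unfolding W Rm4_time_time[OF z] rm_ric[OF z, symmetric] ric_ric[OF z, symmetric] ricE_Ric[OF z, symmetric] tr_def by simp
qed

end

section \<open>The inverse of the curvature operator\<close>

abbreviation (input) \<delta> :: "'n \<Rightarrow> 'n \<Rightarrow> real" where "\<delta> i j \<equiv> if i = j then 1 else 0"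

lemma pairing1:
  fixes F B :: "'n::finite \<Rightarrow> real^'n"
  assumes "\<And>p q. (\<Sum>i\<in>UNIV. F i $ p * B i $ q) = \<delta> p q"
  shows "(\<Sum>i\<in>UNIV. (\<Sum>p\<in>UNIV. F i $ p * u p) * (\<Sum>q\<in>UNIV. B i $ q * v q)) = (\<Sum>p\<in>UNIV. u p * v p)"
proof -
  have "(\<Sum>i\<in>UNIV. (\<Sum>p\<in>UNIV. F i $ p * u p) * (\<Sum>q\<in>UNIV. B i $ q * v q))
    = (\<Sum>i\<in>UNIV. \<Sum>p\<in>UNIV. \<Sum>q\<in>UNIV. u p * (v q * (F i $ p * B i $ q)))"
    unfolding sum_product by (simp add: mult_ac)
  also have "\<dots> = (\<Sum>p\<in>UNIV. \<Sum>q\<in>UNIV. \<Sum>i\<in>UNIV. u p * (v q * (F i $ p * B i $ q)))" by (rule sum_swap3)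
  also have "\<dots> = (\<Sum>p\<in>UNIV. u p * (\<Sum>q\<in>UNIV. v q * \<delta> p q))"
    unfolding sum_distrib_left[symmetric] assms ..
  finally show ?thesis by (simp add: if_distrib[of "\<lambda>x. _ * x"] cong: if_cong)
qed

lemma pairing2:
  fixes F B :: "'n::finite \<Rightarrow> real^'n"
  assumes FB: "\<And>p q. (\<Sum>i\<in>UNIV. F i $ p * B i $ q) = \<delta> p q"
  shows "(\<Sum>i\<in>UNIV. \<Sum>j\<in>UNIV. (\<Sum>p\<in>UNIV. F i $ p * (\<Sum>q\<in>UNIV. F j $ q * U p q)) * (\<Sum>p\<in>UNIV. B i $ p * (\<Sum>q\<in>UNIV. B j $ q * V p q)))
    = (\<Sum>p\<in>UNIV. \<Sum>q\<in>UNIV. U p q * V p q)"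
proof -
  have "(\<Sum>i\<in>UNIV. \<Sum>j\<in>UNIV. (\<Sum>p\<in>UNIV. F i $ p * (\<Sum>q\<in>UNIV. F j $ q * U p q)) * (\<Sum>p\<in>UNIV. B i $ p * (\<Sum>q\<in>UNIV. B j $ q * V p q)))
    = (\<Sum>j\<in>UNIV. \<Sum>i\<in>UNIV. (\<Sum>p\<in>UNIV. F i $ p * (\<Sum>q\<in>UNIV. F j $ q * U p q)) * (\<Sum>p\<in>UNIV. B i $ p * (\<Sum>q\<in>UNIV. B j $ q * V p q)))"
    by (rule sum.swap)
  also have "\<dots> = (\<Sum>j\<in>UNIV. \<Sum>p\<in>UNIV. (\<Sum>q\<in>UNIV. F j $ q * U p q) * (\<Sum>q\<in>UNIV. B j $ q * V p q))"
    unfolding pairing1[OF FB] ..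
  also have "\<dots> = (\<Sum>p\<in>UNIV. \<Sum>j\<in>UNIV. (\<Sum>q\<in>UNIV. F j $ q * U p q) * (\<Sum>q\<in>UNIV. B j $ q * V p q))"
    by (rule sum.swap)
  finally show ?thesis unfolding pairing1[OF FB] .
qed

text \<open>
  The operator \<open>R + sym\<close> acts on all two-tensors and, unlike \<open>R\<close>, has an inverse \<open>A\<close> there; the
  antisymmetric part \<open>Sh\<close> of \<open>A\<close> inverts \<open>R\<close> on two-forms.
\<close>

locale curvature_matrix_inverse =
  fixes g :: "'n::finite \<Rightarrow> 'n \<Rightarrow> real" and R A :: "'n \<Rightarrow> 'n \<Rightarrow> 'n \<Rightarrow> 'n \<Rightarrow> real"
  assumes R12: "R j i k l = - R i j k l" and Rpair: "R k l i j = R i j k l"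
    and A_left: "(\<Sum>p\<in>UNIV. \<Sum>q\<in>UNIV. A i j p q * (R p q k l + (g p k * g q l + g p l * g q k) / 2)) = \<delta> i k * \<delta> j l"
    and A_right: "(\<Sum>p\<in>UNIV. \<Sum>q\<in>UNIV. (R i j p q + (g i p * g j q + g i q * g j p) / 2) * A p q k l) = \<delta> i k * \<delta> j l"
begin

definition Sh where "Sh i j k l = (A i j k l - A i j l k) / 2"

lemma R34: "R i j l k = - R i j k l"
  using Rpair[of l k i j] Rpair[of k l i j] R12[of k l i j] by simp

text \<open>The symmetric summand annihilates two-forms, on which the operator is therefore
  \<open>R\<close>; its right inverse \<open>A\<close> then gives injectivity.\<close>

lemma two_form_eq_0:
  assumes v: "\<And>i j. v j i = - v i j" and 0: "\<And>k l. (\<Sum>p\<in>UNIV. \<Sum>q\<in>UNIV. v p q * R p q k l) = 0"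
  shows "v i j = 0"
proof -
  have 1: "(\<Sum>p\<in>UNIV. \<Sum>q\<in>UNIV. v p q * (R p q k l + (g p k * g q l + g p l * g q k) / 2)) = 0" for k l
  proof -
    have "(\<Sum>p\<in>UNIV. \<Sum>q\<in>UNIV. v p q * (g p l * g q k)) = (\<Sum>q\<in>UNIV. \<Sum>p\<in>UNIV. v p q * (g p l * g q k))" by (rule sum.swap)
    also have "\<dots> = - (\<Sum>p\<in>UNIV. \<Sum>q\<in>UNIV. v p q * (g p k * g q l))"
    proof -
      have "v p q * (g p l * g q k) = - (v q p * (g q k * g p l))" for p q using v[of q p] by simp
      then show ?thesis by (simp only: sum_negf)
    qed
    finally have 2: "(\<Sum>p\<in>UNIV. \<Sum>q\<in>UNIV. v p q * (g p l * g q k)) = - (\<Sum>p\<in>UNIV. \<Sum>q\<in>UNIV. v p q * (g p k * g q l))" .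
    have "(\<Sum>p\<in>UNIV. \<Sum>q\<in>UNIV. v p q * (R p q k l + (g p k * g q l + g p l * g q k) / 2))
      = (\<Sum>p\<in>UNIV. \<Sum>q\<in>UNIV. v p q * R p q k l) + ((\<Sum>p\<in>UNIV. \<Sum>q\<in>UNIV. v p q * (g p k * g q l)) + (\<Sum>p\<in>UNIV. \<Sum>q\<in>UNIV. v p q * (g p l * g q k))) / 2"
      by (simp add: distrib_left add_divide_distrib sum.distrib sum_divide_distrib)
    then show ?thesis using 0 2 by simp
  qed
  have "v i j = (\<Sum>p\<in>UNIV. \<Sum>q\<in>UNIV. v p q * (\<delta> i p * \<delta> j q))" by (rule delta_sum2[symmetric])
  also have "\<dots> = (\<Sum>p\<in>UNIV. \<Sum>q\<in>UNIV. v p q * (\<Sum>k\<in>UNIV. \<Sum>l\<in>UNIV. (R p q k l + (g p k * g q l + g p l * g q k) / 2) * A k l i j))"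
    unfolding A_right by (simp add: eq_commute)
  also have "\<dots> = (\<Sum>k\<in>UNIV. \<Sum>l\<in>UNIV. (\<Sum>p\<in>UNIV. \<Sum>q\<in>UNIV. v p q * (R p q k l + (g p k * g q l + g p l * g q k) / 2)) * A k l i j)"
    unfolding sum_distrib_left sum_distrib_right mult.assoc by (rule sum_swap4)
  finally show ?thesis unfolding 1 by simp
qed

lemma Sh_R: "(\<Sum>p\<in>UNIV. \<Sum>q\<in>UNIV. Sh i j p q * R p q k l) = (\<delta> i k * \<delta> j l - \<delta> i l * \<delta> j k) / 2"
proof -
  \<comment> \<open>Exchanging \<open>k\<close> and \<open>l\<close> and subtracting removes the
    symmetric summand and doubles \<open>R\<close>.\<close>
  have "(\<Sum>p\<in>UNIV. \<Sum>q\<in>UNIV. A i j p q * (R p q k l + (g p k * g q l + g p l * g q k) / 2))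
      - (\<Sum>p\<in>UNIV. \<Sum>q\<in>UNIV. A i j p q * (R p q l k + (g p l * g q k + g p k * g q l) / 2)) = 2 * (\<Sum>p\<in>UNIV. \<Sum>q\<in>UNIV. A i j p q * R p q k l)"
    unfolding sum_subtractf[symmetric] sum_distrib_left
    by (intro sum.cong refl) (simp add: R34[of _ _ l k] algebra_simps)
  then have AR: "(\<Sum>p\<in>UNIV. \<Sum>q\<in>UNIV. A i j p q * R p q k l) = (\<delta> i k * \<delta> j l - \<delta> i l * \<delta> j k) / 2"
    unfolding A_left by simp
  have "(\<Sum>p\<in>UNIV. \<Sum>q\<in>UNIV. A i j q p * R p q k l) = (\<Sum>q\<in>UNIV. \<Sum>p\<in>UNIV. A i j q p * R p q k l)" by (rule sum.swap)
  also have "\<dots> = - (\<Sum>p\<in>UNIV. \<Sum>q\<in>UNIV. A i j p q * R p q k l)"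
  proof -
    have "A i j q p * R p q k l = - (A i j q p * R q p k l)" for p q using R12[of p q k l] by simp
    then show ?thesis by (simp only: sum_negf)
  qed
  finally have "(\<Sum>p\<in>UNIV. \<Sum>q\<in>UNIV. A i j q p * R p q k l) = - (\<Sum>p\<in>UNIV. \<Sum>q\<in>UNIV. A i j p q * R p q k l)" .
  moreover have "(\<Sum>p\<in>UNIV. \<Sum>q\<in>UNIV. Sh i j p q * R p q k l)
    = ((\<Sum>p\<in>UNIV. \<Sum>q\<in>UNIV. A i j p q * R p q k l) - (\<Sum>p\<in>UNIV. \<Sum>q\<in>UNIV. A i j q p * R p q k l)) / 2"
    unfolding Sh_def by (simp add: left_diff_distrib sum_subtractf sum_divide_distrib diff_divide_distrib)
  ultimately show ?thesis unfolding AR by simp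
qed

lemma Sh34: "Sh i j l k = - Sh i j k l"
  by (simp add: Sh_def field_simps)

text \<open>Skewness in the first pair is not visible in the definition; the symmetric part is a
  two-form in the last pair that \<open>R\<close> annihilates.\<close>

lemma Sh12: "Sh j i k l = - Sh i j k l"
proof -
  have "Sh i j k l + Sh j i k l = 0"
  proof (rule two_form_eq_0)
    show "Sh i j l k + Sh j i l k = - (Sh i j k l + Sh j i k l)" for k l using Sh34[of i j l k] Sh34[of j i l k] by simp
    show "(\<Sum>p\<in>UNIV. \<Sum>q\<in>UNIV. (Sh i j p q + Sh j i p q) * R p q k l) = 0" for k l
      by (simp add: distrib_right sum.distrib Sh_R)
  qed
  then show ?thesis by simp
qed

lemma antisymmetrizer:
  fixes w :: "'n \<Rightarrow> 'n \<Rightarrow> real"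
  assumes w: "\<And>i j. w j i = - w i j"
  shows "(\<Sum>r\<in>UNIV. \<Sum>s\<in>UNIV. (\<delta> i r * \<delta> j s - \<delta> i s * \<delta> j r) / 2 * w r s) = w i j"
proof -
  have "(\<Sum>r\<in>UNIV. \<Sum>s\<in>UNIV. (\<delta> i r * \<delta> j s - \<delta> i s * \<delta> j r) / 2 * w r s)
    = ((\<Sum>r\<in>UNIV. \<Sum>s\<in>UNIV. w r s * (\<delta> i r * \<delta> j s)) - (\<Sum>r\<in>UNIV. \<Sum>s\<in>UNIV. w r s * (\<delta> j r * \<delta> i s))) / 2"
    unfolding sum_subtractf[symmetric] sum_divide_distrib by (intro sum.cong refl) (simp add: algebra_simps)
  also have "\<dots> = w i j" unfolding delta_sum2 using w[of i j] by simp
  finally show ?thesis .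
qed

text \<open>The product \<open>S R S\<close> can be evaluated from either side, and it is symmetric
  because \<open>R\<close> is.\<close>

lemma Sh_pair: "Sh k l i j = Sh i j k l"
proof -
  have "(\<Sum>r\<in>UNIV. \<Sum>s\<in>UNIV. (\<Sum>p\<in>UNIV. \<Sum>q\<in>UNIV. Sh i j p q * R p q r s) * Sh k l r s) = Sh k l i j"
    unfolding Sh_R by (rule antisymmetrizer) (rule Sh34)
  moreover have "(\<Sum>r\<in>UNIV. \<Sum>s\<in>UNIV. (\<Sum>p\<in>UNIV. \<Sum>q\<in>UNIV. Sh i j p q * R p q r s) * Sh k l r s)
    = (\<Sum>p\<in>UNIV. \<Sum>q\<in>UNIV. (\<Sum>r\<in>UNIV. \<Sum>s\<in>UNIV. Sh k l r s * R r s p q) * Sh i j p q)"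
    unfolding sum_distrib_right by (subst sum_swap4) (simp add: Rpair mult_ac)
  moreover have "(\<Sum>p\<in>UNIV. \<Sum>q\<in>UNIV. (\<Sum>r\<in>UNIV. \<Sum>s\<in>UNIV. Sh k l r s * R r s p q) * Sh i j p q) = Sh i j k l"
    unfolding Sh_R by (rule antisymmetrizer) (rule Sh34)
  ultimately show ?thesis by simp
qed

end

lemma sum_UNIV_prod: "(\<Sum>x\<in>UNIV. f x) = (\<Sum>i\<in>UNIV. \<Sum>j\<in>UNIV. f (i, j))" for f :: "'n::finite \<times> 'n \<Rightarrow> real"
  unfolding UNIV_Times_UNIV[symmetric] by (simp add: sum.cartesian_product split_def)

lemma fc_skew12:
  assumes "\<And>i j k l. w [j, i, k, l] = - w [i, j, k, l]" shows "fc F w [b, a, c, d] = - fc F w [a, b, c, d]"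
proof -
  have sk: "fc F (\<lambda>js. w (j # i # js)) [c, d] = - fc F (\<lambda>js. w (i # j # js)) [c, d]" for i j
    unfolding fc.simps assms[of i j] by (simp add: sum_negf)
  have e: "F b $ i * (F a $ j * fc F (\<lambda>js. w (i # j # js)) [c, d]) = - (F a $ j * (F b $ i * fc F (\<lambda>js. w (j # i # js)) [c, d]))" for i j
    unfolding sk[of i j] by (simp add: mult.left_commute del: fc.simps)
  have "fc F w [b, a, c, d] = (\<Sum>i\<in>UNIV. \<Sum>j\<in>UNIV. F b $ i * (F a $ j * fc F (\<lambda>js. w (i # j # js)) [c, d]))"
    by (simp only: fc.simps(2)[of _ _ b] fc.simps(2)[of _ _ a] sum_distrib_left)
  also have "\<dots> = (\<Sum>j\<in>UNIV. \<Sum>i\<in>UNIV. F b $ i * (F a $ j * fc F (\<lambda>js. w (i # j # js)) [c, d]))" by (rule sum.swap)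
  also have "\<dots> = - (\<Sum>j\<in>UNIV. \<Sum>i\<in>UNIV. F a $ j * (F b $ i * fc F (\<lambda>js. w (j # i # js)) [c, d]))"
    unfolding e by (simp only: sum_negf)
  finally show ?thesis by (simp only: fc.simps(2)[of _ _ b] fc.simps(2)[of _ _ a] sum_distrib_left)
qed

lemma fc_pair:
  assumes "\<And>i j k l. w [k, l, i, j] = w [i, j, k, l]" shows "fc F w [c, d, a, b] = fc F w [a, b, c, d]"
  by (simp add: sum_distrib_left) (subst sum_swap4, simp add: assms mult_ac)

section \<open>Smoothness of the inverse curvature operator\<close>

context chart_ricci_flow
begin

abbreviation (input) Bd :: "'n \<Rightarrow> real^'n" where "Bd \<equiv> \<lambda>k. \<chi> a. B a $ k"

lemma coordinate_components:
  assumes "linked n s T W" "(s, y) \<in> D" "length ks = n"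
  shows "T ks y = fc Bd (\<lambda>is. W (map Some is) (s, y)) ks"
proof -
  have "(\<Sum>a\<in>UNIV. Bd k $ a * Fr a $ i) = \<delta> k i" for k i
    using dual'[of i k] by (auto simp: mult.commute)
  then have "T ks y = fc Bd (\<lambda>is. fc Fr (\<lambda>js. T js y) is) ks" by (rule fc_dual[symmetric])
  also have "\<dots> = fc Bd (\<lambda>is. W (map Some is) (s, y)) ks"
    using linkedD[OF assms(1,2)] assms(3) by (intro fc_cong) simp
  finally show ?thesis .
qed

definition Rz where "Rz i j k l z = Rm (G (fst z)) [i, j, k, l] (snd z)"

lemma Rz_eq: "z \<in> D \<Longrightarrow> Rz i j k l z = fc Bd (\<lambda>is. Rl (map Some is) z) [i, j, k, l]"
  using coordinate_components[OF linked_Rm, of "fst z" "snd z" "[i, j, k, l]"] by (simp add: Rz_def del: fc.simps)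

lemma smooth_Rz: "smooth (Rz i j k l)"
proof -
  have "smooth (\<lambda>z. fc Bd (\<lambda>is. Rl (map Some is) z) [i, j, k, l])" by (rule smooth_fc) (rule smooth_Rl)
  then show ?thesis by (subst smooth_on_cong[OF open_D Rz_eq])
qed

lemma Rz_skew12:
  assumes z: "z \<in> D" shows "Rz j i k l z = - Rz i j k l z"
  unfolding Rz_eq[OF z] by (rule fc_skew12) (simp only: list.map Rl_simp, rule Rm4_skew12)

lemma Rz_pair:
  assumes z: "z \<in> D" shows "Rz k l i j z = Rz i j k l z"
  unfolding Rz_eq[OF z] by (rule fc_pair) (simp only: list.map Rl_simp, rule Rm4_pair[OF z])

text \<open>The curvature plus the symmetrizer as a square matrix indexed by pairs, all indices
  being lower coordinate indices. Unlike Rm it can be invertible on all two-tensors, so Cramer's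
  rule applies.\<close>

definition MM :: "real \<times> (real^'n) \<Rightarrow> real^('n \<times> 'n)^('n \<times> 'n)" where
  "MM z = (\<chi> p q. Rz (fst p) (snd p) (fst q) (snd q) z
     + (gz (fst p) (fst q) z * gz (snd p) (snd q) z + gz (fst p) (snd q) z * gz (snd p) (fst q) z) / 2)"

lemma smooth_MM: "smooth (\<lambda>z. MM z $ p $ q)"
proof -
  have "smooth (\<lambda>z. Rz (fst p) (snd p) (fst q) (snd q) z
     + (1/2) * (gz (fst p) (fst q) z * gz (snd p) (snd q) z + gz (fst p) (snd q) z * gz (snd p) (fst q) z))"
    by (intro smooth_intros smooth_on_const smooth_Rz smooth_gz)
  then show ?thesis by (simp add: MM_def)
qed

end

locale chart_harnack = chart_ricci_flow +
  assumes MM_inv: "z \<in> D \<Longrightarrow> invertible (MM z)"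
begin

definition AA where "AA i j k l z = matrix_inv (MM z) $ (i, j) $ (k, l)"

lemma smooth_AA: "smooth (AA i j k l)"
  unfolding AA_def by (rule smooth_on_matrix_inv[OF open_D smooth_MM MM_inv])

lemma inverse_at: "z \<in> D \<Longrightarrow> curvature_matrix_inverse (\<lambda>i j. gz i j z) (\<lambda>i j k l. Rz i j k l z) (\<lambda>i j k l. AA i j k l z)"
proof -
  assume z: "z \<in> D"
  have id: "(mat 1 :: real^('a \<times> 'a)^('a \<times> 'a)) $ (i, j) $ (k, l) = \<delta> i k * \<delta> j l" for i j k l
    by (simp add: mat_def)
  have M: "MM z $ (p, q) $ (k, l) = Rz p q k l z + (gz p k z * gz q l z + gz p l z * gz q k z) / 2" for p q k l
    by (simp add: MM_def)
  have prod: "(X ** Y) $ x $ y = (\<Sum>p\<in>UNIV. \<Sum>q\<in>UNIV. X $ x $ (p, q) * Y $ (p, q) $ y)" for X Y :: "real^('a \<times> 'a)^('a \<times> 'a)" and x y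
    by (simp add: matrix_matrix_mult_def sum_UNIV_prod)
  show ?thesis
  proof
    show "Rz j i k l z = - Rz i j k l z" "Rz k l i j z = Rz i j k l z" for i j k l
      by (rule Rz_skew12[OF z], rule Rz_pair[OF z])
    show "(\<Sum>p\<in>UNIV. \<Sum>q\<in>UNIV. AA i j p q z * (Rz p q k l z + (gz p k z * gz q l z + gz p l z * gz q k z) / 2)) = \<delta> i k * \<delta> j l" for i j k l
      unfolding AA_def M[symmetric] prod[symmetric] matrix_inv_left[OF MM_inv[OF z]] by (rule id)
    show "(\<Sum>p\<in>UNIV. \<Sum>q\<in>UNIV. (Rz i j p q z + (gz i p z * gz j q z + gz i q z * gz j p z) / 2) * AA p q k l z) = \<delta> i k * \<delta> j l" for i j k l
      unfolding AA_def M[symmetric] prod[symmetric] matrix_inv_right[OF MM_inv[OF z]] by (rule id)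
  qed
qed

text \<open>As part of the inverse of a matrix with lower indices it carries upper ones: it is
  \<open>curvature_inverse\<close> with all indices raised.\<close>

definition Sz where "Sz i j k l z = (AA i j k l z - AA i j l k z) / 2"

lemma smooth_Sz: "smooth (Sz i j k l)"
proof -
  have "smooth (\<lambda>z. (1/2) * (AA i j k l z - AA i j l k z))" by (intro smooth_intros smooth_on_const smooth_AA)
  then show ?thesis by (simp add: Sz_def[abs_def])
qed

lemma Sz_props:
  assumes z: "z \<in> D"
  shows "Sz j i k l z = - Sz i j k l z" "Sz i j l k z = - Sz i j k l z" "Sz k l i j z = Sz i j k l z"
    "(\<Sum>p\<in>UNIV. \<Sum>q\<in>UNIV. Sz i j p q z * Rz p q k l z) = (\<delta> i k * \<delta> j l - \<delta> i l * \<delta> j k) / 2"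
proof -
  interpret c: curvature_matrix_inverse "\<lambda>i j. gz i j z" "\<lambda>i j k l. Rz i j k l z" "\<lambda>i j k l. AA i j k l z"
    by (rule inverse_at[OF z])
  have S: "Sz i j k l z = c.Sh i j k l" for i j k l by (simp add: Sz_def c.Sh_def)
  show "Sz j i k l z = - Sz i j k l z" "Sz i j l k z = - Sz i j k l z" "Sz k l i j z = Sz i j k l z"
    "(\<Sum>p\<in>UNIV. \<Sum>q\<in>UNIV. Sz i j p q z * Rz p q k l z) = (\<delta> i k * \<delta> j l - \<delta> i l * \<delta> j k) / 2"
    unfolding S by (rule c.Sh12, rule c.Sh34, rule c.Sh_pair, rule c.Sh_R)
qed

definition ST where "ST is = (case is of [i, j, k, l] \<Rightarrow> Sz i j k l | _ \<Rightarrow> (\<lambda>_. 0))"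

lemma ST_simp [simp]: "ST [i, j, k, l] = Sz i j k l"
  by (simp add: ST_def)

lemma smooth_ST: "smooth (ST is)"
  by (auto simp: ST_def smooth_Sz smooth_on_const split: list.split)

abbreviation (input) grow :: "real \<Rightarrow> real^'a \<Rightarrow> 'a \<Rightarrow> real^'a" where "grow s y \<equiv> \<lambda>i. G s y $ i"
abbreviation (input) hrow :: "real \<Rightarrow> real^'a \<Rightarrow> 'a \<Rightarrow> real^'a" where "hrow s y \<equiv> \<lambda>i. matrix_inv (G s y) $ i"

text \<open>Existence and uniqueness at once, which resolves the description in
  \<open>curvature_inverse\<close>: \<open>Sz\<close> with its indices lowered is an inverse, and
  the difference from any other inverse is a two-form annihilated by the curvature.\<close>

lemma is_curvature_inverse_iff:
  assumes z: "(s, y) \<in> D"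
  shows "is_curvature_inverse (G s) y S \<longleftrightarrow> S = (\<lambda>i j k l. fc (grow s y) (\<lambda>js. ST js (s, y)) [i, j, k, l])"
proof -
  let ?z = "(s, y)"
  let ?L = "\<lambda>i j k l. fc (grow s y) (\<lambda>js. ST js ?z) [i, j, k, l]"
  interpret c: curvature_matrix_inverse "\<lambda>i j. gz i j ?z" "\<lambda>i j k l. Rz i j k l ?z" "\<lambda>i j k l. AA i j k l ?z"
    by (rule inverse_at[OF z])
  have gh: "(\<Sum>i\<in>UNIV. grow s y i $ p * hrow s y i $ q) = \<delta> p q" for p q
    using gz_hz[OF z, of p q] gz_sym[OF z, of p] by (simp add: gz_def hz_def ginv_def)
  have hg': "(\<Sum>a\<in>UNIV. grow s y k $ a * hrow s y a $ i) = \<delta> k i" for k i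
    using gz_hz[OF z, of k i] by (simp add: gz_def hz_def ginv_def)
  have contr: "(\<Sum>p\<in>UNIV. \<Sum>q\<in>UNIV. \<Sum>r\<in>UNIV. \<Sum>t\<in>UNIV. S i j p q * ginv (G s) p r y * ginv (G s) q t y * Rm (G s) [r, t, k, l] y)
    = (\<Sum>p\<in>UNIV. \<Sum>q\<in>UNIV. S i j p q * (\<Sum>r\<in>UNIV. hrow s y p $ r * (\<Sum>t\<in>UNIV. hrow s y q $ t * Rz r t k l ?z)))" for S i j k l
    by (simp add: Rz_def ginv_def sum_distrib_left mult_ac)
  have L_skew: "?L j i k l = - ?L i j k l" for i j k l
    by (rule fc_skew12) (simp only: ST_simp, rule Sz_props(1)[OF z])
  have L_pair: "?L k l i j = ?L i j k l" for i j k l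
    by (rule fc_pair) (simp only: ST_simp, rule Sz_props(3)[OF z])
  have L_R: "(\<Sum>p\<in>UNIV. \<Sum>q\<in>UNIV. ?L i j p q * (\<Sum>r\<in>UNIV. hrow s y p $ r * (\<Sum>t\<in>UNIV. hrow s y q $ t * Rz r t k l ?z)))
    = (gz i k ?z * gz j l ?z - gz i l ?z * gz j k ?z) / 2" for i j k l
  proof -
    define U where "U c d = (\<Sum>a\<in>UNIV. grow s y i $ a * (\<Sum>b\<in>UNIV. grow s y j $ b * Sz c d a b ?z))" for c d
    have "?L i j p q = (\<Sum>c\<in>UNIV. grow s y p $ c * (\<Sum>d\<in>UNIV. grow s y q $ d * U c d))" for p q
      unfolding L_pair[of i j p q] U_def by simp
    then have "(\<Sum>p\<in>UNIV. \<Sum>q\<in>UNIV. ?L i j p q * (\<Sum>r\<in>UNIV. hrow s y p $ r * (\<Sum>t\<in>UNIV. hrow s y q $ t * Rz r t k l ?z)))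
      = (\<Sum>c\<in>UNIV. \<Sum>d\<in>UNIV. U c d * Rz c d k l ?z)"
      by (simp only: pairing2[OF gh])
    also have "\<dots> = (\<Sum>a\<in>UNIV. \<Sum>b\<in>UNIV. grow s y i $ a * (grow s y j $ b * (\<Sum>c\<in>UNIV. \<Sum>d\<in>UNIV. Sz a b c d ?z * Rz c d k l ?z)))"
      unfolding U_def sum_distrib_left sum_distrib_right by (subst sum_swap4) (simp add: Sz_props(3)[OF z] mult_ac)
    also have "\<dots> = ((\<Sum>a\<in>UNIV. \<Sum>b\<in>UNIV. (gz i a ?z * gz j b ?z) * (\<delta> k a * \<delta> l b)) - (\<Sum>a\<in>UNIV. \<Sum>b\<in>UNIV. (gz i a ?z * gz j b ?z) * (\<delta> l a * \<delta> k b))) / 2"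
      unfolding Sz_props(4)[OF z] sum_subtractf[symmetric] sum_divide_distrib
      by (intro sum.cong refl) (simp add: gz_def)
    finally show ?thesis unfolding delta_sum2 .
  qed
  have inv_L: "is_curvature_inverse (G s) y ?L"
    unfolding is_curvature_inverse_def
  proof (intro conjI allI)
    fix i j k l
    show "?L i j k l = - ?L j i k l" by (simp only: L_skew[of j i] minus_minus)
    show "?L i j k l = - ?L i j l k" by (simp only: L_pair[of i j k l] L_pair[of i j l k] L_skew[of l k] minus_minus)
    show "?L i j k l = ?L k l i j" by (simp only: L_pair[of i j k l])
    show "(\<Sum>p\<in>UNIV. \<Sum>q\<in>UNIV. \<Sum>r\<in>UNIV. \<Sum>t\<in>UNIV. ?L i j p q * ginv (G s) p r y * ginv (G s) q t y * Rm (G s) [r, t, k, l] y)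
      = (G s y $ i $ k * G s y $ j $ l - G s y $ i $ l * G s y $ j $ k) / 2"
      using trans[OF contr[of ?L i j k l] L_R[of i j k l]] by (simp only: gz_def fst_conv snd_conv)
  qed
  moreover have "S = ?L" if S: "is_curvature_inverse (G s) y S"
  proof (intro ext)
    fix i j k l
    \<comment> \<open>The difference of the candidates for fixed \<open>i\<close> and
      \<open>j\<close>; \<open>v\<close> raises its indices, as \<open>two_form_eq_0\<close>
      expects.\<close>
    define d where "d js = (case js of [p, q] \<Rightarrow> S i j p q - ?L i j p q | _ \<Rightarrow> 0)" for js
    define v where "v r t = fc (hrow s y) d [r, t]" for r t
    have d: "d [q, p] = - d [p, q]" for p q
    proof -
      have "S i j q p = - S i j p q" using S unfolding is_curvature_inverse_def by blast
      moreover have "?L i j q p = - ?L i j p q"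
        by (simp only: L_pair[of i j q p] L_pair[of i j p q] L_skew[of q p])
      ultimately show ?thesis by (simp add: d_def del: fc.simps)
    qed
    have v_skew: "v t r = - v r t" for r t
    proof -
      have "v t r = (\<Sum>p\<in>UNIV. \<Sum>q\<in>UNIV. hrow s y t $ p * (hrow s y r $ q * d [p, q]))" by (simp add: v_def sum_distrib_left)
      also have "\<dots> = (\<Sum>q\<in>UNIV. \<Sum>p\<in>UNIV. hrow s y t $ p * (hrow s y r $ q * d [p, q]))" by (rule sum.swap)
      also have "\<dots> = - (\<Sum>q\<in>UNIV. \<Sum>p\<in>UNIV. hrow s y r $ q * (hrow s y t $ p * d [q, p]))"
      proof -
        have "hrow s y t $ p * (hrow s y r $ q * d [p, q]) = - (hrow s y r $ q * (hrow s y t $ p * d [q, p]))" for p q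
          using d[of p q] by simp
        then show ?thesis by (simp only: sum_negf)
      qed
      finally show ?thesis by (simp add: v_def sum_distrib_left)
    qed
    have "(\<Sum>p\<in>UNIV. \<Sum>q\<in>UNIV. v p q * Rz p q k l ?z) = 0" for k l
    proof -
      have "(\<Sum>p\<in>UNIV. \<Sum>q\<in>UNIV. d [p, q] * (\<Sum>r\<in>UNIV. hrow s y p $ r * (\<Sum>t\<in>UNIV. hrow s y q $ t * Rz r t k l ?z))) = 0"
      proof -
        have "(\<Sum>p\<in>UNIV. \<Sum>q\<in>UNIV. S i j p q * (\<Sum>r\<in>UNIV. hrow s y p $ r * (\<Sum>t\<in>UNIV. hrow s y q $ t * Rz r t k l ?z)))
          = (gz i k ?z * gz j l ?z - gz i l ?z * gz j k ?z) / 2"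
          unfolding contr[of S i j k l, symmetric] gz_def fst_conv snd_conv
          by (rule conjunct2[OF S[unfolded is_curvature_inverse_def], rule_format])
        then show ?thesis using L_R[of i j k l] by (simp add: d_def left_diff_distrib sum_subtractf del: fc.simps)
      qed
      moreover have "(\<Sum>p\<in>UNIV. \<Sum>q\<in>UNIV. d [p, q] * (\<Sum>r\<in>UNIV. hrow s y p $ r * (\<Sum>t\<in>UNIV. hrow s y q $ t * Rz r t k l ?z)))
        = (\<Sum>r\<in>UNIV. \<Sum>t\<in>UNIV. v r t * Rz r t k l ?z)"
      proof -
        have h: "hrow s y p $ r = hrow s y r $ p" for p r using hz_sym[OF z, of p r] by (simp add: hz_def ginv_def)
        have e: "d [p, q] * (hrow s y p $ r * (hrow s y q $ t * Rz r t k l ?z)) = hrow s y r $ p * (hrow s y t $ q * (d [p, q] * Rz r t k l ?z))" for p q r t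
          unfolding h[of p r] h[of q t] by (simp only: mult_ac)
        have "(\<Sum>p\<in>UNIV. \<Sum>q\<in>UNIV. d [p, q] * (\<Sum>r\<in>UNIV. hrow s y p $ r * (\<Sum>t\<in>UNIV. hrow s y q $ t * Rz r t k l ?z)))
          = (\<Sum>p\<in>UNIV. \<Sum>q\<in>UNIV. \<Sum>r\<in>UNIV. \<Sum>t\<in>UNIV. hrow s y r $ p * (hrow s y t $ q * (d [p, q] * Rz r t k l ?z)))"
          unfolding sum_distrib_left e ..
        also have "\<dots> = (\<Sum>r\<in>UNIV. \<Sum>t\<in>UNIV. \<Sum>p\<in>UNIV. \<Sum>q\<in>UNIV. hrow s y r $ p * (hrow s y t $ q * (d [p, q] * Rz r t k l ?z)))"
          by (rule sum_swap4)
        also have "\<dots> = (\<Sum>r\<in>UNIV. \<Sum>t\<in>UNIV. v r t * Rz r t k l ?z)"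
          unfolding v_def fc.simps sum_distrib_left sum_distrib_right mult.assoc ..
        finally show ?thesis .
      qed
      ultimately show ?thesis by simp
    qed
    then have "v r t = 0" for r t by (rule c.two_form_eq_0[OF v_skew])
    moreover have "d [k, l] = fc (grow s y) (\<lambda>js. fc (hrow s y) d js) [k, l]"
      by (rule fc_dual[OF hg', symmetric])
    moreover have "fc (grow s y) (\<lambda>js. fc (hrow s y) d js) [k, l] = (\<Sum>i\<in>UNIV. grow s y k $ i * (\<Sum>j\<in>UNIV. grow s y l $ j * v i j))"
      by (simp add: v_def)
    ultimately have "d [k, l] = 0" by (simp del: fc.simps)
    then show "S i j k l = ?L i j k l" by (simp add: d_def del: fc.simps)
  qed
  ultimately show ?thesis by blast
qed

lemma curvature_inverse_eq:
  assumes z: "(s, y) \<in> D"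
  shows "curvature_inverse (G s) [i, j, k, l] y = fc (grow s y) (\<lambda>js. ST js (s, y)) [i, j, k, l]"
proof -
  have "(THE S. is_curvature_inverse (G s) y S) = (\<lambda>i j k l. fc (grow s y) (\<lambda>js. ST js (s, y)) [i, j, k, l])"
    by (rule the_equality) (simp_all only: is_curvature_inverse_iff[OF z])
  then show ?thesis by (simp add: curvature_inverse_def tensor4_def del: fc.simps)
qed

lemma sharp_curvature_inverse:
  assumes z: "(s, y) \<in> D"
  shows "sharp (G s) (curvature_inverse (G s)) [i, j, k, l] y = Sz i j k l (s, y)"
proof -
  have "sharp (G s) (curvature_inverse (G s)) [i, j, k, l] y = fc (hrow s y) (\<lambda>js. fc (grow s y) (\<lambda>js. ST js (s, y)) js) [i, j, k, l]"
    unfolding sharp_def frame_comp_fc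
  proof (rule fc_cong)
    fix js :: "'a list" assume "length js = length [i, j, k, l]"
    then have "length js = 4" by simp
    then obtain a b c d where "js = [a, b, c, d]" unfolding length_4 by blast
    then show "curvature_inverse (G s) js y = fc (grow s y) (\<lambda>js. ST js (s, y)) js"
      using curvature_inverse_eq[OF z, of a b c d] by (simp only:)
  qed
  also have "\<dots> = ST [i, j, k, l] (s, y)"
    by (rule fc_dual) (use hz_gz[OF z] in \<open>simp add: gz_def hz_def ginv_def\<close>)
  finally show ?thesis by simp
qed

text \<open>Upper indices are contracted with the coframe. At the base point, where the frame is
  orthonormal, these are also the frame components of \<open>curvature_inverse\<close>.\<close>

definition SU where "SU i j k l z = fc B (\<lambda>js. ST js z) [i, j, k, l]"

lemma smooth_SU: "smooth (SU i j k l)"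
  unfolding SU_def[abs_def] by (rule smooth_fc[OF smooth_ST])

lemma SU_skew:
  assumes z: "z \<in> D" shows "SU j i k l z = - SU i j k l z"
  unfolding SU_def by (rule fc_skew12) (simp only: ST_simp, rule Sz_props(1)[OF z])

lemma SU_pair:
  assumes z: "z \<in> D" shows "SU k l i j z = SU i j k l z"
  unfolding SU_def by (rule fc_pair) (simp only: ST_simp, rule Sz_props(3)[OF z])

lemma SU_inverse:
  assumes z: "z \<in> D"
  shows "(\<Sum>p\<in>UNIV. \<Sum>q\<in>UNIV. SU i j p q z * Rm4 (Some p) (Some q) (Some k) (Some l) z) = (\<delta> i k * \<delta> j l - \<delta> i l * \<delta> j k) / 2"
proof -
  obtain s y where sy: "z = (s, y)" by (cases z)
  define U where "U c d = (\<Sum>a\<in>UNIV. Fr k $ a * (\<Sum>b\<in>UNIV. Fr l $ b * Rz c d a b z))" for c d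
  define V where "V c d = (\<Sum>a\<in>UNIV. B i $ a * (\<Sum>b\<in>UNIV. B j $ b * Sz c d a b z))" for c d
  have R: "Rm4 (Some p) (Some q) (Some k) (Some l) z = (\<Sum>c\<in>UNIV. Fr p $ c * (\<Sum>d\<in>UNIV. Fr q $ d * U c d))" for p q
    using Rm_Rl[of s y p q k l] z sy by (simp add: U_def Rz_def)
  have S: "SU i j p q z = (\<Sum>c\<in>UNIV. B p $ c * (\<Sum>d\<in>UNIV. B q $ d * V c d))" for p q
    unfolding SU_pair[OF z, of i j p q] by (simp add: SU_def V_def)
  have "(\<Sum>p\<in>UNIV. \<Sum>q\<in>UNIV. Rm4 (Some p) (Some q) (Some k) (Some l) z * SU i j p q z) = (\<Sum>c\<in>UNIV. \<Sum>d\<in>UNIV. U c d * V c d)"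
    unfolding R S by (rule pairing2[OF dual'])
  also have "\<dots> = (\<Sum>c\<in>UNIV. \<Sum>d\<in>UNIV. \<Sum>a\<in>UNIV. \<Sum>b\<in>UNIV. B i $ a * (B j $ b * (Sz a b c d z * U c d)))"
    unfolding V_def by (simp add: sum_distrib_left Sz_props(3)[OF z] mult_ac)
  also have "\<dots> = (\<Sum>a\<in>UNIV. \<Sum>b\<in>UNIV. \<Sum>c\<in>UNIV. \<Sum>d\<in>UNIV. B i $ a * (B j $ b * (Sz a b c d z * U c d)))"
    by (rule sum_swap4)
  also have "\<dots> = (\<Sum>a\<in>UNIV. \<Sum>b\<in>UNIV. B i $ a * (B j $ b * (\<Sum>c\<in>UNIV. \<Sum>d\<in>UNIV. Sz a b c d z * U c d)))"
    by (simp only: sum_distrib_left)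
  also have "\<dots> = (\<Sum>a\<in>UNIV. \<Sum>b\<in>UNIV. B i $ a * (B j $ b * ((Fr k $ a * Fr l $ b - Fr k $ b * Fr l $ a) / 2)))"
  proof -
    have "(\<Sum>c\<in>UNIV. \<Sum>d\<in>UNIV. Sz a b c d z * U c d) = (Fr k $ a * Fr l $ b - Fr k $ b * Fr l $ a) / 2" for a b
    proof -
      have "(\<Sum>c\<in>UNIV. \<Sum>d\<in>UNIV. Sz a b c d z * U c d)
        = (\<Sum>c\<in>UNIV. \<Sum>d\<in>UNIV. \<Sum>m\<in>UNIV. \<Sum>n\<in>UNIV. Fr k $ m * (Fr l $ n * (Sz a b c d z * Rz c d m n z)))"
        unfolding U_def by (simp add: sum_distrib_left mult_ac)
      also have "\<dots> = (\<Sum>m\<in>UNIV. \<Sum>n\<in>UNIV. \<Sum>c\<in>UNIV. \<Sum>d\<in>UNIV. Fr k $ m * (Fr l $ n * (Sz a b c d z * Rz c d m n z)))"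
        by (rule sum_swap4)
      also have "\<dots> = (\<Sum>m\<in>UNIV. \<Sum>n\<in>UNIV. Fr k $ m * (Fr l $ n * ((\<delta> a m * \<delta> b n - \<delta> a n * \<delta> b m) / 2)))"
        unfolding sum_distrib_left[symmetric] Sz_props(4)[OF z] ..
      also have "\<dots> = ((\<Sum>m\<in>UNIV. \<Sum>n\<in>UNIV. (Fr k $ m * Fr l $ n) * (\<delta> a m * \<delta> b n)) - (\<Sum>m\<in>UNIV. \<Sum>n\<in>UNIV. (Fr k $ m * Fr l $ n) * (\<delta> b m * \<delta> a n))) / 2"
        unfolding sum_subtractf[symmetric] sum_divide_distrib by (intro sum.cong refl) (simp add: algebra_simps)
      finally show ?thesis unfolding delta_sum2 .
    qed
    then show ?thesis by (simp only:)
  qed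
  also have "\<dots> = ((\<Sum>a\<in>UNIV. B i $ a * Fr k $ a) * (\<Sum>b\<in>UNIV. B j $ b * Fr l $ b) - (\<Sum>a\<in>UNIV. B i $ a * Fr l $ a) * (\<Sum>b\<in>UNIV. B j $ b * Fr k $ b)) / 2"
    unfolding sum_product sum_subtractf[symmetric] sum_divide_distrib by (intro sum.cong refl) (simp add: field_simps)
  finally show ?thesis unfolding dual by (simp add: mult.commute)
qed

text \<open>The minimizing two-form of the Harnack quadratic for a basis vector,
  \<open>- S P\<close>, as a smooth function on \<open>D\<close>.\<close>

definition EvH where "EvH i j a z = - (\<Sum>k\<in>UNIV. \<Sum>l\<in>UNIV. SU i j k l z * Rm4 (Some k) (Some l) None (Some a) z)"

sublocale harnack_vector D e0 gE hE \<Gamma>E ricE scalE EvH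
proof
  show "smooth_on (EvH i j a) D" for i j a
    unfolding EvH_def[abs_def] by (intro smooth_intros smooth_SU smooth_Rm4)
  show "Rm4 (Some c) (Some d) None (Some a) z + (\<Sum>i\<in>UNIV. \<Sum>j\<in>UNIV. Rm4 (Some c) (Some d) (Some i) (Some j) z * EvH i j a z) = 0"
    if z: "z \<in> D" for z c d a
  proof -
    let ?P = "\<lambda>k l. Rm4 (Some k) (Some l) None (Some a) z"
    have "(\<Sum>i\<in>UNIV. \<Sum>j\<in>UNIV. Rm4 (Some c) (Some d) (Some i) (Some j) z * EvH i j a z)
      = - (\<Sum>i\<in>UNIV. \<Sum>j\<in>UNIV. \<Sum>k\<in>UNIV. \<Sum>l\<in>UNIV. SU k l i j z * Rm4 (Some i) (Some j) (Some c) (Some d) z * ?P k l)"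
      unfolding EvH_def by (simp add: sum_distrib_left sum_negf SU_pair[OF z] Rm4_pair[OF z, of "Some c" "Some d"] mult_ac)
    also have "(\<Sum>i\<in>UNIV. \<Sum>j\<in>UNIV. \<Sum>k\<in>UNIV. \<Sum>l\<in>UNIV. SU k l i j z * Rm4 (Some i) (Some j) (Some c) (Some d) z * ?P k l)
      = (\<Sum>k\<in>UNIV. \<Sum>l\<in>UNIV. (\<Sum>i\<in>UNIV. \<Sum>j\<in>UNIV. SU k l i j z * Rm4 (Some i) (Some j) (Some c) (Some d) z) * ?P k l)"
      unfolding sum_distrib_right by (rule sum_swap4)
    \<comment> \<open>The product of inverse and curvature is the antisymmetrizer, which fixes
      \<open>?P\<close> because \<open>P\<close> is skew in its first two indices.\<close>
    also have "\<dots> = ((\<Sum>k\<in>UNIV. \<Sum>l\<in>UNIV. ?P k l * (\<delta> c k * \<delta> d l)) - (\<Sum>k\<in>UNIV. \<Sum>l\<in>UNIV. ?P k l * (\<delta> d k * \<delta> c l))) / 2"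
      unfolding SU_inverse[OF z] sum_subtractf[symmetric] sum_divide_distrib by (intro sum.cong refl) simp
    also have "\<dots> = ?P c d" unfolding delta_sum2 using Rm4_skew12[of "Some d" "Some c" None "Some a" z] by simp
    finally show ?thesis by simp
  qed
qed

lemma linked_Z:
  assumes W: "\<And>b c z. z \<in> D \<Longrightarrow> W [Some b, Some c] z = UU [None, Some b, Some c] z + 1 / (2 * \<tau>) * ricE b c z"
  shows "linked 2 s (harnack_Z \<tau> (G s)) W"
proof (rule linkedI2)
  fix y b c assume z: "(s, y) \<in> D"
  let ?z = "(s, y)"
  define WM where "WM js z = (case js of [Some b, Some c] \<Rightarrow> Rm4 None (Some b) None (Some c) z + 1 / (2 * \<tau>) * ricE b c z | _ \<Rightarrow> 0)" for js :: "'a option list" and z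
  have M: "fc Fr (\<lambda>js. harnack_M \<tau> (G s) js y) [b, c] = Rm4 None (Some b) None (Some c) ?z + 1 / (2 * \<tau>) * ricE b c ?z"
    using linkedD[OF linked_M[of WM \<tau> s] z, of "[b, c]"] by (simp add: WM_def del: fc.simps)
  define P where "P b p q = (\<Sum>k\<in>UNIV. Fr b $ k * harnack_P (G s) [p, q, k] y)" for b p q
  have PT: "Rm4 (Some i) (Some j) None (Some b) ?z = (\<Sum>p\<in>UNIV. Fr i $ p * (\<Sum>q\<in>UNIV. Fr j $ q * P b p q))" for i j b
    using linkedD[OF linked_P z, of "[i, j, b]"] by (simp add: PT_simp P_def)
  let ?Q = "tensor2 (\<lambda>i j x. \<Sum>k\<in>UNIV. \<Sum>l\<in>UNIV. \<Sum>p\<in>UNIV. \<Sum>q\<in>UNIV.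
            sharp (G s) (curvature_inverse (G s)) [k, l, p, q] x * harnack_P (G s) [k, l, i] x * harnack_P (G s) [p, q, j] x)"
  have "fc Fr (\<lambda>js. harnack_Z \<tau> (G s) js y) [b, c] = fc Fr (\<lambda>js. harnack_M \<tau> (G s) js y - ?Q js y) [b, c]"
    by (rule fc_cong) (auto simp: harnack_Z_def tensor2_def numeral_eq_Suc length_Suc_conv)
  also have "\<dots> = fc Fr (\<lambda>js. harnack_M \<tau> (G s) js y) [b, c] - fc Fr (\<lambda>js. ?Q js y) [b, c]"
    by (rule fc_diff)
  also have "fc Fr (\<lambda>js. ?Q js y) [b, c] = (\<Sum>k\<in>UNIV. \<Sum>l\<in>UNIV. \<Sum>p\<in>UNIV. \<Sum>q\<in>UNIV. Sz k l p q ?z * P b k l * P c p q)"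
  proof -
    have "fc Fr (\<lambda>js. ?Q js y) [b, c] = (\<Sum>i\<in>UNIV. \<Sum>j\<in>UNIV. \<Sum>x\<in>UNIV. \<Sum>x'\<in>UNIV. Fr b $ i * (Fr c $ j *
        (Sz (fst x) (snd x) (fst x') (snd x') ?z * harnack_P (G s) [fst x, snd x, i] y * harnack_P (G s) [fst x', snd x', j] y)))"
      by (simp add: tensor2_def sharp_curvature_inverse[OF z] sum_distrib_left sum_UNIV_prod)
    also have "\<dots> = (\<Sum>x\<in>UNIV. \<Sum>x'\<in>UNIV. \<Sum>i\<in>UNIV. \<Sum>j\<in>UNIV. Fr b $ i * (Fr c $ j *
        (Sz (fst x) (snd x) (fst x') (snd x') ?z * harnack_P (G s) [fst x, snd x, i] y * harnack_P (G s) [fst x', snd x', j] y)))"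
      by (rule sum_swap4)
    also have "\<dots> = (\<Sum>x\<in>UNIV. \<Sum>x'\<in>UNIV. Sz (fst x) (snd x) (fst x') (snd x') ?z * (P b (fst x) (snd x) * P c (fst x') (snd x')))"
      unfolding P_def sum_product by (simp add: sum_distrib_left mult_ac)
    finally show ?thesis by (simp add: sum_UNIV_prod mult.assoc)
  qed
  also have "(\<Sum>k\<in>UNIV. \<Sum>l\<in>UNIV. \<Sum>p\<in>UNIV. \<Sum>q\<in>UNIV. Sz k l p q ?z * P b k l * P c p q)
    = - (\<Sum>i\<in>UNIV. \<Sum>j\<in>UNIV. Rm4 None (Some b) (Some i) (Some j) ?z * EvH i j c ?z)"
  proof -
    define V where "V k l = (\<Sum>p\<in>UNIV. \<Sum>q\<in>UNIV. Sz k l p q ?z * P c p q)" for k l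
    have E: "EvH i j c ?z = - (\<Sum>k\<in>UNIV. B i $ k * (\<Sum>l\<in>UNIV. B j $ l * V k l))" for i j
    proof -
      have S: "SU i j p q ?z = (\<Sum>c\<in>UNIV. B p $ c * (\<Sum>d\<in>UNIV. B q $ d * (\<Sum>k\<in>UNIV. B i $ k * (\<Sum>l\<in>UNIV. B j $ l * Sz k l c d ?z))))" for p q
        unfolding SU_pair[OF z, of i j p q] by (simp add: SU_def Sz_props(3)[OF z])
      have "(\<Sum>p\<in>UNIV. \<Sum>q\<in>UNIV. Rm4 (Some p) (Some q) None (Some c) ?z * SU i j p q ?z)
        = (\<Sum>p\<in>UNIV. \<Sum>q\<in>UNIV. P c p q * (\<Sum>k\<in>UNIV. B i $ k * (\<Sum>l\<in>UNIV. B j $ l * Sz k l p q ?z)))"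
        unfolding PT S by (rule pairing2[OF dual'])
      also have "\<dots> = (\<Sum>p\<in>UNIV. \<Sum>q\<in>UNIV. \<Sum>k\<in>UNIV. \<Sum>l\<in>UNIV. B i $ k * (B j $ l * (Sz k l p q ?z * P c p q)))"
        by (simp add: sum_distrib_left mult_ac)
      also have "\<dots> = (\<Sum>k\<in>UNIV. \<Sum>l\<in>UNIV. \<Sum>p\<in>UNIV. \<Sum>q\<in>UNIV. B i $ k * (B j $ l * (Sz k l p q ?z * P c p q)))"
        by (rule sum_swap4)
      finally show ?thesis by (simp add: EvH_def V_def sum_distrib_left mult.commute)
    qed
    have "(\<Sum>i\<in>UNIV. \<Sum>j\<in>UNIV. Rm4 None (Some b) (Some i) (Some j) ?z * EvH i j c ?z)
      = - (\<Sum>i\<in>UNIV. \<Sum>j\<in>UNIV. Rm4 (Some i) (Some j) None (Some b) ?z * (\<Sum>k\<in>UNIV. B i $ k * (\<Sum>l\<in>UNIV. B j $ l * V k l)))"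
      unfolding E Rm4_pair[OF z, of None "Some b"] by (simp add: sum_negf)
    also have "(\<Sum>i\<in>UNIV. \<Sum>j\<in>UNIV. Rm4 (Some i) (Some j) None (Some b) ?z * (\<Sum>k\<in>UNIV. B i $ k * (\<Sum>l\<in>UNIV. B j $ l * V k l)))
      = (\<Sum>k\<in>UNIV. \<Sum>l\<in>UNIV. P b k l * V k l)"
      unfolding PT by (rule pairing2[OF dual'])
    finally show ?thesis by (simp add: V_def sum_distrib_left mult_ac)
  qed
  finally show "W [Some b, Some c] ?z = fc Fr (\<lambda>js. harnack_Z \<tau> (G s) js y) [b, c]"
    unfolding W[OF z] M UU by simp
qed

end

section \<open>The evolution equation at a point of a chart\<close>

lemma fc_compose:
  assumes "\<And>a p. (\<Sum>i\<in>UNIV. F a $ i * H i $ p) = C a $ p"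
  shows "fc F (\<lambda>js. fc H w js) is = fc C w is"
proof (induction "is" arbitrary: w)
  case (Cons a "is")
  have "fc F (\<lambda>js. fc H w js) (a # is) = (\<Sum>i\<in>UNIV. F a $ i * (\<Sum>p\<in>UNIV. H i $ p * fc C (\<lambda>ks. w (p # ks)) is))"
    using Cons.IH by (simp add: fc_sum fc_cmult)
  also have "\<dots> = (\<Sum>p\<in>UNIV. (\<Sum>i\<in>UNIV. F a $ i * H i $ p) * fc C (\<lambda>ks. w (p # ks)) is)"
    unfolding sum_distrib_left sum_distrib_right mult.assoc by (rule sum.swap)
  finally show ?case unfolding assms by simp
qed simp

lemma (in connection) cov_add_cmult:
  assumes "\<And>is. smooth (T is)" "\<And>is. smooth (U is)" "z \<in> \<Omega>"
  shows "cov (\<lambda>js z. T js z + c * U js z) is z = cov T is z + c * cov U is z"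
proof (cases "is")
  case (Cons v js)
  have "smooth (\<lambda>z. c * U js z)" using assms by (intro smooth_intros smooth_on_const)
  then have "pd v (\<lambda>z. T js z + c * U js z) z = pd v (T js) z + c * pd v (U js) z"
    using assms by (simp add: pd_add pd_cmult)
  then show ?thesis by (simp add: Cons act_add act_cmult right_diff_distrib)
qed simp

context chart_harnack
begin

lemma harnack_Z_components:
  assumes z: "(s, y) \<in> D"
  shows "frame_comp H (harnack_Z s (G s)) [a, b] y
    = (\<Sum>c\<in>UNIV. (\<Sum>i\<in>UNIV. H a $ i * B c $ i) * (\<Sum>d\<in>UNIV. (\<Sum>i\<in>UNIV. H b $ i * B d $ i)
        * (ZZ [Some c, Some d] (s, y) + 1 / (2 * s) * ricE c d (s, y))))"
proof -
  define W where "W is z = ZZ is z + 1 / (2 * s) * ricT is z" for "is" z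
  have "linked 2 s (harnack_Z s (G s)) W" by (rule linked_Z) (simp add: W_def ricT_spatial)
  note T = coordinate_components[OF this z]
  have "frame_comp H (harnack_Z s (G s)) [a, b] y = fc H (\<lambda>ks. fc Bd (\<lambda>is. W (map Some is) (s, y)) ks) [a, b]"
    unfolding frame_comp_fc by (rule fc_cong, rule T) simp
  also have "\<dots> = fc (\<lambda>a. \<chi> c. \<Sum>i\<in>UNIV. H a $ i * B c $ i) (\<lambda>is. W (map Some is) (s, y)) [a, b]"
    by (rule fc_compose) simp
  finally show ?thesis by (simp add: W_def ricT_spatial[OF z])
qed

context
  fixes t :: real and x :: "real^'a"
  assumes z0: "(t, x) \<in> D" and t: "t > 0" and orth: "orthonormal_frame (G t) x Fr"
    and B_lower: "\<And>a k. B a $ k = (\<Sum>j\<in>UNIV. G t x $ k $ j * Fr a $ j)"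
begin

lemma orthonormal_at_base: "orthonormal_at (t, x)"
proof -
  have g: "gE a b (t, x) = \<delta> a b" for a b
    using orth by (simp add: orthonormal_frame_def gE_def gz_def mult_ac)
  have "hE a c (t, x) = \<delta> a c" for a c
    using gE_hE[OF z0, of a c] by (simp add: g sum_delta_mult')
  then show ?thesis by (simp add: orthonormal_at_def z0)
qed

lemmas h_base = orthonormal_at_simps(2)[OF orthonormal_at_base]

lemma frame_curvature_inverse: "frame_comp Fr (curvature_inverse (G t)) [i, j, k, l] x = SU i j k l (t, x)"
proof -
  have "frame_comp Fr (curvature_inverse (G t)) [i, j, k, l] x = fc Fr (\<lambda>js. fc (grow t x) (\<lambda>js. ST js (t, x)) js) [i, j, k, l]"
    unfolding frame_comp_fc
  proof (rule fc_cong)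
    fix js :: "'a list" assume "length js = length [i, j, k, l]"
    then have "length js = 4" by simp
    then obtain a b c d where "js = [a, b, c, d]" unfolding length_4 by blast
    then show "curvature_inverse (G t) js x = fc (grow t x) (\<lambda>js. ST js (t, x)) js"
      using curvature_inverse_eq[OF z0, of a b c d] by (simp only:)
  qed
  also have "\<dots> = fc B (\<lambda>js. ST js (t, x)) [i, j, k, l]"
  proof (rule fc_compose)
    show "(\<Sum>i\<in>UNIV. Fr a $ i * grow t x i $ p) = B a $ p" for a p
      unfolding B_lower using gz_sym[OF z0, of p] by (simp add: gz_def mult.commute)
  qed
  finally show ?thesis by (simp only: SU_def)
qed

lemma frame_Rm: "frame_comp Fr (Rm (G t)) [i, j, k, l] x = Rm4 (Some i) (Some j) (Some k) (Some l) (t, x)"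
  unfolding frame_comp_fc Rm_Rl[OF z0] ..

lemma frame_Ric: "frame_comp Fr (Ric (G t)) [i, j] x = ricE i j (t, x)"
  unfolding frame_comp_fc ricE_Ric[OF z0] ..

lemma frame_nabla_Rm: "frame_comp Fr (nabla (G t) (Rm (G t))) [v, i, j, k, l] x = cov Rl [Some v, Some i, Some j, Some k, Some l] (t, x)"
  using linkedD[OF linked_nabla[OF smooth_Rl linked_Rm] z0, of "[v, i, j, k, l]"]
  unfolding frame_comp_fc by (simp add: numeral_eq_Suc del: fc.simps cov.simps)

lemma frame_P: "frame_comp Fr (harnack_P (G t)) [i, j, a] x = Rm4 (Some i) (Some j) None (Some a) (t, x)"
  using linkedD[OF linked_P z0, of "[i, j, a]"]
  unfolding frame_comp_fc by (simp add: PT_simp del: fc.simps)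

lemma frame_nabla_P: "frame_comp Fr (nabla (G t) (harnack_P (G t))) [v, i, j, a] x
  = cov Rl [Some v, Some i, Some j, None, Some a] (t, x) - (\<Sum>w\<in>UNIV. ricE v w (t, x) * Rm4 (Some i) (Some j) (Some w) (Some a) (t, x))"
proof -
  have "PT [Some i, Some j, Some a] = Rl [Some i, Some j, None, Some a]" by (simp add: PT_simp)
  then have "cov PT [Some v, Some i, Some j, Some a] (t, x)
    = cov Rl [Some v, Some i, Some j, None, Some a] (t, x) - (\<Sum>w\<in>UNIV. ricE v w (t, x) * Rm4 (Some i) (Some j) (Some w) (Some a) (t, x))"
    by (simp add: cov.simps PT_simp sum_option stG.simps rho.simps h_base sum_delta_mult' sum_negf)
  then show ?thesis using linkedD[OF linked_nabla[OF smooth_PT linked_P] z0, of "[v, i, j, a]"]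
    unfolding frame_comp_fc by (simp add: numeral_eq_Suc del: fc.simps cov.simps)
qed

lemma frame_M: "frame_comp Fr (harnack_M t (G t)) [a, b] x = Rm4 None (Some a) None (Some b) (t, x) + 1 / (2 * t) * ricE a b (t, x)"
proof -
  define W where "W js z = (case js of [Some b, Some c] \<Rightarrow> Rm4 None (Some b) None (Some c) z + 1 / (2 * t) * ricE b c z | _ \<Rightarrow> 0)" for js :: "'a option list" and z
  show ?thesis using linkedD[OF linked_M[of W t t] z0, of "[a, b]"]
    unfolding frame_comp_fc by (simp add: W_def del: fc.simps)
qed

lemma frame_Z: "frame_comp Fr (harnack_Z t (G t)) [a, b] x = ZZ [Some a, Some b] (t, x) + 1 / (2 * t) * ricE a b (t, x)"
proof -
  have "(\<Sum>i\<in>UNIV. Fr a $ i * B c $ i) = \<delta> a c" for a c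
    using dual[of c a] by (simp add: mult.commute eq_commute)
  then show ?thesis unfolding harnack_Z_components[OF z0] by (simp add: sum_delta_mult')
qed

lemma frame_laplacian_Z: "frame_comp Fr (laplacian (G t) (harnack_Z t (G t))) [a, b] x
  = (\<Sum>k\<in>UNIV. cov (cov ZZ) [Some k, Some k, Some a, Some b] (t, x))
    + 1 / (2 * t) * (\<Sum>k\<in>UNIV. cov (cov ricT) [Some k, Some k, Some a, Some b] (t, x))"
proof -
  define W where "W is z = ZZ is z + 1 / (2 * t) * ricT is z" for "is" z
  have link: "linked 2 t (harnack_Z t (G t)) W" by (rule linked_Z) (simp add: W_def ricT_spatial)
  have smooth_W: "smooth (W is)" for "is"
    unfolding W_def[abs_def] by (intro smooth_intros smooth_on_const smooth_UU smooth_ricT)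
  have W1: "cov W is z = cov ZZ is z + 1 / (2 * t) * cov ricT is z" if "z \<in> D" for "is" z
    unfolding W_def[abs_def] by (rule cov_add_cmult[OF smooth_UU smooth_ricT that])
  have W2: "cov (cov W) is (t, x) = cov (cov ZZ) is (t, x) + 1 / (2 * t) * cov (cov ricT) is (t, x)" for "is"
  proof -
    have "cov (cov W) is (t, x) = cov (\<lambda>is z. cov ZZ is z + 1 / (2 * t) * cov ricT is z) is (t, x)"
      by (rule cov_cong[OF W1 z0])
    also have "\<dots> = cov (cov ZZ) is (t, x) + 1 / (2 * t) * cov (cov ricT) is (t, x)"
      by (rule cov_add_cmult[OF smooth_cov[OF smooth_UU] smooth_cov[OF smooth_ricT] z0])
    finally show ?thesis .
  qed
  have "frame_comp Fr (laplacian (G t) (harnack_Z t (G t))) [a, b] x = tr (cov (cov W)) [Some a, Some b] (t, x)"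
    using linkedD[OF linked_laplacian[OF smooth_W link] z0, of "[a, b]"]
    unfolding frame_comp_fc by (simp del: fc.simps cov.simps)
  also have "\<dots> = (\<Sum>k\<in>UNIV. cov (cov W) [Some k, Some k, Some a, Some b] (t, x))"
    unfolding tr_def h_base by (rule sum_delta2)
  finally show ?thesis unfolding W2 sum.distrib sum_distrib_left .
qed

lemma inverse_metric_B: "(\<Sum>i\<in>UNIV. ginv (G t) i j x * B c $ i) = Fr c $ j"
proof -
  have "(\<Sum>i\<in>UNIV. hz j i (t, x) * (\<Sum>p\<in>UNIV. gz i p (t, x) * Fr c $ p)) = (\<Sum>p\<in>UNIV. (\<Sum>i\<in>UNIV. hz j i (t, x) * gz i p (t, x)) * Fr c $ p)"
    unfolding sum_distrib_left sum_distrib_right mult.assoc by (rule sum.swap)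
  also have "\<dots> = Fr c $ j" unfolding hz_gz[OF z0] by (rule sum_delta_mult')
  finally show ?thesis unfolding B_lower using hz_sym[OF z0, of _ j] by (simp add: gz_def hz_def)
qed

lemma cov_time: "cov T [None, Some a, Some b] (t, x) = pd None (T [Some a, Some b]) (t, x)
  + (\<Sum>k\<in>UNIV. ricE a k (t, x) * T [Some k, Some b] (t, x)) + (\<Sum>k\<in>UNIV. ricE b k (t, x) * T [Some a, Some k] (t, x))"
  by (simp add: cov.simps sum_option stG.simps rho.simps h_base sum_delta_mult' sum_negf)

text \<open>The coefficients of the evolving frame are the identity at time \<open>t\<close> with
  derivative Ricci. The product rule thus adds exactly the connection terms of
  \<open>cov_time\<close>, so the derivative in the evolving frame is the covariant one; the last
  term is due to the factor \<open>1 / (2 * s)\<close>.\<close>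

lemma harnack_Z_time_derivative:
  assumes H: "H t = Fr" and dH: "\<And>a i. ((\<lambda>s. H s a $ i) has_real_derivative
      (\<Sum>j\<in>UNIV. \<Sum>k\<in>UNIV. ginv (G t) i j x * Ric (G t) [j, k] x * H t a $ k)) (at t)"
  shows "((\<lambda>s. frame_comp (H s) (harnack_Z s (G s)) [a, b] x) has_real_derivative
    (cov ZZ [None, Some a, Some b] (t, x) + 1 / (2 * t) * cov ricT [None, Some a, Some b] (t, x) - ricE a b (t, x) / (2 * t^2))) (at t)"
proof -
  define C where "C s a c = (\<Sum>i\<in>UNIV. H s a $ i * B c $ i)" for s a c
  define w where "w c d s = ZZ [Some c, Some d] (s, x) + 1 / (2 * s) * ricE c d (s, x)" for c d s
  define w' where "w' c d = pd None (ZZ [Some c, Some d]) (t, x)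
    + (1 / (2 * t) * pd None (ricE c d) (t, x) - ricE c d (t, x) / (2 * t^2))" for c d
  have C0: "C t a c = \<delta> a c" for a c
    using dual[of c a] by (simp add: C_def H mult.commute eq_commute)
  have dC: "((\<lambda>s. C s a c) has_real_derivative ricE a c (t, x)) (at t)" for a c
  proof -
    have "((\<lambda>s. C s a c) has_real_derivative
      (\<Sum>i\<in>UNIV. (\<Sum>j\<in>UNIV. \<Sum>k\<in>UNIV. ginv (G t) i j x * Ric (G t) [j, k] x * Fr a $ k) * B c $ i)) (at t)"
      unfolding C_def by (intro DERIV_sum DERIV_cmult_right dH[unfolded H])
    also have "(\<Sum>i\<in>UNIV. (\<Sum>j\<in>UNIV. \<Sum>k\<in>UNIV. ginv (G t) i j x * Ric (G t) [j, k] x * Fr a $ k) * B c $ i)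
      = (\<Sum>j\<in>UNIV. (\<Sum>k\<in>UNIV. Ric (G t) [j, k] x * Fr a $ k) * (\<Sum>i\<in>UNIV. ginv (G t) i j x * B c $ i))"
      unfolding sum_distrib_left sum_distrib_right by (subst sum.swap) (simp add: mult_ac)
    also have "\<dots> = ricE a c (t, x)"
      unfolding inverse_metric_B ric_sym[OF z0, of a c] ricE_Ric[OF z0, of c a]
      by (simp add: sum_distrib_left sum_distrib_right mult_ac)
    finally show ?thesis .
  qed
  have dw: "((\<lambda>s. w c d s) has_real_derivative w' c d) (at t)" for c d
  proof -
    have 1: "((\<lambda>s. ZZ [Some c, Some d] (s, x)) has_real_derivative pd None (ZZ [Some c, Some d]) (t, x)) (at t)"
      by (rule pd_None[OF smooth_UU z0])
    have 2: "((\<lambda>s. ricE c d (s, x)) has_real_derivative pd None (ricE c d) (t, x)) (at t)"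
      by (rule pd_None[OF _ z0]) auto
    have 3: "((\<lambda>s. 1 / (2 * s)) has_real_derivative - (1 / (2 * t^2))) (at t)"
      using t by (auto intro!: derivative_eq_intros simp: power2_eq_square field_simps)
    show ?thesis unfolding w_def w'_def
      by (rule DERIV_cong[OF DERIV_add[OF 1 DERIV_mult[OF 3 2]]]) simp
  qed
  have "((\<lambda>s. \<Sum>c\<in>UNIV. C s a c * (\<Sum>d\<in>UNIV. C s b d * w c d s)) has_real_derivative
    (\<Sum>c\<in>UNIV. ricE a c (t, x) * (\<Sum>d\<in>UNIV. C t b d * w c d t)
      + (\<Sum>d\<in>UNIV. ricE b d (t, x) * w c d t + w' c d * C t b d) * C t a c)) (at t)"
    by (intro DERIV_sum DERIV_mult dC dw)
  also have "(\<Sum>c\<in>UNIV. ricE a c (t, x) * (\<Sum>d\<in>UNIV. C t b d * w c d t)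
      + (\<Sum>d\<in>UNIV. ricE b d (t, x) * w c d t + w' c d * C t b d) * C t a c)
    = w' a b + (\<Sum>c\<in>UNIV. ricE a c (t, x) * w c b t) + (\<Sum>d\<in>UNIV. ricE b d (t, x) * w a d t)"
    by (simp add: C0 sum.distrib if_distrib[of "\<lambda>x. _ * x"] if_distrib[of "\<lambda>x. x * _"] cong: if_cong)
  also have "\<dots> = cov ZZ [None, Some a, Some b] (t, x) + 1 / (2 * t) * cov ricT [None, Some a, Some b] (t, x) - ricE a b (t, x) / (2 * t^2)"
  proof -
    have "pd None (ricT [Some a, Some b]) (t, x) = pd None (ricE a b) (t, x)"
      by (rule pd_cong) (auto simp: ricT_spatial z0)
    then show ?thesis
      unfolding cov_time ricT_spatial[OF z0] w_def w'_def distrib_left sum.distrib sum_distrib_left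
      by (simp add: mult_ac)
  qed
  finally have d: "((\<lambda>s. \<Sum>c\<in>UNIV. C s a c * (\<Sum>d\<in>UNIV. C s b d * w c d s)) has_real_derivative
    (cov ZZ [None, Some a, Some b] (t, x) + 1 / (2 * t) * cov ricT [None, Some a, Some b] (t, x) - ricE a b (t, x) / (2 * t^2))) (at t)" .
  show ?thesis
  \<comment> \<open>The component formula is available only for times \<open>s\<close> with
    \<open>(s, x)\<close> in \<open>D\<close>, which form an open set around
    \<open>t\<close>.\<close>
  proof (rule has_field_derivative_transform_within_open[OF d])
    have "{s. (s, x) \<in> D} = (\<lambda>s. (s, x)) -` D" by auto
    then show "open {s. (s, x) \<in> D}" using open_D by (simp add: open_vimage continuous_on_Pair)
    show "t \<in> {s. (s, x) \<in> D}" using z0 by simp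
    show "(\<Sum>c\<in>UNIV. C s a c * (\<Sum>d\<in>UNIV. C s b d * w c d s)) = frame_comp (H s) (harnack_Z s (G s)) [a, b] x"
      if "s \<in> {s. (s, x) \<in> D}" for s
      using harnack_Z_components[of s x] that unfolding C_def w_def by simp
  qed
qed

lemma harnack_Z_evolution:
  assumes H: "H t = Fr" and dH: "\<And>a i. ((\<lambda>s. H s a $ i) has_real_derivative
      (\<Sum>j\<in>UNIV. \<Sum>k\<in>UNIV. ginv (G t) i j x * Ric (G t) [j, k] x * H t a $ k)) (at t)"
    and squares: "harnack_decomposition t (G t) Fr x Y X"
  shows "((\<lambda>s. frame_comp (H s) (harnack_Z s (G s)) [a, b] x) has_real_derivative
           (frame_comp Fr (laplacian (G t) (harnack_Z t (G t))) [a, b] x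
            + 2 * (\<Sum>m\<in>UNIV. \<Sum>n\<in>UNIV. \<Sum>\<tau>\<in>UNIV. \<Sum>u\<in>UNIV. \<Sum>v\<in>UNIV.
                frame_comp Fr (curvature_inverse (G t)) [m, n, \<tau>, u] x
                  * harnack_K t (G t) Fr x a v \<tau> u * harnack_K t (G t) Fr x b v m n)
            + (\<Sum>N<harnack_dim TYPE('a). \<Sum>M<harnack_dim TYPE('a).
                harnack_L (G t) Fr x Y X N M a * harnack_L (G t) Fr x Y X N M b)
            - 2 / t * frame_comp Fr (harnack_Z t (G t)) [a, b] x)) (at t)"
proof -
  let ?S = "\<lambda>i j k l. SU i j k l (t, x)" and ?m = "harnack_dim TYPE('a)"
  have t0: "t \<noteq> 0" using t by simp
  have Y_skew: "Y N i j = - Y N j i" if "N < ?m" for N i j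
    using squares that unfolding harnack_decomposition_def Let_def two_form_def by blast
  have R: "Rm4 (Some i) (Some j) (Some k) (Some l) (t, x) = (\<Sum>N<?m. Y N i j * Y N k l)" for i j k l
    using squares unfolding harnack_decomposition_def Let_def frame_Rm by blast
  have P: "Rm4 (Some i) (Some j) None (Some a) (t, x) = (\<Sum>N<?m. Y N i j * X N a)" for i j a
    using squares unfolding harnack_decomposition_def Let_def frame_P by blast
  have M: "Rm4 None (Some a) None (Some b) (t, x) + 1 / (2 * t) * ricE a b (t, x) = (\<Sum>N<?m. X N a * X N b)" for a b
    using squares unfolding harnack_decomposition_def Let_def frame_M by blast
  note inv = orthonormal_at_base t0 SU_skew[OF z0] SU_pair[OF z0] SU_inverse[OF z0] EvH_def
  have K: "harnack_K t (G t) Fr x a v u w = K (t, x) t ?S a v u w" for a v u w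
    unfolding K_def[where z = "(t, x)" and \<tau> = t and S = ?S, OF inv]
    unfolding harnack_K_def frame_curvature_inverse frame_P frame_nabla_Rm frame_nabla_P frame_Rm frame_Ric ..
  have L: "harnack_L (G t) Fr x Y X N M a = L (t, x) ?S Y X N M a" for N M a
    unfolding harnack_L_def frame_curvature_inverse frame_P
    by (rule L_def[where z = "(t, x)" and \<tau> = t and S = ?S and Y = Y and X = X and m = ?m, OF inv Y_skew R P M, symmetric])
  note heat = harnack_heat_equation[where z = "(t, x)" and \<tau> = t and S = ?S and Y = Y and X = X and m = ?m, OF inv Y_skew R P M,
      of a b, unfolded right_diff_distrib]
  show ?thesis
    unfolding K L frame_curvature_inverse frame_laplacian_Z frame_Z right_diff_distrib
    by (rule DERIV_cong[OF harnack_Z_time_derivative[OF H dH]]) (use heat in linarith)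
qed

end

end

section \<open>Positive curvature in a chart\<close>

context chart_ricci_flow
begin

text \<open>On a kernel vector the curvature part is skew and the symmetrizer part symmetric, so
  both vanish. The vector is then a two-form annihilated by Rm, which positivity excludes.\<close>

lemma invertible_MM:
  assumes z0: "(t, x) \<in> D" and orth: "orthonormal_frame (G t) x Fr"
    and B_lower: "\<And>a k. B a $ k = (\<Sum>j\<in>UNIV. G t x $ k $ j * Fr a $ j)"
    and pos: "positive_curvature_operator (G t) x"
  shows "invertible (MM (t, x))"
proof -
  let ?z = "(t, x)"
  have "u = 0" if u: "MM ?z *v u = 0" for u
  proof -
    \<comment> \<open>\<open>MM\<close> has lower indices, so \<open>u\<close> has upper ones and
      its frame components are taken with the coframe.\<close>
    define v where "v a b = (\<Sum>k\<in>UNIV. B a $ k * (\<Sum>l\<in>UNIV. B b $ l * u $ (k, l)))" for a b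
    have FG: "(\<Sum>i\<in>UNIV. Fr a $ i * gz i k ?z) = B a $ k" for a k
      unfolding B_lower using gz_sym[OF z0, of k] by (simp add: gz_def mult.commute)
    have main: "(\<Sum>c\<in>UNIV. \<Sum>d\<in>UNIV. Rm4 (Some c) (Some d) (Some a) (Some b) ?z * v c d) + (v a b + v b a) / 2 = 0" for a b
    proof -
      have row: "(\<Sum>k\<in>UNIV. \<Sum>l\<in>UNIV. (Rz i j k l ?z + (gz i k ?z * gz j l ?z + gz i l ?z * gz j k ?z) / 2) * u $ (k, l)) = 0" for i j
        using arg_cong[OF u, of "\<lambda>w. w $ (i, j)"]
        by (simp only: matrix_vector_mult_def vec_lambda_beta sum_UNIV_prod MM_def fst_conv snd_conv zero_index)
      have "0 = (\<Sum>i\<in>UNIV. Fr a $ i * (\<Sum>j\<in>UNIV. Fr b $ j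
          * (\<Sum>k\<in>UNIV. \<Sum>l\<in>UNIV. (Rz i j k l ?z + (gz i k ?z * gz j l ?z + gz i l ?z * gz j k ?z) / 2) * u $ (k, l))))"
        by (simp only: row mult_zero_right sum.neutral_const)
      also have "\<dots> = (\<Sum>i\<in>UNIV. \<Sum>j\<in>UNIV. \<Sum>k\<in>UNIV. \<Sum>l\<in>UNIV. Fr a $ i * (Fr b $ j * (Rz i j k l ?z * u $ (k, l))))
        + ((\<Sum>i\<in>UNIV. \<Sum>j\<in>UNIV. \<Sum>k\<in>UNIV. \<Sum>l\<in>UNIV. (Fr a $ i * gz i k ?z) * ((Fr b $ j * gz j l ?z) * u $ (k, l)))
          + (\<Sum>i\<in>UNIV. \<Sum>j\<in>UNIV. \<Sum>k\<in>UNIV. \<Sum>l\<in>UNIV. (Fr a $ i * gz i l ?z) * ((Fr b $ j * gz j k ?z) * u $ (k, l)))) / 2"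
        unfolding sum_distrib_left sum.distrib[symmetric] sum_divide_distrib
        by (intro sum.cong refl) (simp add: field_simps)
      also have "(\<Sum>i\<in>UNIV. \<Sum>j\<in>UNIV. \<Sum>k\<in>UNIV. \<Sum>l\<in>UNIV. Fr a $ i * (Fr b $ j * (Rz i j k l ?z * u $ (k, l))))
        = (\<Sum>c\<in>UNIV. \<Sum>d\<in>UNIV. Rm4 (Some c) (Some d) (Some a) (Some b) ?z * v c d)"
      proof -
        define T where "T k l = (\<Sum>i\<in>UNIV. Fr a $ i * (\<Sum>j\<in>UNIV. Fr b $ j * Rz k l i j ?z))" for k l
        have R: "Rm4 (Some c) (Some d) (Some a) (Some b) ?z = (\<Sum>k\<in>UNIV. Fr c $ k * (\<Sum>l\<in>UNIV. Fr d $ l * T k l))" for c d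
          using Rm_Rl[OF z0, of c d a b] by (simp add: T_def Rz_def)
        have "(\<Sum>i\<in>UNIV. \<Sum>j\<in>UNIV. \<Sum>k\<in>UNIV. \<Sum>l\<in>UNIV. Fr a $ i * (Fr b $ j * (Rz i j k l ?z * u $ (k, l))))
          = (\<Sum>k\<in>UNIV. \<Sum>l\<in>UNIV. \<Sum>i\<in>UNIV. \<Sum>j\<in>UNIV. Fr a $ i * (Fr b $ j * (Rz i j k l ?z * u $ (k, l))))"
          by (rule sum_swap4)
        also have "\<dots> = (\<Sum>k\<in>UNIV. \<Sum>l\<in>UNIV. T k l * u $ (k, l))"
          unfolding T_def sum_distrib_left sum_distrib_right mult.assoc
          by (intro sum.cong refl) (simp only: Rz_pair[OF z0, of _ _ _ _])
        also have "\<dots> = (\<Sum>c\<in>UNIV. \<Sum>d\<in>UNIV. Rm4 (Some c) (Some d) (Some a) (Some b) ?z * v c d)"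
          unfolding R v_def by (rule pairing2[OF dual', symmetric])
        finally show ?thesis .
      qed
      also have "(\<Sum>i\<in>UNIV. \<Sum>j\<in>UNIV. \<Sum>k\<in>UNIV. \<Sum>l\<in>UNIV. (Fr a $ i * gz i k ?z) * ((Fr b $ j * gz j l ?z) * u $ (k, l))) = v a b"
      proof -
        have "(\<Sum>i\<in>UNIV. \<Sum>j\<in>UNIV. \<Sum>k\<in>UNIV. \<Sum>l\<in>UNIV. (Fr a $ i * gz i k ?z) * ((Fr b $ j * gz j l ?z) * u $ (k, l)))
          = (\<Sum>k\<in>UNIV. \<Sum>l\<in>UNIV. \<Sum>i\<in>UNIV. \<Sum>j\<in>UNIV. (Fr a $ i * gz i k ?z) * ((Fr b $ j * gz j l ?z) * u $ (k, l)))"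
          by (rule sum_swap4)
        also have "\<dots> = v a b"
          unfolding sum_distrib_left[symmetric] sum_distrib_right[symmetric] FG by (simp only: v_def sum_distrib_left)
        finally show ?thesis .
      qed
      also have "(\<Sum>i\<in>UNIV. \<Sum>j\<in>UNIV. \<Sum>k\<in>UNIV. \<Sum>l\<in>UNIV. (Fr a $ i * gz i l ?z) * ((Fr b $ j * gz j k ?z) * u $ (k, l))) = v b a"
      proof -
        have "(\<Sum>i\<in>UNIV. \<Sum>j\<in>UNIV. \<Sum>k\<in>UNIV. \<Sum>l\<in>UNIV. (Fr a $ i * gz i l ?z) * ((Fr b $ j * gz j k ?z) * u $ (k, l)))
          = (\<Sum>k\<in>UNIV. \<Sum>l\<in>UNIV. \<Sum>i\<in>UNIV. \<Sum>j\<in>UNIV. (Fr a $ i * gz i l ?z) * ((Fr b $ j * gz j k ?z) * u $ (k, l)))"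
          by (rule sum_swap4)
        also have "\<dots> = (\<Sum>k\<in>UNIV. \<Sum>l\<in>UNIV. B a $ l * (B b $ k * u $ (k, l)))"
          unfolding sum_distrib_left[symmetric] sum_distrib_right[symmetric] FG ..
        finally show ?thesis by (simp add: v_def sum_distrib_left mult_ac)
      qed
      finally show ?thesis by simp
    qed
    have sk: "(\<Sum>c\<in>UNIV. \<Sum>d\<in>UNIV. Rm4 (Some c) (Some d) (Some b) (Some a) ?z * v c d)
      = - (\<Sum>c\<in>UNIV. \<Sum>d\<in>UNIV. Rm4 (Some c) (Some d) (Some a) (Some b) ?z * v c d)" for a b
      by (simp only: Rm4_skew34[OF z0, of _ _ "Some b" "Some a"] mult_minus_left sum_negf)
    \<comment> \<open>Adding \<open>main\<close> to its copy with \<open>a\<close> and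
      \<open>b\<close> exchanged cancels the curvature terms.\<close>
    have v_skew: "v a b = - v b a" for a b using main[of a b] main[of b a] sk[of b a] by argo
    have vR: "(\<Sum>c\<in>UNIV. \<Sum>d\<in>UNIV. Rm4 (Some c) (Some d) (Some a) (Some b) ?z * v c d) = 0" for a b
      using main[of a b] v_skew[of a b] by argo
    have v0: "v a b = 0" for a b
    proof (rule ccontr)
      assume "v a b \<noteq> 0"
      moreover have "two_form v" unfolding two_form_def using v_skew by blast
      ultimately have "0 < (\<Sum>a\<in>UNIV. \<Sum>b\<in>UNIV. \<Sum>c\<in>UNIV. \<Sum>d\<in>UNIV. frame_comp Fr (Rm (G t)) [a, b, c, d] x * v a b * v c d)"
        using pos orth unfolding positive_curvature_operator_def by blast
      also have "\<dots> = (\<Sum>c\<in>UNIV. \<Sum>d\<in>UNIV. \<Sum>a\<in>UNIV. \<Sum>b\<in>UNIV. Rm4 (Some a) (Some b) (Some c) (Some d) ?z * v a b * v c d)"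
        unfolding frame_comp_fc Rm_Rl[OF z0, symmetric] by (rule sum_swap4)
      also have "\<dots> = 0" unfolding sum_distrib_right[symmetric] vR by simp
      finally show False by simp
    qed
    have "u $ (k, l) = 0" for k l
    proof -
      have "(\<Sum>a\<in>UNIV. (\<chi> a. Fr a $ k) $ a * B a $ i) = \<delta> k i" for k i using dual'[of k i] by simp
      then have "fc (\<lambda>k. \<chi> a. Fr a $ k) (\<lambda>js. fc B (\<lambda>js. u $ (js ! 0, js ! 1)) js) [k, l] = u $ ([k, l] ! 0, [k, l] ! 1)"
        by (rule fc_dual)
      moreover have "fc (\<lambda>k. \<chi> a. Fr a $ k) (\<lambda>js. fc B (\<lambda>js. u $ (js ! 0, js ! 1)) js) [k, l]
        = (\<Sum>a\<in>UNIV. Fr a $ k * (\<Sum>b\<in>UNIV. Fr b $ l * v a b))"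
        by (simp add: v_def)
      ultimately show ?thesis unfolding v0 by simp
    qed
    then show ?thesis by (simp add: vec_eq_iff)
  qed
  then show ?thesis unfolding invertible_left_inverse matrix_left_invertible_ker by blast
qed

end

lemma Ck_on_subset: "Ck_on k f S \<Longrightarrow> S' \<subseteq> S \<Longrightarrow> Ck_on k f S'"
  by (induction k arbitrary: f) (auto intro: continuous_on_subset)

text \<open>Orthonormality gives one relation directly; the other holds because a one-sided inverse
  of a square matrix is two-sided.\<close>

lemma dual_frame:
  assumes orth: "orthonormal_frame g x F" and B: "\<And>a k. B a $ k = (\<Sum>j\<in>UNIV. g x $ k $ j * F a $ j)"
  shows "(\<Sum>k\<in>UNIV. B a $ k * F b $ k) = \<delta> a b" "(\<Sum>a\<in>UNIV. F a $ k * B a $ l) = \<delta> k l"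
proof -
  have 1: "(\<Sum>k\<in>UNIV. B a $ k * F b $ k) = \<delta> a b" for a b
    using orth[unfolded orthonormal_frame_def, rule_format, of b a]
    by (simp add: B sum_distrib_left sum_distrib_right mult_ac eq_commute)
  show "(\<Sum>k\<in>UNIV. B a $ k * F b $ k) = \<delta> a b" by (rule 1)
  have "(\<Sum>k\<in>UNIV. F a $ k * B b $ k) = \<delta> a b" for a b
    using 1[of b a] by (simp add: mult.commute eq_commute)
  then have "(\<chi> a k. F a $ k) ** (\<chi> k a. B a $ k) = mat 1"
    by (simp add: vec_eq_iff matrix_matrix_mult_def mat_def)
  then have "(\<chi> k a. B a $ k) ** (\<chi> a k. F a $ k) = mat 1" by (simp add: matrix_left_right_inverse)
  then have "(\<Sum>a\<in>UNIV. B a $ l * F a $ k) = \<delta> l k"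
    by (simp add: vec_eq_iff matrix_matrix_mult_def mat_def)
  then show "(\<Sum>a\<in>UNIV. F a $ k * B a $ l) = \<delta> k l" by (simp add: mult.commute eq_commute)
qed

theorem mainTheorem1:
  fixes A :: "('m::{t2_space, second_countable_topology}, 'n::finite) chart set"
    and g :: "('m, 'n) chart \<Rightarrow> real \<Rightarrow> 'n metric"
    and T :: ereal
    and I :: "real set"
    and c :: "('m, 'n) chart"
    and p :: 'm
    and x :: "real^'n"
    and t :: real
    and F :: "real \<Rightarrow> 'n \<Rightarrow> real^'n"
    and Y :: "nat \<Rightarrow> 'n \<Rightarrow> 'n \<Rightarrow> real"
    and X :: "nat \<Rightarrow> 'n \<Rightarrow> real"
  defines "I \<equiv> {s. 0 < s \<and> ereal s < T}"
    and "x \<equiv> snd c p"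
  assumes manifold: "smooth_atlas A"
    and flow: "ricci_flow A I g"
    and pos: "\<And>c s q. c \<in> A \<Longrightarrow> s \<in> I \<Longrightarrow> q \<in> fst c \<Longrightarrow>
                positive_curvature_operator (g c s) (snd c q)"
    and point: "c \<in> A" "p \<in> fst c" "t \<in> I"
    and frame: "evolving_orthonormal_frame I (g c) x F"
    and nonneg: "\<And>U W. two_form U \<Longrightarrow> harnack_form t (g c t) (F t) x U W \<ge> 0"
    and squares: "harnack_decomposition t (g c t) (F t) x Y X"
  shows "((\<lambda>s. frame_comp (F s) (harnack_Z s (g c s)) [a, b] x) has_real_derivative
           (frame_comp (F t) (laplacian (g c t) (harnack_Z t (g c t))) [a, b] x
            + 2 * (\<Sum>m\<in>UNIV. \<Sum>n\<in>UNIV. \<Sum>\<tau>\<in>UNIV. \<Sum>u\<in>UNIV. \<Sum>v\<in>UNIV.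
                frame_comp (F t) (curvature_inverse (g c t)) [m, n, \<tau>, u] x
                  * harnack_K t (g c t) (F t) x a v \<tau> u * harnack_K t (g c t) (F t) x b v m n)
            + (\<Sum>N<harnack_dim TYPE('n). \<Sum>M<harnack_dim TYPE('n).
                harnack_L (g c t) (F t) x Y X N M a * harnack_L (g c t) (F t) x Y X N M b)
            - 2 / t * frame_comp (F t) (harnack_Z t (g c t)) [a, b] x)) (at t)"
proof -
  obtain U \<phi> where c: "c = (U, \<phi>)" by (cases c)
  let ?V = "\<phi> ` U" and ?D0 = "I \<times> \<phi> ` U"
  have xV: "x \<in> ?V" and t: "t > 0" using point by (auto simp: c x_def I_def)
  have "open I"
  proof (cases T)
    case (real r)
    then have "I = {0<..<r}" by (auto simp: I_def)
    then show ?thesis by simp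
  next
    case PInf
    then have "I = {0<..}" by (auto simp: I_def)
    then show ?thesis by simp
  next
    case MInf
    then have "I = {}" by (auto simp: I_def)
    then show ?thesis by simp
  qed
  moreover have "open ?V" using manifold point(1) unfolding smooth_atlas_def c by blast
  ultimately have open_D0: "open ?D0" by (rule open_Times)
  have metric: "smooth_metric_family A I g" using flow by (simp add: ricci_flow_def)
  have smooth_g: "smooth_on (\<lambda>(t, x). g c t x) ?D0"
    and sym_pos: "\<And>s y. s \<in> I \<Longrightarrow> y \<in> ?V \<Longrightarrow> transpose (g c s y) = g c s y \<and> (\<forall>v. v \<noteq> 0 \<longrightarrow> v \<bullet> (g c s y *v v) > 0)"
    using metric point(1) unfolding smooth_metric_family_def c by blast+
  have smooth_entry: "smooth_on (\<lambda>z. g c (fst z) (snd z) $ i $ j) ?D0" for i j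
    using smooth_on_bounded_linear[OF open_D0 bounded_linear_compose[OF bounded_linear_vec_nth[of j] bounded_linear_vec_nth[of i]] smooth_g[unfolded split_def]]
    by simp
  have sym: "g c (fst z) (snd z) $ i $ j = g c (fst z) (snd z) $ j $ i" if "z \<in> ?D0" for z i j
  proof -
    have "transpose (g c (fst z) (snd z)) = g c (fst z) (snd z)" using sym_pos that by auto
    then have "transpose (g c (fst z) (snd z)) $ j $ i = g c (fst z) (snd z) $ j $ i" by simp
    then show ?thesis by (simp add: transpose_def)
  qed
  have inv: "invertible (g c (fst z) (snd z))" if "z \<in> ?D0" for z
  proof -
    have "v = 0" if "g c (fst z) (snd z) *v v = 0" for v
    proof (rule ccontr)
      assume "v \<noteq> 0"
      then have "v \<bullet> (g c (fst z) (snd z) *v v) > 0" using sym_pos[of "fst z" "snd z"] \<open>z \<in> ?D0\<close> by auto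
      then show False using that by simp
    qed
    then show ?thesis unfolding invertible_left_inverse matrix_left_invertible_ker by blast
  qed
  have flow': "((\<lambda>s. g c s y $ i $ j) has_real_derivative (- 2 * Ric (g c s) [i, j] y)) (at s)" if "(s, y) \<in> ?D0" for s y i j
    using flow point(1) that unfolding ricci_flow_def c by auto
  \<comment> \<open>The metric dual of the frame at the base point and base time, kept fixed
    everywhere else.\<close>
  define B where "B a = (\<chi> k. \<Sum>j\<in>UNIV. g c t x $ k $ j * F t a $ j)" for a
  have B_lower: "B a $ k = (\<Sum>j\<in>UNIV. g c t x $ k $ j * F t a $ j)" for a k by (simp add: B_def)
  have orth: "orthonormal_frame (g c t) x (F t)"
    and dF: "((\<lambda>s. F s a $ i) has_real_derivative (\<Sum>j\<in>UNIV. \<Sum>k\<in>UNIV. ginv (g c t) i j x * Ric (g c t) [j, k] x * F t a $ k)) (at t)" for a i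
    using frame point(3) unfolding evolving_orthonormal_frame_def by blast+
  \<comment> \<open>For every open subset, since the locale is used twice: on \<open>?D0\<close> to
    obtain the smoothness of \<open>MM\<close>, and then on the smaller \<open>D\<close>.\<close>
  have chart: "chart_ricci_flow (g c) D (F t) B" if "open D" "D \<subseteq> ?D0" for D
  proof
    show "open D" by fact
    show "smooth_on (\<lambda>z. g c (fst z) (snd z) $ i $ j) D" for i j
      using smooth_entry[of i j] Ck_on_subset[OF _ that(2)] by (auto simp: smooth_on_def)
  qed (use that(2) in \<open>blast intro: sym inv flow' dual_frame[OF orth B_lower]\<close>)+
  interpret c0: chart_ricci_flow "g c" ?D0 "F t" B by (rule chart[OF open_D0 subset_refl])
  \<comment> \<open>\<open>MM\<close> depends on the metric alone and is the same on the smaller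
    set. \<open>D\<close> is open by continuity of the determinant, and positivity at the base point
    places \<open>(t, x)\<close> in it.\<close>
  define D where "D = ?D0 \<inter> (\<lambda>z. det (c0.MM z)) -` (- {0})"
  have "open D" unfolding D_def
    by (rule continuous_open_preimage[OF smooth_on_continuous[OF smooth_on_det[OF open_D0 c0.smooth_MM]] open_D0]) (rule open_Compl, simp)
  then have chart_D: "chart_ricci_flow (g c) D (F t) B" by (rule chart) (auto simp: D_def)
  interpret chart_harnack "g c" D "F t" B
    by (rule chart_harnack.intro[OF chart_D], unfold_locales) (simp add: D_def invertible_det_nz)
  have "(t, x) \<in> ?D0" using point(3) xV by simp
  moreover from this have "invertible (c0.MM (t, x))"
    using pos[OF point(1,3,2)] by (intro c0.invertible_MM orth B_lower) (simp_all add: x_def)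
  ultimately have "(t, x) \<in> D" by (simp add: D_def invertible_det_nz)
  from harnack_Z_evolution[where H = F, OF this t orth B_lower refl dF squares]
  show ?thesis .
qed

end
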